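(* Let $(G_n,R^m_n)$ be a sequence in $\mathbf{X}$ with induced poset $\mathbb{P}$. The following are equivalent: (1) $(G_n,R^m_n)$ is a lax-Fraïssé sequence in $\mathbf{X}$; (2) every branch of spokes of $(G_n,R^m_n)$ is a lax-Fraïssé sequence in $\mathbf{A}$, and the sequence of ends $(\mathsf{E}G_n,\mathsf{E}(R^m_n))$ is a Fraïssé sequence in $\mathbf{D}$; (3) $(G_n,R^m_n)$ has a star-refining end-splitting subsequence; (4) the spectrum $\mathsf{S}\mathbb{P}$ is homeomorphic to the Cantor fan. Moreover, $(G_n,R^m_n)$ is Fraïssé in $\mathbf{X}$ precisely when every branch of spokes of it is a Fraïssé sequence in $\mathbf{A}$.
   Context: Graphs. A graph is a finite non-empty set $G$ with a reflexive symmetric relation $\sqcap$ (the edge relation); the degree of $g$ is $|\{g'\ne g:g'\sqcap g\}|$; an end is a vertex of degree at most $1$, and $\mathsf{E}G$ is the set of ends. A subset of a graph is connected if it cannot be split into two non-empty parts with no edge between them (the empty set is connected). A path is a graph whose vertices can be listed without repetition as $p_0,\dots,p_k$ ($k\ge0$) with $p_i\sqcap p_j$ iff $|i-j|\le1$. A (nontrivial) fan is a connected acyclic graph with exactly one vertex of degree $\ge3$, its root $0_F$; its spokes are the subpaths whose ends are the root and an end of $F$; $*F$ is the set of spokes. Relations. A relation $R\subseteq H\times G$ between graphs is viewed as a relation from $G$ to $H$; write $R(g)=\{h:(h,g)\in R\}$, $R^{-1}(h)=\{g:(h,g)\in R\}$, $R(S)=\bigcup_{g\in S}R(g)$; $(c,a)\in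 Q\circ R$ iff $(c,b)\in Q$ and $(b,a)\in R$ for some $b$. $R$ is: edge-preserving if $(h,g),(h',g')\in R$ and $g\sqcap g'$ imply $h\sqcap h'$; co-bijective if $R(g)\ne\emptyset$ for all $g$ and for all $h\in H$ there is $g$ with $R(g)=\{h\}$; monotone if $\bigcup_{h\in C}R^{-1}(h)$ is connected for every connected $C\subseteq H$; star-refining if for all $g\in G$ there is $h\in H$ with $\{g':g'\sqcap g\}\subseteq R^{-1}(h)$. Between fans $G,H$, $R$ is: spoke-monotone if $R(0_G)=\{0_H\}$ and for every $S\in *G$ there is $T\in *H$ with $R(S)\subseteq T$ and $R\cap(T\times S)$ monotone (as a relation from $S$ to $T$); end-preserving if $R(e)\subseteq\mathsf{E}H$ for all $e\in\mathsf{E}G$; end-splitting if for every $e\in\mathsf{E}H$ there are two distinct $g,g'\in\mathsf{E}G$ with $(e,g),(e,g')\in R$. Categories. $\mathbf{X}$: nontrivial fans with co-bijective edge-preserving, spoke-monotone, end-preserving relations. $\mathbf{A}$: paths with monotone co-bijective edge-preserving relations. $\mathbf{D}$: discrete graphs (edge relation equal to equality) with surjective functions. For $R\in\mathbf{X}$ from $G$ to $H$, $\mathsf{E}(R)=R\cap(\mathsf{E}H\times\mathsf{E}G)$, which is a surjective function $\mathsf{E}G\to\mathsf{E}H$ (ends regarded as discrete graphs). $\mathbf{C}^H_G$ denotes the set of morphisms of $\mathbf{C}$ from $G$ to $H$. Sequences. A sequence in a category $\mathbf{C}$ of graphs and relations is a family $(G_n,R^m_n)_{m\le n\in\omega}$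 with $R^m_n\in\mathbf{C}^{G_m}_{G_n}$, $R^n_n$ the identity and $R^l_m\circ R^m_n=R^l_n$ for $l\le m\le n$. It has a property of morphisms if $R^m_n$ has it for all $m<n$. A subsequence is $(G_{\phi(n)},R^{\phi(m)}_{\phi(n)})$ for a strictly increasing $\phi:\omega\to\omega$. It is Fraïssé (resp. lax-Fraïssé) in $\mathbf{C}$ if it is cofinal, i.e. for every object $G$ of $\mathbf{C}$ some $\mathbf{C}^G_{G_n}$ is non-empty, and for every $m$ and $Q\in\mathbf{C}^{G_m}_G$ there are $n\ge m$ and $P\in\mathbf{C}^G_{G_n}$ with $Q\circ P=R^m_n$ (resp. $Q\circ P\subseteq R^m_n$). A branch of spokes of a sequence in $\mathbf{X}$ is a family $(S_n)$ with $S_n\in *G_n$ and $R^m_n(S_n)=S_m$ for all $m\le n$, identified with $(S_n,R^m_n\cap(S_m\times S_n))$, which is a sequence in $\mathbf{A}$. Spectrum. The induced poset of a sequence is the disjoint union $\mathbb{P}=\bigsqcup_nG_n$, where for $p\in G_n$, $q\in G_m$, $p\le q$ iff $m\le n$ and $(q,p)\in R^m_n$. In a poset $\mathbb{P}$, a band is a finite $B\subseteq\mathbb{P}$ such that every element of $\mathbb{P}$ is comparable to an element of $B$; a cap is a set $C\subseteq\mathbb P$ for which there is a band $B$ such that each $b\in B$ is $\le$ some $c\in C$; a selector is a subset of $\mathbb{P}$ meeting every cap. The spectrum $\mathsf{S}\mathbb{P}$ is the set of minimal selectors (with respect to inclusion) with the topology generated by the sets $p^\in=\{S\in\mathsf{S}\mathbb{P}:p\in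 S\}$, $p\in\mathbb{P}$. The Cantor fan is the quotient of $C\times[0,1]$, $C$ the Cantor space, obtained by collapsing $C\times\{0\}$ to a point.
   Formalization: The "Moreover" clause is proved for sequences satisfying the equivalent conditions (1)–(4); without them it fails: three copies of a Fraïssé sequence of paths glued at the root have only Fraïssé branches but always three ends, so are not cofinal in X. *)

theory Defs
  imports "HOL-Analysis.Analysis" "HOL-Library.Infinite_Typeclass"
begin

section \<open>Graphs\<close>

record 'a rgraph =
  verts :: "'a set"
  edges :: "('a \<times> 'a) set"

definition is_graph :: "'a rgraph \<Rightarrow> bool" where
  "is_graph G \<longleftrightarrow> finite (verts G) \<and> verts G \<noteq> {} \<and> edges G \<subseteq> verts G \<times> verts G
     \<and> refl_on (verts G) (edges G) \<and> sym (edges G)"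

definition induced :: "'a rgraph \<Rightarrow> 'a set \<Rightarrow> 'a rgraph" where
  "induced G S = \<lparr>verts = verts G \<inter> S, edges = edges G \<inter> (S \<times> S)\<rparr>"

definition vdegree :: "'a rgraph \<Rightarrow> 'a \<Rightarrow> nat" where
  "vdegree G g = card {g' \<in> verts G. g' \<noteq> g \<and> (g', g) \<in> edges G}"

definition ends :: "'a rgraph \<Rightarrow> 'a set" where
  "ends G = {g \<in> verts G. vdegree G g \<le> 1}"

definition connected_in :: "'a rgraph \<Rightarrow> 'a set \<Rightarrow> bool" where
  "connected_in G S \<longleftrightarrow>
     \<not> (\<exists>A B. A \<noteq> {} \<and> B \<noteq> {} \<and> A \<union> B = S \<and> A \<inter> B = {} \<and> (\<forall>a\<in>A. \<forall>b\<in>B. (a, b) \<notin> edges G))"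

definition is_path :: "'a rgraph \<Rightarrow> bool" where
  "is_path G \<longleftrightarrow> is_graph G \<and>
     (\<exists>ps. ps \<noteq> [] \<and> distinct ps \<and> set ps = verts G \<and>
        (\<forall>i<length ps. \<forall>j<length ps.
           (ps ! i, ps ! j) \<in> edges G \<longleftrightarrow> \<bar>int i - int j\<bar> \<le> 1))"

definition acyclic_graph :: "'a rgraph \<Rightarrow> bool" where
  "acyclic_graph G \<longleftrightarrow>
     \<not> (\<exists>cs. length cs \<ge> 3 \<and> distinct cs \<and> set cs \<subseteq> verts G \<and>
          (\<forall>i<length cs. (cs ! i, cs ! (Suc i mod length cs)) \<in> edges G))"

definition is_fan :: "'a rgraph \<Rightarrow> bool" where
  "is_fan F \<longleftrightarrow> is_graph F \<and> connected_in F (verts F) \<and> acyclic_graph F \<and>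
     (\<exists>!r. r \<in> verts F \<and> vdegree F r \<ge> 3)"

definition fan_root :: "'a rgraph \<Rightarrow> 'a" where
  "fan_root F = (THE r. r \<in> verts F \<and> vdegree F r \<ge> 3)"

text \<open>A spoke is represented by its vertex set. Nothing is lost, since subpaths of an acyclic
  graph are induced subgraphs.\<close>

definition spokes :: "'a rgraph \<Rightarrow> 'a set set" where
  "spokes F = {S. S \<subseteq> verts F \<and> is_path (induced F S) \<and>
     (\<exists>e\<in>ends F. ends (induced F S) = {fan_root F, e})}"

definition discrete_graph :: "'a rgraph \<Rightarrow> bool" where
  "discrete_graph G \<longleftrightarrow> is_graph G \<and> edges G = Id_on (verts G)"

section \<open>Relations between graphs\<close>

text \<open>A relation from \<open>G\<close> to \<open>H\<close> is a subset of \<open>verts H \<times> verts G\<close>: the \<^emph>\<open>target\<close> is the first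
  component. Hence \<open>Q \<circ> R\<close> is \<open>Q O R\<close>, the forward image \<open>R(S)\<close> is \<open>rel_image R S\<close>, and the
  preimage of \<open>C\<close>, i.e. the union of the preimages of all \<open>h \<in> C\<close>, is \<open>R `` C\<close>.
  All properties below take the source \<open>G\<close> before the target \<open>H\<close>.\<close>

definition rel_image :: "('b \<times> 'a) set \<Rightarrow> 'a set \<Rightarrow> 'b set" where
  "rel_image R S = {h. \<exists>g\<in>S. (h, g) \<in> R}"

definition edge_preserving :: "'a rgraph \<Rightarrow> 'b rgraph \<Rightarrow> ('b \<times> 'a) set \<Rightarrow> bool" where
  "edge_preserving G H R \<longleftrightarrow>
     (\<forall>h g h' g'. (h, g) \<in> R \<longrightarrow> (h', g') \<in> R \<longrightarrow> (g, g') \<in> edges G \<longrightarrow> (h, h') \<in> edges H)"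

definition co_bijective :: "'a rgraph \<Rightarrow> 'b rgraph \<Rightarrow> ('b \<times> 'a) set \<Rightarrow> bool" where
  "co_bijective G H R \<longleftrightarrow>
     (\<forall>g\<in>verts G. rel_image R {g} \<noteq> {}) \<and>
     (\<forall>h\<in>verts H. \<exists>g\<in>verts G. rel_image R {g} = {h})"

definition monotone_rel :: "'a rgraph \<Rightarrow> 'b rgraph \<Rightarrow> ('b \<times> 'a) set \<Rightarrow> bool" where
  "monotone_rel G H R \<longleftrightarrow> (\<forall>C\<subseteq>verts H. connected_in H C \<longrightarrow> connected_in G (R `` C))"

definition star_refining :: "'a rgraph \<Rightarrow> 'b rgraph \<Rightarrow> ('b \<times> 'a) set \<Rightarrow> bool" where
  "star_refining G H R \<longleftrightarrow>
     (\<forall>g\<in>verts G. \<exists>h\<in>verts H. {g' \<in> verts G. (g', g) \<in> edges G} \<subseteq> R `` {h})"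

definition spoke_monotone :: "'a rgraph \<Rightarrow> 'b rgraph \<Rightarrow> ('b \<times> 'a) set \<Rightarrow> bool" where
  "spoke_monotone G H R \<longleftrightarrow> rel_image R {fan_root G} = {fan_root H} \<and>
     (\<forall>S\<in>spokes G. \<exists>T\<in>spokes H. rel_image R S \<subseteq> T \<and>
        monotone_rel (induced G S) (induced H T) (R \<inter> T \<times> S))"

definition end_preserving :: "'a rgraph \<Rightarrow> 'b rgraph \<Rightarrow> ('b \<times> 'a) set \<Rightarrow> bool" where
  "end_preserving G H R \<longleftrightarrow> (\<forall>e\<in>ends G. rel_image R {e} \<subseteq> ends H)"

definition end_splitting :: "'a rgraph \<Rightarrow> 'b rgraph \<Rightarrow> ('b \<times> 'a) set \<Rightarrow> bool" where
  "end_splitting G H R \<longleftrightarrow>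
     (\<forall>e\<in>ends H. \<exists>g\<in>ends G. \<exists>g'\<in>ends G. g \<noteq> g' \<and> (e, g) \<in> R \<and> (e, g') \<in> R)"

definition surjective_function :: "'a rgraph \<Rightarrow> 'b rgraph \<Rightarrow> ('b \<times> 'a) set \<Rightarrow> bool" where
  "surjective_function G H R \<longleftrightarrow>
     (\<forall>g\<in>verts G. \<exists>!h. (h, g) \<in> R) \<and> (\<forall>h\<in>verts H. \<exists>g\<in>verts G. (h, g) \<in> R)"

section \<open>Categories of graphs and relations\<close>

text \<open>All objects of a category have their vertices in one fixed type \<open>'a\<close>. As graphs are finite,
  every graph is isomorphic to one over \<open>'a\<close> as soon as \<open>'a\<close> is infinite.
  \<open>hom C G H\<close> is the set of morphisms from \<open>G\<close> to \<open>H\<close>; it is meant to be used for objects only.\<close>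

record 'a graph_cat =
  obj :: "'a rgraph set"
  hom :: "'a rgraph \<Rightarrow> 'a rgraph \<Rightarrow> ('a \<times> 'a) set set"

definition catX :: "'a graph_cat" where
  "catX = \<lparr>obj = {F. is_fan F},
     hom = (\<lambda>G H. {R. R \<subseteq> verts H \<times> verts G \<and> co_bijective G H R \<and> edge_preserving G H R \<and>
                      spoke_monotone G H R \<and> end_preserving G H R})\<rparr>"

definition catA :: "'a graph_cat" where
  "catA = \<lparr>obj = {P. is_path P},
     hom = (\<lambda>G H. {R. R \<subseteq> verts H \<times> verts G \<and> monotone_rel G H R \<and> co_bijective G H R \<and>
                      edge_preserving G H R})\<rparr>"

definition catD :: "'a graph_cat" where
  "catD = \<lparr>obj = {G. discrete_graph G},
     hom = (\<lambda>G H. {R. R \<subseteq> verts H \<times> verts G \<and> surjective_function G H R})\<rparr>"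

definition end_graph :: "'a rgraph \<Rightarrow> 'a rgraph" where
  "end_graph G = \<lparr>verts = ends G, edges = Id_on (ends G)\<rparr>"

definition end_rel :: "'a rgraph \<Rightarrow> 'b rgraph \<Rightarrow> ('b \<times> 'a) set \<Rightarrow> ('b \<times> 'a) set" where
  "end_rel G H R = R \<inter> (ends H \<times> ends G)"

section \<open>Sequences\<close>

text \<open>\<open>R m n\<close> stands for \<open>R\<^sup>m\<^sub>n\<close>, a relation from \<open>G n\<close> to \<open>G m\<close>; its values for \<open>m > n\<close> are
  irrelevant.\<close>

definition sequence_in :: "'a graph_cat \<Rightarrow> (nat \<Rightarrow> 'a rgraph) \<Rightarrow> (nat \<Rightarrow> nat \<Rightarrow> ('a \<times> 'a) set) \<Rightarrow> bool"
  where
  "sequence_in C G R \<longleftrightarrow>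
     (\<forall>n. G n \<in> obj C) \<and>
     (\<forall>m n. m \<le> n \<longrightarrow> R m n \<in> hom C (G n) (G m)) \<and>
     (\<forall>n. R n n = Id_on (verts (G n))) \<and>
     (\<forall>l m n. l \<le> m \<longrightarrow> m \<le> n \<longrightarrow> R l m O R m n = R l n)"

definition seq_has ::
  "('a rgraph \<Rightarrow> 'a rgraph \<Rightarrow> ('a \<times> 'a) set \<Rightarrow> bool) \<Rightarrow>
   (nat \<Rightarrow> 'a rgraph) \<Rightarrow> (nat \<Rightarrow> nat \<Rightarrow> ('a \<times> 'a) set) \<Rightarrow> bool" where
  "seq_has P G R \<longleftrightarrow> (\<forall>m n. m < n \<longrightarrow> P (G n) (G m) (R m n))"

definition cofinal_in :: "'a graph_cat \<Rightarrow> (nat \<Rightarrow> 'a rgraph) \<Rightarrow> bool" where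
  "cofinal_in C G \<longleftrightarrow> (\<forall>H\<in>obj C. \<exists>n. hom C (G n) H \<noteq> {})"

definition fraisse :: "'a graph_cat \<Rightarrow> (nat \<Rightarrow> 'a rgraph) \<Rightarrow> (nat \<Rightarrow> nat \<Rightarrow> ('a \<times> 'a) set) \<Rightarrow> bool"
  where
  "fraisse C G R \<longleftrightarrow> sequence_in C G R \<and> cofinal_in C G \<and>
     (\<forall>m. \<forall>H\<in>obj C. \<forall>Q\<in>hom C H (G m). \<exists>n\<ge>m. \<exists>P\<in>hom C (G n) H. Q O P = R m n)"

definition lax_fraisse :: "'a graph_cat \<Rightarrow> (nat \<Rightarrow> 'a rgraph) \<Rightarrow> (nat \<Rightarrow> nat \<Rightarrow> ('a \<times> 'a) set) \<Rightarrow> bool"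
  where
  "lax_fraisse C G R \<longleftrightarrow> sequence_in C G R \<and> cofinal_in C G \<and>
     (\<forall>m. \<forall>H\<in>obj C. \<forall>Q\<in>hom C H (G m). \<exists>n\<ge>m. \<exists>P\<in>hom C (G n) H. Q O P \<subseteq> R m n)"

definition spoke_branch ::
  "(nat \<Rightarrow> 'a rgraph) \<Rightarrow> (nat \<Rightarrow> nat \<Rightarrow> ('a \<times> 'a) set) \<Rightarrow> (nat \<Rightarrow> 'a set) \<Rightarrow> bool" where
  "spoke_branch G R S \<longleftrightarrow> (\<forall>n. S n \<in> spokes (G n)) \<and> (\<forall>m n. m \<le> n \<longrightarrow> rel_image (R m n) (S n) = S m)"

definition branch_graphs :: "(nat \<Rightarrow> 'a rgraph) \<Rightarrow> (nat \<Rightarrow> 'a set) \<Rightarrow> nat \<Rightarrow> 'a rgraph" where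
  "branch_graphs G S n = induced (G n) (S n)"

definition branch_rels ::
  "(nat \<Rightarrow> nat \<Rightarrow> ('a \<times> 'a) set) \<Rightarrow> (nat \<Rightarrow> 'a set) \<Rightarrow> nat \<Rightarrow> nat \<Rightarrow> ('a \<times> 'a) set" where
  "branch_rels R S m n = R m n \<inter> (S m \<times> S n)"

section \<open>The spectrum of a poset\<close>

text \<open>A poset is given by a carrier \<open>P\<close> and a set \<open>r\<close> of pairs, where \<open>(p, q) \<in> r\<close> means \<open>p \<le> q\<close>.\<close>

definition induced_poset :: "(nat \<Rightarrow> 'a rgraph) \<Rightarrow> (nat \<times> 'a) set" where
  "induced_poset G = (SIGMA n:UNIV. verts (G n))"

definition induced_le ::
  "(nat \<Rightarrow> 'a rgraph) \<Rightarrow> (nat \<Rightarrow> nat \<Rightarrow> ('a \<times> 'a) set) \<Rightarrow> ((nat \<times> 'a) \<times> (nat \<times> 'a)) set" where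
  "induced_le G R = {((n, p), (m, q)). p \<in> verts (G n) \<and> q \<in> verts (G m) \<and> m \<le> n \<and> (q, p) \<in> R m n}"

definition band :: "'p set \<Rightarrow> ('p \<times> 'p) set \<Rightarrow> 'p set \<Rightarrow> bool" where
  "band P r B \<longleftrightarrow> finite B \<and> B \<subseteq> P \<and> (\<forall>p\<in>P. \<exists>b\<in>B. (p, b) \<in> r \<or> (b, p) \<in> r)"

definition cap :: "'p set \<Rightarrow> ('p \<times> 'p) set \<Rightarrow> 'p set \<Rightarrow> bool" where
  "cap P r C \<longleftrightarrow> C \<subseteq> P \<and> (\<exists>B. band P r B \<and> (\<forall>b\<in>B. \<exists>c\<in>C. (b, c) \<in> r))"

definition selector :: "'p set \<Rightarrow> ('p \<times> 'p) set \<Rightarrow> 'p set \<Rightarrow> bool" where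
  "selector P r S \<longleftrightarrow> S \<subseteq> P \<and> (\<forall>C. cap P r C \<longrightarrow> S \<inter> C \<noteq> {})"

definition spectrum :: "'p set \<Rightarrow> ('p \<times> 'p) set \<Rightarrow> 'p set set" where
  "spectrum P r = {S. selector P r S \<and> (\<forall>S'. selector P r S' \<longrightarrow> S' \<subseteq> S \<longrightarrow> S' = S)}"

text \<open>The whole spectrum is inserted into the subbasis to make it the underlying space in all
  cases.\<close>

definition spectrum_topology :: "'p set \<Rightarrow> ('p \<times> 'p) set \<Rightarrow> 'p set topology" where
  "spectrum_topology P r =
     topology_generated_by (insert (spectrum P r) ((\<lambda>p. {S \<in> spectrum P r. p \<in> S}) ` P))"

section \<open>The Cantor fan\<close>

definition quotient_topology :: "'a topology \<Rightarrow> ('a \<times> 'a) set \<Rightarrow> 'a set topology" where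
  "quotient_topology X r =
     topology (\<lambda>U. U \<subseteq> topspace X // r \<and> openin X {x \<in> topspace X. r `` {x} \<in> U})"

lemma openin_quotient_topology:
  "openin (quotient_topology X r) U \<longleftrightarrow>
     U \<subseteq> topspace X // r \<and> openin X {x \<in> topspace X. r `` {x} \<in> U}"
proof -
  let ?Q = "\<lambda>U. U \<subseteq> topspace X // r \<and> openin X {x \<in> topspace X. r `` {x} \<in> U}"
  have "?Q (S \<inter> T)" if "?Q S" "?Q T" for S T
  proof -
    have "{x \<in> topspace X. r `` {x} \<in> S \<inter> T}
        = {x \<in> topspace X. r `` {x} \<in> S} \<inter> {x \<in> topspace X. r `` {x} \<in> T}"
      by blast
    then show ?thesis
      using that by (auto intro: openin_Int)
  qed
  moreover have "?Q (\<Union>K)" if "\<forall>S\<in>K. ?Q S" for K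
  proof -
    have "{x \<in> topspace X. r `` {x} \<in> \<Union>K} = (\<Union>S\<in>K. {x \<in> topspace X. r `` {x} \<in> S})"
      by blast
    moreover have "openin X (\<Union>S\<in>K. {x \<in> topspace X. r `` {x} \<in> S})"
      using that by (intro openin_Union) auto
    ultimately show ?thesis
      using that by auto
  qed
  ultimately have "istopology ?Q"
    unfolding istopology_def by blast
  then show ?thesis
    unfolding quotient_topology_def by (simp add: topology_inverse')
qed

lemma topspace_quotient_topology: "topspace (quotient_topology X r) = topspace X // r"
proof
  show "topspace (quotient_topology X r) \<subseteq> topspace X // r"
    using openin_quotient_topology openin_topspace by blast
  have "{x \<in> topspace X. r `` {x} \<in> topspace X // r} = topspace X"
    by (auto simp: quotientI)
  then have "openin (quotient_topology X r) (topspace X // r)"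
    by (simp add: openin_quotient_topology)
  then show "topspace X // r \<subseteq> topspace (quotient_topology X r)"
    by (rule openin_subset)
qed

lemma quotient_map_quotient_topology:
  "quotient_map X (quotient_topology X r) (\<lambda>x. r `` {x})"
  unfolding quotient_map_def topspace_quotient_topology openin_quotient_topology
  by (auto simp: quotient_def)

definition cantor_space :: "(nat \<Rightarrow> bool) topology" where
  "cantor_space = product_topology (\<lambda>_. discrete_topology UNIV) UNIV"

definition cantor_fan :: "((nat \<Rightarrow> bool) \<times> real) set topology" where
  "cantor_fan =
     (let X = prod_topology cantor_space (top_of_set {0..1})
      in quotient_topology X
           {(x, y). x \<in> topspace X \<and> y \<in> topspace X \<and> (x = y \<or> snd x = 0 \<and> snd y = 0)})"

end

theory Submission imports Defs
begin

text \<open>Number the spokes of every fan by its ends and the vertices of each spoke from the root. A morphism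
  of fans becomes a surjection \<open>\<epsilon>\<close> of ends together with one monotone walk per end of the domain, and
  conditions (1)-(3) all reduce to two numerical statements: every \<open>G m\<close> is refined by some \<open>G n\<close> so
  finely that each vertex of a spoke has arbitrarily many vertices of \<open>G n\<close> over it alone on every spoke
  (refining), and so that every end of \<open>G m\<close> has arbitrarily many ends of \<open>G n\<close> over it (splitting). For
  branches this is Koenig's lemma on the finite sets of ends. A morphism into a given fan is then lifted
  spoke by spoke, and exactness of the factorisation is decided on each spoke separately.

  Under refining, nested partitions of \<open>[0,1]\<close> assign to each vertex an interval, so that the spectrum is
  the quotient of (branches of ends) \<open>\<times> [0,1]\<close> collapsing the roots; under splitting the space of branches
  is the Cantor space. Conversely, regularity of the Cantor fan gives star-refinement, its connectedness
  makes the sets of the two ends of an edge meet, and an end that never splits would yield an isolated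
  arc, which the Cantor fan does not contain.\<close>

section \<open>Monotone walks and morphisms of paths\<close>

text \<open>Morphisms are relations, not maps: edge preservation leaves a vertex of a spoke at most
  two images, which are adjacent. This slack separates lax from exact factorisation. Lax factors are
  found by counting alone, whereas exact ones have to be collected from the branches by compactness.
  Counting works because the widths of windows with a common image add up: each star-refinement
  contributes 2, so the single constant 2 of a star becomes unbounded under iteration, just as
  fibres with two ends grow to powers of 2. For necessity one test fan suffices, with two copies of
  every spoke and every edge divided into three. Two obstacles shape the details. A morphism of
  paths may reverse the direction, although the root orients all spokes. And a chain of vertices
  generates a selector that need not be minimal: neighbouring chains can describe the same point of
  the spectrum. Points are therefore described by the vertices above whole stars
  (\<open>sel\<close>), and chains are compared only up to distance two, an error that the shrinking
  meshes absorb.\<close>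

text \<open>A morphism of paths that preserves the orientation relates the \<open>i\<close>-th vertex exactly to the
  vertices with numbers in \<open>{\<alpha> i..\<beta> i}\<close>; \<open>walk\<close> axiomatises the pairs \<open>(\<alpha>, \<beta>)\<close> that arise.\<close>

definition walk :: "nat \<Rightarrow> nat \<Rightarrow> (nat \<Rightarrow> nat) \<Rightarrow> (nat \<Rightarrow> nat) \<Rightarrow> bool" where
  "walk k l \<alpha> \<beta> \<longleftrightarrow> \<alpha> 0 = 0 \<and> \<beta> 0 = 0 \<and> \<alpha> k = l \<and> \<beta> k = l \<and> (\<forall>i\<le>k. \<alpha> i \<le> \<beta> i) \<and>
     (\<forall>i<k. \<alpha> i \<le> \<alpha> (Suc i) \<and> \<beta> i \<le> \<beta> (Suc i) \<and> \<beta> (Suc i) \<le> Suc (\<alpha> i))"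

lemma walk_ends: "walk k l \<alpha> \<beta> \<Longrightarrow> \<alpha> 0 = 0 \<and> \<beta> 0 = 0 \<and> \<alpha> k = l \<and> \<beta> k = l"
  by (simp add: walk_def)

lemma walk_le: "walk k l \<alpha> \<beta> \<Longrightarrow> i \<le> k \<Longrightarrow> \<alpha> i \<le> \<beta> i"
  by (simp add: walk_def)

lemma walk_mono:
  assumes "walk k l \<alpha> \<beta>" "i \<le> j" "j \<le> k"
  shows "\<alpha> i \<le> \<alpha> j" "\<beta> i \<le> \<beta> j"
proof -
  have "j \<le> k \<longrightarrow> \<alpha> i \<le> \<alpha> j \<and> \<beta> i \<le> \<beta> j"
    using assms(2)
  proof (induction j rule: dec_induct)
    case (step n)
    then show ?case
      using assms(1) unfolding walk_def by (metis Suc_le_lessD le_trans less_imp_le_nat)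
  qed auto
  then show "\<alpha> i \<le> \<alpha> j" "\<beta> i \<le> \<beta> j"
    using assms(3) by auto
qed

lemma walk_bound:
  assumes "walk k l \<alpha> \<beta>" "i \<le> k"
  shows "\<beta> i \<le> l" "\<alpha> i \<le> l"
  using walk_mono[OF assms(1) assms(2) le_refl] walk_ends[OF assms(1)] by auto

text \<open>The monotone step squeezes \<open>\<beta> i\<close> below
  \<open>\<beta> (Suc i)\<close>, hence below \<open>Suc (\<alpha> i)\<close>. So a vertex has one
  image or two adjacent ones.\<close>

lemma walk_gap:
  assumes "walk k l \<alpha> \<beta>" "i \<le> k"
  shows "\<beta> i \<le> Suc (\<alpha> i)"
proof (cases "i < k")
  case True
  then have "\<beta> i \<le> \<beta> (Suc i)" "\<beta> (Suc i) \<le> Suc (\<alpha> i)"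
    using assms(1) unfolding walk_def by auto
  then show ?thesis
    by linarith
next
  case False
  then show ?thesis
    using assms unfolding walk_def by auto
qed

lemma walk_lipschitz:
  assumes "walk k l \<alpha> \<beta>" "i + d \<le> k"
  shows "\<alpha> (i + d) \<le> \<alpha> i + d"
  using assms(2)
proof (induction d)
  case (Suc d)
  then have "\<beta> (Suc (i + d)) \<le> Suc (\<alpha> (i + d))" "\<alpha> (Suc (i + d)) \<le> \<beta> (Suc (i + d))"
    using assms(1) unfolding walk_def by auto
  then show ?case
    using Suc by simp
qed auto

text \<open>Discrete intermediate value theorem: at the first \<open>i\<close> with
  \<open>j \<le> \<alpha> i\<close> the predecessor still has \<open>\<alpha>\<close> below
  \<open>j\<close>, so \<open>\<beta> i\<close> cannot exceed \<open>j\<close>. This is what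
  co-bijectivity means for walks.\<close>

lemma walk_hit:
  assumes "walk k l \<alpha> \<beta>" "j \<le> l"
  obtains i where "i \<le> k" "\<alpha> i = j" "\<beta> i = j"
proof -
  define i where "i = (LEAST i. j \<le> \<alpha> i)"
  have k: "j \<le> \<alpha> k"
    using assms walk_ends by metis
  then have i: "j \<le> \<alpha> i" "i \<le> k"
    unfolding i_def by (auto intro: LeastI Least_le)
  have "\<beta> i \<le> j"
  proof (cases i)
    case 0
    then show ?thesis
      using walk_ends[OF assms(1)] by auto
  next
    case (Suc i')
    then have "\<not> j \<le> \<alpha> i'"
      unfolding i_def by (metis lessI not_less_Least)
    moreover have "\<beta> (Suc i') \<le> Suc (\<alpha> i')"
      using assms(1) i Suc unfolding walk_def by auto
    ultimately show ?thesis
      using Suc by auto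
  qed
  then show ?thesis
    using that[OF i(2)] i(1) walk_le[OF assms(1) i(2)] by auto
qed

lemma walk_id: "walk k k (\<lambda>i. i) (\<lambda>i. i)"
  by (simp add: walk_def)

lemma walk_min: "l \<le> k \<Longrightarrow> walk k l (\<lambda>i. min i l) (\<lambda>i. min i l)"
  by (auto simp: walk_def)

lemma walk_comp:
  assumes "walk k l \<alpha> \<beta>" "walk k' k \<alpha>' \<beta>'"
  shows "walk k' l (\<lambda>i. \<alpha> (\<alpha>' i)) (\<lambda>i. \<beta> (\<beta>' i))"
proof -
  have "\<alpha> (\<alpha>' i) \<le> \<beta> (\<beta>' i)" if "i \<le> k'" for i
    using walk_le[OF assms(2) that] walk_bound[OF assms(2) that] walk_mono[OF assms(1)]
      walk_le[OF assms(1)] by (meson le_trans)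
  moreover have "\<alpha> (\<alpha>' i) \<le> \<alpha> (\<alpha>' (Suc i)) \<and> \<beta> (\<beta>' i) \<le> \<beta> (\<beta>' (Suc i)) \<and> \<beta> (\<beta>' (Suc i)) \<le> Suc (\<alpha> (\<alpha>' i))"
    if "i < k'" for i
  proof -
    have *: "\<alpha>' i \<le> \<alpha>' (Suc i)" "\<beta>' i \<le> \<beta>' (Suc i)" "\<beta>' (Suc i) \<le> Suc (\<alpha>' i)"
      "\<alpha>' (Suc i) \<le> k" "\<beta>' (Suc i) \<le> k" "\<alpha>' i \<le> k"
      using assms(2) that walk_bound[OF assms(2)] unfolding walk_def by auto
    have "\<beta> (\<beta>' (Suc i)) \<le> Suc (\<alpha> (\<alpha>' i))"
    proof (cases "\<alpha>' i < k")
      case True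
      then have "\<beta> (\<beta>' (Suc i)) \<le> \<beta> (Suc (\<alpha>' i))" "\<beta> (Suc (\<alpha>' i)) \<le> Suc (\<alpha> (\<alpha>' i))"
        using walk_mono(2)[OF assms(1) *(3)] assms(1) unfolding walk_def by auto
      then show ?thesis
        by simp
    next
      case False
      then have "\<alpha>' i = k"
        using *(6) by simp
      then show ?thesis
        using walk_bound[OF assms(1) *(5)] walk_ends[OF assms(1)] by simp
    qed
    then show ?thesis
      using walk_mono[OF assms(1) *(1,4)] walk_mono[OF assms(1) *(2,5)] by simp
  qed
  ultimately show ?thesis
    using walk_ends[OF assms(1)] walk_ends[OF assms(2)] unfolding walk_def by auto
qed

text \<open>The intermediate interval \<open>{\<alpha>' i..\<beta>' i}\<close> has at most two
  points, and the images of two consecutive points leave no gap. Therefore composition of relations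
  is composition of the bounds.\<close>

lemma walk_comp_rel:
  assumes "walk k l \<alpha> \<beta>" "walk k' k \<alpha>' \<beta>'" "i \<le> k'"
  shows "(\<exists>x. \<alpha>' i \<le> x \<and> x \<le> \<beta>' i \<and> \<alpha> x \<le> j \<and> j \<le> \<beta> x) \<longleftrightarrow> \<alpha> (\<alpha>' i) \<le> j \<and> j \<le> \<beta> (\<beta>' i)"
proof
  assume "\<exists>x. \<alpha>' i \<le> x \<and> x \<le> \<beta>' i \<and> \<alpha> x \<le> j \<and> j \<le> \<beta> x"
  then show "\<alpha> (\<alpha>' i) \<le> j \<and> j \<le> \<beta> (\<beta>' i)"
    using walk_mono[OF assms(1)] walk_bound[OF assms(2,3)] by (meson le_trans)
next
  assume j: "\<alpha> (\<alpha>' i) \<le> j \<and> j \<le> \<beta> (\<beta>' i)"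
  have b: "\<alpha>' i \<le> \<beta>' i" "\<beta>' i \<le> Suc (\<alpha>' i)" "\<beta>' i \<le> k" "\<alpha>' i \<le> k"
    using walk_le[OF assms(2,3)] walk_gap[OF assms(2,3)] walk_bound[OF assms(2,3)] by auto
  show "\<exists>x. \<alpha>' i \<le> x \<and> x \<le> \<beta>' i \<and> \<alpha> x \<le> j \<and> j \<le> \<beta> x"
  proof (cases "j \<le> \<beta> (\<alpha>' i)")
    case True
    then show ?thesis
      using j b by auto
  next
    case False
    then have "\<beta>' i = Suc (\<alpha>' i)"
      using j b by (metis le_SucE le_antisym)
    moreover have "\<alpha> (Suc (\<alpha>' i)) \<le> \<beta> (Suc (\<alpha>' i))" "\<beta> (Suc (\<alpha>' i)) \<le> Suc (\<alpha> (\<alpha>' i))" "\<alpha> (\<alpha>' i) \<le> \<beta> (\<alpha>' i)"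
      using assms(1) b calculation unfolding walk_def by auto
    ultimately show ?thesis
      using j b False by (intro exI[of _ "\<beta>' i"]) auto
  qed
qed

text \<open>Any \<open>N + 1\<close> consecutive vertices have a common image, for instance the
  value of \<open>\<alpha>\<close> at the last of them. For \<open>N = 2\<close> these windows are
  the stars of a path.\<close>

definition refines :: "nat \<Rightarrow> nat \<Rightarrow> (nat \<Rightarrow> nat) \<Rightarrow> (nat \<Rightarrow> nat) \<Rightarrow> bool" where
  "refines N k \<alpha> \<beta> \<longleftrightarrow> (\<forall>i i'. i \<le> i' \<longrightarrow> i' \<le> k \<longrightarrow> i' \<le> i + N \<longrightarrow> \<alpha> i' \<le> \<beta> i)"

lemma refines_mono: "refines N k \<alpha> \<beta> \<Longrightarrow> M \<le> N \<Longrightarrow> refines M k \<alpha> \<beta>"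
  unfolding refines_def by (meson add_le_cancel_left le_trans)

lemma refines_0: "walk k l \<alpha> \<beta> \<Longrightarrow> refines 0 k \<alpha> \<beta>"
  unfolding refines_def by (auto dest: walk_le)

lemma refines_length:
  assumes "walk k l \<alpha> \<beta>" "refines N k \<alpha> \<beta>" "1 \<le> l"
  shows "N < k"
proof (rule ccontr)
  assume "\<not> N < k"
  then have "\<alpha> k \<le> \<beta> 0"
    using assms(2) unfolding refines_def by auto
  then show False
    using walk_ends[OF assms(1)] assms(3) by simp
qed

text \<open>The first two steps of a window cost nothing, as \<open>\<alpha>'\<close> does not rise
  above \<open>\<beta>' i\<close> there; the remaining ones raise it by at most one each. So a
  star-refinement adds 2 to the width.\<close>

lemma refines_comp_star:
  assumes "walk k l \<alpha> \<beta>" "walk k' k \<alpha>' \<beta>'" "refines N k \<alpha> \<beta>" "refines 2 k' \<alpha>' \<beta>'"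
  shows "refines (N + 2) k' (\<lambda>i. \<alpha> (\<alpha>' i)) (\<lambda>i. \<beta> (\<beta>' i))"
  unfolding refines_def
proof (intro allI impI)
  fix i i' assume i: "i \<le> i'" "i' \<le> k'" "i' \<le> i + (N + 2)"
  have b: "\<alpha>' i' \<le> k" "\<beta>' i \<le> k"
    using walk_bound[OF assms(2)] i by auto
  have "\<alpha>' i' \<le> \<beta>' i + N"
  proof (cases "i' \<le> i + 2")
    case True
    then show ?thesis
      using assms(4) i unfolding refines_def by (metis trans_le_add1)
  next
    case False
    then obtain d where d: "i' = i + 2 + d" "d \<le> N"
      using i by (metis add.assoc add_le_cancel_left le_Suc_ex nat_le_linear add.commute)
    then have "\<alpha>' (i + 2 + d) \<le> \<alpha>' (i + 2) + d" "\<alpha>' (i + 2) \<le> \<beta>' i"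
      using walk_lipschitz[OF assms(2), of "i + 2" d] assms(4) i unfolding refines_def by auto
    then show ?thesis
      unfolding d(1) using d(2) by linarith
  qed
  then show "\<alpha> (\<alpha>' i') \<le> \<beta> (\<beta>' i)"
    using assms(3) b walk_mono(1)[OF assms(1), of "\<alpha>' i'" "\<beta>' i"] walk_le[OF assms(1) b(2)]
    unfolding refines_def by (metis le_trans nat_le_linear)
qed

lemma refines_comp:
  assumes "walk k l \<alpha> \<beta>" "walk k' k \<alpha>' \<beta>'" "refines N k \<alpha> \<beta>"
  shows "refines N k' (\<lambda>i. \<alpha> (\<alpha>' i)) (\<lambda>i. \<beta> (\<beta>' i))"
  unfolding refines_def
proof (intro allI impI)
  fix i i' assume i: "i \<le> i'" "i' \<le> k'" "i' \<le> i + N"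
  have b: "\<alpha>' i' \<le> k" "\<beta>' i \<le> k"
    using walk_bound[OF assms(2)] i by auto
  obtain d where d: "i' = i + d" "d \<le> N"
    using i by (metis add_le_cancel_left le_Suc_ex)
  have "\<alpha>' i' \<le> \<beta>' i + N"
    using walk_lipschitz[OF assms(2), of i d] walk_le[OF assms(2), of i] d i by auto
  then show "\<alpha> (\<alpha>' i') \<le> \<beta> (\<beta>' i)"
    using assms(3) b walk_mono(1)[OF assms(1), of "\<alpha>' i'" "\<beta>' i"] walk_le[OF assms(1) b(2)]
    unfolding refines_def by (metis le_trans nat_le_linear)
qed

lemma refines_comp_left:
  assumes "walk k l \<alpha> \<beta>" "walk k' k \<alpha>' \<beta>'" "refines N k' \<alpha>' \<beta>'"
  shows "refines N k' (\<lambda>i. \<alpha> (\<alpha>' i)) (\<lambda>i. \<beta> (\<beta>' i))"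
  unfolding refines_def
proof (intro allI impI)
  fix i i' assume i: "i \<le> i'" "i' \<le> k'" "i' \<le> i + N"
  have b: "\<beta>' i \<le> k"
    using walk_bound[OF assms(2)] i by auto
  have "\<alpha>' i' \<le> \<beta>' i"
    using assms(3) i unfolding refines_def by auto
  then show "\<alpha> (\<alpha>' i') \<le> \<beta> (\<beta>' i)"
    using b walk_mono(1)[OF assms(1), of "\<alpha>' i'" "\<beta>' i"] walk_le[OF assms(1) b] by simp
qed

text \<open>With \<open>m j\<close> a vertex over \<open>j\<close> alone, \<open>p\<close> is the largest 1-Lipschitz function starting at \<open>0\<close>
  below \<open>m \<circ> \<beta>\<close>. It stays above \<open>m \<circ> \<alpha>\<close> because a step of \<open>m \<circ> \<beta>\<close> has \<open>N\<close> vertices to be climbed.\<close>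

lemma walk_lax_factor:
  assumes r: "walk k l \<alpha> \<beta>" "refines N k \<alpha> \<beta>" and q: "walk h l \<gamma> \<delta>" and "h \<le> N" "1 \<le> l"
  obtains p where "walk k h p p" "\<And>i. i \<le> k \<Longrightarrow> \<alpha> i \<le> \<gamma> (p i) \<and> \<delta> (p i) \<le> \<beta> i"
proof -
  \<comment> \<open>For \<open>j < l\<close> this is the first vertex over \<open>j\<close> alone.
    At \<open>j = l\<close> the last vertex replaces the first one, so that \<open>p\<close> runs up
    to \<open>h\<close>.\<close>
  define m where "m j = (if j = l then h else LEAST t. j \<le> \<gamma> t)" for j
  have m: "m j \<le> h \<and> \<gamma> (m j) = j \<and> \<delta> (m j) = j" if "j \<le> l" for j
  proof (cases "j = l")
    case True
    then show ?thesis
      using walk_ends[OF q] by (simp add: m_def)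
  next
    case False
    let ?t = "LEAST t. j \<le> \<gamma> t"
    have "j \<le> \<gamma> h"
      using walk_ends[OF q] that by simp
    then have t: "j \<le> \<gamma> ?t" "?t \<le> h"
      by (auto intro: LeastI Least_le)
    have "\<delta> ?t \<le> j"
    proof (cases ?t)
      case 0
      then show ?thesis
        using walk_ends[OF q] by simp
    next
      case (Suc s)
      then have "\<not> j \<le> \<gamma> s"
        by (metis lessI not_less_Least)
      moreover have "\<delta> (Suc s) \<le> Suc (\<gamma> s)"
        using q t Suc unfolding walk_def by auto
      ultimately show ?thesis
        using Suc by auto
    qed
    then show ?thesis
      using t walk_le[OF q t(2)] False by (auto simp: m_def)
  qed
  have m_mono: "m j \<le> m j'" if "j \<le> j'" "j' \<le> l" for j j'
  proof (cases "j' = l")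
    case True
    then show ?thesis
      using m[of j] that by (simp add: m_def)
  next
    case False
    then have "j \<le> \<gamma> (m j')" "j \<noteq> l"
      using m[of j'] that by auto
    then show ?thesis
      by (auto simp: m_def intro: Least_le)
  qed
  have m0: "m 0 = 0"
    using \<open>1 \<le> l\<close> by (simp add: m_def)
  define p where "p = rec_nat 0 (\<lambda>i x. min (Suc x) (m (\<beta> (Suc i))))"
  have p0: "p 0 = 0" and pS: "p (Suc i) = min (Suc (p i)) (m (\<beta> (Suc i)))" for i
    by (simp_all add: p_def)
  have upper: "p i \<le> m (\<beta> i)" for i
    by (cases i) (auto simp: p0 pS)
  \<comment> \<open>The largest such function attains its value by climbing with slope one from an
    earlier value of \<open>m \<circ> \<beta>\<close>.\<close>
  have formula: "\<exists>i0\<le>i. p i = m (\<beta> i0) + (i - i0)" for i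
  proof (induction i)
    case 0
    then show ?case
      using walk_ends[OF r(1)] by (simp add: p0 m0)
  next
    case (Suc i)
    then obtain i0 where "i0 \<le> i" "p i = m (\<beta> i0) + (i - i0)"
      by auto
    then have "p (Suc i) = m (\<beta> i0) + (Suc i - i0) \<or> p (Suc i) = m (\<beta> (Suc i)) + (Suc i - Suc i)"
      by (auto simp: pS)
    then show ?case
      using \<open>i0 \<le> i\<close> le_Suc_eq by blast
  qed
  have lower: "m (\<alpha> i) \<le> p i" if i: "i \<le> k" for i
  proof -
    obtain i0 where i0: "i0 \<le> i" "p i = m (\<beta> i0) + (i - i0)"
      using formula by blast
    \<comment> \<open>Either \<open>i0\<close> is so close that refinement compares
      \<open>\<alpha> i\<close> with \<open>\<beta> i0\<close>, or more than \<open>N\<close> steps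
      have been climbed since \<open>i0\<close>, and \<open>h \<le> N\<close>.\<close>
    show ?thesis
    proof (cases "i \<le> i0 + N")
      case True
      then have "\<alpha> i \<le> \<beta> i0"
        using r(2) i0 i unfolding refines_def by auto
      then have "m (\<alpha> i) \<le> m (\<beta> i0)"
        using m_mono walk_bound[OF r(1)] i0 i by auto
      then show ?thesis
        using i0 by simp
    next
      case False
      then show ?thesis
        using m[OF walk_bound(2)[OF r(1) i]] i0 \<open>h \<le> N\<close> by linarith
    qed
  qed
  have ph: "p i \<le> h" if "i \<le> k" for i
    using upper[of i] m walk_bound[OF r(1) that] by (meson le_trans)
  have "p i \<le> p (Suc i)" if "i < k" for i
    using upper[of i] m_mono[of "\<beta> i" "\<beta> (Suc i)"] walk_mono[OF r(1), of i "Suc i"]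
      walk_bound[OF r(1), of "Suc i"] that by (auto simp: pS)
  moreover have "p k = h"
    using lower[of k] ph[of k] walk_ends[OF r(1)] by (simp add: m_def)
  ultimately have "walk k h p p"
    unfolding walk_def by (auto simp: p0 pS)
  moreover have "\<alpha> i \<le> \<gamma> (p i) \<and> \<delta> (p i) \<le> \<beta> i" if i: "i \<le> k" for i
  proof -
    have "\<gamma> (m (\<alpha> i)) \<le> \<gamma> (p i)" "\<delta> (p i) \<le> \<delta> (m (\<beta> i))"
      using walk_mono(1)[OF q lower[OF i] ph[OF i]] walk_mono(2)[OF q upper[of i]]
        m[OF walk_bound(1)[OF r(1) i]] by auto
    then show ?thesis
      using m walk_bound[OF r(1) i] by simp
  qed
  ultimately show ?thesis
    using that by blast
qed

text \<open>Every edge is divided into three: \<open>3 * j\<close> lies over \<open>j\<close> alone,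
  the two vertices between \<open>3 * j\<close> and \<open>3 * j + 3\<close> over both
  \<open>j\<close> and \<open>j + 1\<close>. Factoring through this walk forces a sequence to
  star-refine.\<close>

lemma star_walk: "walk (3 * l) l (\<lambda>i. i div 3) (\<lambda>i. (i + 2) div 3)" "refines 2 (3 * l) (\<lambda>i. i div 3) (\<lambda>i. (i + 2) div 3)"
  unfolding walk_def refines_def by (auto intro: div_le_mono)

text \<open>Every vertex gets two copies. Factors through this walk are the source of the fibres
  with two elements by which the meshes of the partitions of \<open>[0,1]\<close> are
  halved.\<close>

lemma double_walk: "walk (2 * l + 1) l (\<lambda>i. i div 2) (\<lambda>i. i div 2)"
  unfolding walk_def by (auto intro: div_le_mono)

text \<open>\<open>up\<close> and \<open>down\<close> are what monotonicity of a relation of paths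
  yields; they make the maximum and the minimum of the images monotone. \<open>edge\<close> bounds
  the distance of these two by one, so that they already exhaust the images.\<close>

lemma walk_rel_exists:
  fixes r :: "(nat \<times> nat) set"
  assumes sub: "r \<subseteq> {..l} \<times> {..k}"
    and total: "\<And>i. i \<le> k \<Longrightarrow> \<exists>j. (j, i) \<in> r"
    and edge: "\<And>i i' j j'. (j, i) \<in> r \<Longrightarrow> (j', i') \<in> r \<Longrightarrow> i \<le> Suc i' \<Longrightarrow> i' \<le> Suc i \<Longrightarrow> j \<le> Suc j'"
    and first: "\<And>j. (j, 0) \<in> r \<longleftrightarrow> j = 0" and final: "\<And>j. (j, k) \<in> r \<longleftrightarrow> j = l"
    and up: "\<And>i i' j. (j, i) \<in> r \<Longrightarrow> i \<le> i' \<Longrightarrow> i' \<le> k \<Longrightarrow> \<exists>j'\<ge>j. (j', i') \<in> r"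
    and down: "\<And>i i' j. (j, i) \<in> r \<Longrightarrow> i' \<le> i \<Longrightarrow> \<exists>j'\<le>j. (j', i') \<in> r"
  obtains \<alpha> \<beta> where "walk k l \<alpha> \<beta>" "\<And>i j. (j, i) \<in> r \<longleftrightarrow> i \<le> k \<and> \<alpha> i \<le> j \<and> j \<le> \<beta> i"
proof -
  define \<alpha> where "\<alpha> i = Min {j. (j, i) \<in> r}" for i
  define \<beta> where "\<beta> i = Max {j. (j, i) \<in> r}" for i
  have fin: "finite {j. (j, i) \<in> r}" for i
    using sub by (auto intro: finite_subset[of _ "{..l}"])
  have a: "(\<alpha> i, i) \<in> r" and b: "(\<beta> i, i) \<in> r" if "i \<le> k" for i
    using Min_in[OF fin, of i] Max_in[OF fin, of i] total[OF that] by (auto simp: \<alpha>_def \<beta>_def)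
  have le: "\<alpha> i \<le> j" "j \<le> \<beta> i" if "(j, i) \<in> r" for i j
    using that fin by (auto simp: \<alpha>_def \<beta>_def)
  have "\<alpha> 0 = 0" "\<beta> 0 = 0" "\<alpha> k = l" "\<beta> k = l"
    using a b first final by auto
  moreover have "\<alpha> i \<le> \<beta> i" if "i \<le> k" for i
    using a[OF that] le by simp
  moreover have "\<alpha> i \<le> \<alpha> (Suc i) \<and> \<beta> i \<le> \<beta> (Suc i) \<and> \<beta> (Suc i) \<le> Suc (\<alpha> i)" if "i < k" for i
  proof -
    have i: "i \<le> k" "Suc i \<le> k"
      using that by auto
    have "\<alpha> i \<le> \<alpha> (Suc i)"
      using down[OF a[OF i(2)], of i] le(1) by (meson le_SucI le_refl le_trans)
    moreover have "\<beta> i \<le> \<beta> (Suc i)"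
      using up[OF b[OF i(1)], of "Suc i"] le(2) i by (meson le_SucI le_refl le_trans)
    moreover have "\<beta> (Suc i) \<le> Suc (\<alpha> i)"
      using edge[OF b[OF i(2)] a[OF i(1)]] by simp
    ultimately show ?thesis
      by simp
  qed
  ultimately have w: "walk k l \<alpha> \<beta>"
    unfolding walk_def by auto
  have "(j, i) \<in> r" if "i \<le> k" "\<alpha> i \<le> j" "j \<le> \<beta> i" for i j
  proof -
    have "j = \<alpha> i \<or> j = \<beta> i"
      using walk_gap[OF w that(1)] that by linarith
    then show ?thesis
      using a b that by auto
  qed
  then have "(j, i) \<in> r \<longleftrightarrow> i \<le> k \<and> \<alpha> i \<le> j \<and> j \<le> \<beta> i" for i j
    using le sub by auto
  then show ?thesis
    using that w by blast
qed

lemma walk_edge: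
  assumes r: "walk k l \<alpha> \<beta>" and i: "i \<le> k" "i' \<le> k" "i \<le> Suc i'" "i' \<le> Suc i"
    and j: "\<alpha> i \<le> j" "j \<le> \<beta> i" "\<alpha> i' \<le> j'" "j' \<le> \<beta> i'"
  shows "j \<le> Suc j' \<and> j' \<le> Suc j"
proof -
  have key: "b \<le> Suc a" if "x \<le> y" "y \<le> Suc x" "y \<le> k" "\<alpha> x \<le> a" "b \<le> \<beta> y" for a b x y
  proof (cases "y = x")
    case True
    then show ?thesis
      using walk_gap[OF r, of x] that by simp
  next
    case False
    then have "y = Suc x"
      using that by simp
    then have "\<beta> y \<le> Suc (\<alpha> x)"
      using r that unfolding walk_def by auto
    then show ?thesis
      using that by simp
  qed
  have key': "a \<le> Suc b" if "x \<le> y" "y \<le> Suc x" "y \<le> k" "a \<le> \<beta> x" "\<alpha> y \<le> b" for a b x y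
    using walk_mono(1)[OF r that(1,3)] walk_gap[OF r, of x] that by linarith
  show ?thesis
  proof (cases "i \<le> i'")
    case True
    then show ?thesis
      using key[of i i' j j'] key'[of i i' j j'] i j by auto
  next
    case False
    then show ?thesis
      using key[of i' i j' j] key'[of i' i j' j] i j by auto
  qed
qed

lemma walk_le_self:
  assumes "walk k l \<alpha> \<beta>" "i \<le> k"
  shows "\<beta> i \<le> i"
  using assms(2)
proof (induction i)
  case 0
  then show ?case
    using walk_ends[OF assms(1)] by simp
next
  case (Suc i)
  then have "\<beta> (Suc i) \<le> Suc (\<alpha> i)" "\<alpha> i \<le> \<beta> i"
    using assms(1) unfolding walk_def by auto
  then show ?case
    using Suc by simp
qed

section \<open>Paths in coordinates and their morphisms\<close>

definition path_coords :: "'a rgraph \<Rightarrow> nat \<Rightarrow> (nat \<Rightarrow> 'a) \<Rightarrow> bool" where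
  "path_coords P k w \<longleftrightarrow> inj_on w {..k} \<and> verts P = w ` {..k} \<and>
     edges P = {(w i, w j) | i j. i \<le> k \<and> j \<le> k \<and> i \<le> Suc j \<and> j \<le> Suc i}"

lemma path_coords_eq: "path_coords P k w \<Longrightarrow> i \<le> k \<Longrightarrow> j \<le> k \<Longrightarrow> w i = w j \<longleftrightarrow> i = j"
  unfolding path_coords_def inj_on_def by auto

lemma path_coords_edge:
  assumes "path_coords P k w" "i \<le> k" "j \<le> k"
  shows "(w i, w j) \<in> edges P \<longleftrightarrow> i \<le> Suc j \<and> j \<le> Suc i"
proof
  assume "(w i, w j) \<in> edges P"
  then obtain i' j' where "w i = w i'" "w j = w j'" "i' \<le> k" "j' \<le> k" "i' \<le> Suc j'" "j' \<le> Suc i'"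
    using assms(1) unfolding path_coords_def by auto
  then show "i \<le> Suc j \<and> j \<le> Suc i"
    using path_coords_eq[OF assms(1)] assms by metis
next
  assume "i \<le> Suc j \<and> j \<le> Suc i"
  then show "(w i, w j) \<in> edges P"
    using assms unfolding path_coords_def by auto
qed

lemma path_coords_vertI: "path_coords P k w \<Longrightarrow> i \<le> k \<Longrightarrow> w i \<in> verts P"
  unfolding path_coords_def by auto
lemma path_coords_verts: "path_coords P k w \<Longrightarrow> x \<in> verts P \<longleftrightarrow> (\<exists>i\<le>k. x = w i)"
  unfolding path_coords_def by auto

lemma path_coords_rev:
  assumes "path_coords P k w"
  shows "path_coords P k (\<lambda>i. w (k - i))"
proof -
  have "(\<lambda>i. w (k - i)) ` {..k} = w ` {..k}"
  proof (intro set_eqI iffI; clarsimp)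
    fix i assume "i \<le> k"
    then show "w i \<in> (\<lambda>i. w (k - i)) ` {..k}"
      by (intro image_eqI[of _ _ "k - i"]) auto
  qed
  moreover have "inj_on (\<lambda>i. w (k - i)) {..k}"
    using path_coords_eq[OF assms] by (auto simp: inj_on_def)
  moreover have "{(w i, w j) | i j. i \<le> k \<and> j \<le> k \<and> i \<le> Suc j \<and> j \<le> Suc i}
    = {(w (k - i), w (k - j)) | i j. i \<le> k \<and> j \<le> k \<and> i \<le> Suc j \<and> j \<le> Suc i}" (is "?A = ?B")
  proof
    show "?A \<subseteq> ?B"
    proof clarify
      fix i j assume "i \<le> k" "j \<le> k" "i \<le> Suc j" "j \<le> Suc i"
      then show "\<exists>i' j'. (w i, w j) = (w (k - i'), w (k - j')) \<and> i' \<le> k \<and> j' \<le> k \<and> i' \<le> Suc j' \<and> j' \<le> Suc i'"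
        by (intro exI[of _ "k - i"] exI[of _ "k - j"]) auto
    qed
    show "?B \<subseteq> ?A"
    proof clarify
      fix i j assume "i \<le> k" "j \<le> k" "i \<le> Suc j" "j \<le> Suc i"
      then show "\<exists>i' j'. (w (k - i), w (k - j)) = (w i', w j') \<and> i' \<le> k \<and> j' \<le> k \<and> i' \<le> Suc j' \<and> j' \<le> Suc i'"
        by (intro exI[of _ "k - i"] exI[of _ "k - j"]) auto
    qed
  qed
  ultimately show ?thesis
    using assms unfolding path_coords_def by auto
qed

lemma path_coords_is_path:
  assumes "path_coords P k w"
  shows "is_path P"
proof -
  have "is_graph P"
    using path_coords_edge[OF assms] assms
    unfolding path_coords_def is_graph_def refl_on_def sym_def by auto
  moreover have "(map w [0..<Suc k] ! i, map w [0..<Suc k] ! j) \<in> edges P \<longleftrightarrow> \<bar>int i - int j\<bar> \<le> 1"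
    if "i < Suc k" "j < Suc k" for i j
    using path_coords_edge[OF assms, of i j] that by (auto simp del: upt_Suc)
  moreover have "set (map w [0..<Suc k]) = verts P" "distinct (map w [0..<Suc k])"
    using assms unfolding path_coords_def
    by (auto simp: distinct_map atLeast0LessThan lessThan_Suc_atMost simp del: upt_Suc)
  ultimately show ?thesis
    unfolding is_path_def by (intro conjI exI[of _ "map w [0..<Suc k]"]) (auto simp del: upt_Suc)
qed

lemma is_path_coords:
  assumes "is_path P"
  obtains k w where "path_coords P k w"
proof -
  obtain ps where ps: "ps \<noteq> []" "distinct ps" "set ps = verts P"
    "\<And>i j. i < length ps \<Longrightarrow> j < length ps \<Longrightarrow> (ps ! i, ps ! j) \<in> edges P \<longleftrightarrow> \<bar>int i - int j\<bar> \<le> 1"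
    using assms unfolding is_path_def by blast
  define k where "k = length ps - 1"
  have k: "i < length ps \<longleftrightarrow> i \<le> k" for i
    using ps(1) by (cases ps) (auto simp: k_def)
  have sub: "edges P \<subseteq> verts P \<times> verts P"
    using assms unfolding is_path_def is_graph_def by blast
  have "inj_on ((!) ps) {..k}"
    using ps(2) k by (auto simp: inj_on_def nth_eq_iff_index_eq)
  moreover have V: "verts P = (!) ps ` {..k}"
    unfolding ps(3)[symmetric] set_conv_nth using k by auto
  moreover have "edges P = {(ps ! i, ps ! j) | i j. i \<le> k \<and> j \<le> k \<and> i \<le> Suc j \<and> j \<le> Suc i}" (is "_ = ?B")
  proof (intro set_eqI iffI; clarify)
    fix x y assume xy: "(x, y) \<in> edges P"
    then obtain i j where "x = ps ! i" "y = ps ! j" "i \<le> k" "j \<le> k"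
      using sub V by auto
    moreover from this have "i \<le> Suc j" "j \<le> Suc i"
      using xy ps(4)[of i j] k[of i] k[of j] by auto
    ultimately show "\<exists>i j. (x, y) = (ps ! i, ps ! j) \<and> i \<le> k \<and> j \<le> k \<and> i \<le> Suc j \<and> j \<le> Suc i"
      by blast
  next
    fix i j assume "i \<le> k" "j \<le> k" "i \<le> Suc j" "j \<le> Suc i"
    then show "(ps ! i, ps ! j) \<in> edges P"
      using ps(4)[of i j] k by auto
  qed
  ultimately show ?thesis
    using that unfolding path_coords_def by blast
qed

lemma connected_inD:
  assumes "connected_in G S" "A \<union> B = S" "A \<inter> B = {}" "x \<in> A" "y \<in> B"
  obtains a b where "a \<in> A" "b \<in> B" "(a, b) \<in> edges G"
  using assms unfolding connected_in_def by (metis empty_iff)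

text \<open>A missing index separates the smaller ones from the larger ones; without a gap,
  membership in one part passes along consecutive edges.\<close>

lemma path_coords_connected:
  assumes P: "path_coords P k w" and J: "J \<subseteq> {..k}"
  shows "connected_in P (w ` J) \<longleftrightarrow> (\<forall>i\<in>J. \<forall>j\<in>J. \<forall>x. i \<le> x \<longrightarrow> x \<le> j \<longrightarrow> x \<in> J)"
proof
  assume conn: "connected_in P (w ` J)"
  show "\<forall>i\<in>J. \<forall>j\<in>J. \<forall>x. i \<le> x \<longrightarrow> x \<le> j \<longrightarrow> x \<in> J"
  proof (rule ccontr)
    assume "\<not> ?thesis"
    then obtain i j x where x: "i \<in> J" "j \<in> J" "i \<le> x" "x \<le> j" "x \<notin> J"
      by auto
    have un: "w ` {y\<in>J. y < x} \<union> w ` {y\<in>J. x < y} = w ` J"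
      unfolding image_Un[symmetric] using x(5)
      by (intro arg_cong[of _ _ "(`) w"]) (auto intro: linorder_neqE_nat)
    have disj: "w ` {y\<in>J. y < x} \<inter> w ` {y\<in>J. x < y} = {}"
      using path_coords_eq[OF P] J by (fastforce simp: subset_iff)
    have ij: "w i \<in> w ` {y\<in>J. y < x}" "w j \<in> w ` {y\<in>J. x < y}"
      using x by (auto intro!: imageI simp: order_less_le)
    obtain a b where ab: "a \<in> w ` {y\<in>J. y < x}" "b \<in> w ` {y\<in>J. x < y}" "(a, b) \<in> edges P"
      by (rule connected_inD[OF conn un disj ij])
    then obtain y z where "a = w y" "b = w z" "y \<le> k" "z \<le> k" "y < x" "x < z"
      using J by auto
    then show False
      using path_coords_edge[OF P, of y z] ab(3) by simp
  qed
next
  assume conv: "\<forall>i\<in>J. \<forall>j\<in>J. \<forall>x. i \<le> x \<longrightarrow> x \<le> j \<longrightarrow> x \<in> J"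
  have step: False
    if AB: "A \<union> B = w ` J" "A \<inter> B = {}" and ab: "w i \<in> A" "w j \<in> B" "i \<in> J" "j \<in> J" "i < j"
      and E: "\<And>a b. a \<in> A \<Longrightarrow> b \<in> B \<Longrightarrow> (a, b) \<notin> edges P" for A B i j
  proof -
    have "x \<le> j \<longrightarrow> w x \<in> A" if "i \<le> x" for x
      using that
    proof (induction x rule: dec_induct)
      case (step n)
      show ?case
      proof
        assume n: "Suc n \<le> j"
        then have "Suc n \<in> J" "n \<in> J"
          using conv ab step by (meson Suc_leD le_SucI)+
        then have "(w n, w (Suc n)) \<in> edges P"
          using path_coords_edge[OF P] J by (auto simp: subset_iff)
        moreover have "w n \<in> A"
          using step n by auto
        ultimately show "w (Suc n) \<in> A"
          using E AB \<open>Suc n \<in> J\<close> by blast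
      qed
    qed (use ab in auto)
    then show False
      using ab AB by (meson disjoint_iff less_imp_le_nat le_refl)
  qed
  have symE: "(a, b) \<in> edges P \<longleftrightarrow> (b, a) \<in> edges P" for a b
    using P unfolding path_coords_def by auto
  show "connected_in P (w ` J)"
    unfolding connected_in_def
  proof clarify
    fix A B assume AB: "A \<noteq> {}" "B \<noteq> {}" "A \<union> B = w ` J" "A \<inter> B = {}" "\<forall>a\<in>A. \<forall>b\<in>B. (a, b) \<notin> edges P"
    obtain a b where "a \<in> A" "b \<in> B"
      using AB(1,2) by blast
    moreover from this have "a \<in> w ` J" "b \<in> w ` J"
      unfolding AB(3)[symmetric] by simp_all
    ultimately obtain i j where ij: "i \<in> J" "j \<in> J" "w i \<in> A" "w j \<in> B"
      by blast
    then have "i \<noteq> j"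
      using AB by auto
    then consider "i < j" | "j < i"
      by linarith
    then show False
    proof cases
      case 1
      then show False
        using step[OF AB(3,4) ij(3,4,1,2)] AB(5) by blast
    next
      case 2
      then show False
        using step[of B A j i] AB ij symE by (metis Int_commute Un_commute)
    qed
  qed
qed

lemma path_coords_ends:
  assumes P: "path_coords P k w" and "1 \<le> k"
  shows "ends P = {w 0, w k}"
proof -
  have nb: "{g' \<in> verts P. g' \<noteq> w i \<and> (g', w i) \<in> edges P} = w ` {j. j \<le> k \<and> (j = Suc i \<or> i = Suc j)}"
    if "i \<le> k" for i
  proof (intro set_eqI iffI)
    fix x assume "x \<in> {g' \<in> verts P. g' \<noteq> w i \<and> (g', w i) \<in> edges P}"
    then obtain j where "j \<le> k" "x = w j" "w j \<noteq> w i" "(w j, w i) \<in> edges P"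
      by (auto simp: path_coords_verts[OF P])
    then show "x \<in> w ` {j. j \<le> k \<and> (j = Suc i \<or> i = Suc j)}"
      using path_coords_edge[OF P, of j i] that by (auto intro!: imageI) (metis le_SucE le_antisym)
  next
    fix x assume "x \<in> w ` {j. j \<le> k \<and> (j = Suc i \<or> i = Suc j)}"
    then show "x \<in> {g' \<in> verts P. g' \<noteq> w i \<and> (g', w i) \<in> edges P}"
      using path_coords_edge[OF P] path_coords_eq[OF P] path_coords_vertI[OF P] that by auto
  qed
  have card: "vdegree P (w i) = card {j. j \<le> k \<and> (j = Suc i \<or> i = Suc j)}" if "i \<le> k" for i
    unfolding vdegree_def nb[OF that]
    by (rule card_image) (use P in \<open>auto simp: path_coords_def inj_on_def\<close>)
  have "vdegree P (w i) \<le> 1 \<longleftrightarrow> i = 0 \<or> i = k" if i: "i \<le> k" for i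
  proof (cases "i = 0 \<or> i = k")
    case True
    then have "card {j. j \<le> k \<and> (j = Suc i \<or> i = Suc j)} \<le> card {if i = 0 then 1 else k - 1}"
      by (intro card_mono) auto
    then show ?thesis
      using card[OF i] True by simp
  next
    case False
    then have "{j. j \<le> k \<and> (j = Suc i \<or> i = Suc j)} = {i - 1, Suc i}"
      using i by auto
    then show ?thesis
      using card[OF i] False by simp
  qed
  then show ?thesis
    unfolding ends_def by (auto simp: path_coords_verts[OF P])
qed

definition walk_rel :: "(nat \<Rightarrow> 'b) \<Rightarrow> (nat \<Rightarrow> 'a) \<Rightarrow> nat \<Rightarrow> (nat \<Rightarrow> nat) \<Rightarrow> (nat \<Rightarrow> nat) \<Rightarrow> ('b \<times> 'a) set" where
  "walk_rel w' w k \<alpha> \<beta> = {(w' j, w i) | i j. i \<le> k \<and> \<alpha> i \<le> j \<and> j \<le> \<beta> i}"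

lemma walk_relI: "i \<le> k \<Longrightarrow> \<alpha> i \<le> j \<Longrightarrow> j \<le> \<beta> i \<Longrightarrow> (w' j, w i) \<in> walk_rel w' w k \<alpha> \<beta>"
  unfolding walk_rel_def by blast

lemma walk_rel_iff:
  assumes "path_coords P k w" "path_coords P' l w'" "walk k l \<alpha> \<beta>" "i \<le> k" "j \<le> l"
  shows "(w' j, w i) \<in> walk_rel w' w k \<alpha> \<beta> \<longleftrightarrow> \<alpha> i \<le> j \<and> j \<le> \<beta> i"
proof -
  have "j' \<le> l" if "j' \<le> \<beta> i'" "i' \<le> k" for i' j'
    using walk_bound[OF assms(3) that(2)] that by simp
  then show ?thesis
    using assms path_coords_eq[OF assms(1)] path_coords_eq[OF assms(2)] unfolding walk_rel_def by blast
qed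

text \<open>Connected sets are intervals of indices. If \<open>i\<close> and \<open>i'\<close> have
  images \<open>j\<close> and \<open>j'\<close> in such an interval and \<open>x\<close> is between
  them, then \<open>\<alpha> x \<le> j'\<close> and \<open>j \<le> \<beta> x\<close>, so
  \<open>\<beta> x\<close> or \<open>j'\<close> is an image of \<open>x\<close> in the
  interval.\<close>

lemma walk_rel_monotone:
  assumes P: "path_coords P k w" and P': "path_coords P' l w'" and r: "walk k l \<alpha> \<beta>"
  shows "monotone_rel P P' (walk_rel w' w k \<alpha> \<beta>)"
  unfolding monotone_rel_def
proof (intro allI impI)
  fix C assume C: "C \<subseteq> verts P'" "connected_in P' C"
  define J where "J = {j. j \<le> l \<and> w' j \<in> C}"
  have CJ: "C = w' ` J"
    using C(1) by (auto simp: J_def path_coords_verts[OF P'] image_iff subset_iff)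
  have conv: "x \<in> J" if "j \<in> J" "j' \<in> J" "j \<le> x" "x \<le> j'" for j j' x
  proof -
    have "J \<subseteq> {..l}"
      by (auto simp: J_def)
    then show ?thesis
      using C(2) path_coords_connected[OF P', of J] that unfolding CJ by blast
  qed
  let ?I = "{i. i \<le> k \<and> (\<exists>j\<in>J. \<alpha> i \<le> j \<and> j \<le> \<beta> i)}"
  have img: "walk_rel w' w k \<alpha> \<beta> `` C = w ` ?I"
  proof -
    have "j' \<in> J" if "j \<in> J" "j' \<le> \<beta> i" "i \<le> k" "w' j = w' j'" for i j j'
      using that path_coords_eq[OF P', of j j'] walk_bound[OF r that(3)] by (auto simp: J_def)
    then show ?thesis
      unfolding CJ walk_rel_def by (fastforce simp: image_iff)
  qed
  have "x \<in> ?I" if i: "i \<in> ?I" "i' \<in> ?I" "i \<le> x" "x \<le> i'" for i i' x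
  proof -
    obtain j j' where j: "j \<in> J" "\<alpha> i \<le> j" "j \<le> \<beta> i" "j' \<in> J" "\<alpha> i' \<le> j'" "j' \<le> \<beta> i'" "i' \<le> k"
      using i by auto
    then have *: "\<alpha> x \<le> j'" "j \<le> \<beta> x" "\<alpha> x \<le> \<beta> x" "\<beta> x \<le> Suc (\<alpha> x)"
      using walk_mono[OF r i(3)] walk_mono[OF r i(4)] walk_le[OF r, of x] walk_gap[OF r, of x] i by auto
    show ?thesis
    proof (cases "\<beta> x \<le> j'")
      case True
      then have "\<beta> x \<in> J"
        using conv[OF j(1,4)] * by simp
      then show ?thesis
        using * i j by auto
    next
      case False
      then show ?thesis
        using * i j by (auto intro!: bexI[of _ j'])
    qed
  qed
  then have "connected_in P (w ` ?I)"
    by (subst path_coords_connected[OF P]) blast+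
  then show "connected_in P (walk_rel w' w k \<alpha> \<beta> `` C)"
    by (simp add: img)
qed

lemma walk_rel_homA:
  assumes P: "path_coords P k w" and P': "path_coords P' l w'" and r: "walk k l \<alpha> \<beta>"
  shows "walk_rel w' w k \<alpha> \<beta> \<in> hom catA P P'"
proof -
  let ?R = "walk_rel w' w k \<alpha> \<beta>"
  have bd: "j \<le> l" if "j \<le> \<beta> i" "i \<le> k" for i j
    using walk_bound[OF r that(2)] that by simp
  have "?R \<subseteq> verts P' \<times> verts P"
    using bd by (auto simp: walk_rel_def path_coords_vertI[OF P] path_coords_vertI[OF P'])
  moreover have "co_bijective P P' ?R"
    unfolding co_bijective_def
  proof (intro conjI ballI)
    fix g assume "g \<in> verts P"
    then obtain i where i: "i \<le> k" "g = w i"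
      by (auto simp: path_coords_verts[OF P])
    then have "(w' (\<alpha> i), g) \<in> ?R"
      using walk_le[OF r] by (auto simp: walk_rel_def)
    then show "rel_image ?R {g} \<noteq> {}"
      by (auto simp: rel_image_def)
  next
    fix h assume "h \<in> verts P'"
    then obtain j where j: "j \<le> l" "h = w' j"
      by (auto simp: path_coords_verts[OF P'])
    obtain i where i: "i \<le> k" "\<alpha> i = j" "\<beta> i = j"
      using walk_hit[OF r j(1)] .
    have "x = h" if x: "(x, w i) \<in> ?R" for x
    proof -
      obtain i' j' where "x = w' j'" "w i = w i'" "i' \<le> k" "\<alpha> i' \<le> j'" "j' \<le> \<beta> i'"
        using x unfolding walk_rel_def by auto
      then show ?thesis
        using path_coords_eq[OF P i(1), of i'] i j by simp
    qed
    moreover have "(h, w i) \<in> ?R"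
      using i j walk_relI[of i k \<alpha> j \<beta> w' w] by simp
    ultimately have "rel_image ?R {w i} = {h}"
      unfolding rel_image_def by blast
    then show "\<exists>g\<in>verts P. rel_image ?R {g} = {h}"
      using path_coords_vertI[OF P i(1)] by blast
  qed
  moreover have "edge_preserving P P' ?R"
    unfolding edge_preserving_def
  proof (intro allI impI)
    fix h g h' g' assume *: "(h, g) \<in> ?R" "(h', g') \<in> ?R" "(g, g') \<in> edges P"
    obtain i j where ij: "h = w' j" "g = w i" "i \<le> k" "\<alpha> i \<le> j" "j \<le> \<beta> i"
      using *(1) unfolding walk_rel_def by auto
    obtain i' j' where ij': "h' = w' j'" "g' = w i'" "i' \<le> k" "\<alpha> i' \<le> j'" "j' \<le> \<beta> i'"
      using *(2) unfolding walk_rel_def by auto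
    have adj: "i \<le> Suc i'" "i' \<le> Suc i"
      using *(3) ij ij' path_coords_edge[OF P] by auto
    have "j \<le> Suc j'" "j' \<le> Suc j"
      using walk_edge[OF r, of i i' j j'] adj ij ij' by auto
    then show "(h, h') \<in> edges P'"
      using path_coords_edge[OF P', of j j'] ij ij' bd by auto
  qed
  ultimately show ?thesis
    using walk_rel_monotone[OF assms] by (simp add: catA_def)
qed

lemma monotone_rel_convex:
  assumes P: "path_coords P k w" and P': "path_coords P' l w'"
    and sub: "Q \<subseteq> verts P' \<times> verts P" and mono: "monotone_rel P P' Q"
    and J: "J \<subseteq> {..l}" "\<And>i j x. i \<in> J \<Longrightarrow> j \<in> J \<Longrightarrow> i \<le> x \<Longrightarrow> x \<le> j \<Longrightarrow> x \<in> J"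
    and i: "(w' j, w i) \<in> Q" "(w' j', w i') \<in> Q" "j \<in> J" "j' \<in> J" "i \<le> x" "x \<le> i'" "i' \<le> k"
  shows "\<exists>j\<in>J. (w' j, w x) \<in> Q"
proof -
  let ?I = "{i. i \<le> k \<and> (\<exists>j\<in>J. (w' j, w i) \<in> Q)}"
  have "connected_in P' (w' ` J)"
    unfolding path_coords_connected[OF P' J(1)] using J(2) by blast
  moreover have "w' ` J \<subseteq> verts P'"
    using J(1) by (auto simp: path_coords_vertI[OF P'])
  ultimately have "connected_in P (Q `` (w' ` J))"
    using mono unfolding monotone_rel_def by blast
  moreover have "Q `` (w' ` J) = w ` ?I"
  proof (intro set_eqI iffI)
    fix y assume "y \<in> Q `` (w' ` J)"
    then obtain j where "j \<in> J" "(w' j, y) \<in> Q"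
      by blast
    moreover from this obtain i where "i \<le> k" "y = w i"
      using sub path_coords_verts[OF P] by blast
    ultimately show "y \<in> w ` ?I"
      by blast
  qed blast
  ultimately have "connected_in P (w ` ?I)"
    by simp
  moreover have "?I \<subseteq> {..k}"
    by auto
  ultimately have "\<forall>i\<in>?I. \<forall>j\<in>?I. \<forall>x. i \<le> x \<longrightarrow> x \<le> j \<longrightarrow> x \<in> ?I"
    using path_coords_connected[OF P, of ?I] by blast
  moreover have "i \<in> ?I" "i' \<in> ?I"
    using i by auto
  ultimately have "x \<in> ?I"
    using i(5,6) by blast
  then show ?thesis
    by blast
qed

text \<open>Monotonicity makes the preimage of a final segment a connected set that contains the last
  vertex, i.e. a final segment.\<close>

lemma monotone_walk_rel:
  assumes P: "path_coords P k w" and P': "path_coords P' l w'"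
    and sub: "Q \<subseteq> verts P' \<times> verts P"
    and total: "\<And>g. g \<in> verts P \<Longrightarrow> \<exists>h. (h, g) \<in> Q"
    and edge: "edge_preserving P P' Q" and mono: "monotone_rel P P' Q"
    and first: "\<And>h. (h, w 0) \<in> Q \<longleftrightarrow> h = w' 0" and final: "\<And>h. (h, w k) \<in> Q \<longleftrightarrow> h = w' l"
  obtains \<alpha> \<beta> where "walk k l \<alpha> \<beta>" "Q = walk_rel w' w k \<alpha> \<beta>"
proof -
  define r where "r = {(j, i). j \<le> l \<and> i \<le> k \<and> (w' j, w i) \<in> Q}"
  have conv: "\<exists>j\<ge>a. j \<le> b \<and> (j, x) \<in> r"
    if "(j, i) \<in> r" "(j', i') \<in> r" "i \<le> x" "x \<le> i'" "a \<le> j" "a \<le> j'" "j \<le> b" "j' \<le> b" "b \<le> l" for a b i i' j j' x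
  proof -
    have "\<exists>j\<in>{a..b}. (w' j, w x) \<in> Q"
      by (rule monotone_rel_convex[OF P P' sub mono, of _ j i j' i']) (use that in \<open>auto simp: r_def\<close>)
    then obtain j'' where "j'' \<in> {a..b}" "(w' j'', w x) \<in> Q"
      by blast
    then show ?thesis
      using that by (intro exI[of _ j'']) (auto simp: r_def)
  qed
  have r0: "(0, 0) \<in> r" and rk: "(l, k) \<in> r"
    using first final by (auto simp: r_def)
  have r_sub: "r \<subseteq> {..l} \<times> {..k}"
    by (auto simp: r_def)
  have r_total: "\<exists>j. (j, i) \<in> r" if i: "i \<le> k" for i
  proof -
    obtain h where "(h, w i) \<in> Q"
      using total path_coords_vertI[OF P i] by blast
    moreover from this obtain j where "j \<le> l" "h = w' j"
      using sub path_coords_verts[OF P'] by blast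
    ultimately show ?thesis
      using i by (auto simp: r_def)
  qed
  have r_edge: "j \<le> Suc j'" if "(j, i) \<in> r" "(j', i') \<in> r" "i \<le> Suc i'" "i' \<le> Suc i" for i i' j j'
  proof -
    have "(w i, w i') \<in> edges P"
      using that path_coords_edge[OF P] by (auto simp: r_def)
    then have "(w' j, w' j') \<in> edges P'"
      using edge that unfolding edge_preserving_def by (auto simp: r_def)
    then show ?thesis
      using that path_coords_edge[OF P'] by (auto simp: r_def)
  qed
  have r_first: "(j, 0) \<in> r \<longleftrightarrow> j = 0" for j
    using first path_coords_eq[OF P'] by (auto simp: r_def)
  have r_final: "(j, k) \<in> r \<longleftrightarrow> j = l" for j
    using final path_coords_eq[OF P'] by (auto simp: r_def)
  have r_up: "\<exists>j'\<ge>j. (j', i') \<in> r" if "(j, i) \<in> r" "i \<le> i'" "i' \<le> k" for i i' j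
    using conv[OF that(1) rk that(2,3), of j l] that by (auto simp: r_def)
  have r_down: "\<exists>j'\<le>j. (j', i') \<in> r" if "(j, i) \<in> r" "i' \<le> i" for i i' j
    using conv[OF r0 that(1) _ that(2), of 0 j] that by (auto simp: r_def)
  obtain \<alpha> \<beta> where w: "walk k l \<alpha> \<beta>" "\<And>i j. (j, i) \<in> r \<longleftrightarrow> i \<le> k \<and> \<alpha> i \<le> j \<and> j \<le> \<beta> i"
    by (rule walk_rel_exists[OF r_sub r_total r_edge r_first r_final r_up r_down]) blast+
  have "Q = {(w' j, w i) | i j. (j, i) \<in> r}"
    using sub by (fastforce simp: r_def path_coords_verts[OF P] path_coords_verts[OF P'])
  then have "Q = walk_rel w' w k \<alpha> \<beta>"
    unfolding walk_rel_def using w(2) by auto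
  then show ?thesis
    using that w by blast
qed

text \<open>Vertices \<open>a\<close> and \<open>b\<close> lying over the first and over the last
  vertex alone decide on the direction; they differ since \<open>1 \<le> l\<close>. If
  \<open>a < b\<close>, nothing before \<open>a\<close> has an image other than the first vertex: as
  \<open>b\<close> has an image in \<open>{1..l}\<close>, monotonicity would give \<open>a\<close>
  one too. The part behind \<open>b\<close> is treated likewise. If \<open>b < a\<close>, the source
  is numbered backwards.\<close>

lemma homA_walk_rel:
  assumes P: "path_coords P k w" and P': "path_coords P' l w'" and l: "1 \<le> l" and Q: "Q \<in> hom catA P P'"
  shows "(\<exists>\<alpha> \<beta>. walk k l \<alpha> \<beta> \<and> Q = walk_rel w' w k \<alpha> \<beta>) \<or>
    (\<exists>\<alpha> \<beta>. walk k l \<alpha> \<beta> \<and> Q = walk_rel w' (\<lambda>i. w (k - i)) k \<alpha> \<beta>)"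
proof -
  have sub: "Q \<subseteq> verts P' \<times> verts P" and mono: "monotone_rel P P' Q" and edge: "edge_preserving P P' Q"
    and co: "co_bijective P P' Q"
    using Q by (auto simp: catA_def)
  have total: "\<exists>h. (h, g) \<in> Q" if "g \<in> verts P" for g
    using co that unfolding co_bijective_def rel_image_def by blast
  have hit: "\<exists>i\<le>k. \<forall>h. (h, w i) \<in> Q \<longleftrightarrow> h = w' j" if j: "j \<le> l" for j
  proof -
    obtain g where g: "g \<in> verts P" "rel_image Q {g} = {w' j}"
      using co j path_coords_verts[OF P'] unfolding co_bijective_def by blast
    then show ?thesis
      unfolding rel_image_def path_coords_verts[OF P] by blast
  qed
  obtain a where a: "a \<le> k" "\<And>h. (h, w a) \<in> Q \<longleftrightarrow> h = w' 0"
    using hit[of 0] by auto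
  obtain b where b: "b \<le> k" "\<And>h. (h, w b) \<in> Q \<longleftrightarrow> h = w' l"
    using hit[of l] by auto
  have oriented: "\<exists>\<alpha> \<beta>. walk k l \<alpha> \<beta> \<and> Q = walk_rel w' w k \<alpha> \<beta>"
    if P: "path_coords P k w" and ab: "a < b" "b \<le> k" and a: "\<And>h. (h, w a) \<in> Q \<longleftrightarrow> h = w' 0"
      and b: "\<And>h. (h, w b) \<in> Q \<longleftrightarrow> h = w' l" for w a b
  proof -
    note conv = monotone_rel_convex[OF P P' sub mono]
    have low: "h = w' 0" if i: "i \<le> a" and h: "(h, w i) \<in> Q" for i h
    proof (rule ccontr)
      assume "h \<noteq> w' 0"
      moreover obtain j where j: "j \<le> l" "h = w' j"
        using h sub path_coords_verts[OF P'] by blast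
      ultimately have "j \<in> {1..l}"
        by (cases j) auto
      then obtain j' where "j' \<in> {1..l}" "(w' j', w a) \<in> Q"
        using conv[of "{1..l}" j i l b a] h j i ab b l by auto
      then show False
        using a path_coords_eq[OF P', of j' 0] by auto
    qed
    have high: "h = w' l" if i: "b \<le> i" "i \<le> k" and h: "(h, w i) \<in> Q" for i h
    proof (rule ccontr)
      assume "h \<noteq> w' l"
      moreover obtain j where j: "j \<le> l" "h = w' j"
        using h sub path_coords_verts[OF P'] by blast
      ultimately have "j \<in> {..<l}"
        by (cases "j = l") auto
      moreover have "{..<l} \<subseteq> {..l}"
        by auto
      ultimately obtain j' where "j' \<in> {..<l}" "(w' j', w b) \<in> Q"
        using conv[of "{..<l}" 0 a j i b] h j i ab a l by (auto simp del: lessThan_subset_iff)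
      then show False
        using b path_coords_eq[OF P', of j' l] by auto
    qed
    have "(h, w 0) \<in> Q \<longleftrightarrow> h = w' 0" for h
      using low[of 0 h] total[of "w 0"] low[of 0] path_coords_verts[OF P, of "w 0"] by auto
    moreover have "(h, w k) \<in> Q \<longleftrightarrow> h = w' l" for h
      using high[of k h] total[of "w k"] high[of k] path_coords_verts[OF P, of "w k"] ab by auto
    ultimately show ?thesis
      using monotone_walk_rel[OF P P' sub total edge mono] by blast
  qed
  have "a \<noteq> b"
    using a b l path_coords_eq[OF P', of 0 l] by auto
  then consider "a < b" | "b < a"
    by linarith
  then show ?thesis
  proof cases
    case 1
    then show ?thesis
      using oriented[OF P 1 b(1) a(2) b(2)] by simp
  next
    case 2
    then show ?thesis
      using oriented[OF path_coords_rev[OF P], of "k - a" "k - b"] a b by auto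
  qed
qed

section \<open>Coordinates of fans\<close>

lemma connected_in_edges_mono:
  assumes "connected_in G S" "\<And>a b. a \<in> S \<Longrightarrow> b \<in> S \<Longrightarrow> (a, b) \<in> edges G \<Longrightarrow> (a, b) \<in> edges H"
  shows "connected_in H S"
  unfolding connected_in_def
proof clarify
  fix A B assume AB: "A \<noteq> {}" "B \<noteq> {}" "S = A \<union> B" "A \<inter> B = {}" "\<forall>a\<in>A. \<forall>b\<in>B. (a, b) \<notin> edges H"
  obtain x y where xy: "x \<in> A" "y \<in> B"
    using AB(1,2) by blast
  obtain a b where "a \<in> A" "b \<in> B" "(a, b) \<in> edges G"
    using connected_inD[OF assms(1) AB(3)[symmetric] AB(4) xy] by blast
  then show False
    using assms(2)[of a b] AB(3,5) by simp
qed

text \<open>All \<open>v i 0\<close> are the root and \<open>v i 0, \<dots>, v i (l i)\<close> is the \<open>i\<close>-th spoke.\<close>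

locale fan_coords =
  fixes F :: "'a rgraph" and I :: "'i set" and l :: "'i \<Rightarrow> nat" and v :: "'i \<Rightarrow> nat \<Rightarrow> 'a"
  assumes finite_I: "finite I" and card_I: "3 \<le> card I" and l_pos: "i \<in> I \<Longrightarrow> 1 \<le> l i"
    and v_eq: "i \<in> I \<Longrightarrow> i' \<in> I \<Longrightarrow> j \<le> l i \<Longrightarrow> j' \<le> l i' \<Longrightarrow>
      v i j = v i' j' \<longleftrightarrow> j = 0 \<and> j' = 0 \<or> i = i' \<and> j = j'"
    and verts_F: "verts F = {v i j | i j. i \<in> I \<and> j \<le> l i}"
    and edges_F: "edges F \<subseteq> verts F \<times> verts F"
    and edge_iff: "i \<in> I \<Longrightarrow> i' \<in> I \<Longrightarrow> j \<le> l i \<Longrightarrow> j' \<le> l i' \<Longrightarrow>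
      (v i j, v i' j') \<in> edges F \<longleftrightarrow> i = i' \<and> j \<le> Suc j' \<and> j' \<le> Suc j \<or> j + j' \<le> 1"
begin

definition spoke :: "'i \<Rightarrow> 'a set" where
  "spoke i = v i ` {..l i}"

lemma I_nonempty: "I \<noteq> {}"
  using card_I by auto

lemma vertI: "i \<in> I \<Longrightarrow> j \<le> l i \<Longrightarrow> v i j \<in> verts F"
  using verts_F by auto

lemma vertE:
  assumes "x \<in> verts F"
  obtains i j where "i \<in> I" "j \<le> l i" "x = v i j"
  using assms verts_F by auto

lemma root_eq: "i \<in> I \<Longrightarrow> i' \<in> I \<Longrightarrow> v i 0 = v i' 0"
  using v_eq by simp

lemma graph: "is_graph F"
proof -
  have "verts F = (\<lambda>(i, j). v i j) ` (SIGMA i:I. {..l i})"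
    using verts_F by auto
  then have "finite (verts F)"
    using finite_I by simp
  moreover have "verts F \<noteq> {}"
    using I_nonempty vertI by blast
  moreover have "refl_on (verts F) (edges F)"
    using edges_F edge_iff by (auto simp: refl_on_def elim!: vertE)
  moreover have "sym (edges F)"
  proof (rule symI)
    fix x y assume xy: "(x, y) \<in> edges F"
    then have "x \<in> verts F" "y \<in> verts F"
      using edges_F by auto
    then obtain i j i' j' where "i \<in> I" "j \<le> l i" "x = v i j" "i' \<in> I" "j' \<le> l i'" "y = v i' j'"
      by (metis vertE)
    then show "(y, x) \<in> edges F"
      using xy edge_iff[of i i' j j'] edge_iff[of i' i j' j] by auto
  qed
  ultimately show ?thesis
    using edges_F unfolding is_graph_def by blast
qed

lemma edges_sym: "(x, y) \<in> edges F \<Longrightarrow> (y, x) \<in> edges F"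
  using graph unfolding is_graph_def by (meson symD)

lemma spoke_path: "i \<in> I \<Longrightarrow> path_coords (induced F (spoke i)) (l i) (v i)"
  unfolding path_coords_def
proof (intro conjI)
  assume i: "i \<in> I"
  show "inj_on (v i) {..l i}"
    using v_eq i by (auto simp: inj_on_def)
  show "verts (induced F (spoke i)) = v i ` {..l i}"
    using vertI i by (auto simp: induced_def spoke_def)
  show "edges (induced F (spoke i)) = {(v i ia, v i j) |ia j. ia \<le> l i \<and> j \<le> l i \<and> ia \<le> Suc j \<and> j \<le> Suc ia}"
  proof (intro set_eqI iffI)
    fix z assume "z \<in> edges (induced F (spoke i))"
    then obtain j j' where z: "z = (v i j, v i j')" "j \<le> l i" "j' \<le> l i" "(v i j, v i j') \<in> edges F"
      by (auto simp: induced_def spoke_def)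
    then have "j \<le> Suc j'" "j' \<le> Suc j"
      using edge_iff[OF i i] by auto
    then show "z \<in> {(v i ia, v i j) |ia j. ia \<le> l i \<and> j \<le> l i \<and> ia \<le> Suc j \<and> j \<le> Suc ia}"
      using z by blast
  next
    fix z assume "z \<in> {(v i ia, v i j) |ia j. ia \<le> l i \<and> j \<le> l i \<and> ia \<le> Suc j \<and> j \<le> Suc ia}"
    then obtain j j' where "z = (v i j, v i j')" "j \<le> l i" "j' \<le> l i" "j \<le> Suc j'" "j' \<le> Suc j"
      by blast
    then show "z \<in> edges (induced F (spoke i))"
      using edge_iff[OF i i, of j j'] by (simp add: induced_def spoke_def)
  qed
qed

lemma connected: "connected_in F (verts F)"
proof -
  have all: "v i j \<in> A"
    if AB: "A \<union> B = verts F" "A \<inter> B = {}" "\<forall>a\<in>A. \<forall>b\<in>B. (a, b) \<notin> edges F" and r: "i0 \<in> I" "v i0 0 \<in> A"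
      and i: "i \<in> I" "j \<le> l i" for A B i0 i j
    using i(2)
  proof (induction j)
    case 0
    then show ?case
      using root_eq[OF i(1) r(1)] r(2) by simp
  next
    case (Suc j)
    then have "(v i j, v i (Suc j)) \<in> edges F"
      using edge_iff[OF i(1) i(1)] by simp
    moreover have "v i (Suc j) \<in> A \<union> B"
      unfolding AB(1) using vertI i Suc by simp
    ultimately show ?case
      using Suc AB(3) by auto
  qed
  show ?thesis
    unfolding connected_in_def
  proof clarify
    fix A B assume AB: "A \<noteq> {}" "B \<noteq> {}" "A \<union> B = verts F" "A \<inter> B = {}" "\<forall>a\<in>A. \<forall>b\<in>B. (a, b) \<notin> edges F"
    obtain i0 where i0: "i0 \<in> I"
      using I_nonempty by blast
    have "v i0 0 \<in> A \<union> B"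
      unfolding AB(3) using vertI i0 by simp
    then consider "v i0 0 \<in> A" | "v i0 0 \<in> B"
      by blast
    then show False
    proof cases
      case 1
      have "verts F \<subseteq> A"
      proof
        fix x assume "x \<in> verts F"
        then show "x \<in> A"
          using all[OF AB(3,4,5) i0 1] by (metis vertE)
      qed
      then show False
        using AB by blast
    next
      case 2
      have BA: "B \<union> A = verts F" "B \<inter> A = {}" "\<forall>b\<in>B. \<forall>a\<in>A. (b, a) \<notin> edges F"
        using AB edges_sym by blast+
      have "verts F \<subseteq> B"
      proof
        fix x assume "x \<in> verts F"
        then show "x \<in> B"
          using all[OF BA i0 2] by (metis vertE)
      qed
      then show False
        using AB by blast
    qed
  qed
qed

text \<open>A vertex of a cycle furthest from the root has two distinct neighbours on the cycle, but
  only one neighbour that is not further away.\<close>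

lemma acyclic: "acyclic_graph F"
  unfolding acyclic_graph_def
proof
  assume "\<exists>cs. length cs \<ge> 3 \<and> distinct cs \<and> set cs \<subseteq> verts F \<and>
          (\<forall>i<length cs. (cs ! i, cs ! (Suc i mod length cs)) \<in> edges F)"
  then obtain cs where cs: "length cs \<ge> 3" "distinct cs" "set cs \<subseteq> verts F"
    "\<And>i. i < length cs \<Longrightarrow> (cs ! i, cs ! (Suc i mod length cs)) \<in> edges F"
    by blast
  define n where "n = length cs"
  have n: "3 \<le> n"
    using cs by (simp add: n_def)
  have "\<exists>i j. i \<in> I \<and> j \<le> l i \<and> cs ! k = v i j" if "k < n" for k
    using cs(3) that nth_mem[of k cs] by (metis n_def subsetD vertE)
  then obtain a b where ab: "\<And>k. k < n \<Longrightarrow> a k \<in> I \<and> b k \<le> l (a k) \<and> cs ! k = v (a k) (b k)"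
    by metis
  have dist: "v (a k) (b k) \<noteq> v (a k') (b k')" if "k < n" "k' < n" "k \<noteq> k'" for k k'
    using ab[of k] ab[of k'] cs(2) that by (metis n_def nth_eq_iff_index_eq)
  have "Max (b ` {..<n}) \<in> b ` {..<n}"
    using n by (intro Max_in) (auto simp: lessThan_empty_iff)
  then obtain k where k: "k < n" "b k = Max (b ` {..<n})"
    by (metis imageE lessThan_iff)
  have max: "b k' \<le> b k" if "k' < n" for k'
    unfolding k(2) using that by simp
  define nx where "nx = Suc k mod n"
  define pv where "pv = (if k = 0 then n - 1 else k - 1)"
  have nx: "nx < n" "nx \<noteq> k" and pv: "pv < n" "pv \<noteq> k" "pv \<noteq> nx" "Suc pv mod n = k"
    using n k(1) by (auto simp: nx_def pv_def mod_Suc split: if_splits)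
  have down: "v (a m) (b m) = v (a k) (b k - 1)"
    if m: "m < n" "m \<noteq> k" and E: "(v (a m) (b m), v (a k) (b k)) \<in> edges F" for m
  proof -
    have "a m = a k \<and> b m \<le> Suc (b k) \<and> b k \<le> Suc (b m) \<or> b m + b k \<le> 1"
      using E edge_iff[of "a m" "a k" "b m" "b k"] ab[OF m(1)] ab[OF k(1)] by blast
    moreover have "\<not> (b m = 0 \<and> b k = 0 \<or> a m = a k \<and> b m = b k)"
      using dist[OF m(1) k(1) m(2)] v_eq[of "a m" "a k" "b m" "b k"] ab[OF m(1)] ab[OF k(1)] by blast
    ultimately have "a m = a k \<and> b m = b k - 1 \<or> b m = 0 \<and> b k = 1"
      using max[OF m(1)] by linarith
    then show ?thesis
      using root_eq[of "a m" "a k"] ab[OF m(1)] ab[OF k(1)] by auto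
  qed
  have "(v (a pv) (b pv), v (a k) (b k)) \<in> edges F" "(v (a k) (b k), v (a nx) (b nx)) \<in> edges F"
    using cs(4)[of pv] cs(4)[of k] ab nx pv k n_def nx_def by auto
  then have "v (a pv) (b pv) = v (a nx) (b nx)"
    using down pv nx edges_sym by metis
  then show False
    using dist pv nx by blast
qed

lemma vdegree_root:
  assumes "i0 \<in> I"
  shows "vdegree F (v i0 0) = card I"
proof -
  have "{g' \<in> verts F. g' \<noteq> v i0 0 \<and> (g', v i0 0) \<in> edges F} = (\<lambda>i. v i 1) ` I"
  proof (intro set_eqI iffI)
    fix x assume x: "x \<in> {g' \<in> verts F. g' \<noteq> v i0 0 \<and> (g', v i0 0) \<in> edges F}"
    then obtain i j where ij: "i \<in> I" "j \<le> l i" "x = v i j"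
      by (auto elim: vertE)
    then have "j = 1"
      using x edge_iff[of i i0 j 0] v_eq[of i i0 j 0] assms by auto
    then show "x \<in> (\<lambda>i. v i 1) ` I"
      using ij by simp
  next
    fix x assume "x \<in> (\<lambda>i. v i 1) ` I"
    then obtain i where "i \<in> I" "x = v i 1"
      by auto
    then show "x \<in> {g' \<in> verts F. g' \<noteq> v i0 0 \<and> (g', v i0 0) \<in> edges F}"
      using edge_iff[of i i0 1 0] v_eq[of i i0 1 0] assms l_pos vertI by auto
  qed
  moreover have "inj_on (\<lambda>i. v i 1) I"
    using v_eq l_pos by (auto simp: inj_on_def)
  ultimately show ?thesis
    unfolding vdegree_def by (simp add: card_image)
qed

lemma vdegree_nonroot:
  assumes i: "i \<in> I" and j: "1 \<le> j" "j \<le> l i"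
  shows "vdegree F (v i j) = (if j = l i then 1 else 2)"
proof -
  have "{g' \<in> verts F. g' \<noteq> v i j \<and> (g', v i j) \<in> edges F} = v i ` {j'. j' \<le> l i \<and> (j' = j - 1 \<or> j' = Suc j)}"
  proof (intro set_eqI iffI)
    fix x assume x: "x \<in> {g' \<in> verts F. g' \<noteq> v i j \<and> (g', v i j) \<in> edges F}"
    then obtain i' j' where ij: "i' \<in> I" "j' \<le> l i'" "x = v i' j'"
      by (auto elim: vertE)
    have "i' = i \<and> j' \<le> Suc j \<and> j \<le> Suc j' \<or> j' + j \<le> 1" "\<not> (i' = i \<and> j' = j)"
      using x ij edge_iff[of i' i j' j] i j by auto
    then have "i' = i \<and> (j' = j - 1 \<or> j' = Suc j) \<or> j' = 0 \<and> j = 1"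
      using j(1) by (cases "i' = i") auto
    then show "x \<in> v i ` {j'. j' \<le> l i \<and> (j' = j - 1 \<or> j' = Suc j)}"
      using ij root_eq[OF ij(1) i] by auto
  next
    fix x assume "x \<in> v i ` {j'. j' \<le> l i \<and> (j' = j - 1 \<or> j' = Suc j)}"
    then obtain j' where j': "x = v i j'" "j' \<le> l i" "j' = j - 1 \<or> j' = Suc j"
      by blast
    then have "j' \<le> Suc j" "j \<le> Suc j'" "j' \<noteq> j"
      using j by auto
    then show "x \<in> {g' \<in> verts F. g' \<noteq> v i j \<and> (g', v i j) \<in> edges F}"
      using edge_iff[OF i i j'(2) j(2)] v_eq[OF i i j'(2) j(2)] vertI[OF i j'(2)] j j'(1) by auto
  qed
  moreover have "inj_on (v i) {j'. j' \<le> l i \<and> (j' = j - 1 \<or> j' = Suc j)}"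
    using v_eq i by (auto simp: inj_on_def)
  moreover have "{j'. j' \<le> l i \<and> (j' = j - 1 \<or> j' = Suc j)} = (if j = l i then {j - 1} else {j - 1, Suc j})"
    using j by auto
  ultimately show ?thesis
    unfolding vdegree_def by (simp add: card_image)
qed

lemma degree_ge_3: "i \<in> I \<Longrightarrow> j \<le> l i \<Longrightarrow> 3 \<le> vdegree F (v i j) \<longleftrightarrow> j = 0"
  using vdegree_root[of i] vdegree_nonroot[of i j] card_I by (cases "j = 0") auto

lemma fan: "is_fan F"
proof -
  obtain i0 where i0: "i0 \<in> I"
    using I_nonempty by blast
  have "\<exists>!r. r \<in> verts F \<and> vdegree F r \<ge> 3"
  proof (rule ex1I)
    show "v i0 0 \<in> verts F \<and> 3 \<le> vdegree F (v i0 0)"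
      using vertI degree_ge_3 i0 by simp
    fix r assume r: "r \<in> verts F \<and> 3 \<le> vdegree F r"
    then obtain i j where "i \<in> I" "j \<le> l i" "r = v i j"
      by (auto elim: vertE)
    then show "r = v i0 0"
      using degree_ge_3 root_eq[OF _ i0] r by auto
  qed
  then show ?thesis
    unfolding is_fan_def using graph connected acyclic by blast
qed

lemma fan_root_eq:
  assumes i: "i \<in> I"
  shows "fan_root F = v i 0"
  unfolding fan_root_def
proof (rule the_equality)
  show "v i 0 \<in> verts F \<and> 3 \<le> vdegree F (v i 0)"
    using vertI degree_ge_3 i by simp
  fix r assume r: "r \<in> verts F \<and> 3 \<le> vdegree F r"
  then obtain i' j where "i' \<in> I" "j \<le> l i'" "r = v i' j"
    by (auto elim: vertE)
  then show "r = v i 0"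
    using degree_ge_3 root_eq[OF _ i] r by auto
qed

lemma ends_eq: "ends F = (\<lambda>i. v i (l i)) ` I"
proof (intro set_eqI iffI)
  fix x assume x: "x \<in> ends F"
  then obtain i j where ij: "i \<in> I" "j \<le> l i" "x = v i j"
    unfolding ends_def by (auto elim: vertE)
  have "vdegree F (v i j) \<le> 1"
    using x ij unfolding ends_def by simp
  then have "j = l i"
    using vdegree_root[OF ij(1)] vdegree_nonroot[OF ij(1) _ ij(2)] card_I by (cases "j = 0") (auto split: if_splits)
  then show "x \<in> (\<lambda>i. v i (l i)) ` I"
    using ij by simp
next
  fix x assume "x \<in> (\<lambda>i. v i (l i)) ` I"
  then show "x \<in> ends F"
    using vdegree_nonroot l_pos vertI unfolding ends_def by auto
qed

text \<open>A path between the root and an end \<open>e\<close> contains the spoke of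
  \<open>e\<close>, since a missing vertex would separate \<open>e\<close> from the root. Conversely
  the spoke is a connected part of the path that contains both ends of the path, hence all of
  it.\<close>

lemma spokes_eq: "spokes F = spoke ` I"
proof (intro set_eqI iffI)
  fix S assume "S \<in> spoke ` I"
  then obtain i where i: "i \<in> I" "S = spoke i"
    by blast
  have "S \<subseteq> verts F"
    using i vertI by (auto simp: spoke_def)
  moreover have "is_path (induced F S)"
    using path_coords_is_path[OF spoke_path] i by simp
  moreover have "ends (induced F S) = {fan_root F, v i (l i)}"
    using path_coords_ends[OF spoke_path] i l_pos fan_root_eq by simp
  moreover have "v i (l i) \<in> ends F"
    using ends_eq i by simp
  ultimately show "S \<in> spokes F"
    unfolding spokes_def by blast
next
  fix S assume "S \<in> spokes F"
  then obtain e where S: "S \<subseteq> verts F" "is_path (induced F S)" "e \<in> ends F" "ends (induced F S) = {fan_root F, e}"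
    unfolding spokes_def by blast
  then obtain i where i: "i \<in> I" "e = v i (l i)"
    using ends_eq by auto
  have li: "1 \<le> l i"
    using l_pos i by simp
  obtain k w where w: "path_coords (induced F S) k w"
    using is_path_coords[OF S(2)] .
  have Sw: "S = w ` {..k}"
    using w S(1) unfolding path_coords_def induced_def by auto
  have r: "v i 0 \<in> S" and e: "v i (l i) \<in> S"
    using S(4) fan_root_eq[OF i(1)] i(2) unfolding ends_def induced_def by auto
  have connS: "connected_in (induced F S) S"
    unfolding Sw using path_coords_connected[OF w, of "{..k}"] Sw by auto
  have sub: "spoke i \<subseteq> S"
  proof (rule ccontr)
    assume "\<not> spoke i \<subseteq> S"
    then obtain j where j: "j \<le> l i" "v i j \<notin> S"
      unfolding spoke_def by auto
    then have j1: "1 \<le> j" "j < l i"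
      using r e by (metis One_nat_def Suc_leI gr0I, metis le_neq_implies_less)
    \<comment> \<open>The part beyond the missing vertex. In \<open>F\<close> it can be left only
      through that vertex, because its indices are at least 2.\<close>
    let ?A = "{v i j' | j'. j < j' \<and> j' \<le> l i} \<inter> S"
    have inA: "v i (l i) \<in> ?A"
      using e j1 by blast
    have "v i 0 \<notin> {v i j' | j'. j < j' \<and> j' \<le> l i}"
      using v_eq[OF i(1) i(1)] by auto
    then have notA: "v i 0 \<in> S - ?A"
      using r by blast
    have split: "?A \<union> (S - ?A) = S" "?A \<inter> (S - ?A) = {}"
      by blast+
    obtain a b where ab: "a \<in> ?A" "b \<in> S - ?A" "(a, b) \<in> edges (induced F S)"
      by (rule connected_inD[OF connS split inA notA])
    from IntD1[OF ab(1)] obtain ja where ja: "a = v i ja" "j < ja" "ja \<le> l i"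
      by auto
    have "b \<in> verts F"
      using DiffD1[OF ab(2)] S(1) by (rule subsetD[rotated])
    then obtain i' jb where jb: "i' \<in> I" "jb \<le> l i'" "b = v i' jb"
      by (rule vertE)
    have "(v i ja, v i' jb) \<in> edges F"
      using ab(3) ja jb unfolding induced_def by auto
    then have "i' = i" "ja \<le> Suc jb"
      using edge_iff[OF i(1) jb(1) ja(3) jb(2)] ja j1 by auto
    then have "j \<le> jb" "jb \<noteq> j"
      using ja j(2) ab(2) jb by auto
    then have "b \<in> ?A"
      using jb ab(2) \<open>i' = i\<close> by auto
    then show False
      using ab(2) by blast
  qed
  have "v i 0 \<noteq> v i (l i)"
    using v_eq[OF i(1) i(1), of 0 "l i"] li by auto
  then have k1: "1 \<le> k"
    using r e unfolding Sw by (cases k) auto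
  have ends: "{w 0, w k} = {v i 0, v i (l i)}"
    using path_coords_ends[OF w k1] S(4) fan_root_eq[OF i(1)] i(2) by simp
  define J where "J = {t. t \<le> k \<and> w t \<in> spoke i}"
  have "spoke i \<subseteq> w ` {..k}"
    using sub Sw by simp
  then have J: "spoke i = w ` J" "J \<subseteq> {..k}"
    unfolding J_def by blast+
  have "connected_in (induced F (spoke i)) (spoke i)"
    using path_coords_connected[OF spoke_path[OF i(1)], of "{..l i}"] unfolding spoke_def by auto
  then have "connected_in (induced F S) (w ` J)"
    unfolding J(1)[symmetric] by (rule connected_in_edges_mono) (use sub in \<open>auto simp: induced_def\<close>)
  then have conv: "\<forall>i\<in>J. \<forall>j\<in>J. \<forall>x. i \<le> x \<longrightarrow> x \<le> j \<longrightarrow> x \<in> J"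
    using path_coords_connected[OF w J(2)] by blast
  have "v i 0 \<in> spoke i" "v i (l i) \<in> spoke i"
    unfolding spoke_def by auto
  then have "w 0 \<in> spoke i" "w k \<in> spoke i"
    using ends by (metis insertCI insertE singletonD)+
  then have "0 \<in> J" "k \<in> J"
    by (auto simp: J_def)
  then have "x \<in> J" if "x \<le> k" for x
    using conv that by blast
  then have "J = {..k}"
    using J(2) by blast
  then show "S \<in> spoke ` I"
    using J Sw i by auto
qed

lemma reindex:
  assumes "bij_betw \<tau> I' I"
  shows "fan_coords F I' (\<lambda>i. l (\<tau> i)) (\<lambda>i. v (\<tau> i))"
proof
  have t: "\<tau> i \<in> I" if "i \<in> I'" for i
    using assms that bij_betwE by blast
  have inj: "\<tau> i = \<tau> i' \<longleftrightarrow> i = i'" if "i \<in> I'" "i' \<in> I'" for i i'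
    using assms that unfolding bij_betw_def inj_on_def by blast
  show "finite I'" "3 \<le> card I'"
    using assms finite_I card_I bij_betw_finite bij_betw_same_card by metis+
  show "1 \<le> l (\<tau> i)" if "i \<in> I'" for i
    using l_pos t that by blast
  show "(v (\<tau> i) j = v (\<tau> i') j') = (j = 0 \<and> j' = 0 \<or> i = i' \<and> j = j')"
    if "i \<in> I'" "i' \<in> I'" "j \<le> l (\<tau> i)" "j' \<le> l (\<tau> i')" for i i' j j'
    using v_eq[OF t t] inj that by simp
  show "verts F = {v (\<tau> i) j |i j. i \<in> I' \<and> j \<le> l (\<tau> i)}"
  proof -
    have "I = \<tau> ` I'"
      using assms bij_betw_def by metis
    then show ?thesis
      unfolding verts_F by auto
  qed
  show "edges F \<subseteq> verts F \<times> verts F"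
    by (rule edges_F)
  show "((v (\<tau> i) j, v (\<tau> i') j') \<in> edges F) = (i = i' \<and> j \<le> Suc j' \<and> j' \<le> Suc j \<or> j + j' \<le> 1)"
    if "i \<in> I'" "i' \<in> I'" "j \<le> l (\<tau> i)" "j' \<le> l (\<tau> i')" for i i' j j'
    using edge_iff[OF t t] inj that by simp
qed

end

text \<open>Supplies the fans on which the Fraisse conditions are tested: the lengths of at least
  three spokes can be prescribed.\<close>

lemma fan_exists:
  fixes I :: "'i set" and l :: "'i \<Rightarrow> nat"
  assumes "finite I" "3 \<le> card I" "\<And>i. i \<in> I \<Longrightarrow> 1 \<le> l i"
  obtains F :: "'a::infinite rgraph" and v where "fan_coords F I l v"
proof -
  obtain i0 where i0: "i0 \<in> I"
    using assms(2) by fastforce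
  have "finite (SIGMA i:I. {..l i})"
    using assms(1) by simp
  then obtain \<iota> :: "'i \<times> nat \<Rightarrow> 'a" where \<iota>: "inj_on \<iota> (SIGMA i:I. {..l i})"
    using arb_inj_on_finite_infinite by blast
  \<comment> \<open>At \<open>j = 0\<close> all spokes use the index \<open>i0\<close>, so that they
    share the root.\<close>
  define v where "v i j = \<iota> (if j = 0 then i0 else i, j)" for i j
  let ?V = "{v i j | i j. i \<in> I \<and> j \<le> l i}"
  let ?adj = "\<lambda>i j i' j'. i = i' \<and> j \<le> Suc j' \<and> j' \<le> Suc j \<or> j + j' \<le> (1::nat)"
  define F where "F = \<lparr>verts = ?V,
    edges = {(v i j, v i' j') | i j i' j'. i \<in> I \<and> j \<le> l i \<and> i' \<in> I \<and> j' \<le> l i' \<and> ?adj i j i' j'}\<rparr>"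
  have v_eq: "v i j = v i' j' \<longleftrightarrow> j = 0 \<and> j' = 0 \<or> i = i' \<and> j = j'"
    if "i \<in> I" "i' \<in> I" "j \<le> l i" "j' \<le> l i'" for i i' j j'
    unfolding v_def using inj_on_eq_iff[OF \<iota>] that i0 by auto
  have "fan_coords F I l v"
  proof
    show "((v i j, v i' j') \<in> edges F) = ?adj i j i' j'"
      if ij: "i \<in> I" "i' \<in> I" "j \<le> l i" "j' \<le> l i'" for i i' j j'
    proof
      assume "(v i j, v i' j') \<in> edges F"
      then obtain a b a' b' where ab: "v i j = v a b" "v i' j' = v a' b'" "a \<in> I" "b \<le> l a" "a' \<in> I" "b' \<le> l a'" "?adj a b a' b'"
        unfolding F_def by auto
      show "?adj i j i' j'"
        using v_eq[OF ij(1) ab(3) ij(3) ab(4)] v_eq[OF ij(2) ab(5) ij(4) ab(6)] ab by auto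
    next
      assume "?adj i j i' j'"
      then show "(v i j, v i' j') \<in> edges F"
        unfolding F_def using ij by auto
    qed
  qed (use assms v_eq in \<open>auto simp: F_def\<close>)
  then show ?thesis
    using that by blast
qed

text \<open>The spokes are the longest paths starting at the root and leaving it through a given
  neighbour: by acyclicity and since all other degrees are at most \<open>2\<close>, such a path contains all
  neighbours of its vertices other than the root.\<close>

lemma fan_coords_exist:
  assumes "is_fan F"
  shows "\<exists>l v. fan_coords F (ends F) l v \<and> (\<forall>e\<in>ends F. v e (l e) = e)"
proof -
  let ?V = "verts F" and ?E = "edges F"
  define r where "r = fan_root F"
  have fin: "finite ?V" and sub: "?E \<subseteq> ?V \<times> ?V" and refl: "\<And>x. x \<in> ?V \<Longrightarrow> (x, x) \<in> ?E"
    and symE: "\<And>x y. (x, y) \<in> ?E \<Longrightarrow> (y, x) \<in> ?E"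
    using assms unfolding is_fan_def is_graph_def refl_on_def by (auto dest: symD)
  have ex1: "\<exists>!r. r \<in> ?V \<and> vdegree F r \<ge> 3"
    using assms unfolding is_fan_def by blast
  have r: "r \<in> ?V" "3 \<le> vdegree F r"
    using theI'[OF ex1] unfolding r_def fan_root_def by auto
  define N where "N x = {y \<in> ?V. y \<noteq> x \<and> (y, x) \<in> ?E}" for x
  have finN: "finite (N x)" for x
    using fin by (simp add: N_def)
  have cardN: "card (N x) \<le> 2" if "x \<in> ?V" "x \<noteq> r" for x
  proof (rule ccontr)
    assume "\<not> card (N x) \<le> 2"
    then have "vdegree F x \<ge> 3"
      by (simp add: N_def vdegree_def)
    then show False
      using ex1 r that by blast
  qed
  have Nr: "3 \<le> card (N r)"
    using r(2) by (simp add: N_def vdegree_def)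
  have N_sym: "y \<in> N x \<Longrightarrow> x \<in> N y" for x y
    using sub symE by (auto simp: N_def)
  have N_iff: "(x, y) \<in> ?E \<longleftrightarrow> y = x \<or> y \<in> N x" if "x \<in> ?V" "y \<in> ?V" for x y
    using refl[OF that(1)] that(2) symE[of x y] symE[of y x] unfolding N_def by blast
  define ray where "ray p \<longleftrightarrow> 2 \<le> length p \<and> distinct p \<and> set p \<subseteq> ?V \<and> p ! 0 = r \<and>
      (\<forall>i. Suc i < length p \<longrightarrow> (p ! i, p ! Suc i) \<in> ?E)" for p
  have "\<exists>p. (ray p \<and> p ! 1 = x) \<and> (\<forall>q. ray q \<and> q ! 1 = x \<longrightarrow> length q \<le> length p)" if x: "x \<in> N r" for x
  proof (rule ex_has_greatest_nat[where b = "Suc (card ?V)"])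
    show "ray [r, x] \<and> [r, x] ! 1 = x"
      using x r symE by (auto simp: ray_def N_def less_Suc_eq)
    show "\<forall>q. ray q \<and> q ! 1 = x \<longrightarrow> length q < Suc (card ?V)"
      unfolding ray_def using fin by (metis card_mono distinct_card le_imp_less_Suc)
  qed
  then obtain p where p: "\<And>x. x \<in> N r \<Longrightarrow> ray (p x) \<and> p x ! 1 = x"
    and longest: "\<And>x q. x \<in> N r \<Longrightarrow> ray q \<Longrightarrow> q ! 1 = x \<Longrightarrow> length q \<le> length (p x)"
    by metis
  define l where "l x = length (p x) - 1" for x
  define v where "v x j = p x ! j" for x j
  have l1: "1 \<le> l x" and lenp: "length (p x) = Suc (l x)" if "x \<in> N r" for x
    using p[OF that] by (auto simp: l_def ray_def)
  have v0: "v x 0 = r" and v1: "v x 1 = x" if "x \<in> N r" for x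
    using p[OF that] by (auto simp: v_def ray_def)
  have vV: "v x j \<in> ?V" if "x \<in> N r" "j \<le> l x" for x j
    using p[OF that(1)] lenp[OF that(1)] that(2) nth_mem[of j "p x"] by (auto simp: v_def ray_def)
  have vE: "(v x j, v x (Suc j)) \<in> ?E" if "x \<in> N r" "j < l x" for x j
    using p[OF that(1)] lenp[OF that(1)] that(2) by (auto simp: v_def ray_def)
  have v_inj: "v x j = v x j' \<longleftrightarrow> j = j'" if "x \<in> N r" "j \<le> l x" "j' \<le> l x" for x j j'
    using p[OF that(1)] lenp[OF that(1)] that by (simp add: v_def ray_def nth_eq_iff_index_eq)
  have v_r: "v x j = r \<longleftrightarrow> j = 0" if "x \<in> N r" "j \<le> l x" for x j
    using v_inj[OF that(1), of j 0] v0 that by simp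
  have prev: "v x (j - 1) \<in> N (v x j)" if "x \<in> N r" "1 \<le> j" "j \<le> l x" for x j
    using vE[OF that(1), of "j - 1"] vV[OF that(1), of "j - 1"] v_inj[OF that(1), of "j - 1" j] that
    by (auto simp: N_def)
  have succ: "v x (Suc j) \<in> N (v x j)" if "x \<in> N r" "j < l x" for x j
    using N_sym[OF prev[OF that(1), of "Suc j"]] that by simp
  \<comment> \<open>At an inner vertex of a ray the degree bound leaves only the two neighbours on
    the ray. At the last vertex a second neighbour would either close a cycle or prolong a ray of
    maximal length.\<close>
  have nb: "N (v x j) \<subseteq> v x ` {..l x} \<and> (\<forall>j'\<le>l x. v x j' \<in> N (v x j) \<longrightarrow> j' = j - 1 \<or> j' = Suc j)"
    if x: "x \<in> N r" and j: "1 \<le> j" "j \<le> l x" for x j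
  proof (cases "j < l x")
    case True
    have "{v x (j - 1), v x (Suc j)} \<subseteq> N (v x j)"
      using prev[OF x j] succ[OF x True] by simp
    moreover have "v x (j - 1) \<noteq> v x (Suc j)"
      using v_inj[OF x, of "j - 1" "Suc j"] True by auto
    then have "card (N (v x j)) \<le> card {v x (j - 1), v x (Suc j)}"
      using cardN[OF vV[OF x j(2)]] v_r[OF x j(2)] j by simp
    ultimately have eq: "{v x (j - 1), v x (Suc j)} = N (v x j)"
      by (intro card_seteq finN) auto
    show ?thesis
      unfolding eq[symmetric] using v_inj[OF x, of _ "j - 1"] v_inj[OF x, of _ "Suc j"] True by simp
  next
    case False
    then have jl: "j = l x"
      using j by simp
    have "y = v x (j - 1)" if y: "y \<in> N (v x j)" for y
    proof (rule ccontr)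
      assume ne: "y \<noteq> v x (j - 1)"
      have yV: "y \<in> ?V" "y \<noteq> v x j" "(v x j, y) \<in> ?E"
        using y symE by (auto simp: N_def)
      show False
      proof (cases "y \<in> set (p x)")
        case True
        then obtain i where i: "i \<le> l x" "y = v x i"
          using lenp[OF x] by (metis in_set_conv_nth less_Suc_eq_le v_def)
        then have i2: "Suc i < l x"
          using ne yV(2) jl by (metis Suc_lessI diff_Suc_1 le_neq_implies_less)
        define cs where "cs = drop i (p x)"
        have len: "length cs = Suc (l x) - i"
          using lenp[OF x] by (simp add: cs_def)
        have csn: "cs ! t = v x (i + t)" for t
          using i lenp[OF x] by (simp add: cs_def v_def)
        have "length cs \<ge> 3"
          using len i2 by simp
        moreover have "distinct cs" "set cs \<subseteq> ?V"
          using p[OF x] set_drop_subset[of i "p x"] by (auto simp: cs_def ray_def)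
        moreover have "(cs ! t, cs ! (Suc t mod length cs)) \<in> ?E" if t: "t < length cs" for t
        proof (cases "Suc t = length cs")
          case True
          then have "i + t = l x"
            using len i2 by simp
          then show ?thesis
            using True yV(3) i(2) jl by (simp add: csn)
        next
          case False
          then have "i + t < l x"
            using t len by simp
          then show ?thesis
            using False t vE[OF x] by (simp add: csn)
        qed
        ultimately have "\<not> acyclic_graph F"
          unfolding acyclic_graph_def by blast
        then show False
          using assms unfolding is_fan_def by blast
      next
        case False
        have edge: "((p x @ [y]) ! i, (p x @ [y]) ! Suc i) \<in> ?E" if "Suc i < length (p x @ [y])" for i
        proof (cases "i < l x")
          case True
          then show ?thesis
            using vE[OF x True] lenp[OF x] by (simp add: nth_append v_def)
        next
          case False
          then have "i = l x"
            using that lenp[OF x] by simp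
          then show ?thesis
            using yV(3) jl lenp[OF x] by (simp add: nth_append v_def)
        qed
        have "ray (p x @ [y])"
          unfolding ray_def
        proof (intro conjI allI impI)
          show "2 \<le> length (p x @ [y])" "distinct (p x @ [y])" "set (p x @ [y]) \<subseteq> ?V" "(p x @ [y]) ! 0 = r"
            using p[OF x] False yV lenp[OF x] by (auto simp: ray_def nth_append)
        qed (use edge in blast)
        moreover have "(p x @ [y]) ! 1 = x"
          using p[OF x] lenp[OF x] l1[OF x] by (simp add: nth_append)
        ultimately show False
          using longest[OF x] by fastforce
      qed
    qed
    then have "N (v x j) \<subseteq> {v x (j - 1)}"
      by blast
    moreover have "j - 1 \<le> l x"
      using j by simp
    ultimately show ?thesis
      using v_inj[OF x, of _ "j - 1"] by blast
  qed
  have not1: False if x: "x \<in> N r" "x' \<in> N r" and j: "2 \<le> j" "j \<le> l x'" and eq: "x = v x' j" for x x' j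
  proof -
    have "v x' 0 \<in> N (v x' j)"
      using N_sym[OF x(1)] eq v0[OF x(2)] by simp
    then have "0 = j - 1 \<or> 0 = Suc j"
      using nb[OF x(2), of j] j by auto
    then show False
      using j by auto
  qed
  \<comment> \<open>Going back along the ray of \<open>x\<close>, each vertex remains on the ray of
    \<open>x'\<close> by \<open>nb\<close>, until one of the two indices is 1; there
    \<open>not1\<close> applies.\<close>
  have v_inj': "x = x' \<and> j = j'"
    if xx: "x \<in> N r" "x' \<in> N r" and jj: "1 \<le> j" "j \<le> l x" "1 \<le> j'" "j' \<le> l x'" "v x j = v x' j'" for x x' j j'
  proof -
    have "x = x'"
      using jj
    proof (induction j arbitrary: j')
      case (Suc j)
      show ?case
      proof (cases "j = 0 \<or> j' = 1")
        case True
        then show ?thesis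
        proof
          assume "j = 0"
          then have "x = v x' j'"
            using Suc.prems v1[OF xx(1)] by simp
          moreover from this have "\<not> 2 \<le> j'"
            using not1[OF xx] Suc.prems by blast
          ultimately show ?thesis
            using Suc.prems v1[OF xx(2)] by (metis One_nat_def Suc_1 le_antisym not_less_eq_eq)
        next
          assume "j' = 1"
          then have "x' = v x (Suc j)"
            using Suc.prems v1[OF xx(2)] by simp
          moreover from this have "\<not> 2 \<le> Suc j"
            using not1[OF xx(2,1)] Suc.prems by blast
          ultimately show ?thesis
            using v1[OF xx(1)] by (cases j) auto
        qed
      next
        case False
        then have j: "1 \<le> j" "j \<le> l x" "2 \<le> j'"
          using Suc.prems by auto
        have n: "v x j \<in> N (v x' j')"
          using prev[OF xx(1) Suc.prems(1,2)] Suc.prems(5) by simp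
        note nb' = nb[OF xx(2) Suc.prems(3,4)]
        have "v x j \<in> v x' ` {..l x'}"
          using conjunct1[OF nb'] n by (rule subsetD)
        then obtain j'' where j'': "v x j = v x' j''" "j'' \<le> l x'"
          by auto
        have "v x' j'' \<in> N (v x' j')"
          using n j''(1) by simp
        then have "j'' = j' - 1 \<or> j'' = Suc j'"
          using conjunct2[OF nb'] j''(2) by simp
        then have "1 \<le> j''"
          using j(3) by linarith
        then show ?thesis
          using Suc.IH[OF j(1,2) _ j''(2,1)] by simp
      qed
    qed simp
    then show ?thesis
      using v_inj xx jj by blast
  qed
  let ?W = "{v i j | i j. i \<in> N r \<and> j \<le> l i}"
  have "N r \<noteq> {}"
    using Nr by auto
  then obtain x0 where x0: "x0 \<in> N r"
    by blast
  have WV: "?W = ?V"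
  proof (rule ccontr)
    assume ne: "?W \<noteq> ?V"
    have WsubV: "?W \<subseteq> ?V"
      using vV by auto
    then obtain y where y: "y \<in> ?V - ?W"
      using ne by blast
    have rW: "r \<in> ?W"
      using v0[OF x0] x0 by (metis (mono_tags, lifting) le0 mem_Collect_eq)
    have "connected_in F ?V"
      using assms unfolding is_fan_def by blast
    moreover have "?W \<union> (?V - ?W) = ?V" "?W \<inter> (?V - ?W) = {}"
      using WsubV by blast+
    ultimately obtain a b where ab: "a \<in> ?W" "b \<in> ?V - ?W" "(a, b) \<in> ?E"
      using rW y connected_inD[of F ?V ?W "?V - ?W" r y] by blast
    obtain x j where xj: "a = v x j" "x \<in> N r" "j \<le> l x"
      using ab(1) by blast
    have bN: "b \<in> N a"
      using ab symE unfolding N_def by blast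
    show False
    proof (cases "j = 0")
      case True
      then have "b \<in> N r"
        using bN xj v0 by simp
      then have "b = v b 1" "1 \<le> l b"
        using v1 l1 by auto
      then have "b \<in> ?W"
        using \<open>b \<in> N r\<close> by blast
      then show False
        using ab by blast
    next
      case False
      then have "b \<in> v x ` {..l x}"
        using nb[OF xj(2) _ xj(3)] bN xj(1) by (metis One_nat_def Suc_leI gr0I subsetD)
      then have "b \<in> ?W"
        using xj by auto
      then show False
        using ab by blast
    qed
  qed
  have edge_r: "(r, v x j) \<in> ?E \<longleftrightarrow> j \<le> 1" if x: "x \<in> N r" "j \<le> l x" for x j
  proof (cases "j = 0")
    case True
    then show ?thesis
      using v0[OF x(1)] refl[OF r(1)] by simp
  next
    case False
    have "v x j \<in> N r \<longleftrightarrow> j = 1"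
    proof
      assume y: "v x j \<in> N r"
      then show "j = 1"
        using v_inj'[OF y x(1) _ l1[OF y] _ x(2)] v1[OF y] False by simp
    next
      assume "j = 1"
      then show "v x j \<in> N r"
        using v1 x by simp
    qed
    moreover have "v x j \<in> N r \<longleftrightarrow> (r, v x j) \<in> ?E"
      using vV[OF x] v_r[OF x] False symE unfolding N_def by blast
    ultimately show ?thesis
      using False by auto
  qed
  have edge_iff: "(v x j, v x' j') \<in> ?E \<longleftrightarrow> x = x' \<and> j \<le> Suc j' \<and> j' \<le> Suc j \<or> j + j' \<le> 1"
    if x: "x \<in> N r" "x' \<in> N r" "j \<le> l x" "j' \<le> l x'" for x x' j j'
  proof -
    consider "j = 0" | "j' = 0" | "1 \<le> j" "1 \<le> j'"
      by linarith
    then show ?thesis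
    proof cases
      case 1
      then show ?thesis
        using edge_r[OF x(2,4)] v0[OF x(1)] by auto
    next
      case 2
      have "(v x j, r) \<in> ?E \<longleftrightarrow> (r, v x j) \<in> ?E"
        using symE by blast
      then show ?thesis
        using edge_r[OF x(1,3)] v0[OF x(2)] 2 by auto
    next
      case 3
      have "(v x j, v x' j') \<in> ?E \<longleftrightarrow> v x' j' = v x j \<or> v x' j' \<in> N (v x j)"
        using N_iff[OF vV[OF x(1,3)] vV[OF x(2,4)]] .
      also have "\<dots> \<longleftrightarrow> x = x' \<and> j \<le> Suc j' \<and> j' \<le> Suc j"
      proof
        assume "v x' j' = v x j \<or> v x' j' \<in> N (v x j)"
        then show "x = x' \<and> j \<le> Suc j' \<and> j' \<le> Suc j"
        proof
          assume "v x' j' = v x j"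
          then show ?thesis
            using v_inj'[OF x(2,1) 3(2) x(4) 3(1) x(3)] by simp
        next
          assume n: "v x' j' \<in> N (v x j)"
          then obtain j'' where j'': "j'' \<le> l x" "v x' j' = v x j''"
            using nb[OF x(1) 3(1) x(3)] by blast
          have "v x' j' \<noteq> r"
            using v_r[OF x(2,4)] 3 by simp
          then have "j'' \<noteq> 0"
            using j''(2) v0[OF x(1)] by (cases j'') simp_all
          then have "x' = x \<and> j' = j''"
            using v_inj'[OF x(2,1) 3(2) x(4) _ j''(1)] j''(2) by simp
          moreover have "j'' = j - 1 \<or> j'' = Suc j"
            using nb[OF x(1) 3(1) x(3)] n j'' by simp
          ultimately show ?thesis
            using 3 by auto
        qed
      next
        assume *: "x = x' \<and> j \<le> Suc j' \<and> j' \<le> Suc j"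
        then consider "j' = j" | "j' = j - 1" | "j' = Suc j"
          by linarith
        then show "v x' j' = v x j \<or> v x' j' \<in> N (v x j)"
          using * prev[OF x(1) 3(1) x(3)] succ[OF x(1), of j] x by cases auto
      qed
      finally show ?thesis
        using 3 by auto
    qed
  qed
  have C: "fan_coords F (N r) l v"
  proof
    show "(v i j = v i' j') = (j = 0 \<and> j' = 0 \<or> i = i' \<and> j = j')"
      if "i \<in> N r" "i' \<in> N r" "j \<le> l i" "j' \<le> l i'" for i i' j j'
    proof (cases "j = 0 \<or> j' = 0")
      case True
      then show ?thesis
        using v_r[OF that(1,3)] v_r[OF that(2,4)] v0[OF that(1)] v0[OF that(2)] by auto
    next
      case False
      then show ?thesis
        using v_inj'[OF that(1,2) _ that(3) _ that(4)] by auto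
    qed
  qed (use finN Nr l1 WV sub edge_iff in auto)
  \<comment> \<open>Each ray stops in exactly one end, so the rays can be renumbered by the
    ends.\<close>
  define t where "t x = v x (l x)" for x
  have "inj_on t (N r)"
    unfolding inj_on_def t_def using v_inj'[OF _ _ l1 le_refl l1 le_refl] by blast
  moreover have "t ` N r = ends F"
    using fan_coords.ends_eq[OF C] by (simp add: t_def)
  ultimately have bij: "bij_betw t (N r) (ends F)"
    unfolding bij_betw_def by simp
  let ?\<tau> = "inv_into (N r) t"
  have "fan_coords F (ends F) (\<lambda>e. l (?\<tau> e)) (\<lambda>e. v (?\<tau> e))"
    using fan_coords.reindex[OF C bij_betw_inv_into[OF bij]] .
  moreover have "v (?\<tau> e) (l (?\<tau> e)) = e" if "e \<in> ends F" for e
    using bij that unfolding t_def[symmetric] by (simp add: bij_betw_inv_into_right)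
  ultimately have "fan_coords F (ends F) (\<lambda>e. l (?\<tau> e)) (\<lambda>e. v (?\<tau> e)) \<and> (\<forall>e\<in>ends F. v (?\<tau> e) (l (?\<tau> e)) = e)"
    by blast
  then show ?thesis
    by (rule exI[of _ "\<lambda>e. l (?\<tau> e)", OF exI[of _ "\<lambda>e. v (?\<tau> e)"]])
qed

section \<open>Morphisms of fans in coordinates\<close>

definition fan_mor ::
  "'i set \<Rightarrow> ('i \<Rightarrow> nat) \<Rightarrow> 'j set \<Rightarrow> ('j \<Rightarrow> nat) \<Rightarrow> ('i \<Rightarrow> 'j) \<Rightarrow> ('i \<Rightarrow> nat \<Rightarrow> nat) \<Rightarrow> ('i \<Rightarrow> nat \<Rightarrow> nat) \<Rightarrow> bool" where
  "fan_mor I l I' l' \<epsilon> \<alpha> \<beta> \<longleftrightarrow> \<epsilon> ` I = I' \<and> (\<forall>i\<in>I. walk (l i) (l' (\<epsilon> i)) (\<alpha> i) (\<beta> i))"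

definition fan_rel ::
  "('j \<Rightarrow> nat \<Rightarrow> 'b) \<Rightarrow> 'i set \<Rightarrow> ('i \<Rightarrow> nat) \<Rightarrow> ('i \<Rightarrow> nat \<Rightarrow> 'a) \<Rightarrow> ('i \<Rightarrow> 'j) \<Rightarrow> ('i \<Rightarrow> nat \<Rightarrow> nat) \<Rightarrow>
   ('i \<Rightarrow> nat \<Rightarrow> nat) \<Rightarrow> ('b \<times> 'a) set" where
  "fan_rel v' I l v \<epsilon> \<alpha> \<beta> = {(v' (\<epsilon> i) j', v i j) | i j j'. i \<in> I \<and> j \<le> l i \<and> \<alpha> i j \<le> j' \<and> j' \<le> \<beta> i j}"

lemma fan_morD: "fan_mor I l I' l' \<epsilon> \<alpha> \<beta> \<Longrightarrow> i \<in> I \<Longrightarrow> \<epsilon> i \<in> I' \<and> walk (l i) (l' (\<epsilon> i)) (\<alpha> i) (\<beta> i)"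
  unfolding fan_mor_def by auto

lemma fan_relI:
  "i \<in> I \<Longrightarrow> j \<le> l i \<Longrightarrow> \<alpha> i j \<le> j' \<Longrightarrow> j' \<le> \<beta> i j \<Longrightarrow> (v' (\<epsilon> i) j', v i j) \<in> fan_rel v' I l v \<epsilon> \<alpha> \<beta>"
  unfolding fan_rel_def by blast

lemma fan_relE:
  assumes "(x, y) \<in> fan_rel v' I l v \<epsilon> \<alpha> \<beta>"
  obtains i j j' where "i \<in> I" "j \<le> l i" "\<alpha> i j \<le> j'" "j' \<le> \<beta> i j" "x = v' (\<epsilon> i) j'" "y = v i j"
  using assms unfolding fan_rel_def by blast

locale fan_pair = G: fan_coords G I l v + H: fan_coords H I' l' v'
  for G :: "'a rgraph" and I :: "'i set" and l v and H :: "'a rgraph" and I' :: "'j set" and l' v'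
begin

text \<open>The alternative \<open>j' = 0\<close> to \<open>i' = \<epsilon> i\<close> is due to the
  root, which has coordinates on every spoke.\<close>

lemma fan_rel_iff:
  assumes m: "fan_mor I l I' l' \<epsilon> \<alpha> \<beta>" and i: "i \<in> I" "j \<le> l i" "i' \<in> I'" "j' \<le> l' i'"
  shows "(v' i' j', v i j) \<in> fan_rel v' I l v \<epsilon> \<alpha> \<beta> \<longleftrightarrow> (i' = \<epsilon> i \<or> j' = 0) \<and> \<alpha> i j \<le> j' \<and> j' \<le> \<beta> i j"
proof
  assume "(v' i' j', v i j) \<in> fan_rel v' I l v \<epsilon> \<alpha> \<beta>"
  then obtain a b b' where a: "a \<in> I" "b \<le> l a" "\<alpha> a b \<le> b'" "b' \<le> \<beta> a b" "v' i' j' = v' (\<epsilon> a) b'" "v i j = v a b"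
    by (rule fan_relE)
  have w: "\<epsilon> a \<in> I'" "walk (l a) (l' (\<epsilon> a)) (\<alpha> a) (\<beta> a)" "walk (l i) (l' (\<epsilon> i)) (\<alpha> i) (\<beta> i)"
    using fan_morD[OF m] a(1) i(1) by auto
  have b': "b' \<le> l' (\<epsilon> a)"
    using walk_bound[OF w(2) a(2)] a(4) by simp
  have eq: "j' = 0 \<and> b' = 0 \<or> i' = \<epsilon> a \<and> j' = b'"
    using H.v_eq[OF i(3) w(1) i(4) b'] a(5) by simp
  have "j = 0 \<and> b = 0 \<or> i = a \<and> j = b"
    using G.v_eq[OF i(1) a(1) i(2) a(2)] a(6) by simp
  then show "(i' = \<epsilon> i \<or> j' = 0) \<and> \<alpha> i j \<le> j' \<and> j' \<le> \<beta> i j"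
  proof
    assume 0: "j = 0 \<and> b = 0"
    then have "b' = 0"
      using walk_ends[OF w(2)] a(4) by simp
    then show ?thesis
      using eq 0 walk_ends[OF w(3)] by auto
  next
    assume "i = a \<and> j = b"
    then show ?thesis
      using eq a by auto
  qed
next
  assume *: "(i' = \<epsilon> i \<or> j' = 0) \<and> \<alpha> i j \<le> j' \<and> j' \<le> \<beta> i j"
  then have "v' i' j' = v' (\<epsilon> i) j'"
    using H.root_eq[OF i(3), of "\<epsilon> i"] fan_morD[OF m i(1)] by auto
  then show "(v' i' j', v i j) \<in> fan_rel v' I l v \<epsilon> \<alpha> \<beta>"
    using fan_relI[OF i(1), of j l \<alpha> j' \<beta> v' \<epsilon> v] i(2) * by simp
qed

lemma fan_rel_sub:
  assumes m: "fan_mor I l I' l' \<epsilon> \<alpha> \<beta>"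
  shows "fan_rel v' I l v \<epsilon> \<alpha> \<beta> \<subseteq> verts H \<times> verts G"
proof clarify
  fix x y assume "(x, y) \<in> fan_rel v' I l v \<epsilon> \<alpha> \<beta>"
  then obtain a b b' where a: "a \<in> I" "b \<le> l a" "\<alpha> a b \<le> b'" "b' \<le> \<beta> a b" "x = v' (\<epsilon> a) b'" "y = v a b"
    by (rule fan_relE)
  have w: "\<epsilon> a \<in> I'" "walk (l a) (l' (\<epsilon> a)) (\<alpha> a) (\<beta> a)"
    using fan_morD[OF m a(1)] by auto
  show "x \<in> verts H \<and> y \<in> verts G"
    using G.vertI[OF a(1,2)] H.vertI[OF w(1), of b'] walk_bound(1)[OF w(2) a(2)] a(4-6) by simp
qed

lemma fan_rel_root:
  assumes m: "fan_mor I l I' l' \<epsilon> \<alpha> \<beta>" and i: "i \<in> I" "i' \<in> I'"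
  shows "(x, v i 0) \<in> fan_rel v' I l v \<epsilon> \<alpha> \<beta> \<longleftrightarrow> x = v' i' 0"
proof
  have w: "walk (l i) (l' (\<epsilon> i)) (\<alpha> i) (\<beta> i)"
    using fan_morD[OF m i(1)] by auto
  assume x: "(x, v i 0) \<in> fan_rel v' I l v \<epsilon> \<alpha> \<beta>"
  then have "x \<in> verts H"
    using fan_rel_sub[OF m] by blast
  then obtain a b where ab: "a \<in> I'" "b \<le> l' a" "x = v' a b"
    by (rule H.vertE)
  then have "b \<le> \<beta> i 0"
    using fan_rel_iff[OF m i(1) _ ab(1,2), of 0] x by simp
  then show "x = v' i' 0"
    using ab walk_ends[OF w] H.root_eq[OF ab(1) i(2)] by simp
next
  assume "x = v' i' 0"
  moreover have "(v' i' 0, v i 0) \<in> fan_rel v' I l v \<epsilon> \<alpha> \<beta>"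
    using fan_rel_iff[OF m i(1) _ i(2), of 0 0] walk_ends[OF conjunct2[OF fan_morD[OF m i(1)]]] by simp
  ultimately show "(x, v i 0) \<in> fan_rel v' I l v \<epsilon> \<alpha> \<beta>"
    by simp
qed

lemma fan_rel_end:
  assumes m: "fan_mor I l I' l' \<epsilon> \<alpha> \<beta>" and i: "i \<in> I"
  shows "(x, v i (l i)) \<in> fan_rel v' I l v \<epsilon> \<alpha> \<beta> \<longleftrightarrow> x = v' (\<epsilon> i) (l' (\<epsilon> i))"
proof
  have w: "\<epsilon> i \<in> I'" "walk (l i) (l' (\<epsilon> i)) (\<alpha> i) (\<beta> i)"
    using fan_morD[OF m i] by auto
  assume x: "(x, v i (l i)) \<in> fan_rel v' I l v \<epsilon> \<alpha> \<beta>"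
  then have "x \<in> verts H"
    using fan_rel_sub[OF m] by blast
  then obtain a b where ab: "a \<in> I'" "b \<le> l' a" "x = v' a b"
    by (rule H.vertE)
  then have "(a = \<epsilon> i \<or> b = 0) \<and> \<alpha> i (l i) \<le> b \<and> b \<le> \<beta> i (l i)"
    using fan_rel_iff[OF m i _ ab(1,2), of "l i"] x by simp
  then have "b = l' (\<epsilon> i)" "a = \<epsilon> i"
    using walk_ends[OF w(2)] H.l_pos[OF w(1)] by auto
  then show "x = v' (\<epsilon> i) (l' (\<epsilon> i))"
    using ab by simp
next
  assume "x = v' (\<epsilon> i) (l' (\<epsilon> i))"
  then show "(x, v i (l i)) \<in> fan_rel v' I l v \<epsilon> \<alpha> \<beta>"
    using fan_relI[OF i, of "l i" l \<alpha> "l' (\<epsilon> i)" \<beta> v' \<epsilon> v]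
      walk_ends[OF conjunct2[OF fan_morD[OF m i]]] by simp
qed

lemma fan_rel_spoke:
  assumes m: "fan_mor I l I' l' \<epsilon> \<alpha> \<beta>" and i: "i \<in> I"
  shows "rel_image (fan_rel v' I l v \<epsilon> \<alpha> \<beta>) (G.spoke i) \<subseteq> H.spoke (\<epsilon> i)"
    and "fan_rel v' I l v \<epsilon> \<alpha> \<beta> \<inter> H.spoke (\<epsilon> i) \<times> G.spoke i = walk_rel (v' (\<epsilon> i)) (v i) (l i) (\<alpha> i) (\<beta> i)"
proof -
  let ?R = "fan_rel v' I l v \<epsilon> \<alpha> \<beta>"
  have w: "\<epsilon> i \<in> I'" "walk (l i) (l' (\<epsilon> i)) (\<alpha> i) (\<beta> i)"
    using fan_morD[OF m i] by auto
  have key: "\<exists>b\<le>l' (\<epsilon> i). x = v' (\<epsilon> i) b \<and> \<alpha> i j \<le> b \<and> b \<le> \<beta> i j" if x: "(x, v i j) \<in> ?R" "j \<le> l i" for x j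
  proof -
    have "x \<in> verts H"
      using fan_rel_sub[OF m] x by blast
    then obtain a b where ab: "a \<in> I'" "b \<le> l' a" "x = v' a b"
      by (rule H.vertE)
    have "(a = \<epsilon> i \<or> b = 0) \<and> \<alpha> i j \<le> b \<and> b \<le> \<beta> i j"
      using fan_rel_iff[OF m i x(2) ab(1,2)] x ab by simp
    moreover from this have "v' a b = v' (\<epsilon> i) b" "b \<le> l' (\<epsilon> i)"
      using H.root_eq[OF ab(1) w(1)] walk_bound(1)[OF w(2) x(2)] by auto
    ultimately show ?thesis
      using ab(3) by auto
  qed
  show "rel_image ?R (G.spoke i) \<subseteq> H.spoke (\<epsilon> i)"
  proof
    fix x assume "x \<in> rel_image ?R (G.spoke i)"
    then obtain j where j: "j \<le> l i" "(x, v i j) \<in> ?R"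
      unfolding rel_image_def G.spoke_def by blast
    from key[OF j(2,1)] show "x \<in> H.spoke (\<epsilon> i)"
      unfolding H.spoke_def by auto
  qed
  show "?R \<inter> H.spoke (\<epsilon> i) \<times> G.spoke i = walk_rel (v' (\<epsilon> i)) (v i) (l i) (\<alpha> i) (\<beta> i)"
  proof (intro set_eqI iffI)
    fix z assume "z \<in> ?R \<inter> H.spoke (\<epsilon> i) \<times> G.spoke i"
    then obtain x j where j: "z = (x, v i j)" "j \<le> l i" "(x, v i j) \<in> ?R"
      unfolding G.spoke_def by blast
    from key[OF j(3,2)] obtain b where b: "x = v' (\<epsilon> i) b" "\<alpha> i j \<le> b" "b \<le> \<beta> i j"
      by blast
    then show "z \<in> walk_rel (v' (\<epsilon> i)) (v i) (l i) (\<alpha> i) (\<beta> i)"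
      using walk_relI[of j "l i" "\<alpha> i" b "\<beta> i" "v' (\<epsilon> i)" "v i"] j b by simp
  next
    fix z assume "z \<in> walk_rel (v' (\<epsilon> i)) (v i) (l i) (\<alpha> i) (\<beta> i)"
    then obtain b j where z: "z = (v' (\<epsilon> i) b, v i j)" "j \<le> l i" "\<alpha> i j \<le> b" "b \<le> \<beta> i j"
      unfolding walk_rel_def by blast
    have "b \<le> l' (\<epsilon> i)"
      using walk_bound(1)[OF w(2) z(2)] z(4) by simp
    then show "z \<in> ?R \<inter> H.spoke (\<epsilon> i) \<times> G.spoke i"
      using fan_relI[OF i, of j l \<alpha> b \<beta> v' \<epsilon> v] z unfolding G.spoke_def H.spoke_def by auto
  qed
qed

lemma fan_rel_co_bijective:
  assumes m: "fan_mor I l I' l' \<epsilon> \<alpha> \<beta>"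
  shows "co_bijective G H (fan_rel v' I l v \<epsilon> \<alpha> \<beta>)"
  unfolding co_bijective_def
proof (intro conjI ballI)
  let ?R = "fan_rel v' I l v \<epsilon> \<alpha> \<beta>"
  {
    fix g assume "g \<in> verts G"
    then obtain i j where ij: "i \<in> I" "j \<le> l i" "g = v i j"
      by (rule G.vertE)
    have "(v' (\<epsilon> i) (\<alpha> i j), g) \<in> ?R"
      unfolding ij(3) using fan_relI[OF ij(1), of j l \<alpha> "\<alpha> i j" \<beta> v' \<epsilon> v] walk_le ij(2) fan_morD[OF m ij(1)] by blast
    then show "rel_image ?R {g} \<noteq> {}"
      unfolding rel_image_def by blast
  next
    fix h assume "h \<in> verts H"
    then obtain i' j' where i': "i' \<in> I'" "j' \<le> l' i'" "h = v' i' j'"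
      by (rule H.vertE)
    then obtain i where i: "i \<in> I" "i' = \<epsilon> i"
      using m unfolding fan_mor_def by blast
    have w: "walk (l i) (l' (\<epsilon> i)) (\<alpha> i) (\<beta> i)"
      using fan_morD[OF m i(1)] by auto
    obtain j where j: "j \<le> l i" "\<alpha> i j = j'" "\<beta> i j = j'"
      using walk_hit[OF w] i' i by blast
    have "x = h" if x: "(x, v i j) \<in> ?R" for x
    proof -
      have "x \<in> verts H"
        using fan_rel_sub[OF m] x by blast
      then obtain a b where ab: "a \<in> I'" "b \<le> l' a" "x = v' a b"
        by (rule H.vertE)
      have "(a = \<epsilon> i \<or> b = 0) \<and> \<alpha> i j \<le> b \<and> b \<le> \<beta> i j"
        using fan_rel_iff[OF m i(1) j(1) ab(1,2)] x ab by simp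
      then show ?thesis
        using H.v_eq[OF ab(1) i'(1) ab(2) i'(2)] ab(3) i'(3) i(2) j by auto
    qed
    moreover have "(h, v i j) \<in> ?R"
      using fan_relI[OF i(1), of j l \<alpha> j' \<beta> v' \<epsilon> v] j i i' by simp
    ultimately have "rel_image ?R {v i j} = {h}"
      unfolding rel_image_def by blast
    then show "\<exists>g\<in>verts G. rel_image ?R {g} = {h}"
      using G.vertI[OF i(1) j(1)] by blast
  }
qed

lemma fan_rel_edge_preserving:
  assumes m: "fan_mor I l I' l' \<epsilon> \<alpha> \<beta>"
  shows "edge_preserving G H (fan_rel v' I l v \<epsilon> \<alpha> \<beta>)"
  unfolding edge_preserving_def
proof (intro allI impI)
  let ?R = "fan_rel v' I l v \<epsilon> \<alpha> \<beta>"
  fix h g h' g' assume *: "(h, g) \<in> ?R" "(h', g') \<in> ?R" "(g, g') \<in> edges G"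
  obtain i j b where i: "i \<in> I" "j \<le> l i" "\<alpha> i j \<le> b" "b \<le> \<beta> i j" "h = v' (\<epsilon> i) b" "g = v i j"
    using *(1) by (rule fan_relE)
  obtain i2 j2 b2 where i2: "i2 \<in> I" "j2 \<le> l i2" "\<alpha> i2 j2 \<le> b2" "b2 \<le> \<beta> i2 j2" "h' = v' (\<epsilon> i2) b2" "g' = v i2 j2"
    using *(2) by (rule fan_relE)
  have w: "\<epsilon> i \<in> I'" "walk (l i) (l' (\<epsilon> i)) (\<alpha> i) (\<beta> i)" "\<epsilon> i2 \<in> I'" "walk (l i2) (l' (\<epsilon> i2)) (\<alpha> i2) (\<beta> i2)"
    using fan_morD[OF m] i(1) i2(1) by auto
  have b: "b \<le> l' (\<epsilon> i)" "b2 \<le> l' (\<epsilon> i2)" "b \<le> j" "b2 \<le> j2"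
    using walk_bound(1)[OF w(2) i(2)] walk_bound(1)[OF w(4) i2(2)] walk_le_self[OF w(2) i(2)]
      walk_le_self[OF w(4) i2(2)] i i2 by auto
  have "i = i2 \<and> j \<le> Suc j2 \<and> j2 \<le> Suc j \<or> j + j2 \<le> 1"
    using G.edge_iff[OF i(1) i2(1) i(2) i2(2)] *(3) i(6) i2(6) by simp
  then have "\<epsilon> i = \<epsilon> i2 \<and> b \<le> Suc b2 \<and> b2 \<le> Suc b \<or> b + b2 \<le> 1"
  proof
    assume a: "i = i2 \<and> j \<le> Suc j2 \<and> j2 \<le> Suc j"
    then have "b \<le> Suc b2 \<and> b2 \<le> Suc b"
      using walk_edge[OF w(2), of j j2 b b2] i i2 by auto
    then show ?thesis
      using a by simp
  next
    assume "j + j2 \<le> 1"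
    then show ?thesis
      using b by auto
  qed
  then show "(h, h') \<in> edges H"
    using H.edge_iff[OF w(1,3) b(1,2)] i i2 by simp
qed

lemma fan_rel_hom:
  assumes m: "fan_mor I l I' l' \<epsilon> \<alpha> \<beta>"
  shows "fan_rel v' I l v \<epsilon> \<alpha> \<beta> \<in> hom catX G H"
proof -
  let ?R = "fan_rel v' I l v \<epsilon> \<alpha> \<beta>"
  have "spoke_monotone G H ?R"
    unfolding spoke_monotone_def
  proof (intro conjI ballI)
    obtain i where i: "i \<in> I"
      using G.I_nonempty by blast
    have e: "\<epsilon> i \<in> I'"
      using fan_morD[OF m i] by simp
    show "rel_image ?R {fan_root G} = {fan_root H}"
      unfolding G.fan_root_eq[OF i] H.fan_root_eq[OF e] rel_image_def using fan_rel_root[OF m i e] by simp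
  next
    fix S assume "S \<in> spokes G"
    then obtain i where i: "i \<in> I" "S = G.spoke i"
      unfolding G.spokes_eq by blast
    have w: "\<epsilon> i \<in> I'" "walk (l i) (l' (\<epsilon> i)) (\<alpha> i) (\<beta> i)"
      using fan_morD[OF m i(1)] by auto
    have "monotone_rel (induced G S) (induced H (H.spoke (\<epsilon> i))) (?R \<inter> H.spoke (\<epsilon> i) \<times> S)"
      unfolding i(2) fan_rel_spoke(2)[OF m i(1)]
      by (rule walk_rel_monotone[OF G.spoke_path[OF i(1)] H.spoke_path[OF w(1)] w(2)])
    then show "\<exists>T\<in>spokes H. rel_image ?R S \<subseteq> T \<and> monotone_rel (induced G S) (induced H T) (?R \<inter> T \<times> S)"
      using fan_rel_spoke(1)[OF m i(1)] i(2) w(1) unfolding H.spokes_eq by blast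
  qed
  moreover have "end_preserving G H ?R"
    unfolding end_preserving_def
  proof (intro ballI subsetI)
    fix e x assume "e \<in> ends G" "x \<in> rel_image ?R {e}"
    then obtain i where i: "i \<in> I" "(x, v i (l i)) \<in> ?R"
      unfolding G.ends_eq rel_image_def by blast
    then have "x = v' (\<epsilon> i) (l' (\<epsilon> i))" "\<epsilon> i \<in> I'"
      using fan_rel_end[OF m i(1)] fan_morD[OF m i(1)] by auto
    then show "x \<in> ends H"
      unfolding H.ends_eq by blast
  qed
  ultimately show ?thesis
    using fan_rel_sub[OF m] fan_rel_co_bijective[OF m] fan_rel_edge_preserving[OF m] by (simp add: catX_def)
qed

text \<open>Restriction to a spoke and the spoke that contains its image gives a monotone relation
  of paths. It maps root to root, and end to end because the last vertex is the only end of
  \<open>H\<close> on that spoke; so \<open>monotone_walk_rel\<close> applies and the direction is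
  fixed. Every end of \<open>H\<close> is the only image of some vertex and lies on one spoke, which
  makes \<epsilon> surjective.\<close>

lemma hom_fan_rel:
  assumes R: "R \<in> hom catX G H"
  obtains \<epsilon> \<alpha> \<beta> where "fan_mor I l I' l' \<epsilon> \<alpha> \<beta>" "R = fan_rel v' I l v \<epsilon> \<alpha> \<beta>"
proof -
  have sub: "R \<subseteq> verts H \<times> verts G" and co: "co_bijective G H R" and ep: "edge_preserving G H R"
    and sm: "spoke_monotone G H R" and endp: "end_preserving G H R"
    using R by (auto simp: catX_def)
  have total: "\<exists>h. (h, g) \<in> R" if "g \<in> verts G" for g
    using co that unfolding co_bijective_def rel_image_def by blast
  have ex: "\<exists>i' a b. i' \<in> I' \<and> walk (l i) (l' i') a b \<and> rel_image R (G.spoke i) \<subseteq> H.spoke i' \<and>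
      R \<inter> H.spoke i' \<times> G.spoke i = walk_rel (v' i') (v i) (l i) a b" if i: "i \<in> I" for i
  proof -
    have "G.spoke i \<in> spokes G"
      using i G.spokes_eq by blast
    then obtain T where T: "T \<in> spokes H" "rel_image R (G.spoke i) \<subseteq> T"
        "monotone_rel (induced G (G.spoke i)) (induced H T) (R \<inter> T \<times> G.spoke i)"
      using sm unfolding spoke_monotone_def by blast
    obtain i' where i': "i' \<in> I'" "T = H.spoke i'"
      using T(1) unfolding H.spokes_eq by blast
    let ?Q = "R \<inter> T \<times> G.spoke i"
    let ?P = "induced G (G.spoke i)" and ?P' = "induced H T"
    have P: "path_coords ?P (l i) (v i)" and P': "path_coords ?P' (l' i') (v' i')"
      using G.spoke_path[OF i] H.spoke_path[OF i'(1)] i'(2) by auto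
    have image: "h \<in> T" if "(h, g) \<in> R" "g \<in> G.spoke i" for h g
      using T(2) that unfolding rel_image_def by blast
    have vP: "verts ?P = G.spoke i" "verts ?P' = T"
      using P P' unfolding path_coords_def G.spoke_def i'(2) H.spoke_def by auto
    have spV: "G.spoke i \<subseteq> verts G"
      using G.vertI[OF i] unfolding G.spoke_def by auto
    have q_sub: "?Q \<subseteq> verts ?P' \<times> verts ?P"
      unfolding vP by blast
    have q_total: "\<exists>h. (h, g) \<in> ?Q" if "g \<in> verts ?P" for g
    proof -
      have g: "g \<in> G.spoke i" "g \<in> verts G"
        using that vP spV by auto
      then show ?thesis
        using total[OF g(2)] image[OF _ g(1)] by blast
    qed
    have q_edge: "edge_preserving ?P ?P' ?Q"
      using ep image unfolding edge_preserving_def induced_def by simp blast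
    have q_first: "(h, v i 0) \<in> ?Q \<longleftrightarrow> h = v' i' 0" for h
    proof -
      have "{h. (h, v i 0) \<in> R} = {v' i' 0}"
        using sm G.fan_root_eq[OF i] H.fan_root_eq[OF i'(1)] unfolding spoke_monotone_def rel_image_def by simp
      moreover have "v i 0 \<in> G.spoke i" "v' i' 0 \<in> T"
        unfolding i'(2) G.spoke_def H.spoke_def by auto
      ultimately show ?thesis
        by blast
    qed
    have end1: "h = v' i' (l' i')" if h: "(h, v i (l i)) \<in> R" for h
    proof -
      have "v i (l i) \<in> ends G"
        using i G.ends_eq by blast
      then have "h \<in> ends H"
        using endp h unfolding end_preserving_def rel_image_def by blast
      then obtain a where a: "a \<in> I'" "h = v' a (l' a)"
        using H.ends_eq by blast
      have "v i (l i) \<in> G.spoke i"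
        unfolding G.spoke_def by simp
      then have "h \<in> T"
        using image h by blast
      then obtain b where b: "b \<le> l' i'" "h = v' i' b"
        unfolding i'(2) H.spoke_def by auto
      then show ?thesis
        using H.v_eq[OF a(1) i'(1) _ b(1), of "l' a"] a(2) H.l_pos[OF a(1)] by auto
    qed
    have q_final: "(h, v i (l i)) \<in> ?Q \<longleftrightarrow> h = v' i' (l' i')" for h
    proof -
      have "v i (l i) \<in> G.spoke i"
        unfolding G.spoke_def by simp
      then have "v i (l i) \<in> verts ?P"
        using vP(1) by simp
      then obtain h' where "(h', v i (l i)) \<in> ?Q"
        using q_total by blast
      then show ?thesis
        using end1 by blast
    qed
    obtain a b where "walk (l i) (l' i') a b" "?Q = walk_rel (v' i') (v i) (l i) a b"
      by (rule monotone_walk_rel[OF P P' q_sub q_total q_edge T(3) q_first q_final])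
    then show ?thesis
      using i' T(2) by blast
  qed
  then obtain \<epsilon> \<alpha> \<beta> where w: "\<And>i. i \<in> I \<Longrightarrow> \<epsilon> i \<in> I' \<and> walk (l i) (l' (\<epsilon> i)) (\<alpha> i) (\<beta> i) \<and>
      rel_image R (G.spoke i) \<subseteq> H.spoke (\<epsilon> i) \<and>
      R \<inter> H.spoke (\<epsilon> i) \<times> G.spoke i = walk_rel (v' (\<epsilon> i)) (v i) (l i) (\<alpha> i) (\<beta> i)"
    by metis
  have R_eq: "R = fan_rel v' I l v \<epsilon> \<alpha> \<beta>"
  proof (intro set_eqI iffI)
    fix z assume z: "z \<in> R"
    obtain x y where xy: "z = (x, y)"
      by (cases z)
    then have "y \<in> verts G"
      using sub z by blast
    then obtain i j where ij: "i \<in> I" "j \<le> l i" "y = v i j"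
      by (rule G.vertE)
    have y: "y \<in> G.spoke i"
      using ij unfolding G.spoke_def by simp
    then have "x \<in> rel_image R (G.spoke i)"
      using z xy unfolding rel_image_def by blast
    then have "x \<in> H.spoke (\<epsilon> i)"
      using w[OF ij(1)] by blast
    then have "z \<in> R \<inter> H.spoke (\<epsilon> i) \<times> G.spoke i"
      using xy y z by blast
    then have "z \<in> walk_rel (v' (\<epsilon> i)) (v i) (l i) (\<alpha> i) (\<beta> i)"
      using w[OF ij(1)] by blast
    then show "z \<in> fan_rel v' I l v \<epsilon> \<alpha> \<beta>"
      unfolding walk_rel_def fan_rel_def using ij(1) by blast
  next
    fix z assume "z \<in> fan_rel v' I l v \<epsilon> \<alpha> \<beta>"
    then obtain i where i: "i \<in> I" "z \<in> walk_rel (v' (\<epsilon> i)) (v i) (l i) (\<alpha> i) (\<beta> i)"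
      unfolding walk_rel_def fan_rel_def by blast
    then show "z \<in> R"
      using w[OF i(1)] by blast
  qed
  have "\<epsilon> ` I = I'"
  proof (intro set_eqI iffI)
    fix i' assume i': "i' \<in> I'"
    then have "v' i' (l' i') \<in> verts H"
      using H.vertI by simp
    then obtain g where g: "g \<in> verts G" "rel_image R {g} = {v' i' (l' i')}"
      using co unfolding co_bijective_def by blast
    then obtain i j where ij: "i \<in> I" "j \<le> l i" "g = v i j"
      using G.vertE by blast
    have "v' i' (l' i') \<in> rel_image R (G.spoke i)"
      using g(2) ij unfolding rel_image_def G.spoke_def by blast
    then have "v' i' (l' i') \<in> H.spoke (\<epsilon> i)"
      using w[OF ij(1)] by blast
    then obtain b where b: "b \<le> l' (\<epsilon> i)" "v' i' (l' i') = v' (\<epsilon> i) b"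
      unfolding H.spoke_def by auto
    have "\<epsilon> i \<in> I'"
      using w[OF ij(1)] by blast
    then have "i' = \<epsilon> i"
      using H.v_eq[OF i' _ le_refl b(1)] b(2) H.l_pos[OF i'] by auto
    then show "i' \<in> \<epsilon> ` I"
      using ij by blast
  qed (use w in auto)
  then have "fan_mor I l I' l' \<epsilon> \<alpha> \<beta>"
    unfolding fan_mor_def using w by blast
  then show ?thesis
    using that R_eq by blast
qed

text \<open>The last vertex of a spoke has a single image, which determines \<epsilon>; then the
  extreme images give the inequalities. Used for both inclusions this shows that a relation
  determines its coordinates; used for one it expresses lax factorisation.\<close>

lemma fan_rel_mono_iff:
  assumes m: "fan_mor I l I' l' \<epsilon> \<alpha> \<beta>" and m2: "fan_mor I l I' l' \<epsilon>2 \<alpha>2 \<beta>2"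
  shows "fan_rel v' I l v \<epsilon> \<alpha> \<beta> \<subseteq> fan_rel v' I l v \<epsilon>2 \<alpha>2 \<beta>2 \<longleftrightarrow>
    (\<forall>i\<in>I. \<epsilon> i = \<epsilon>2 i \<and> (\<forall>j\<le>l i. \<alpha>2 i j \<le> \<alpha> i j \<and> \<beta> i j \<le> \<beta>2 i j))"
proof
  assume sub: "fan_rel v' I l v \<epsilon> \<alpha> \<beta> \<subseteq> fan_rel v' I l v \<epsilon>2 \<alpha>2 \<beta>2"
  show "\<forall>i\<in>I. \<epsilon> i = \<epsilon>2 i \<and> (\<forall>j\<le>l i. \<alpha>2 i j \<le> \<alpha> i j \<and> \<beta> i j \<le> \<beta>2 i j)"
  proof (intro ballI conjI allI impI)
    fix i assume i: "i \<in> I"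
    have w: "\<epsilon> i \<in> I'" "walk (l i) (l' (\<epsilon> i)) (\<alpha> i) (\<beta> i)" "\<epsilon>2 i \<in> I'"
      using fan_morD[OF m i] fan_morD[OF m2 i] by auto
    have "(v' (\<epsilon> i) (l' (\<epsilon> i)), v i (l i)) \<in> fan_rel v' I l v \<epsilon>2 \<alpha>2 \<beta>2"
      using sub fan_rel_end[OF m i] by blast
    then have "v' (\<epsilon> i) (l' (\<epsilon> i)) = v' (\<epsilon>2 i) (l' (\<epsilon>2 i))"
      using fan_rel_end[OF m2 i] by blast
    then show e: "\<epsilon> i = \<epsilon>2 i"
      using H.v_eq[OF w(1,3) le_refl le_refl] H.l_pos[OF w(1)] by auto
    fix j assume j: "j \<le> l i"
    have b: "\<alpha> i j \<le> \<beta> i j" "\<beta> i j \<le> l' (\<epsilon> i)" "\<alpha> i j \<le> l' (\<epsilon> i)"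
      using walk_le[OF w(2) j] walk_bound[OF w(2) j] by auto
    have "(v' (\<epsilon> i) b, v i j) \<in> fan_rel v' I l v \<epsilon>2 \<alpha>2 \<beta>2" if "\<alpha> i j \<le> b" "b \<le> \<beta> i j" for b
      using sub fan_relI[of i I j l \<alpha> b \<beta> v' \<epsilon> v] i j that by blast
    then have "(v' (\<epsilon> i) (\<alpha> i j), v i j) \<in> fan_rel v' I l v \<epsilon>2 \<alpha>2 \<beta>2"
      "(v' (\<epsilon> i) (\<beta> i j), v i j) \<in> fan_rel v' I l v \<epsilon>2 \<alpha>2 \<beta>2"
      using b by auto
    then show "\<alpha>2 i j \<le> \<alpha> i j" "\<beta> i j \<le> \<beta>2 i j"
      using fan_rel_iff[OF m2 i j w(1)] b by auto
  qed
next
  assume le: "\<forall>i\<in>I. \<epsilon> i = \<epsilon>2 i \<and> (\<forall>j\<le>l i. \<alpha>2 i j \<le> \<alpha> i j \<and> \<beta> i j \<le> \<beta>2 i j)"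
  show "fan_rel v' I l v \<epsilon> \<alpha> \<beta> \<subseteq> fan_rel v' I l v \<epsilon>2 \<alpha>2 \<beta>2"
  proof clarify
    fix x y assume "(x, y) \<in> fan_rel v' I l v \<epsilon> \<alpha> \<beta>"
    then obtain i j b where i: "i \<in> I" "j \<le> l i" "\<alpha> i j \<le> b" "b \<le> \<beta> i j" "x = v' (\<epsilon> i) b" "y = v i j"
      by (rule fan_relE)
    then have "\<epsilon> i = \<epsilon>2 i" "\<alpha>2 i j \<le> b" "b \<le> \<beta>2 i j"
      using le by (auto intro: order_trans)
    then show "(x, y) \<in> fan_rel v' I l v \<epsilon>2 \<alpha>2 \<beta>2"
      using fan_relI[of i I j l \<alpha>2 b \<beta>2 v' \<epsilon>2 v] i by simp
  qed
qed

text \<open>Away from the root a star lies on one spoke and consists of consecutive vertices. The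
  star of the root meets all spokes, but \<open>refines 2\<close> forces
  \<open>\<alpha> a 1 = 0\<close> on each of them, so the root of \<open>H\<close> serves.\<close>

lemma star_refining_iff:
  assumes m: "fan_mor I l I' l' \<epsilon> \<alpha> \<beta>"
  shows "star_refining G H (fan_rel v' I l v \<epsilon> \<alpha> \<beta>) \<longleftrightarrow> (\<forall>i\<in>I. refines 2 (l i) (\<alpha> i) (\<beta> i))"
proof
  let ?R = "fan_rel v' I l v \<epsilon> \<alpha> \<beta>"
  assume star: "star_refining G H ?R"
  show "\<forall>i\<in>I. refines 2 (l i) (\<alpha> i) (\<beta> i)"
    unfolding refines_def
  proof (intro ballI allI impI)
    fix i j j' assume i: "i \<in> I" and j: "j \<le> j'" "j' \<le> l i" "j' \<le> j + 2"
    \<comment> \<open>The middle of the window, or its beginning if the window has fewer than three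
      vertices.\<close>
    define t where "t = (if j' = j + 2 then j + 1 else j)"
    have t: "t \<le> l i" "j \<le> Suc t" "t \<le> Suc j" "j' \<le> Suc t" "t \<le> Suc j'" "j \<le> l i"
      using j by (auto simp: t_def)
    obtain h where h: "h \<in> verts H" "{g' \<in> verts G. (g', v i t) \<in> edges G} \<subseteq> ?R `` {h}"
      using star G.vertI[OF i t(1)] unfolding star_refining_def by blast
    obtain a b where ab: "a \<in> I'" "b \<le> l' a" "h = v' a b"
      using h(1) by (rule H.vertE)
    have "(h, v i j) \<in> ?R" "(h, v i j') \<in> ?R"
      using h(2) G.vertI[OF i t(6)] G.vertI[OF i j(2)] G.edge_iff[OF i i t(6,1)] G.edge_iff[OF i i j(2) t(1)] t by auto
    then show "\<alpha> i j' \<le> \<beta> i j"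
      using fan_rel_iff[OF m i t(6) ab(1,2)] fan_rel_iff[OF m i j(2) ab(1,2)] ab(3) by simp
  qed
next
  let ?R = "fan_rel v' I l v \<epsilon> \<alpha> \<beta>"
  assume ref: "\<forall>i\<in>I. refines 2 (l i) (\<alpha> i) (\<beta> i)"
  show "star_refining G H ?R"
    unfolding star_refining_def
  proof
    fix g assume "g \<in> verts G"
    then obtain i j where i: "i \<in> I" "j \<le> l i" "g = v i j"
      by (rule G.vertE)
    have w: "\<epsilon> i \<in> I'" "walk (l i) (l' (\<epsilon> i)) (\<alpha> i) (\<beta> i)"
      using fan_morD[OF m i(1)] by auto
    \<comment> \<open>The least image of the outer neighbour: it is above the least images of the
      whole star, and below the largest ones by refinement.\<close>
    define c where "c = \<alpha> i (min (Suc j) (l i))"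
    have c: "c \<le> l' (\<epsilon> i)"
      using walk_bound(2)[OF w(2), of "min (Suc j) (l i)"] by (simp add: c_def)
    have "(v' (\<epsilon> i) c, x) \<in> ?R" if x: "x \<in> verts G" "(x, g) \<in> edges G" for x
    proof -
      obtain a t where a: "a \<in> I" "t \<le> l a" "x = v a t"
        using x(1) by (rule G.vertE)
      have adj: "a = i \<and> t \<le> Suc j \<and> j \<le> Suc t \<or> t + j \<le> 1"
        using G.edge_iff[OF a(1) i(1) a(2) i(2)] x(2) a(3) i(3) by simp
      have ca: "\<alpha> i t \<le> c" "c \<le> \<beta> i t" if t: "t \<le> Suc j" "j \<le> Suc t" "t \<le> l i" for t
      proof -
        show "\<alpha> i t \<le> c"
          unfolding c_def using t by (intro walk_mono(1)[OF w(2)]) auto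
        have "refines 2 (l i) (\<alpha> i) (\<beta> i)"
          using ref i(1) by blast
        then show "c \<le> \<beta> i t"
          unfolding c_def refines_def using t by (metis (no_types, lifting) add_2_eq_Suc' le_SucI min.bounded_iff min.cobounded1 min.cobounded2 Suc_le_mono le_trans)
      qed
      show ?thesis
      proof (cases "a = i \<or> t = 0")
        case True
        then have xt: "x = v i t" "t \<le> l i"
          using a G.root_eq[OF a(1) i(1)] by auto
        have "t \<le> Suc j" "j \<le> Suc t"
          using adj by auto
        then show ?thesis
          using fan_relI[of i I t l \<alpha> c \<beta> v' \<epsilon> v] i(1) ca xt by simp
      next
        case False
        then have "t = 1" "j = 0"
          using adj by auto
        have "refines 2 (l a) (\<alpha> a) (\<beta> a)"
          using ref a(1) by blast
        then have "\<alpha> a 1 \<le> \<beta> a 0"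
          unfolding refines_def using a(2) \<open>t = 1\<close> by simp
        then have "\<alpha> a t = 0"
          using walk_ends fan_morD[OF m a(1)] \<open>t = 1\<close> by fastforce
        have "c \<le> \<beta> i 0"
          using ca(2)[of 0] \<open>j = 0\<close> by simp
        then have "c = 0"
          using walk_ends[OF w(2)] by simp
        then show ?thesis
          using fan_rel_iff[OF m a(1,2) w(1) c] a(3) \<open>\<alpha> a t = 0\<close> by simp
      qed
    qed
    then show "\<exists>h\<in>verts H. {g' \<in> verts G. (g', g) \<in> edges G} \<subseteq> ?R `` {h}"
      using H.vertI[OF w(1) c] by blast
  qed
qed

lemma end_splitting_iff:
  assumes m: "fan_mor I l I' l' \<epsilon> \<alpha> \<beta>"
  shows "end_splitting G H (fan_rel v' I l v \<epsilon> \<alpha> \<beta>) \<longleftrightarrow> (\<forall>i'\<in>I'. 2 \<le> card {i \<in> I. \<epsilon> i = i'})"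
proof -
  let ?R = "fan_rel v' I l v \<epsilon> \<alpha> \<beta>"
  have v_end: "v i (l i) = v i2 (l i2) \<longleftrightarrow> i = i2" if "i \<in> I" "i2 \<in> I" for i i2
    using G.v_eq[OF that le_refl le_refl] G.l_pos[OF that(1)] by auto
  have end_R: "(v' i' (l' i'), v i (l i)) \<in> ?R \<longleftrightarrow> \<epsilon> i = i'" if "i \<in> I" "i' \<in> I'" for i i'
  proof -
    have e: "\<epsilon> i \<in> I'"
      using fan_morD[OF m that(1)] by simp
    show ?thesis
      unfolding fan_rel_end[OF m that(1)]
      using H.v_eq[OF that(2) e le_refl le_refl] H.l_pos[OF e] by auto
  qed
  have "(\<exists>g\<in>ends G. \<exists>g'\<in>ends G. g \<noteq> g' \<and> (v' i' (l' i'), g) \<in> ?R \<and> (v' i' (l' i'), g') \<in> ?R) \<longleftrightarrow>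
      2 \<le> card {i \<in> I. \<epsilon> i = i'}" if i': "i' \<in> I'" for i'
  proof
    assume "\<exists>g\<in>ends G. \<exists>g'\<in>ends G. g \<noteq> g' \<and> (v' i' (l' i'), g) \<in> ?R \<and> (v' i' (l' i'), g') \<in> ?R"
    then obtain a b where ab: "a \<in> I" "b \<in> I" "a \<noteq> b" "\<epsilon> a = i'" "\<epsilon> b = i'"
      unfolding G.ends_eq using end_R[OF _ i'] by blast
    have "card {a, b} \<le> card {i \<in> I. \<epsilon> i = i'}"
      using G.finite_I ab by (intro card_mono) auto
    then show "2 \<le> card {i \<in> I. \<epsilon> i = i'}"
      using ab by simp
  next
    assume "2 \<le> card {i \<in> I. \<epsilon> i = i'}"
    then obtain B where "B \<subseteq> {i \<in> I. \<epsilon> i = i'}" "card B = 2"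
      by (meson obtain_subset_with_card_n)
    then obtain a b where ab: "a \<in> I" "b \<in> I" "a \<noteq> b" "\<epsilon> a = i'" "\<epsilon> b = i'"
      by (auto simp: card_2_iff)
    show "\<exists>g\<in>ends G. \<exists>g'\<in>ends G. g \<noteq> g' \<and> (v' i' (l' i'), g) \<in> ?R \<and> (v' i' (l' i'), g') \<in> ?R"
    proof (intro bexI conjI)
      show "v a (l a) \<noteq> v b (l b)"
        using v_end ab by simp
    qed (use ab end_R[OF _ i'] G.ends_eq in auto)
  qed
  then show ?thesis
    unfolding end_splitting_def H.ends_eq by simp
qed

end

lemma fan_mor_comp:
  assumes "fan_mor I l I' l' \<epsilon> \<alpha> \<beta>" "fan_mor I'' l'' I l \<epsilon>' \<alpha>' \<beta>'"
  shows "fan_mor I'' l'' I' l' (\<lambda>i. \<epsilon> (\<epsilon>' i)) (\<lambda>i j. \<alpha> (\<epsilon>' i) (\<alpha>' i j)) (\<lambda>i j. \<beta> (\<epsilon>' i) (\<beta>' i j))"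
  unfolding fan_mor_def
proof (intro conjI ballI)
  show "(\<lambda>i. \<epsilon> (\<epsilon>' i)) ` I'' = I'"
    using assms unfolding fan_mor_def by (metis image_image)
  fix i assume "i \<in> I''"
  then show "walk (l'' i) (l' (\<epsilon> (\<epsilon>' i))) (\<lambda>j. \<alpha> (\<epsilon>' i) (\<alpha>' i j)) (\<lambda>j. \<beta> (\<epsilon>' i) (\<beta>' i j))"
    using fan_morD[OF assms(2)] fan_morD[OF assms(1)] walk_comp by blast
qed

lemma fan_rel_comp:
  assumes G: "fan_coords (G :: 'a rgraph) I l v" and H: "fan_coords (H :: 'a rgraph) I' l' v'" and m: "fan_mor I l I' l' \<epsilon> \<alpha> \<beta>"
    and m': "fan_mor I'' l'' I l \<epsilon>' \<alpha>' \<beta>'"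
  shows "fan_rel v' I l v \<epsilon> \<alpha> \<beta> O fan_rel v I'' l'' v'' \<epsilon>' \<alpha>' \<beta>' =
    fan_rel v' I'' l'' v'' (\<lambda>i. \<epsilon> (\<epsilon>' i)) (\<lambda>i j. \<alpha> (\<epsilon>' i) (\<alpha>' i j)) (\<lambda>i j. \<beta> (\<epsilon>' i) (\<beta>' i j))" (is "?R O ?R' = ?C")
proof -
  interpret fan_pair G I l v H I' l' v'
    using G H by (rule fan_pair.intro)
  show ?thesis
  proof (intro set_eqI iffI)
    fix z assume "z \<in> ?R O ?R'"
    then obtain x y u where z: "z = (x, u)" "(x, y) \<in> ?R" "(y, u) \<in> ?R'"
      by blast
    obtain i j b where i: "i \<in> I''" "j \<le> l'' i" "\<alpha>' i j \<le> b" "b \<le> \<beta>' i j" "y = v (\<epsilon>' i) b" "u = v'' i j"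
      using z(3) by (rule fan_relE)
    have w': "\<epsilon>' i \<in> I" "walk (l'' i) (l (\<epsilon>' i)) (\<alpha>' i) (\<beta>' i)"
      using fan_morD[OF m' i(1)] by auto
    have w: "\<epsilon> (\<epsilon>' i) \<in> I'" "walk (l (\<epsilon>' i)) (l' (\<epsilon> (\<epsilon>' i))) (\<alpha> (\<epsilon>' i)) (\<beta> (\<epsilon>' i))"
      using fan_morD[OF m w'(1)] by auto
    have b: "b \<le> l (\<epsilon>' i)"
      using walk_bound(1)[OF w'(2) i(2)] i(4) by simp
    have "x \<in> verts H"
      using fan_rel_sub[OF m] z(2) by blast
    then obtain a c where ac: "a \<in> I'" "c \<le> l' a" "x = v' a c"
      by (rule H.vertE)
    have ac2: "(a = \<epsilon> (\<epsilon>' i) \<or> c = 0) \<and> \<alpha> (\<epsilon>' i) b \<le> c \<and> c \<le> \<beta> (\<epsilon>' i) b"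
      using fan_rel_iff[OF m w'(1) b ac(1,2)] z(2) ac(3) i(5) by simp
    then have "x = v' (\<epsilon> (\<epsilon>' i)) c"
      using H.root_eq[OF ac(1) w(1)] ac(3) by auto
    moreover have "\<alpha> (\<epsilon>' i) (\<alpha>' i j) \<le> c \<and> c \<le> \<beta> (\<epsilon>' i) (\<beta>' i j)"
      using walk_comp_rel[OF w(2) w'(2) i(2), of c] ac2 i by blast
    ultimately show "z \<in> ?C"
      using fan_relI[OF i(1), of j l'' "\<lambda>i j. \<alpha> (\<epsilon>' i) (\<alpha>' i j)" c "\<lambda>i j. \<beta> (\<epsilon>' i) (\<beta>' i j)" v' "\<lambda>i. \<epsilon> (\<epsilon>' i)" v''] i z(1)
      by simp
  next
    fix z assume "z \<in> ?C"
    then obtain i j c where i: "i \<in> I''" "j \<le> l'' i" "\<alpha> (\<epsilon>' i) (\<alpha>' i j) \<le> c" "c \<le> \<beta> (\<epsilon>' i) (\<beta>' i j)"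
        "z = (v' (\<epsilon> (\<epsilon>' i)) c, v'' i j)"
      unfolding fan_rel_def by blast
    have w': "\<epsilon>' i \<in> I" "walk (l'' i) (l (\<epsilon>' i)) (\<alpha>' i) (\<beta>' i)"
      using fan_morD[OF m' i(1)] by auto
    have w: "walk (l (\<epsilon>' i)) (l' (\<epsilon> (\<epsilon>' i))) (\<alpha> (\<epsilon>' i)) (\<beta> (\<epsilon>' i))"
      using fan_morD[OF m w'(1)] by auto
    obtain b where b: "\<alpha>' i j \<le> b" "b \<le> \<beta>' i j" "\<alpha> (\<epsilon>' i) b \<le> c" "c \<le> \<beta> (\<epsilon>' i) b"
      using walk_comp_rel[OF w w'(2) i(2), of c] i by blast
    have "b \<le> l (\<epsilon>' i)"
      using walk_bound(1)[OF w'(2) i(2)] b(2) by simp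
    then have "(v' (\<epsilon> (\<epsilon>' i)) c, v (\<epsilon>' i) b) \<in> ?R"
      using fan_relI[OF w'(1), of b l \<alpha> c \<beta> v' \<epsilon> v] b by simp
    moreover have "(v (\<epsilon>' i) b, v'' i j) \<in> ?R'"
      using fan_relI[OF i(1), of j l'' \<alpha>' b \<beta>' v \<epsilon>' v''] b i by simp
    ultimately show "z \<in> ?R O ?R'"
      using i(5) by blast
  qed
qed

section \<open>Sequences of fans in coordinates\<close>

lemma surjection_of_card_le:
  assumes "finite A" "B \<noteq> {}" "finite B" "card B \<le> card A"
  obtains f where "f ` A = B"
proof -
  obtain g where g: "g ` B \<subseteq> A" "inj_on g B"
    using card_le_inj[OF assms(3,1,4)] by blast
  obtain b where b: "b \<in> B"
    using assms(2) by blast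
  define f where "f x = (if x \<in> g ` B then inv_into B g x else b)" for x
  have "f ` A \<subseteq> B"
    using b by (auto simp: f_def inv_into_into)
  moreover have "B \<subseteq> f ` A"
  proof
    fix x assume x: "x \<in> B"
    then have "f (g x) = x" "g x \<in> A"
      using g by (auto simp: f_def inv_into_f_f)
    then show "x \<in> f ` A"
      by (metis imageI)
  qed
  ultimately show ?thesis
    using that by blast
qed

lemma finite_bound:
  fixes f :: "'b \<Rightarrow> nat"
  assumes "finite A"
  shows "\<exists>N. card A \<le> N \<and> (\<forall>i\<in>A. f i \<le> N)"
proof (intro exI[of _ "max (card A) (Max (f ` A))"] conjI ballI)
  fix i assume "i \<in> A"
  then have "f i \<le> Max (f ` A)"
    using assms by (intro Max_ge) auto
  then show "f i \<le> max (card A) (Max (f ` A))"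
    by simp
qed simp

text \<open>The two maps are matched fibre by fibre. \<open>card I\<close> is a crude bound for all
  fibres of \<pi> at once.\<close>

lemma surjective_lift:
  assumes A: "finite A" "\<epsilon> ` A = E" and I: "finite I" "\<pi> ` I = E"
    and card: "\<And>e. e \<in> E \<Longrightarrow> card I \<le> card {a \<in> A. \<epsilon> a = e}"
  obtains \<sigma> where "\<sigma> ` A = I" "\<And>a. a \<in> A \<Longrightarrow> \<pi> (\<sigma> a) = \<epsilon> a"
proof -
  have "\<exists>f. f ` {a \<in> A. \<epsilon> a = e} = {i \<in> I. \<pi> i = e}" if e: "e \<in> E" for e
  proof -
    have "{i \<in> I. \<pi> i = e} \<noteq> {}"
      using I(2) e by blast
    moreover have "card {i \<in> I. \<pi> i = e} \<le> card {a \<in> A. \<epsilon> a = e}"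
      using card[OF e] card_mono[OF I(1), of "{i \<in> I. \<pi> i = e}"] by simp
    moreover have "finite {a \<in> A. \<epsilon> a = e}" "finite {i \<in> I. \<pi> i = e}"
      using A(1) I(1) by auto
    ultimately obtain f where "f ` {a \<in> A. \<epsilon> a = e} = {i \<in> I. \<pi> i = e}"
      by (metis surjection_of_card_le)
    then show ?thesis
      by (rule exI[of _ f])
  qed
  then have "\<forall>e\<in>E. \<exists>f. f ` {a \<in> A. \<epsilon> a = e} = {i \<in> I. \<pi> i = e}"
    by (rule ballI)
  from bchoice[OF this] obtain f where f: "\<forall>e\<in>E. f e ` {a \<in> A. \<epsilon> a = e} = {i \<in> I. \<pi> i = e}" ..
  define \<sigma> where "\<sigma> a = f (\<epsilon> a) a" for a
  have s: "\<sigma> a \<in> I \<and> \<pi> (\<sigma> a) = \<epsilon> a" if "a \<in> A" for a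
    using bspec[OF f, of "\<epsilon> a"] A(2) that unfolding \<sigma>_def by blast
  have "I \<subseteq> \<sigma> ` A"
  proof
    fix i assume i: "i \<in> I"
    then have "\<pi> i \<in> E"
      using I(2) by blast
    then have "i \<in> f (\<pi> i) ` {a \<in> A. \<epsilon> a = \<pi> i}"
      using bspec[OF f, of "\<pi> i"] i by simp
    then obtain a where "a \<in> A" "\<epsilon> a = \<pi> i" "i = f (\<pi> i) a"
      by blast
    then have "i = \<sigma> a"
      by (simp add: \<sigma>_def)
    then show "i \<in> \<sigma> ` A"
      using \<open>a \<in> A\<close> by (rule image_eqI)
  qed
  then show ?thesis
    using that[of \<sigma>] s by blast
qed

text \<open>By \<open>v_end\<close> the spokes are numbered by the ends themselves, which identifies
  \<open>\<epsilon> m n\<close> with the map that \<open>R m n\<close> induces on ends.\<close>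

locale fan_seq =
  fixes G :: "nat \<Rightarrow> 'a::infinite rgraph" and R :: "nat \<Rightarrow> nat \<Rightarrow> ('a \<times> 'a) set"
    and l :: "nat \<Rightarrow> 'a \<Rightarrow> nat" and v :: "nat \<Rightarrow> 'a \<Rightarrow> nat \<Rightarrow> 'a"
    and \<epsilon> :: "nat \<Rightarrow> nat \<Rightarrow> 'a \<Rightarrow> 'a" and \<alpha> \<beta> :: "nat \<Rightarrow> nat \<Rightarrow> 'a \<Rightarrow> nat \<Rightarrow> nat"
  assumes seq: "sequence_in catX G R"
    and coords: "fan_coords (G n) (ends (G n)) (l n) (v n)"
    and v_end: "e \<in> ends (G n) \<Longrightarrow> v n e (l n e) = e"
    and mor: "m \<le> n \<Longrightarrow> fan_mor (ends (G n)) (l n) (ends (G m)) (l m) (\<epsilon> m n) (\<alpha> m n) (\<beta> m n)"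
    and R_eq: "m \<le> n \<Longrightarrow> R m n = fan_rel (v m) (ends (G n)) (l n) (v n) (\<epsilon> m n) (\<alpha> m n) (\<beta> m n)"

lemma fan_seq_exists:
  fixes G :: "nat \<Rightarrow> 'a::infinite rgraph"
  assumes "sequence_in catX G R"
  obtains l v \<epsilon> \<alpha> \<beta> where "fan_seq G R l v \<epsilon> \<alpha> \<beta>"
proof -
  have "is_fan (G n)" for n
    using assms by (auto simp: sequence_in_def catX_def)
  then have "\<exists>l v. fan_coords (G n) (ends (G n)) l v \<and> (\<forall>e\<in>ends (G n). v e (l e) = e)" for n
    using fan_coords_exist by blast
  then obtain l v where c: "\<And>n. fan_coords (G n) (ends (G n)) (l n) (v n)"
    and e: "\<And>n e. e \<in> ends (G n) \<Longrightarrow> v n e (l n e) = e"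
    by metis
  have "\<exists>\<epsilon> \<alpha> \<beta>. m \<le> n \<longrightarrow> fan_mor (ends (G n)) (l n) (ends (G m)) (l m) \<epsilon> \<alpha> \<beta> \<and>
      R m n = fan_rel (v m) (ends (G n)) (l n) (v n) \<epsilon> \<alpha> \<beta>" for m n
  proof (cases "m \<le> n")
    case True
    then have "R m n \<in> hom catX (G n) (G m)"
      using assms by (auto simp: sequence_in_def)
    then show ?thesis
      using fan_pair.hom_fan_rel[OF fan_pair.intro[OF c c]] by metis
  qed simp
  then obtain \<epsilon> \<alpha> \<beta> where "\<And>m n. m \<le> n \<longrightarrow> fan_mor (ends (G n)) (l n) (ends (G m)) (l m) (\<epsilon> m n) (\<alpha> m n) (\<beta> m n) \<and>
      R m n = fan_rel (v m) (ends (G n)) (l n) (v n) (\<epsilon> m n) (\<alpha> m n) (\<beta> m n)"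
    by metis
  then have "fan_seq G R l v \<epsilon> \<alpha> \<beta>"
    using assms c e by (intro fan_seq.intro) auto
  then show ?thesis
    using that by blast
qed

context fan_seq
begin

lemma pair: "fan_pair (G n) (ends (G n)) (l n) (v n) (G m) (ends (G m)) (l m) (v m)"
  using coords by (intro fan_pair.intro)

lemma R_id: "R n n = Id_on (verts (G n))"
  using seq by (simp add: sequence_in_def)

lemma R_comp: "k \<le> m \<Longrightarrow> m \<le> n \<Longrightarrow> R k m O R m n = R k n"
  using seq by (simp add: sequence_in_def)

lemma R_hom: "m \<le> n \<Longrightarrow> R m n \<in> hom catX (G n) (G m)"
  using seq by (simp add: sequence_in_def)

lemma finite_ends: "finite (ends (G n))"
  using fan_coords.finite_I[OF coords] .

lemma ends_nonempty: "ends (G n) \<noteq> {}"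
  using fan_coords.I_nonempty[OF coords] .

lemma l_pos: "e \<in> ends (G n) \<Longrightarrow> 1 \<le> l n e"
  using fan_coords.l_pos[OF coords] .

lemma \<epsilon>_in: "m \<le> n \<Longrightarrow> e \<in> ends (G n) \<Longrightarrow> \<epsilon> m n e \<in> ends (G m)"
  using fan_morD[OF mor] by blast

lemma \<epsilon>_surj: "m \<le> n \<Longrightarrow> \<epsilon> m n ` ends (G n) = ends (G m)"
  using mor unfolding fan_mor_def by blast

lemma walk: "m \<le> n \<Longrightarrow> e \<in> ends (G n) \<Longrightarrow> walk (l n e) (l m (\<epsilon> m n e)) (\<alpha> m n e) (\<beta> m n e)"
  using fan_morD[OF mor] by blast

text \<open>Composites of coordinates are coordinates of the composite relation, and
  \<open>fan_rel_mono_iff\<close> for both inclusions shows that these are unique; \<alpha> and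
  \<beta> are determined only at the vertices of the spoke.\<close>

lemma comp:
  assumes "k \<le> m" "m \<le> n" "e \<in> ends (G n)"
  shows "\<epsilon> k m (\<epsilon> m n e) = \<epsilon> k n e"
    and "j \<le> l n e \<Longrightarrow> \<alpha> k m (\<epsilon> m n e) (\<alpha> m n e j) = \<alpha> k n e j"
    and "j \<le> l n e \<Longrightarrow> \<beta> k m (\<epsilon> m n e) (\<beta> m n e j) = \<beta> k n e j"
proof -
  have kn: "k \<le> n"
    using assms by simp
  have m: "fan_mor (ends (G n)) (l n) (ends (G k)) (l k) (\<lambda>e. \<epsilon> k m (\<epsilon> m n e))
      (\<lambda>e j. \<alpha> k m (\<epsilon> m n e) (\<alpha> m n e j)) (\<lambda>e j. \<beta> k m (\<epsilon> m n e) (\<beta> m n e j))"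
    by (rule fan_mor_comp[OF mor[OF assms(1)] mor[OF assms(2)]])
  have eq: "fan_rel (v k) (ends (G n)) (l n) (v n) (\<lambda>e. \<epsilon> k m (\<epsilon> m n e))
      (\<lambda>e j. \<alpha> k m (\<epsilon> m n e) (\<alpha> m n e j)) (\<lambda>e j. \<beta> k m (\<epsilon> m n e) (\<beta> m n e j))
      = fan_rel (v k) (ends (G n)) (l n) (v n) (\<epsilon> k n) (\<alpha> k n) (\<beta> k n)"
    using fan_rel_comp[OF coords coords mor[OF assms(1)] mor[OF assms(2)], of "v n"] R_comp[OF assms(1,2)]
    unfolding R_eq[OF assms(1)] R_eq[OF assms(2)] R_eq[OF kn] by metis
  note iff1 = fan_pair.fan_rel_mono_iff[OF pair m mor[OF kn]]
  note iff2 = fan_pair.fan_rel_mono_iff[OF pair mor[OF kn] m]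
  note le1 = iffD1[OF iff1 equalityD1[OF eq], rule_format, OF assms(3)]
  note le2 = iffD1[OF iff2 equalityD2[OF eq], rule_format, OF assms(3)]
  show "\<epsilon> k m (\<epsilon> m n e) = \<epsilon> k n e"
    using le1 by simp
  show "\<alpha> k m (\<epsilon> m n e) (\<alpha> m n e j) = \<alpha> k n e j" if "j \<le> l n e"
    using le1 le2 that by (simp add: le_antisym)
  show "\<beta> k m (\<epsilon> m n e) (\<beta> m n e j) = \<beta> k n e j" if "j \<le> l n e"
    using le1 le2 that by (simp add: le_antisym)
qed

lemma \<epsilon>_id:
  assumes e: "e \<in> ends (G n)"
  shows "\<epsilon> n n e = e"
proof -
  have "(v n (\<epsilon> n n e) (l n (\<epsilon> n n e)), v n e (l n e)) \<in> R n n"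
    using fan_pair.fan_rel_end[OF pair mor[OF le_refl] e] unfolding R_eq[OF le_refl] by blast
  then show ?thesis
    using v_end[OF e] v_end[OF \<epsilon>_in[OF le_refl e]] unfolding R_id by auto
qed

section \<open>Refinement and splitting between levels\<close>

definition refining :: "nat \<Rightarrow> nat \<Rightarrow> nat \<Rightarrow> bool" where
  "refining N m n \<longleftrightarrow> m \<le> n \<and> (\<forall>e\<in>ends (G n). refines N (l n e) (\<alpha> m n e) (\<beta> m n e))"

definition splitting :: "nat \<Rightarrow> nat \<Rightarrow> nat \<Rightarrow> bool" where
  "splitting N m n \<longleftrightarrow> m \<le> n \<and> (\<forall>e\<in>ends (G m). N \<le> card {e' \<in> ends (G n). \<epsilon> m n e' = e})"

lemma refining_2_iff: "refining 2 m n \<longleftrightarrow> m \<le> n \<and> star_refining (G n) (G m) (R m n)"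
  unfolding refining_def using fan_pair.star_refining_iff[OF pair mor] R_eq by auto

lemma splitting_2_iff: "splitting 2 m n \<longleftrightarrow> m \<le> n \<and> end_splitting (G n) (G m) (R m n)"
  unfolding splitting_def using fan_pair.end_splitting_iff[OF pair mor] R_eq by auto

lemma refines_cong:
  "refines N k a b \<Longrightarrow> (\<And>i. i \<le> k \<Longrightarrow> a i = a' i) \<Longrightarrow> (\<And>i. i \<le> k \<Longrightarrow> b i = b' i) \<Longrightarrow> refines N k a' b'"
  unfolding refines_def by (metis le_trans)

lemma refining_comp:
  assumes "refining N k m" "m \<le> n"
  shows "refining N k n"
  unfolding refining_def
proof (intro conjI ballI)
  have km: "k \<le> m"
    using assms(1) by (simp add: refining_def)
  then show "k \<le> n"
    using assms(2) by simp
  fix e assume e: "e \<in> ends (G n)"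
  have e': "\<epsilon> m n e \<in> ends (G m)"
    using \<epsilon>_in assms e by blast
  have "refines N (l m (\<epsilon> m n e)) (\<alpha> k m (\<epsilon> m n e)) (\<beta> k m (\<epsilon> m n e))"
    using assms e' by (simp add: refining_def)
  from refines_comp[OF walk[OF km e'] walk[OF assms(2) e] this]
  show "refines N (l n e) (\<alpha> k n e) (\<beta> k n e)"
    by (rule refines_cong) (use comp[OF km assms(2) e] in auto)
qed

lemma refining_comp_left:
  assumes "k \<le> m" "refining N m n"
  shows "refining N k n"
  unfolding refining_def
proof (intro conjI ballI)
  have mn: "m \<le> n"
    using assms(2) by (simp add: refining_def)
  then show "k \<le> n"
    using assms(1) by simp
  fix e assume e: "e \<in> ends (G n)"
  have e': "\<epsilon> m n e \<in> ends (G m)"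
    using \<epsilon>_in mn e by blast
  have "refines N (l n e) (\<alpha> m n e) (\<beta> m n e)"
    using assms e by (simp add: refining_def)
  from refines_comp_left[OF walk[OF assms(1) e'] walk[OF mn e] this]
  show "refines N (l n e) (\<alpha> k n e) (\<beta> k n e)"
    by (rule refines_cong) (use comp[OF assms(1) mn e] in auto)
qed

lemma refining_comp_star:
  assumes "refining N k m" "refining 2 m n"
  shows "refining (N + 2) k n"
  unfolding refining_def
proof (intro conjI ballI)
  have km: "k \<le> m" and mn: "m \<le> n"
    using assms by (auto simp: refining_def)
  then show "k \<le> n"
    by simp
  fix e assume e: "e \<in> ends (G n)"
  have e': "\<epsilon> m n e \<in> ends (G m)"
    using \<epsilon>_in mn e by blast
  have "refines N (l m (\<epsilon> m n e)) (\<alpha> k m (\<epsilon> m n e)) (\<beta> k m (\<epsilon> m n e))" "refines 2 (l n e) (\<alpha> m n e) (\<beta> m n e)"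
    using assms e e' by (auto simp: refining_def)
  from refines_comp_star[OF walk[OF km e'] walk[OF mn e] this]
  show "refines (N + 2) (l n e) (\<alpha> k n e) (\<beta> k n e)"
    by (rule refines_cong) (use comp[OF km mn e] in auto)
qed

lemma refining_mono: "refining N m n \<Longrightarrow> M \<le> N \<Longrightarrow> refining M m n"
  unfolding refining_def using refines_mono by blast

lemma refining_unbounded:
  assumes "\<And>m. \<exists>n. refining 2 m n"
  shows "\<exists>n. refining N m n"
proof -
  have "\<exists>n. refining (2 * N) m n"
  proof (induction N)
    case 0
    have "refining 0 m m"
      unfolding refining_def using refines_0 walk by blast
    then show ?case
      by auto
  next
    case (Suc N)
    then obtain n where "refining (2 * N) m n"
      by blast
    moreover obtain n' where "refining 2 n n'"
      using assms by blast
    ultimately have "refining (2 * N + 2) m n'"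
      by (rule refining_comp_star)
    then show ?case
      by auto
  qed
  then show ?thesis
    using refining_mono[of "2 * N" m _ N] by auto
qed

lemma refining_length:
  assumes "refining N m n" "e \<in> ends (G n)"
  shows "N < l n e"
proof -
  have mn: "m \<le> n"
    using assms(1) by (simp add: refining_def)
  show ?thesis
    using refines_length[OF walk[OF mn assms(2)]] assms l_pos[OF \<epsilon>_in[OF mn assms(2)]]
    unfolding refining_def by blast
qed

lemma splitting_1: "m \<le> n \<Longrightarrow> splitting 1 m n"
  unfolding splitting_def
proof (intro conjI ballI)
  fix e assume "m \<le> n" "e \<in> ends (G m)"
  then have "e \<in> \<epsilon> m n ` ends (G n)"
    using \<epsilon>_surj by simp
  then have "{e' \<in> ends (G n). \<epsilon> m n e' = e} \<noteq> {}"
    by blast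
  then show "1 \<le> card {e' \<in> ends (G n). \<epsilon> m n e' = e}"
    using finite_ends by (simp add: Suc_leI card_gt_0_iff)
qed

lemma splitting_mult:
  assumes "splitting N k m" "splitting M m n"
  shows "splitting (N * M) k n"
  unfolding splitting_def
proof (intro conjI ballI)
  have km: "k \<le> m" and mn: "m \<le> n"
    using assms by (auto simp: splitting_def)
  then show "k \<le> n"
    by simp
  fix e assume e: "e \<in> ends (G k)"
  let ?A = "{e' \<in> ends (G m). \<epsilon> k m e' = e}"
  let ?B = "\<lambda>e'. {e'' \<in> ends (G n). \<epsilon> m n e'' = e'}"
  have "{e'' \<in> ends (G n). \<epsilon> k n e'' = e} = (\<Union>e'\<in>?A. ?B e')"
    using comp(1)[OF km mn] \<epsilon>_in[OF mn] by auto
  moreover have "card (\<Union>e'\<in>?A. ?B e') = (\<Sum>e'\<in>?A. card (?B e'))"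
    using finite_ends by (intro card_UN_disjoint) auto
  moreover have "(\<Sum>e'\<in>?A. card (?B e')) \<ge> (\<Sum>e'\<in>?A. M)"
    using assms(2) by (intro sum_mono) (auto simp: splitting_def)
  moreover have "(\<Sum>e'\<in>?A. M) \<ge> N * M"
    using assms(1) e by (simp add: splitting_def)
  ultimately show "N * M \<le> card {e'' \<in> ends (G n). \<epsilon> k n e'' = e}"
    by (metis (no_types, lifting) order_trans)
qed

lemma splitting_comp: "splitting N k m \<Longrightarrow> m \<le> n \<Longrightarrow> splitting N k n"
  using splitting_mult[OF _ splitting_1] by fastforce

lemma splitting_comp_left: "k \<le> m \<Longrightarrow> splitting N m n \<Longrightarrow> splitting N k n"
  using splitting_mult[OF splitting_1] by fastforce

lemma splitting_mono: "splitting N m n \<Longrightarrow> M \<le> N \<Longrightarrow> splitting M m n"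
  unfolding splitting_def using order_trans by blast

lemma splitting_unbounded:
  assumes "\<And>m. \<exists>n. splitting 2 m n"
  shows "\<exists>n. splitting N m n"
proof -
  have "\<exists>n. splitting (2 ^ N) m n"
  proof (induction N)
    case 0
    then show ?case
      using splitting_1[of m m] by auto
  next
    case (Suc N)
    then show ?case
      using splitting_mult assms by (metis power_Suc2)
  qed
  then show ?thesis
    using splitting_mono[OF _ less_imp_le[OF less_exp]] by blast
qed

text \<open>Both properties survive composition with morphisms of the sequence on either side, so it
  is enough to have them once above every level.\<close>

lemma subsequence_iff:
  "(\<exists>\<phi>::nat \<Rightarrow> nat. strict_mono \<phi> \<and>
      seq_has star_refining (\<lambda>n. G (\<phi> n)) (\<lambda>m n. R (\<phi> m) (\<phi> n)) \<and>
      seq_has end_splitting (\<lambda>n. G (\<phi> n)) (\<lambda>m n. R (\<phi> m) (\<phi> n))) \<longleftrightarrow>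
   (\<forall>m. \<exists>n. refining 2 m n \<and> splitting 2 m n)" (is "?L \<longleftrightarrow> ?R")
proof
  assume ?L
  then obtain \<phi> :: "nat \<Rightarrow> nat" where \<phi>: "strict_mono \<phi>"
      "\<And>m n. m < n \<Longrightarrow> star_refining (G (\<phi> n)) (G (\<phi> m)) (R (\<phi> m) (\<phi> n))"
      "\<And>m n. m < n \<Longrightarrow> end_splitting (G (\<phi> n)) (G (\<phi> m)) (R (\<phi> m) (\<phi> n))"
    unfolding seq_has_def by blast
  have "refining 2 m (\<phi> (Suc m)) \<and> splitting 2 m (\<phi> (Suc m))" for m
  proof -
    have "m \<le> \<phi> m"
      using strict_mono_imp_increasing[OF \<phi>(1)] by blast
    moreover have "refining 2 (\<phi> m) (\<phi> (Suc m))" "splitting 2 (\<phi> m) (\<phi> (Suc m))"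
      using \<phi> strict_mono_less_eq[OF \<phi>(1)] by (auto simp: refining_2_iff splitting_2_iff)
    ultimately show ?thesis
      using refining_comp_left splitting_comp_left by blast
  qed
  then show ?R
    by blast
next
  assume ?R
  then obtain f where f: "\<And>m. refining 2 m (f m) \<and> splitting 2 m (f m)"
    by metis
  \<comment> \<open>\<open>Suc\<close> gives strict monotonicity from \<open>m \<le> f m\<close>
    alone.\<close>
  define \<phi> where "\<phi> = rec_nat 0 (\<lambda>_ m. Suc (f m))"
  have \<phi>S: "\<phi> (Suc n) = Suc (f (\<phi> n))" for n
    by (simp add: \<phi>_def)
  have "\<phi> n < \<phi> (Suc n)" for n
    using f[of "\<phi> n"] unfolding \<phi>S refining_def by simp
  then have sm: "strict_mono \<phi>"
    by (rule strict_mono_Suc_iff[THEN iffD2, rule_format])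
  have "refining 2 (\<phi> m) (\<phi> n) \<and> splitting 2 (\<phi> m) (\<phi> n)" if "m < n" for m n
  proof -
    have "\<phi> (Suc m) \<le> \<phi> n"
      using strict_mono_less_eq[OF sm] that by simp
    then have "f (\<phi> m) \<le> \<phi> n"
      unfolding \<phi>S by simp
    then show ?thesis
      using f[of "\<phi> m"] refining_comp splitting_comp by blast
  qed
  then show ?L
    unfolding seq_has_def using sm refining_2_iff splitting_2_iff by blast
qed

text \<open>Ends are lifted by counting, and the spokes are then treated independently, since they
  share only the root, which every walk fixes. \<open>K\<close> is left open because it stands for
  lax factorisation in one application and for exact factorisation in the other.\<close>

lemma fan_factor:
  assumes H: "fan_coords H I l' v'" and Q: "fan_mor I l' (ends (G m)) (l m) \<pi> \<gamma> \<delta>"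
    and mn: "m \<le> n" and card: "splitting (card I) m n"
    and p: "\<And>e i. e \<in> ends (G n) \<Longrightarrow> i \<in> I \<Longrightarrow> \<pi> i = \<epsilon> m n e \<Longrightarrow> \<exists>a b. walk (l n e) (l' i) a b \<and> K e i a b"
  obtains \<sigma> a b where "fan_mor (ends (G n)) (l n) I l' \<sigma> a b" "\<And>e. e \<in> ends (G n) \<Longrightarrow> \<pi> (\<sigma> e) = \<epsilon> m n e"
    "\<And>e. e \<in> ends (G n) \<Longrightarrow> K e (\<sigma> e) (a e) (b e)"
proof -
  have "\<pi> ` I = ends (G m)"
    using Q by (simp add: fan_mor_def)
  moreover have "card I \<le> card {a \<in> ends (G n). \<epsilon> m n a = e}" if "e \<in> ends (G m)" for e
    using card that by (simp add: splitting_def)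
  ultimately obtain \<sigma> where \<sigma>: "\<sigma> ` ends (G n) = I" "\<And>e. e \<in> ends (G n) \<Longrightarrow> \<pi> (\<sigma> e) = \<epsilon> m n e"
    by (rule surjective_lift[OF finite_ends \<epsilon>_surj[OF mn] fan_coords.finite_I[OF H]]) auto
  have "\<exists>a b. walk (l n e) (l' (\<sigma> e)) a b \<and> K e (\<sigma> e) a b" if "e \<in> ends (G n)" for e
    using p[OF that _ \<sigma>(2)[OF that]] \<sigma>(1) that by blast
  then obtain a b where ab: "\<And>e. e \<in> ends (G n) \<Longrightarrow> walk (l n e) (l' (\<sigma> e)) (a e) (b e) \<and> K e (\<sigma> e) (a e) (b e)"
    by metis
  then have "fan_mor (ends (G n)) (l n) I l' \<sigma> a b"
    unfolding fan_mor_def using \<sigma>(1) by blast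
  then show ?thesis
    using that \<sigma>(2) ab by blast
qed

lemma fraisse_factor:
  assumes "\<And>m. \<exists>n. refining 2 m n \<and> splitting 2 m n"
  shows "\<exists>n. refining N m n \<and> splitting N m n"
proof -
  obtain n n' where "refining N m n" "splitting N m n'"
    using refining_unbounded splitting_unbounded assms by meson
  then have "refining N m (max n n')" "splitting N m (max n n')"
    using refining_comp splitting_comp by auto
  then show ?thesis
    by blast
qed

text \<open>Sufficiently many ends and sufficiently long spokes give a morphism:
  \<open>min j\<close> follows the target spoke and then stays at its end.\<close>

lemma cofinal:
  assumes fine: "\<And>m. \<exists>n. refining 2 m n \<and> splitting 2 m n"
  shows "cofinal_in catX G"
  unfolding cofinal_in_def
proof
  fix H :: "'a rgraph" assume "H \<in> obj catX"
  then have "is_fan H"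
    by (simp add: catX_def)
  from fan_coords_exist[OF this] obtain l' v' where H: "fan_coords H (ends H) l' v'"
    by (elim exE conjE) (rule that)
  obtain N where N: "card (ends H) \<le> N" "\<And>i. i \<in> ends H \<Longrightarrow> l' i \<le> N"
    using finite_bound[OF fan_coords.finite_I[OF H]] by blast
  obtain n where n: "refining N 0 n" "splitting N 0 n"
    using fraisse_factor[OF fine] by blast
  obtain e0 where e0: "e0 \<in> ends (G 0)"
    using ends_nonempty by blast
  have "N \<le> card {e' \<in> ends (G n). \<epsilon> 0 n e' = e0}"
    using n(2) e0 by (simp add: splitting_def)
  also have "\<dots> \<le> card (ends (G n))"
    using finite_ends by (intro card_mono) auto
  finally have "card (ends H) \<le> card (ends (G n))"
    using N by simp
  then obtain \<sigma> where \<sigma>: "\<sigma> ` ends (G n) = ends H"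
    using surjection_of_card_le[OF finite_ends fan_coords.I_nonempty[OF H] fan_coords.finite_I[OF H]] by metis
  have "fan_mor (ends (G n)) (l n) (ends H) l' \<sigma> (\<lambda>e j. min j (l' (\<sigma> e))) (\<lambda>e j. min j (l' (\<sigma> e)))"
    unfolding fan_mor_def
  proof (intro conjI ballI \<sigma>)
    fix e assume e: "e \<in> ends (G n)"
    then have "\<sigma> e \<in> ends H"
      using \<sigma> by blast
    then have "l' (\<sigma> e) \<le> l n e"
      using N(2) refining_length[OF n(1) e] by fastforce
    then show "walk (l n e) (l' (\<sigma> e)) (\<lambda>j. min j (l' (\<sigma> e))) (\<lambda>j. min j (l' (\<sigma> e)))"
      by (rule walk_min)
  qed
  from fan_pair.fan_rel_hom[OF fan_pair.intro[OF coords H] this]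
  show "\<exists>n. hom catX (G n) H \<noteq> {}"
    by blast
qed

text \<open>A single \<open>N\<close> bounds both the number of spokes of \<open>H\<close> and their
  lengths. The first bound allows lifting the ends, the second one allows applying
  \<open>walk_lax_factor\<close> to each spoke.\<close>

lemma lax_fraisse_if_fine:
  assumes fine: "\<And>m. \<exists>n. refining 2 m n \<and> splitting 2 m n"
  shows "lax_fraisse catX G R"
  unfolding lax_fraisse_def
proof (intro conjI seq cofinal[OF fine] allI ballI)
  fix m and H :: "'a rgraph" and Q
  assume "H \<in> obj catX" and Q: "Q \<in> hom catX H (G m)"
  then have "is_fan H"
    by (simp add: catX_def)
  from fan_coords_exist[OF this] obtain l' v' where H: "fan_coords H (ends H) l' v'"
    by (elim exE conjE) (rule that)
  obtain \<pi> \<gamma> \<delta> where q: "fan_mor (ends H) l' (ends (G m)) (l m) \<pi> \<gamma> \<delta>" "Q = fan_rel (v m) (ends H) l' v' \<pi> \<gamma> \<delta>"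
    using fan_pair.hom_fan_rel[OF fan_pair.intro[OF H coords] Q] .
  obtain N where N: "card (ends H) \<le> N" "\<And>i. i \<in> ends H \<Longrightarrow> l' i \<le> N"
    using finite_bound[OF fan_coords.finite_I[OF H]] by blast
  obtain n where n: "refining N m n" "splitting N m n"
    using fraisse_factor[OF fine] by blast
  then have mn: "m \<le> n" and ends: "splitting (card (ends H)) m n"
    using splitting_mono N(1) by (auto simp: refining_def)
  let ?K = "\<lambda>e i a b. \<forall>j\<le>l n e. \<alpha> m n e j \<le> \<gamma> i (a j) \<and> \<delta> i (b j) \<le> \<beta> m n e j"
  have p: "\<exists>a b. walk (l n e) (l' i) a b \<and> ?K e i a b"
    if e: "e \<in> ends (G n)" and i: "i \<in> ends H" and \<pi>: "\<pi> i = \<epsilon> m n e" for e i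
  proof -
    have r: "refines N (l n e) (\<alpha> m n e) (\<beta> m n e)"
      using n(1) e by (simp add: refining_def)
    have w: "walk (l' i) (l m (\<epsilon> m n e)) (\<gamma> i) (\<delta> i)"
      using fan_morD[OF q(1) i] \<pi> by simp
    obtain p where "walk (l n e) (l' i) p p" "\<And>j. j \<le> l n e \<Longrightarrow> \<alpha> m n e j \<le> \<gamma> i (p j) \<and> \<delta> i (p j) \<le> \<beta> m n e j"
      using walk_lax_factor[OF walk[OF mn e] r w N(2)[OF i] l_pos[OF \<epsilon>_in[OF mn e]]] by blast
    then show ?thesis
      by blast
  qed
  obtain \<sigma> a b where s: "fan_mor (ends (G n)) (l n) (ends H) l' \<sigma> a b"
      "\<And>e. e \<in> ends (G n) \<Longrightarrow> \<pi> (\<sigma> e) = \<epsilon> m n e" "\<And>e. e \<in> ends (G n) \<Longrightarrow> ?K e (\<sigma> e) (a e) (b e)"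
    using fan_factor[OF H q(1) mn ends, of ?K] p by metis
  let ?P = "fan_rel v' (ends (G n)) (l n) (v n) \<sigma> a b"
  have P: "?P \<in> hom catX (G n) H"
    by (rule fan_pair.fan_rel_hom[OF fan_pair.intro[OF coords H] s(1)])
  have "Q O ?P \<subseteq> R m n"
    unfolding q(2) R_eq[OF mn] fan_rel_comp[OF H coords q(1) s(1)]
    by (subst fan_pair.fan_rel_mono_iff[OF pair fan_mor_comp[OF q(1) s(1)] mor[OF mn]]) (use s in auto)
  then show "\<exists>n\<ge>m. \<exists>P\<in>hom catX (G n) H. Q O P \<subseteq> R m n"
    using P mn by blast
qed

text \<open>The test fan has two copies of every spoke of \<open>G m\<close>, each edge divided into
  three; three spokes are there because \<open>G m\<close> is a fan. A factor through it needs
  different ends for the two copies of \<open>e\<close>. It inherits \<open>refines 2\<close> from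
  \<open>star_walk\<close>, and passing to the larger relation \<open>R m n\<close> only widens the
  intervals.\<close>

lemma fine_if_lax_fraisse:
  assumes "lax_fraisse catX G R"
  shows "\<exists>n. refining 2 m n \<and> splitting 2 m n"
proof -
  interpret M: fan_coords "G m" "ends (G m)" "l m" "v m"
    by (rule coords)
  let ?I = "ends (G m) \<times> (UNIV :: bool set)"
  let ?l = "\<lambda>i. 3 * l m (fst i)"
  have "3 \<le> card ?I"
    using M.card_I by (simp add: card_cartesian_product)
  moreover have "finite ?I" "1 \<le> ?l i" if "i \<in> ?I" for i
    using M.finite_I M.l_pos[of "fst i"] that by auto
  ultimately obtain H :: "'a rgraph" and v' where H: "fan_coords H ?I ?l v'"
    using fan_exists[of ?I ?l] by (metis M.finite_I finite_SigmaI finite_code)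
  let ?a = "\<lambda>i j. j div 3" and ?b = "\<lambda>i j. (j + 2) div 3"
  have q: "fan_mor ?I ?l (ends (G m)) (l m) fst ?a ?b"
    unfolding fan_mor_def using star_walk(1) by auto
  let ?Q = "fan_rel (v m) ?I ?l v' fst ?a ?b"
  have "?Q \<in> hom catX H (G m)"
    by (rule fan_pair.fan_rel_hom[OF fan_pair.intro[OF H coords] q])
  moreover have "H \<in> obj catX"
    using fan_coords.fan[OF H] by (simp add: catX_def)
  ultimately obtain n P where n: "m \<le> n" "P \<in> hom catX (G n) H" "?Q O P \<subseteq> R m n"
    using assms unfolding lax_fraisse_def by blast
  obtain \<sigma> a b where p: "fan_mor (ends (G n)) (l n) ?I ?l \<sigma> a b" "P = fan_rel v' (ends (G n)) (l n) (v n) \<sigma> a b"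
    using fan_pair.hom_fan_rel[OF fan_pair.intro[OF coords H] n(2)] .
  have le: "\<forall>e\<in>ends (G n). fst (\<sigma> e) = \<epsilon> m n e \<and>
      (\<forall>j\<le>l n e. \<alpha> m n e j \<le> a e j div 3 \<and> (b e j + 2) div 3 \<le> \<beta> m n e j)"
    using n(3) unfolding p(2) R_eq[OF n(1)] fan_rel_comp[OF H coords q p(1)]
      fan_pair.fan_rel_mono_iff[OF pair fan_mor_comp[OF q p(1)] mor[OF n(1)]] .
  have "refining 2 m n"
    unfolding refining_def
  proof (intro conjI ballI n(1))
    fix e assume e: "e \<in> ends (G n)"
    have "refines 2 (l n e) (\<lambda>j. a e j div 3) (\<lambda>j. (b e j + 2) div 3)"
      using refines_comp[OF star_walk(1) _ star_walk(2)] fan_morD[OF p(1) e] by blast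
    then show "refines 2 (l n e) (\<alpha> m n e) (\<beta> m n e)"
      using le e unfolding refines_def by (meson order_trans)
  qed
  moreover have "splitting 2 m n"
    unfolding splitting_def
  proof (intro conjI ballI n(1))
    fix e assume e: "e \<in> ends (G m)"
    then have "(e, True) \<in> \<sigma> ` ends (G n)" "(e, False) \<in> \<sigma> ` ends (G n)"
      using p(1) unfolding fan_mor_def by auto
    then obtain e1 e2 where e12: "e1 \<in> ends (G n)" "\<sigma> e1 = (e, True)" "e2 \<in> ends (G n)" "\<sigma> e2 = (e, False)"
      by (metis imageE)
    then have "e1 \<noteq> e2" "{e1, e2} \<subseteq> {e' \<in> ends (G n). \<epsilon> m n e' = e}"
      using le by force+
    then show "2 \<le> card {e' \<in> ends (G n). \<epsilon> m n e' = e}"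
      using card_mono[of "{e' \<in> ends (G n). \<epsilon> m n e' = e}" "{e1, e2}"] finite_ends by simp
  qed
  ultimately show ?thesis
    by blast
qed

lemma lax_fraisse_iff: "lax_fraisse catX G R \<longleftrightarrow> (\<forall>m. \<exists>n. refining 2 m n \<and> splitting 2 m n)"
  using lax_fraisse_if_fine fine_if_lax_fraisse by blast

end

section \<open>Branches of spokes and sequences of ends\<close>

text \<open>The tree is given by relations instead of maps, as selectors require;
  \<open>factor\<close> makes up for predecessors not being unique. An element is
  \<open>good\<close> if it has descendants at all levels. Finitely many elements that are not good
  have lost their descendants at a common level, so good ones cannot run out.\<close>

lemma koenig:
  fixes B :: "nat \<Rightarrow> 'b set" and D :: "nat \<Rightarrow> nat \<Rightarrow> 'b \<Rightarrow> 'b \<Rightarrow> bool"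
  assumes fin: "\<And>n. finite (B n)" and ne: "\<And>n. B n \<noteq> {}"
    and trans: "\<And>k m n x y z. k \<le> m \<Longrightarrow> m \<le> n \<Longrightarrow> D k m x y \<Longrightarrow> D m n y z \<Longrightarrow> D k n x z"
    and factor: "\<And>k m n x z. k \<le> m \<Longrightarrow> m \<le> n \<Longrightarrow> x \<in> B k \<Longrightarrow> z \<in> B n \<Longrightarrow> D k n x z \<Longrightarrow> \<exists>y\<in>B m. D k m x y \<and> D m n y z"
    and total: "\<And>m n z. m \<le> n \<Longrightarrow> z \<in> B n \<Longrightarrow> \<exists>x\<in>B m. D m n x z"
  obtains g where "\<And>n. g n \<in> B n" "\<And>m n. m < n \<Longrightarrow> D m n (g m) (g n)"
proof -
  define good where "good m x \<longleftrightarrow> x \<in> B m \<and> (\<forall>n\<ge>m. \<exists>y\<in>B n. D m n x y)" for m x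
  have common: "\<exists>N\<ge>m. \<forall>x\<in>A. \<forall>z\<in>B N. \<not> D m N x z"
    if A: "finite A" "A \<subseteq> B m" "\<And>x. x \<in> A \<Longrightarrow> \<not> good m x" for A m
    using A
  proof (induction A rule: finite_induct)
    case (insert x A)
    obtain n where n: "m \<le> n" "\<forall>z\<in>B n. \<not> D m n x z"
      using insert.prems(1) insert.prems(2)[of x] unfolding good_def by auto
    obtain N where N: "m \<le> N" "\<forall>x\<in>A. \<forall>z\<in>B N. \<not> D m N x z"
      using insert.IH insert.prems by auto
    have "\<forall>y\<in>insert x A. \<forall>z\<in>B (max n N). \<not> D m (max n N) y z"
    proof (intro ballI notI)
      fix y z assume y: "y \<in> insert x A" "z \<in> B (max n N)" "D m (max n N) y z"
      have yB: "y \<in> B m"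
        using y(1) insert.prems(1) by blast
      show False
      proof (cases "y = x")
        case True
        then show False
          using factor[OF n(1) max.cobounded1 yB y(2,3)] n(2) by blast
      next
        case False
        then show False
          using factor[OF N(1) max.cobounded2 yB y(2,3)] N(2) y(1) by blast
      qed
    qed
    then show ?case
      using n(1) by (intro exI[of _ "max n N"]) auto
  qed auto
  have "\<exists>x. good 0 x"
  proof (rule ccontr)
    assume "\<not> ?thesis"
    then obtain N where "\<forall>x\<in>B 0. \<forall>z\<in>B N. \<not> D 0 N x z"
      using common[OF fin[of 0] subset_refl] by blast
    then show False
      using ne[of N] total[of 0 N] by blast
  qed
  moreover have "\<exists>y. good (Suc m) y \<and> D m (Suc m) x y" if x: "good m x" for m x
  proof (rule ccontr)
    assume no: "\<not> ?thesis"
    let ?A = "{y \<in> B (Suc m). D m (Suc m) x y}"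
    have fA: "finite ?A"
      using fin by simp
    obtain N where N: "Suc m \<le> N" "\<forall>y\<in>?A. \<forall>z\<in>B N. \<not> D (Suc m) N y z"
      using common[OF fA, of "Suc m"] no by blast
    have "m \<le> N"
      using N(1) by simp
    then obtain z where z: "z \<in> B N" "D m N x z"
      using x unfolding good_def by blast
    have "x \<in> B m"
      using x unfolding good_def by blast
    from factor[OF le_SucI[OF le_refl] N(1) this z] show False
      using N(2) z by blast
  qed
  ultimately obtain g where g: "\<And>n. good n (g n)" "\<And>n. D n (Suc n) (g n) (g (Suc n))"
    using dependent_nat_choice[of good "\<lambda>m x y. D m (Suc m) x y"] by blast
  have "D m n (g m) (g n)" if "m < n" for m n
    using that
  proof (induction n)
    case (Suc n)
    then show ?case
      using g(2)[of n] trans[of m n "Suc n" "g m" "g n" "g (Suc n)"] by (cases "m = n") auto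
  qed simp
  then show ?thesis
    using that g(1) unfolding good_def by blast
qed

lemma finite_common:
  assumes "finite A" "\<And>x. x \<in> A \<Longrightarrow> \<exists>n. K n x" "\<And>m n x. x \<in> A \<Longrightarrow> m \<le> n \<Longrightarrow> K m x \<Longrightarrow> K n x"
  shows "\<exists>n::nat. \<forall>x\<in>A. K n x"
  using assms
proof (induction A rule: finite_induct)
  case (insert x A)
  obtain n where n: "K n x"
    using insert.prems(1) by blast
  have "\<exists>n. \<forall>x\<in>A. K n x"
    using insert.prems by (intro insert.IH) blast+
  then obtain n' where n': "\<forall>x\<in>A. K n' x"
    by blast
  have "\<forall>y\<in>insert x A. K (max n n') y"
    using n n' insert.prems(2)[OF _ max.cobounded1] insert.prems(2)[OF _ max.cobounded2] by blast
  then show ?case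
    by blast
qed simp

lemma path_exists:
  obtains P :: "'a::infinite rgraph" and w where "path_coords P k w"
proof -
  obtain w :: "nat \<Rightarrow> 'a" where "inj_on w {..k}"
    using arb_inj_on_finite_infinite[of "{..k}"] by blast
  then have "path_coords \<lparr>verts = w ` {..k}, edges = {(w i, w j) | i j. i \<le> k \<and> j \<le> k \<and> i \<le> Suc j \<and> j \<le> Suc i}\<rparr> k w"
    unfolding path_coords_def by simp
  then show ?thesis
    by (rule that)
qed

lemma walk_rel_comp:
  assumes w: "path_coords P k w" and r: "walk k l \<alpha> \<beta>" and r': "walk k' k \<alpha>' \<beta>'"
  shows "walk_rel u w k \<alpha> \<beta> O walk_rel w w' k' \<alpha>' \<beta>' = walk_rel u w' k' (\<lambda>i. \<alpha> (\<alpha>' i)) (\<lambda>i. \<beta> (\<beta>' i))"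
proof (intro set_eqI iffI)
  fix z assume "z \<in> walk_rel u w k \<alpha> \<beta> O walk_rel w w' k' \<alpha>' \<beta>'"
  then obtain x y t where z: "z = (x, t)" "(x, y) \<in> walk_rel u w k \<alpha> \<beta>" "(y, t) \<in> walk_rel w w' k' \<alpha>' \<beta>'"
    by blast
  obtain i j where i: "x = u j" "y = w i" "i \<le> k" "\<alpha> i \<le> j" "j \<le> \<beta> i"
    using z(2) unfolding walk_rel_def by blast
  obtain i' j' where i': "y = w j'" "t = w' i'" "i' \<le> k'" "\<alpha>' i' \<le> j'" "j' \<le> \<beta>' i'"
    using z(3) unfolding walk_rel_def by blast
  have "j' \<le> k"
    using walk_bound(1)[OF r' i'(3)] i'(5) by simp
  then have "i = j'"
    using path_coords_eq[OF w i(3), of j'] i(2) i'(1) by simp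
  then have "\<alpha> (\<alpha>' i') \<le> j \<and> j \<le> \<beta> (\<beta>' i')"
    using walk_comp_rel[OF r r' i'(3), of j] i i' by blast
  then show "z \<in> walk_rel u w' k' (\<lambda>i. \<alpha> (\<alpha>' i)) (\<lambda>i. \<beta> (\<beta>' i))"
    using walk_relI[of i' k' "\<lambda>i. \<alpha> (\<alpha>' i)" j "\<lambda>i. \<beta> (\<beta>' i)" u w'] i' i z(1) by simp
next
  fix z assume "z \<in> walk_rel u w' k' (\<lambda>i. \<alpha> (\<alpha>' i)) (\<lambda>i. \<beta> (\<beta>' i))"
  then obtain i j where i: "z = (u j, w' i)" "i \<le> k'" "\<alpha> (\<alpha>' i) \<le> j" "j \<le> \<beta> (\<beta>' i)"
    unfolding walk_rel_def by blast
  obtain x where x: "\<alpha>' i \<le> x" "x \<le> \<beta>' i" "\<alpha> x \<le> j" "j \<le> \<beta> x"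
    using walk_comp_rel[OF r r' i(2), of j] i by blast
  have "x \<le> k"
    using walk_bound(1)[OF r' i(2)] x(2) by simp
  then have "(u j, w x) \<in> walk_rel u w k \<alpha> \<beta>" "(w x, w' i) \<in> walk_rel w w' k' \<alpha>' \<beta>'"
    using walk_relI[of x k \<alpha> j \<beta> u w] walk_relI[of i k' \<alpha>' x \<beta>' w w'] x i by auto
  then show "z \<in> walk_rel u w k \<alpha> \<beta> O walk_rel w w' k' \<alpha>' \<beta>'"
    using i(1) by blast
qed

lemma walk_rel_mono:
  "(\<And>i. i \<le> k \<Longrightarrow> \<alpha>2 i \<le> \<alpha> i \<and> \<beta> i \<le> \<beta>2 i) \<Longrightarrow> walk_rel u w k \<alpha> \<beta> \<subseteq> walk_rel u w k \<alpha>2 \<beta>2"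
  unfolding walk_rel_def by (blast intro: order_trans)

lemma walk_rel_cong:
  "(\<And>i. i \<le> k \<Longrightarrow> \<alpha> i = \<alpha>2 i \<and> \<beta> i = \<beta>2 i) \<Longrightarrow> walk_rel u w k \<alpha> \<beta> = walk_rel u w k \<alpha>2 \<beta>2"
  by (intro equalityI walk_rel_mono) auto

lemma walk_rel_subD:
  assumes "path_coords P k w" "path_coords P' l u" "walk k l \<alpha> \<beta>" "walk k l \<alpha>2 \<beta>2"
    "walk_rel u w k \<alpha> \<beta> \<subseteq> walk_rel u w k \<alpha>2 \<beta>2" "i \<le> k"
  shows "\<alpha>2 i \<le> \<alpha> i" "\<beta> i \<le> \<beta>2 i"
proof -
  have b: "\<alpha> i \<le> \<beta> i" "\<alpha> i \<le> l" "\<beta> i \<le> l"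
    using walk_le[OF assms(3,6)] walk_bound[OF assms(3,6)] by auto
  show "\<alpha>2 i \<le> \<alpha> i"
    using walk_relI[of i k \<alpha> "\<alpha> i" \<beta> u w] walk_rel_iff[OF assms(1,2,4,6) b(2)] assms(5,6) b(1) by blast
  show "\<beta> i \<le> \<beta>2 i"
    using walk_relI[of i k \<alpha> "\<beta> i" \<beta> u w] walk_rel_iff[OF assms(1,2,4,6) b(3)] assms(5,6) b(1) by blast
qed

section \<open>Threads of ends and branches of spokes\<close>

context fan_seq
begin

text \<open>The points of the inverse limit of the sets of ends.\<close>

definition thread :: "(nat \<Rightarrow> 'a) \<Rightarrow> bool" where
  "thread e \<longleftrightarrow> (\<forall>n. e n \<in> ends (G n)) \<and> (\<forall>m n. m \<le> n \<longrightarrow> \<epsilon> m n (e n) = e m)"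

lemma thread_ends: "thread e \<Longrightarrow> e n \<in> ends (G n)"
  by (simp add: thread_def)

lemma thread_\<epsilon>: "thread e \<Longrightarrow> m \<le> n \<Longrightarrow> \<epsilon> m n (e n) = e m"
  by (simp add: thread_def)

lemma koenig_thread:
  assumes B: "\<And>n. B n \<subseteq> ends (G n)" "\<And>n. B n \<noteq> {}" "\<And>m n e. m \<le> n \<Longrightarrow> e \<in> B n \<Longrightarrow> \<epsilon> m n e \<in> B m"
  obtains e where "thread e" "\<And>n. e n \<in> B n"
proof -
  have fin: "finite (B n)" for n
    using B(1) finite_ends finite_subset by blast
  have factor: "\<exists>y\<in>B m. \<epsilon> k m y = x \<and> \<epsilon> m n z = y"
    if "k \<le> m" "m \<le> n" "x \<in> B k" "z \<in> B n" "\<epsilon> k n z = x" for k m n x z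
  proof (intro bexI conjI)
    have "z \<in> ends (G n)"
      using B(1) that(4) by blast
    then show "\<epsilon> k m (\<epsilon> m n z) = x"
      using comp(1)[OF that(1,2)] that(5) by simp
    show "\<epsilon> m n z \<in> B m"
      using B(3)[OF that(2,4)] .
  qed simp
  have trans: "\<epsilon> k n z = x" if "k \<le> m" "m \<le> n" "\<epsilon> k m y = x \<and> y \<in> ends (G m)" "\<epsilon> m n z = y \<and> z \<in> ends (G n)" for k m n x y z
    using comp(1)[OF that(1,2), of z] that(3,4) by simp
  obtain e where e: "\<And>n. e n \<in> B n" "\<And>m n. m < n \<Longrightarrow> \<epsilon> m n (e n) = e m \<and> e n \<in> ends (G n)"
  proof (rule koenig[of B "\<lambda>m n x y. \<epsilon> m n y = x \<and> y \<in> ends (G n)"])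
    show "\<exists>y\<in>B m. (\<epsilon> k m y = x \<and> y \<in> ends (G m)) \<and> \<epsilon> m n z = y \<and> z \<in> ends (G n)"
      if "k \<le> m" "m \<le> n" "x \<in> B k" "z \<in> B n" "\<epsilon> k n z = x \<and> z \<in> ends (G n)" for k m n x z
      using factor[of k m n x z] that B(1) by blast
    show "\<exists>x\<in>B m. \<epsilon> m n z = x \<and> z \<in> ends (G n)" if "m \<le> n" "z \<in> B n" for m n z
      using B that by blast
    show "\<epsilon> k n z = x \<and> z \<in> ends (G n)"
      if "k \<le> m" "m \<le> n" "\<epsilon> k m y = x \<and> y \<in> ends (G m)" "\<epsilon> m n z = y \<and> z \<in> ends (G n)" for k m n x y z
      using trans[OF that] that(4) by simp
  qed (use fin B(2) in auto)
  have "thread e"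
    unfolding thread_def
  proof (intro conjI allI impI)
    show en: "e n \<in> ends (G n)" for n
      using e(1) B(1) by blast
    show "\<epsilon> m n (e n) = e m" if "m \<le> n" for m n
      using e(2)[of m n] \<epsilon>_id[OF en] that by (cases "m = n") auto
  qed
  then show ?thesis
    using that e(1) by blast
qed

text \<open>Compactness of the inverse limit of ends: by \<open>mono\<close> the ends where
  \<open>P\<close> fails are closed under passing to earlier levels, so failure at every level would
  produce a thread along which \<open>P\<close> fails throughout.\<close>

lemma koenig_ends:
  assumes mono: "\<And>m n e. m \<le> n \<Longrightarrow> e \<in> ends (G n) \<Longrightarrow> P m (\<epsilon> m n e) \<Longrightarrow> P n e"
    and "\<And>e. thread e \<Longrightarrow> \<exists>n. P n (e n)"
  shows "\<exists>n. \<forall>e\<in>ends (G n). P n e"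
proof (rule ccontr)
  assume no: "\<not> ?thesis"
  obtain e where "thread e" "\<And>n. e n \<in> {e \<in> ends (G n). \<not> P n e}"
  proof (rule koenig_thread[of "\<lambda>n. {e \<in> ends (G n). \<not> P n e}"])
    show "{e \<in> ends (G n). \<not> P n e} \<noteq> {}" for n
      using no by blast
    show "\<epsilon> m n e \<in> {e \<in> ends (G m). \<not> P m e}" if "m \<le> n" "e \<in> {e \<in> ends (G n). \<not> P n e}" for m n e
      using mono[OF that(1)] \<epsilon>_in[OF that(1)] that(2) by blast
  qed auto
  then show False
    using assms(2) by blast
qed

text \<open>Koenig's lemma for the tree of predecessors and descendants of \<open>e\<close>.\<close>

lemma thread_through:
  assumes "e \<in> ends (G m)"
  obtains t where "thread t" "t m = e"
proof -
  obtain t where t: "thread t" "\<And>n. t n \<in> {e' \<in> ends (G n). if m \<le> n then \<epsilon> m n e' = e else \<epsilon> n m e = e'}"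
  proof (rule koenig_thread[of "\<lambda>n. {e' \<in> ends (G n). if m \<le> n then \<epsilon> m n e' = e else \<epsilon> n m e = e'}"])
    show "{e' \<in> ends (G n). if m \<le> n then \<epsilon> m n e' = e else \<epsilon> n m e = e'} \<noteq> {}" for n
    proof (cases "m \<le> n")
      case True
      then have "e \<in> \<epsilon> m n ` ends (G n)"
        using \<epsilon>_surj assms by simp
      then show ?thesis
        using True by auto
    next
      case False
      then show ?thesis
        using \<epsilon>_in[of n m e] assms by auto
    qed
    show "\<epsilon> k n e' \<in> {e' \<in> ends (G k). if m \<le> k then \<epsilon> m k e' = e else \<epsilon> k m e = e'}"
      if k: "k \<le> n" and e': "e' \<in> {e' \<in> ends (G n). if m \<le> n then \<epsilon> m n e' = e else \<epsilon> n m e = e'}" for k n e'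
    proof -
      have in_k: "\<epsilon> k n e' \<in> ends (G k)"
        using \<epsilon>_in k e' by blast
      consider "m \<le> k" | "k < m" "m \<le> n" | "n < m"
        using k by linarith
      then show ?thesis
      proof cases
        case 1
        then show ?thesis
          using comp(1)[OF 1 k, of e'] e' in_k k by auto
      next
        case 2
        then show ?thesis
          using comp(1)[of k m n e'] e' in_k by auto
      next
        case 3
        then show ?thesis
          using comp(1)[OF k, of m e] e' in_k k assms by auto
      qed
    qed
  qed auto
  have "\<epsilon> m m (t m) = e"
    using t(2)[of m] by simp
  then have "t m = e"
    using \<epsilon>_id thread_ends[OF t(1)] by simp
  then show ?thesis
    using that t(1) by blast
qed

definition branch :: "(nat \<Rightarrow> 'a) \<Rightarrow> nat \<Rightarrow> 'a set" where
  "branch e n = v n (e n) ` {..l n (e n)}"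

lemma spoke_eq: "fan_coords.spoke (l n) (v n) e = v n e ` {..l n e}"
  using fan_coords.spoke_def[OF coords] .

lemma spokes_eq: "spokes (G n) = (\<lambda>e. v n e ` {..l n e}) ` ends (G n)"
  using fan_coords.spokes_eq[OF coords] spoke_eq by auto

lemma image_spoke:
  assumes mn: "m \<le> n" and e: "e \<in> ends (G n)"
  shows "rel_image (R m n) (v n e ` {..l n e}) = v m (\<epsilon> m n e) ` {..l m (\<epsilon> m n e)}"
proof
  show "rel_image (R m n) (v n e ` {..l n e}) \<subseteq> v m (\<epsilon> m n e) ` {..l m (\<epsilon> m n e)}"
    using fan_pair.fan_rel_spoke(1)[OF pair mor[OF mn] e] unfolding R_eq[OF mn] spoke_eq .
  show "v m (\<epsilon> m n e) ` {..l m (\<epsilon> m n e)} \<subseteq> rel_image (R m n) (v n e ` {..l n e})"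
  proof clarify
    fix j assume "j \<le> l m (\<epsilon> m n e)"
    then obtain i where i: "i \<le> l n e" "\<alpha> m n e i = j" "\<beta> m n e i = j"
      using walk_hit[OF walk[OF mn e]] by blast
    then have "(v m (\<epsilon> m n e) j, v n e i) \<in> R m n"
      unfolding R_eq[OF mn] using fan_relI[OF e, of i "l n" "\<alpha> m n" j "\<beta> m n" "v m" "\<epsilon> m n" "v n"] by simp
    then show "v m (\<epsilon> m n e) j \<in> rel_image (R m n) (v n e ` {..l n e})"
      using i(1) unfolding rel_image_def by blast
  qed
qed

lemma spoke_inj:
  assumes "e \<in> ends (G n)" "e' \<in> ends (G n)" "v n e ` {..l n e} = v n e' ` {..l n e'}"
  shows "e = e'"
proof -
  have "v n e (l n e) \<in> v n e' ` {..l n e'}"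
    using assms(3) by blast
  then obtain j where "j \<le> l n e'" "v n e (l n e) = v n e' j"
    by blast
  then show ?thesis
    using fan_coords.v_eq[OF coords assms(1,2) le_refl, of j] l_pos[OF assms(1)] by auto
qed

lemma spoke_branch_iff: "spoke_branch G R S \<longleftrightarrow> (\<exists>e. thread e \<and> S = branch e)"
proof
  assume S: "spoke_branch G R S"
  have "\<exists>e. e \<in> ends (G n) \<and> S n = v n e ` {..l n e}" for n
  proof -
    have "S n \<in> spokes (G n)"
      using S by (simp add: spoke_branch_def)
    then show ?thesis
      unfolding spokes_eq by blast
  qed
  then obtain e where e: "\<And>n. e n \<in> ends (G n)" "\<And>n. S n = v n (e n) ` {..l n (e n)}"
    by metis
  have "\<epsilon> m n (e n) = e m" if mn: "m \<le> n" for m n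
  proof -
    have "rel_image (R m n) (S n) = S m"
      using S mn unfolding spoke_branch_def by blast
    then have "v m (\<epsilon> m n (e n)) ` {..l m (\<epsilon> m n (e n))} = v m (e m) ` {..l m (e m)}"
      using image_spoke[OF mn e(1)] e(2) by simp
    then show ?thesis
      by (rule spoke_inj[OF \<epsilon>_in[OF mn e(1)] e(1)])
  qed
  then have "thread e"
    unfolding thread_def using e(1) by blast
  moreover have "S = branch e"
    using e(2) by (auto simp: branch_def)
  ultimately show "\<exists>e. thread e \<and> S = branch e"
    by blast
next
  assume "\<exists>e. thread e \<and> S = branch e"
  then obtain e where e: "thread e" "S = branch e"
    by blast
  show "spoke_branch G R S"
    unfolding spoke_branch_def
  proof (intro conjI allI impI)
    show "S n \<in> spokes (G n)" for n
      unfolding e(2) branch_def spokes_eq using thread_ends[OF e(1)] by blast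
    show "rel_image (R m n) (S n) = S m" if "m \<le> n" for m n
      unfolding e(2) branch_def using image_spoke[OF that thread_ends[OF e(1)]] thread_\<epsilon>[OF e(1) that] by simp
  qed
qed

context
  fixes e assumes e: "thread e"
begin

lemma branch_path: "path_coords (branch_graphs G (branch e) n) (l n (e n)) (v n (e n))"
  using fan_coords.spoke_path[OF coords thread_ends[OF e]] unfolding branch_graphs_def branch_def spoke_eq .

lemma branch_walk: "m \<le> n \<Longrightarrow> walk (l n (e n)) (l m (e m)) (\<alpha> m n (e n)) (\<beta> m n (e n))"
  using walk[OF _ thread_ends[OF e]] thread_\<epsilon>[OF e] by metis

lemma branch_rels_eq:
  assumes "m \<le> n"
  shows "branch_rels R (branch e) m n = walk_rel (v m (e m)) (v n (e n)) (l n (e n)) (\<alpha> m n (e n)) (\<beta> m n (e n))"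
  using fan_pair.fan_rel_spoke(2)[OF pair mor[OF assms] thread_ends[OF e]] thread_\<epsilon>[OF e assms]
  unfolding branch_rels_def branch_def R_eq[OF assms] spoke_eq by simp

lemma branch_hom: "m \<le> n \<Longrightarrow> branch_rels R (branch e) m n \<in> hom catA (branch_graphs G (branch e) n) (branch_graphs G (branch e) m)"
  unfolding branch_rels_eq by (rule walk_rel_homA[OF branch_path branch_path branch_walk])

lemma branch_sequence: "sequence_in catA (branch_graphs G (branch e)) (branch_rels R (branch e))"
  unfolding sequence_in_def
proof (intro conjI allI impI)
  show "branch_graphs G (branch e) n \<in> obj catA" for n
    using path_coords_is_path[OF branch_path] by (simp add: catA_def)
  show "branch_rels R (branch e) m n \<in> hom catA (branch_graphs G (branch e) n) (branch_graphs G (branch e) m)" if "m \<le> n" for m n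
    using branch_hom[OF that] .
  have sub: "branch e n \<subseteq> verts (G n)" for n
    unfolding branch_def using fan_coords.vertI[OF coords thread_ends[OF e]] by auto
  then show "branch_rels R (branch e) n n = Id_on (verts (branch_graphs G (branch e) n))" for n
    unfolding branch_rels_def branch_graphs_def R_id induced_def by auto
  show "branch_rels R (branch e) k m O branch_rels R (branch e) m n = branch_rels R (branch e) k n"
    if km: "k \<le> m" and mn: "m \<le> n" for k m n
  proof -
    have kn: "k \<le> n"
      using km mn by simp
    have "walk_rel (v k (e k)) (v n (e n)) (l n (e n)) (\<lambda>i. \<alpha> k m (e m) (\<alpha> m n (e n) i)) (\<lambda>i. \<beta> k m (e m) (\<beta> m n (e n) i))
      = walk_rel (v k (e k)) (v n (e n)) (l n (e n)) (\<alpha> k n (e n)) (\<beta> k n (e n))"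
      using comp(2,3)[OF km mn thread_ends[OF e]] thread_\<epsilon>[OF e mn] by (intro walk_rel_cong) simp
    then show ?thesis
      unfolding branch_rels_eq[OF km] branch_rels_eq[OF mn] branch_rels_eq[OF kn]
        walk_rel_comp[OF branch_path branch_walk[OF km] branch_walk[OF mn]] .
  qed
qed

text \<open>A reversing morphism becomes direction preserving when the vertices of \<open>H\<close>
  are numbered backwards, and the numbering of \<open>H\<close> is free to choose.\<close>

lemma branch_oriented:
  assumes "H \<in> obj catA" "Q \<in> hom catA H (branch_graphs G (branch e) m)"
  obtains h w \<gamma> \<delta> where "path_coords H h w" "walk h (l m (e m)) \<gamma> \<delta>" "Q = walk_rel (v m (e m)) w h \<gamma> \<delta>"
proof -
  have "is_path H"
    using assms(1) by (simp add: catA_def)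
  then obtain h w where w: "path_coords H h w"
    by (rule is_path_coords)
  from homA_walk_rel[OF w branch_path l_pos[OF thread_ends[OF e]] assms(2)] show ?thesis
    using that[OF w] that[OF path_coords_rev[OF w]] by blast
qed

lemma branch_cofinal:
  assumes "\<And>m. \<exists>n. refining 2 m n"
  shows "cofinal_in catA (branch_graphs G (branch e))"
  unfolding cofinal_in_def
proof
  fix H :: "'a rgraph" assume "H \<in> obj catA"
  then have "is_path H"
    by (simp add: catA_def)
  then obtain h w where w: "path_coords H h w"
    by (rule is_path_coords)
  obtain n where n: "refining h 0 n"
    using refining_unbounded[OF assms] by blast
  have "h \<le> l n (e n)"
    using refining_length[OF n thread_ends[OF e]] by simp
  from walk_rel_homA[OF branch_path w walk_min[OF this]]
  show "\<exists>n. hom catA (branch_graphs G (branch e) n) H \<noteq> {}"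
    by blast
qed

lemma branch_lax_fraisse:
  assumes "\<And>m. \<exists>n. refining 2 m n"
  shows "lax_fraisse catA (branch_graphs G (branch e)) (branch_rels R (branch e))"
  unfolding lax_fraisse_def
proof (intro conjI branch_sequence branch_cofinal assms allI ballI)
  fix m H Q assume "H \<in> obj catA" "Q \<in> hom catA H (branch_graphs G (branch e) m)"
  then obtain h w \<gamma> \<delta> where w: "path_coords H h w" and q: "walk h (l m (e m)) \<gamma> \<delta>" "Q = walk_rel (v m (e m)) w h \<gamma> \<delta>"
    by (rule branch_oriented)
  obtain n where n: "refining h m n"
    using refining_unbounded[OF assms] by blast
  then have mn: "m \<le> n" and r: "refines h (l n (e n)) (\<alpha> m n (e n)) (\<beta> m n (e n))"
    using thread_ends[OF e] by (auto simp: refining_def)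
  obtain p where p: "walk (l n (e n)) h p p"
      "\<And>i. i \<le> l n (e n) \<Longrightarrow> \<alpha> m n (e n) i \<le> \<gamma> (p i) \<and> \<delta> (p i) \<le> \<beta> m n (e n) i"
    using walk_lax_factor[OF branch_walk[OF mn] r q(1) le_refl l_pos[OF thread_ends[OF e]]] by blast
  have "Q O walk_rel w (v n (e n)) (l n (e n)) p p \<subseteq> branch_rels R (branch e) m n"
    unfolding q(2) branch_rels_eq[OF mn] walk_rel_comp[OF w q(1) p(1)] using p(2) by (rule walk_rel_mono)
  then show "\<exists>n\<ge>m. \<exists>P\<in>hom catA (branch_graphs G (branch e) n) H. Q O P \<subseteq> branch_rels R (branch e) m n"
    using walk_rel_homA[OF branch_path w p(1)] mn by blast
qed

text \<open>The test path is that of \<open>star_walk\<close>. The factor \<open>P\<close> may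
  reverse the direction, so the argument uses adjacency only: images \<open>t1\<close> and
  \<open>t2\<close> of two vertices adjacent to \<open>c\<close> differ by at most 2, and then the
  intervals \<open>{t1 div 3..(t1 + 2) div 3}\<close> and \<open>{t2 div 3..(t2 + 2) div 3}\<close>
  meet.\<close>

lemma refines_if_branch_lax_fraisse:
  assumes "lax_fraisse catA (branch_graphs G (branch e)) (branch_rels R (branch e))"
  shows "\<exists>n\<ge>m. refines 2 (l n (e n)) (\<alpha> m n (e n)) (\<beta> m n (e n))"
proof -
  let ?k = "3 * l m (e m)"
  obtain H :: "'a rgraph" and w where w: "path_coords H ?k w"
    by (rule path_exists)
  let ?Q = "walk_rel (v m (e m)) w ?k (\<lambda>i. i div 3) (\<lambda>i. (i + 2) div 3)"
  have "?Q \<in> hom catA H (branch_graphs G (branch e) m)"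
    by (rule walk_rel_homA[OF w branch_path star_walk(1)])
  moreover have "H \<in> obj catA"
    using path_coords_is_path[OF w] by (simp add: catA_def)
  ultimately obtain n P where n: "m \<le> n" "P \<in> hom catA (branch_graphs G (branch e) n) H" "?Q O P \<subseteq> branch_rels R (branch e) m n"
    using assms unfolding lax_fraisse_def by blast
  let ?S = "branch_graphs G (branch e) n" and ?k' = "l n (e n)"
  have total: "\<exists>t\<le>?k. (w t, v n (e n) i) \<in> P" if "i \<le> ?k'" for i
  proof -
    have "rel_image P {v n (e n) i} \<noteq> {}"
      using n(2) path_coords_vertI[OF branch_path that] by (simp add: catA_def co_bijective_def)
    then obtain y where "(y, v n (e n) i) \<in> P"
      unfolding rel_image_def by blast
    moreover from this have "y \<in> verts H"
      using n(2) by (auto simp: catA_def)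
    then obtain t where "t \<le> ?k" "y = w t"
      using path_coords_verts[OF w] by blast
    ultimately show ?thesis
      by blast
  qed
  have near: "t \<le> Suc t' \<and> t' \<le> Suc t"
    if "(w t, v n (e n) i) \<in> P" "(w t', v n (e n) i') \<in> P" "i \<le> Suc i'" "i' \<le> Suc i" "i \<le> ?k'" "i' \<le> ?k'" "t \<le> ?k" "t' \<le> ?k" for i i' t t'
  proof -
    have "(v n (e n) i, v n (e n) i') \<in> edges ?S"
      using path_coords_edge[OF branch_path that(5,6)] that(3,4) by simp
    then have "(w t, w t') \<in> edges H"
      using n(2) that(1,2) unfolding catA_def edge_preserving_def by auto
    then show ?thesis
      using path_coords_edge[OF w that(7,8)] by simp
  qed
  have "refines 2 ?k' (\<alpha> m n (e n)) (\<beta> m n (e n))"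
    unfolding refines_def
  proof (intro allI impI)
    fix i i' assume i: "i \<le> i'" "i' \<le> ?k'" "i' \<le> i + 2"
    define c where "c = (if i' = i + 2 then i + 1 else i)"
    have c: "c \<le> ?k'" "i \<le> Suc c" "c \<le> Suc i" "i' \<le> Suc c" "c \<le> Suc i'" "i \<le> ?k'"
      using i by (auto simp: c_def)
    obtain t where t: "t \<le> ?k" "(w t, v n (e n) c) \<in> P"
      using total[OF c(1)] by blast
    obtain t1 where t1: "t1 \<le> ?k" "(w t1, v n (e n) i) \<in> P"
      using total[OF c(6)] by blast
    obtain t2 where t2: "t2 \<le> ?k" "(w t2, v n (e n) i') \<in> P"
      using total[OF i(2)] by blast
    have "t1 \<le> Suc t \<and> t \<le> Suc t1" "t2 \<le> Suc t \<and> t \<le> Suc t2"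
      using near[OF t1(2) t(2) c(2,3,6,1) t1(1) t(1)] near[OF t2(2) t(2) c(4,5) i(2) c(1) t2(1) t(1)] by auto
    then obtain j where j: "t1 div 3 \<le> j" "j \<le> (t1 + 2) div 3" "t2 div 3 \<le> j" "j \<le> (t2 + 2) div 3"
    proof -
      have "t1 div 3 \<le> (t2 + 2) div 3" "t2 div 3 \<le> (t1 + 2) div 3"
        using \<open>t1 \<le> Suc t \<and> t \<le> Suc t1\<close> \<open>t2 \<le> Suc t \<and> t \<le> Suc t2\<close> by (auto intro: div_le_mono)
      moreover have "t1 div 3 \<le> (t1 + 2) div 3" "t2 div 3 \<le> (t2 + 2) div 3"
        by (auto intro: div_le_mono)
      ultimately show ?thesis
        by (intro that[of "max (t1 div 3) (t2 div 3)"]) auto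
    qed
    have "(v m (e m) j, w t1) \<in> ?Q" "(v m (e m) j, w t2) \<in> ?Q"
      using j t1(1) t2(1) walk_relI[of _ ?k "\<lambda>i. i div 3" j "\<lambda>i. (i + 2) div 3" "v m (e m)" w] by auto
    then have in_R: "(v m (e m) j, v n (e n) i) \<in> branch_rels R (branch e) m n"
        "(v m (e m) j, v n (e n) i') \<in> branch_rels R (branch e) m n"
      using n(3) t1(2) t2(2) by blast+
    have "(t1 + 2) div 3 \<le> (?k + 2) div 3"
      using t1(1) by (intro div_le_mono) simp
    then have "j \<le> l m (e m)"
      using j by simp
    then show "\<alpha> m n (e n) i' \<le> \<beta> m n (e n) i"
      using walk_rel_iff[OF branch_path branch_path branch_walk[OF n(1)]] in_R i(2) c(6)
      unfolding branch_rels_eq[OF n(1)] by (meson order_trans)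
  qed
  then show ?thesis
    using n(1) by blast
qed

end

text \<open>Every branch reaches \<open>refines 2\<close> at a level of its own. The property
  persists at later levels, so \<open>koenig_ends\<close> makes the level uniform.\<close>

lemma refining_if_branches:
  assumes "\<And>S. spoke_branch G R S \<Longrightarrow> lax_fraisse catA (branch_graphs G S) (branch_rels R S)"
  shows "\<exists>n. refining 2 m n"
proof -
  let ?P = "\<lambda>n e. m \<le> n \<and> refines 2 (l n e) (\<alpha> m n e) (\<beta> m n e)"
  have "\<exists>n. \<forall>e\<in>ends (G n). ?P n e"
  proof (rule koenig_ends)
    fix k n e assume kn: "k \<le> n" and e: "e \<in> ends (G n)" and P: "?P k (\<epsilon> k n e)"
    have "refines 2 (l n e) (\<lambda>i. \<alpha> m k (\<epsilon> k n e) (\<alpha> k n e i)) (\<lambda>i. \<beta> m k (\<epsilon> k n e) (\<beta> k n e i))"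
      using refines_comp[OF walk[OF _ \<epsilon>_in[OF kn e]] walk[OF kn e]] P by blast
    then have "refines 2 (l n e) (\<alpha> m n e) (\<beta> m n e)"
      by (rule refines_cong) (use comp[OF _ kn e] P in auto)
    then show "?P n e"
      using P kn by simp
  next
    fix e assume "thread e"
    then show "\<exists>n. ?P n (e n)"
      using refines_if_branch_lax_fraisse assms spoke_branch_iff by blast
  qed
  moreover have "ends (G n) \<noteq> {}" for n
    by (rule ends_nonempty)
  ultimately show ?thesis
    unfolding refining_def by blast
qed

section \<open>The sequence of ends\<close>

lemma end_rel_eq:
  assumes "m \<le> n"
  shows "end_rel (G n) (G m) (R m n) = {(\<epsilon> m n e, e) | e. e \<in> ends (G n)}"
proof -
  have "(x, e) \<in> R m n \<longleftrightarrow> x = \<epsilon> m n e" if "e \<in> ends (G n)" for x e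
    using fan_pair.fan_rel_end[OF pair mor[OF assms] that, of x] v_end[OF that] v_end[OF \<epsilon>_in[OF assms that]]
    unfolding R_eq[OF assms] by simp
  then show ?thesis
    using \<epsilon>_in[OF assms] unfolding end_rel_def by blast
qed

lemma end_rel_hom:
  assumes "m \<le> n"
  shows "end_rel (G n) (G m) (R m n) \<in> hom catD (end_graph (G n)) (end_graph (G m))"
  unfolding end_rel_eq[OF assms] catD_def surjective_function_def end_graph_def
  using \<epsilon>_in[OF assms] \<epsilon>_surj[OF assms] by auto

lemma end_sequence: "sequence_in catD (\<lambda>n. end_graph (G n)) (\<lambda>m n. end_rel (G n) (G m) (R m n))"
  unfolding sequence_in_def
proof (intro conjI allI impI)
  show "end_graph (G n) \<in> obj catD" for n
    using finite_ends ends_nonempty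
    by (auto simp: catD_def discrete_graph_def is_graph_def end_graph_def refl_on_def sym_def)
  show "end_rel (G n) (G m) (R m n) \<in> hom catD (end_graph (G n)) (end_graph (G m))" if "m \<le> n" for m n
    by (rule end_rel_hom[OF that])
  show "end_rel (G n) (G n) (R n n) = Id_on (verts (end_graph (G n)))" for n
    unfolding end_rel_eq[OF le_refl] end_graph_def using \<epsilon>_id by auto
  show "end_rel (G m) (G k) (R k m) O end_rel (G n) (G m) (R m n) = end_rel (G n) (G k) (R k n)"
    if km: "k \<le> m" and mn: "m \<le> n" for k m n
    unfolding end_rel_eq[OF km] end_rel_eq[OF mn] end_rel_eq[OF order_trans[OF km mn]]
    using comp(1)[OF km mn] \<epsilon>_in[OF mn] by force
qed

text \<open>Ends are mapped by functions, so lifting fibre by fibre gives exact factorisation at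
  once.\<close>

lemma ends_fraisse:
  assumes split: "\<And>m. \<exists>n. splitting 2 m n"
  shows "fraisse catD (\<lambda>n. end_graph (G n)) (\<lambda>m n. end_rel (G n) (G m) (R m n))"
  unfolding fraisse_def cofinal_in_def
proof (intro conjI end_sequence ballI allI)
  fix H :: "'a rgraph" assume "H \<in> obj catD"
  then have H: "finite (verts H)" "verts H \<noteq> {}"
    by (auto simp: catD_def discrete_graph_def is_graph_def)
  obtain n where n: "splitting (card (verts H)) 0 n"
    using splitting_unbounded[OF split] by blast
  obtain e0 where e0: "e0 \<in> ends (G 0)"
    using ends_nonempty by blast
  have "card (verts H) \<le> card {e' \<in> ends (G n). \<epsilon> 0 n e' = e0}"
    using n e0 by (simp add: splitting_def)
  also have "\<dots> \<le> card (ends (G n))"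
    using finite_ends by (intro card_mono) auto
  finally obtain \<sigma> where \<sigma>: "\<sigma> ` ends (G n) = verts H"
    using surjection_of_card_le[OF finite_ends H(2,1)] by metis
  have "{(\<sigma> e, e) | e. e \<in> ends (G n)} \<in> hom catD (end_graph (G n)) H"
    using \<sigma> by (auto simp: catD_def surjective_function_def end_graph_def)
  then show "\<exists>n. hom catD (end_graph (G n)) H \<noteq> {}"
    by blast
next
  fix m and H :: "'a rgraph" and Q assume "H \<in> obj catD" and Q: "Q \<in> hom catD H (end_graph (G m))"
  then have H: "finite (verts H)"
    by (auto simp: catD_def discrete_graph_def is_graph_def)
  have Qsub: "Q \<subseteq> ends (G m) \<times> verts H" and Qfun: "\<And>g. g \<in> verts H \<Longrightarrow> \<exists>!e. (e, g) \<in> Q"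
    and Qsurj: "\<And>e. e \<in> ends (G m) \<Longrightarrow> \<exists>g\<in>verts H. (e, g) \<in> Q"
    using Q by (auto simp: catD_def surjective_function_def end_graph_def)
  define \<pi> where "\<pi> g = (THE e. (e, g) \<in> Q)" for g
  have \<pi>: "(e, g) \<in> Q \<longleftrightarrow> e = \<pi> g" if "g \<in> verts H" for e g
    using theI'[OF Qfun[OF that]] Qfun[OF that] unfolding \<pi>_def by blast
  have \<pi>_surj: "\<pi> ` verts H = ends (G m)"
  proof
    show "\<pi> ` verts H \<subseteq> ends (G m)"
      using \<pi> Qsub by blast
    show "ends (G m) \<subseteq> \<pi> ` verts H"
      using \<pi> Qsurj by blast
  qed
  obtain n where n: "splitting (card (verts H)) m n"
    using splitting_unbounded[OF split] by blast
  then have mn: "m \<le> n"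
    and card: "\<And>e. e \<in> ends (G m) \<Longrightarrow> card (verts H) \<le> card {a \<in> ends (G n). \<epsilon> m n a = e}"
    by (auto simp: splitting_def)
  obtain \<sigma> where \<sigma>: "\<sigma> ` ends (G n) = verts H" "\<And>e. e \<in> ends (G n) \<Longrightarrow> \<pi> (\<sigma> e) = \<epsilon> m n e"
    using surjective_lift[OF finite_ends \<epsilon>_surj[OF mn] H \<pi>_surj card] by blast
  let ?P = "{(\<sigma> e, e) | e. e \<in> ends (G n)}"
  have "?P \<in> hom catD (end_graph (G n)) H"
    using \<sigma>(1) by (auto simp: catD_def surjective_function_def end_graph_def)
  moreover have "Q O ?P = end_rel (G n) (G m) (R m n)"
  proof -
    have "(x, \<sigma> e) \<in> Q \<longleftrightarrow> x = \<epsilon> m n e" if "e \<in> ends (G n)" for x e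
      using \<pi>[of "\<sigma> e" x] \<sigma> that by auto
    then show ?thesis
      unfolding end_rel_eq[OF mn] by blast
  qed
  ultimately show "\<exists>n\<ge>m. \<exists>P\<in>hom catD (end_graph (G n)) H. Q O P = end_rel (G n) (G m) (R m n)"
    using mn by blast
qed

text \<open>Tested on two copies of every end: a factor has to hit both copies of \<open>e\<close>,
  and it is a function, so two ends lie over \<open>e\<close>.\<close>

lemma splitting_if_ends_fraisse:
  assumes "fraisse catD (\<lambda>n. end_graph (G n)) (\<lambda>m n. end_rel (G n) (G m) (R m n))"
  shows "\<exists>n. splitting 2 m n"
proof -
  let ?X = "ends (G m) \<times> (UNIV :: bool set)"
  have "finite ?X"
    using finite_ends by simp
  then obtain \<iota> :: "'a \<times> bool \<Rightarrow> 'a" where \<iota>: "inj_on \<iota> ?X"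
    using arb_inj_on_finite_infinite by blast
  define H where "H = \<lparr>verts = \<iota> ` ?X, edges = Id_on (\<iota> ` ?X)\<rparr>"
  define Q where "Q = {(e, \<iota> (e, b)) | e b. e \<in> ends (G m)}"
  have Q_iff: "(e, \<iota> x) \<in> Q \<longleftrightarrow> e = fst x" if "x \<in> ?X" for e x
    using that inj_onD[OF \<iota>, of x] unfolding Q_def by (cases x) auto
  have "H \<in> obj catD"
    using \<open>finite ?X\<close> ends_nonempty
    by (auto simp: H_def catD_def discrete_graph_def is_graph_def refl_on_def sym_def)
  moreover have "Q \<in> hom catD H (end_graph (G m))"
    unfolding catD_def surjective_function_def
  proof (simp, intro conjI ballI)
    show "Q \<subseteq> verts (end_graph (G m)) \<times> verts H"
      by (auto simp: Q_def H_def end_graph_def)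
    show "\<exists>!h. (h, g) \<in> Q" if "g \<in> verts H" for g
      using that Q_iff by (auto simp: H_def)
    show "\<exists>g\<in>verts H. (h, g) \<in> Q" if "h \<in> verts (end_graph (G m))" for h
      using that Q_iff[of "(h, True)" h] by (auto simp: H_def end_graph_def)
  qed
  ultimately obtain n P where n: "m \<le> n" "P \<in> hom catD (end_graph (G n)) H" "Q O P = end_rel (G n) (G m) (R m n)"
    using assms unfolding fraisse_def by blast
  have "splitting 2 m n"
    unfolding splitting_def
  proof (intro conjI ballI n(1))
    fix e assume e: "e \<in> ends (G m)"
    have ex: "\<exists>e'\<in>ends (G n). (\<iota> (e, b), e') \<in> P" for b
      using n(2) e unfolding catD_def surjective_function_def by (auto simp: H_def end_graph_def)
    obtain e1 where e1: "e1 \<in> ends (G n)" "(\<iota> (e, True), e1) \<in> P"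
      using ex by blast
    obtain e2 where e2: "e2 \<in> ends (G n)" "(\<iota> (e, False), e2) \<in> P"
      using ex by blast
    have "\<epsilon> m n e' = e" if "(\<iota> (e, b), e') \<in> P" for e' b
    proof -
      have "(e, e') \<in> Q O P"
        using that Q_iff[of "(e, b)" e] e by auto
      then show ?thesis
        unfolding n(3) end_rel_eq[OF n(1)] by blast
    qed
    then have sub: "{e1, e2} \<subseteq> {e' \<in> ends (G n). \<epsilon> m n e' = e}"
      using e1 e2 by blast
    have "e1 \<noteq> e2"
    proof
      assume "e1 = e2"
      moreover have "\<exists>!h. (h, e1) \<in> P"
        using n(2) e1(1) by (auto simp: catD_def surjective_function_def end_graph_def)
      ultimately have "\<iota> (e, True) = \<iota> (e, False)"
        using e1(2) e2(2) by blast
      then show False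
        using inj_onD[OF \<iota>, of "(e, True)" "(e, False)"] e by simp
    qed
    then show "2 \<le> card {e' \<in> ends (G n). \<epsilon> m n e' = e}"
      using card_mono[OF _ sub] finite_ends by simp
  qed
  then show ?thesis
    by blast
qed

lemma fine_iff_branches:
  "(\<forall>m. \<exists>n. refining 2 m n \<and> splitting 2 m n) \<longleftrightarrow>
   (\<forall>S. spoke_branch G R S \<longrightarrow> lax_fraisse catA (branch_graphs G S) (branch_rels R S)) \<and>
   fraisse catD (\<lambda>n. end_graph (G n)) (\<lambda>m n. end_rel (G n) (G m) (R m n))" (is "?L \<longleftrightarrow> ?A \<and> ?D")
proof (intro iffI conjI)
  assume L: ?L
  have "\<exists>n. refining 2 m n" for m
    using L by blast
  then show ?A
    using branch_lax_fraisse unfolding spoke_branch_iff by blast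
  show ?D
    using ends_fraisse L by blast
next
  assume AD: "?A \<and> ?D"
  have fine: "\<exists>n. refining 2 m n" "\<exists>n. splitting 2 m n" for m
    using refining_if_branches splitting_if_ends_fraisse AD by auto
  show ?L
  proof
    fix m
    obtain n n' where "refining 2 m n" "splitting 2 m n'"
      using fine by meson
    then have "refining 2 m (max n n')" "splitting 2 m (max n n')"
      using refining_comp splitting_comp by auto
    then show "\<exists>n. refining 2 m n \<and> splitting 2 m n"
      by blast
  qed
qed

text \<open>To test a branch, the spoke of \<open>e m\<close> is replaced by the given path and all
  other spokes are kept. An exact factor through this fan restricts to one on the branch, since
  equal relations of fans have equal coordinates on each spoke.\<close>

lemma branch_fraisse_if_fraisse:
  assumes fr: "fraisse catX G R" and lax: "lax_fraisse catX G R" and e: "thread e"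
  shows "fraisse catA (branch_graphs G (branch e)) (branch_rels R (branch e))"
  unfolding fraisse_def
proof (intro conjI branch_sequence[OF e] allI ballI)
  show "cofinal_in catA (branch_graphs G (branch e))"
    using branch_cofinal[OF e] lax lax_fraisse_iff by blast
  fix m H Q assume "H \<in> obj catA" "Q \<in> hom catA H (branch_graphs G (branch e) m)"
  then obtain h w \<gamma> \<delta> where w: "path_coords H h w" and q: "walk h (l m (e m)) \<gamma> \<delta>" "Q = walk_rel (v m (e m)) w h \<gamma> \<delta>"
    by (rule branch_oriented[OF e])
  have em: "e m \<in> ends (G m)"
    using thread_ends[OF e] .
  interpret M: fan_coords "G m" "ends (G m)" "l m" "v m"
    by (rule coords)
  let ?l = "\<lambda>i. if i = e m then h else l m i"
  have h: "1 \<le> h"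
    using walk_le_self[OF q(1) le_refl] walk_ends[OF q(1)] l_pos[OF em] by simp
  have "1 \<le> ?l i" if "i \<in> ends (G m)" for i
    using M.l_pos[OF that] h by simp
  then obtain F :: "'a rgraph" and v' where F: "fan_coords F (ends (G m)) ?l v'"
    using fan_exists[OF M.finite_I M.card_I, of ?l] by blast
  let ?a = "\<lambda>i. if i = e m then \<gamma> else (\<lambda>j. j)" and ?b = "\<lambda>i. if i = e m then \<delta> else (\<lambda>j. j)"
  have f: "fan_mor (ends (G m)) ?l (ends (G m)) (l m) (\<lambda>i. i) ?a ?b"
    unfolding fan_mor_def using q(1) walk_id by simp
  let ?Q = "fan_rel (v m) (ends (G m)) ?l v' (\<lambda>i. i) ?a ?b"
  have "?Q \<in> hom catX F (G m)"
    by (rule fan_pair.fan_rel_hom[OF fan_pair.intro[OF F coords] f])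
  moreover have "F \<in> obj catX"
    using fan_coords.fan[OF F] by (simp add: catX_def)
  ultimately obtain n P where n: "m \<le> n" "P \<in> hom catX (G n) F" "?Q O P = R m n"
    using fr unfolding fraisse_def by blast
  obtain \<sigma> a b where p: "fan_mor (ends (G n)) (l n) (ends (G m)) ?l \<sigma> a b" "P = fan_rel v' (ends (G n)) (l n) (v n) \<sigma> a b"
    by (rule fan_pair.hom_fan_rel[OF fan_pair.intro[OF coords F] n(2)])
  have eq: "fan_rel (v m) (ends (G n)) (l n) (v n) (\<lambda>i. \<sigma> i) (\<lambda>i j. ?a (\<sigma> i) (a i j)) (\<lambda>i j. ?b (\<sigma> i) (b i j))
      = fan_rel (v m) (ends (G n)) (l n) (v n) (\<epsilon> m n) (\<alpha> m n) (\<beta> m n)"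
    using n(3) unfolding p(2) R_eq[OF n(1)] fan_rel_comp[OF F coords f p(1)] .
  have en: "e n \<in> ends (G n)"
    using thread_ends[OF e] .
  note c = fan_mor_comp[OF f p(1)]
  note le1 = iffD1[OF fan_pair.fan_rel_mono_iff[OF pair c mor[OF n(1)]] equalityD1[OF eq], rule_format, OF en]
  note le2 = iffD1[OF fan_pair.fan_rel_mono_iff[OF pair mor[OF n(1)] c] equalityD2[OF eq], rule_format, OF en]
  have \<sigma>: "\<sigma> (e n) = e m"
    using le1 thread_\<epsilon>[OF e n(1)] by simp
  have ab: "\<gamma> (a (e n) j) = \<alpha> m n (e n) j \<and> \<delta> (b (e n) j) = \<beta> m n (e n) j" if "j \<le> l n (e n)" for j
    using le1 le2 \<sigma> that by (simp add: le_antisym)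
  have wp: "walk (l n (e n)) h (a (e n)) (b (e n))"
    using fan_morD[OF p(1) en] \<sigma> by simp
  have "Q O walk_rel w (v n (e n)) (l n (e n)) (a (e n)) (b (e n)) = branch_rels R (branch e) m n"
    unfolding q(2) branch_rels_eq[OF e n(1)] walk_rel_comp[OF w q(1) wp] using ab by (rule walk_rel_cong)
  then show "\<exists>n\<ge>m. \<exists>P\<in>hom catA (branch_graphs G (branch e) n) H. Q O P = branch_rels R (branch e) m n"
    using walk_rel_homA[OF branch_path[OF e] w wp] n(1) by blast
qed

lemma branch_exact_factor:
  assumes fr: "fraisse catA (branch_graphs G (branch e)) (branch_rels R (branch e))" and e: "thread e"
    and q: "walk h (l m (e m)) \<gamma> \<delta>"
  shows "\<exists>n\<ge>m. \<exists>a b. walk (l n (e n)) h a b \<and> (\<forall>j\<le>l n (e n). \<gamma> (a j) = \<alpha> m n (e n) j \<and> \<delta> (b j) = \<beta> m n (e n) j)"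
proof -
  have lm: "1 \<le> l m (e m)"
    using l_pos[OF thread_ends[OF e]] .
  have h: "1 \<le> h"
    using walk_le_self[OF q le_refl] walk_ends[OF q] lm by simp
  obtain H :: "'a rgraph" and w where w: "path_coords H h w"
    by (rule path_exists)
  let ?Q = "walk_rel (v m (e m)) w h \<gamma> \<delta>"
  have "?Q \<in> hom catA H (branch_graphs G (branch e) m)"
    by (rule walk_rel_homA[OF w branch_path[OF e] q])
  moreover have "H \<in> obj catA"
    using path_coords_is_path[OF w] by (simp add: catA_def)
  ultimately obtain n P where n: "m \<le> n" "P \<in> hom catA (branch_graphs G (branch e) n) H" "?Q O P = branch_rels R (branch e) m n"
    using fr unfolding fraisse_def by blast
  note B = branch_path[OF e, of n] and B' = branch_path[OF e, of m]
  from homA_walk_rel[OF B w h n(2)] show ?thesis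
  proof (elim disjE exE conjE)
    fix a b assume ab: "walk (l n (e n)) h a b" "P = walk_rel w (v n (e n)) (l n (e n)) a b"
    have eq: "walk_rel (v m (e m)) (v n (e n)) (l n (e n)) (\<lambda>j. \<gamma> (a j)) (\<lambda>j. \<delta> (b j))
      = walk_rel (v m (e m)) (v n (e n)) (l n (e n)) (\<alpha> m n (e n)) (\<beta> m n (e n))"
      using n(3) unfolding ab(2) branch_rels_eq[OF e n(1)] walk_rel_comp[OF w q ab(1)] .
    note c = walk_comp[OF q ab(1)]
    have "\<gamma> (a j) = \<alpha> m n (e n) j \<and> \<delta> (b j) = \<beta> m n (e n) j" if "j \<le> l n (e n)" for j
      using walk_rel_subD[OF B B' c branch_walk[OF e n(1)] equalityD1[OF eq] that]
        walk_rel_subD[OF B B' branch_walk[OF e n(1)] c equalityD2[OF eq] that] by (simp add: le_antisym)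
    then show ?thesis
      using n(1) ab(1) by blast
  next
    \<comment> \<open>Impossible: a reversing \<open>P\<close> would make the composite relate the
      end of the spoke at level \<open>n\<close> to the root at level \<open>m\<close>.\<close>
    fix a b assume ab: "walk (l n (e n)) h a b" "P = walk_rel w (\<lambda>i. v n (e n) (l n (e n) - i)) (l n (e n)) a b"
    let ?u = "\<lambda>i. v n (e n) (l n (e n) - i)"
    note c = walk_comp[OF q ab(1)]
    have "(v m (e m) 0, ?u 0) \<in> walk_rel (v m (e m)) ?u (l n (e n)) (\<lambda>j. \<gamma> (a j)) (\<lambda>j. \<delta> (b j))"
      using walk_rel_iff[OF path_coords_rev[OF B] B' c, of 0 0] walk_ends[OF c] by simp
    also have "\<dots> = branch_rels R (branch e) m n"
      using n(3) unfolding ab(2) walk_rel_comp[OF w q ab(1)] .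
    finally have "\<alpha> m n (e n) (l n (e n)) \<le> 0"
      using walk_rel_iff[OF B B' branch_walk[OF e n(1)], of "l n (e n)" 0] unfolding branch_rels_eq[OF e n(1)] by simp
    then show ?thesis
      using walk_ends[OF branch_walk[OF e n(1)]] lm by simp
  qed
qed

text \<open>For a spoke \<open>i\<close> of \<open>H\<close> over a branch the exact factor appears
  at a level that depends on both, and it persists at later levels (\<open>E_mono\<close>).
  Finiteness of \<open>ends H\<close> and compactness of the space of threads make the level
  uniform. The lax-Fraisse hypothesis supplies cofinality and the splitting by which ends are
  lifted.\<close>

lemma fraisse_if_branches_fraisse:
  assumes lax: "lax_fraisse catX G R"
    and br: "\<And>S. spoke_branch G R S \<Longrightarrow> fraisse catA (branch_graphs G S) (branch_rels R S)"
  shows "fraisse catX G R"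
  unfolding fraisse_def
proof (intro conjI seq allI ballI)
  show "cofinal_in catX G"
    using lax by (simp add: lax_fraisse_def)
  fix m and H :: "'a rgraph" and Q
  assume "H \<in> obj catX" and Q: "Q \<in> hom catX H (G m)"
  then have "is_fan H"
    by (simp add: catX_def)
  from fan_coords_exist[OF this] obtain l' v' where H: "fan_coords H (ends H) l' v'"
    by (elim exE conjE) (rule that)
  obtain \<pi> \<gamma> \<delta> where q: "fan_mor (ends H) l' (ends (G m)) (l m) \<pi> \<gamma> \<delta>" "Q = fan_rel (v m) (ends H) l' v' \<pi> \<gamma> \<delta>"
    using fan_pair.hom_fan_rel[OF fan_pair.intro[OF H coords] Q] .
  let ?K = "\<lambda>n e i a b. \<forall>j\<le>l n e. \<gamma> i (a j) = \<alpha> m n e j \<and> \<delta> i (b j) = \<beta> m n e j"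
  let ?E = "\<lambda>n e i. m \<le> n \<and> (\<exists>a b. walk (l n e) (l' i) a b \<and> ?K n e i a b)"
  have E_mono: "?E n e i" if k: "k \<le> n" "e \<in> ends (G n)" "?E k (\<epsilon> k n e) i" for k n e i
  proof -
    obtain a b where ab: "m \<le> k" "walk (l k (\<epsilon> k n e)) (l' i) a b" "?K k (\<epsilon> k n e) i a b"
      using k(3) by blast
    have "?K n e i (\<lambda>j. a (\<alpha> k n e j)) (\<lambda>j. b (\<beta> k n e j))"
      using ab(3) comp(2,3)[OF ab(1) k(1,2)] walk_bound[OF walk[OF k(1,2)]] by auto
    then show ?thesis
      using walk_comp[OF ab(2) walk[OF k(1,2)]] ab(1) k(1) by auto
  qed
  let ?P = "\<lambda>n e. m \<le> n \<and> (\<forall>i\<in>ends H. \<pi> i = \<epsilon> m n e \<longrightarrow> ?E n e i)"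
  have P_mono: "?P n e" if "k \<le> n" "e \<in> ends (G n)" "?P k (\<epsilon> k n e)" for k n e
    using that E_mono[OF that(1,2)] comp(1)[OF _ that(1,2), of m] by auto
  have "\<exists>n. \<forall>e\<in>ends (G n). ?P n e"
  proof (rule koenig_ends)
    show "?P n e" if "k \<le> n" "e \<in> ends (G n)" "?P k (\<epsilon> k n e)" for k n e
      using P_mono[OF that] .
    fix e assume e: "thread e"
    have "\<exists>n. \<forall>i\<in>{i \<in> ends H. \<pi> i = e m}. ?E n (e n) i"
    proof (rule finite_common)
      show "finite {i \<in> ends H. \<pi> i = e m}"
        using fan_coords.finite_I[OF H] by simp
      show "\<exists>n. ?E n (e n) i" if "i \<in> {i \<in> ends H. \<pi> i = e m}" for i
      proof -
        have "walk (l' i) (l m (e m)) (\<gamma> i) (\<delta> i)"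
          using fan_morD[OF q(1), of i] that by auto
        from branch_exact_factor[OF br e this] show ?thesis
          using spoke_branch_iff e by blast
      qed
      show "?E n (e n) i" if "k \<le> n" "?E k (e k) i" for k n i
        by (rule E_mono[OF that(1) thread_ends[OF e]]) (use thread_\<epsilon>[OF e that(1)] that(2) in simp)
    qed
    then obtain n where n: "\<forall>i\<in>{i \<in> ends H. \<pi> i = e m}. ?E n (e n) i"
      by blast
    have "?P (max m n) (e (max m n))"
    proof (intro conjI ballI impI)
      fix i assume "i \<in> ends H" "\<pi> i = \<epsilon> m (max m n) (e (max m n))"
      then have "?E n (e n) i"
        using n thread_\<epsilon>[OF e max.cobounded1] by simp
      then have "?E n (\<epsilon> n (max m n) (e (max m n))) i"
        unfolding thread_\<epsilon>[OF e max.cobounded2] .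
      then have "?E (max m n) (e (max m n)) i"
        using E_mono[OF max.cobounded2 thread_ends[OF e], of n m i] by blast
      then show "m \<le> max m n" "\<exists>a b. walk (l (max m n) (e (max m n))) (l' i) a b \<and> ?K (max m n) (e (max m n)) i a b"
        by blast+
    qed simp
    then show "\<exists>n. ?P n (e n)"
      by blast
  qed
  then obtain n1 where n1: "\<forall>e\<in>ends (G n1). ?P n1 e"
    by blast
  obtain n2 where n2: "splitting (card (ends H)) m n2"
    using splitting_unbounded lax lax_fraisse_iff by blast
  define n where "n = max n1 n2"
  have P: "?P n e" if "e \<in> ends (G n)" for e
    using P_mono[of n1 n e] n1 \<epsilon>_in[of n1 n e] that by (simp add: n_def)
  have card: "splitting (card (ends H)) m n"
    using splitting_comp[OF n2] by (simp add: n_def)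
  then have mn: "m \<le> n"
    by (simp add: splitting_def)
  obtain \<sigma> a b where s: "fan_mor (ends (G n)) (l n) (ends H) l' \<sigma> a b"
      "\<And>e. e \<in> ends (G n) \<Longrightarrow> \<pi> (\<sigma> e) = \<epsilon> m n e" "\<And>e. e \<in> ends (G n) \<Longrightarrow> ?K n e (\<sigma> e) (a e) (b e)"
    using fan_factor[OF H q(1) mn card, of "?K n"] P by metis
  let ?P = "fan_rel v' (ends (G n)) (l n) (v n) \<sigma> a b"
  have "?P \<in> hom catX (G n) H"
    by (rule fan_pair.fan_rel_hom[OF fan_pair.intro[OF coords H] s(1)])
  moreover have "Q O ?P = R m n"
    unfolding q(2) R_eq[OF mn] fan_rel_comp[OF H coords q(1) s(1)]
  proof (rule equalityI)
    note c = fan_mor_comp[OF q(1) s(1)]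
    show "fan_rel (v m) (ends (G n)) (l n) (v n) (\<lambda>i. \<pi> (\<sigma> i)) (\<lambda>i j. \<gamma> (\<sigma> i) (a i j)) (\<lambda>i j. \<delta> (\<sigma> i) (b i j))
      \<subseteq> fan_rel (v m) (ends (G n)) (l n) (v n) (\<epsilon> m n) (\<alpha> m n) (\<beta> m n)"
      by (subst fan_pair.fan_rel_mono_iff[OF pair c mor[OF mn]]) (use s in auto)
    show "fan_rel (v m) (ends (G n)) (l n) (v n) (\<epsilon> m n) (\<alpha> m n) (\<beta> m n) \<subseteq>
      fan_rel (v m) (ends (G n)) (l n) (v n) (\<lambda>i. \<pi> (\<sigma> i)) (\<lambda>i j. \<gamma> (\<sigma> i) (a i j)) (\<lambda>i j. \<delta> (\<sigma> i) (b i j))"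
      by (subst fan_pair.fan_rel_mono_iff[OF pair mor[OF mn] c]) (use s in auto)
  qed
  ultimately show "\<exists>n\<ge>m. \<exists>P\<in>hom catX (G n) H. Q O P = R m n"
    using mn by blast
qed

lemma fraisse_iff_branches:
  assumes "lax_fraisse catX G R"
  shows "fraisse catX G R \<longleftrightarrow> (\<forall>S. spoke_branch G R S \<longrightarrow> fraisse catA (branch_graphs G S) (branch_rels R S))"
proof (intro iffI allI impI)
  show "fraisse catA (branch_graphs G S) (branch_rels R S)" if "fraisse catX G R" "spoke_branch G R S" for S
    using branch_fraisse_if_fraisse[OF that(1) assms] that(2) unfolding spoke_branch_iff by blast
  show "fraisse catX G R" if "\<forall>S. spoke_branch G R S \<longrightarrow> fraisse catA (branch_graphs G S) (branch_rels R S)"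
    by (rule fraisse_if_branches_fraisse[OF assms]) (use that in blast)
qed

end

section \<open>The spectrum of a sequence of graphs\<close>

text \<open>The general facts about spectra rest on co-bijectivity and edge preservation; fans enter
  later through a sublocale.\<close>

locale graph_seq =
  fixes G :: "nat \<Rightarrow> 'a rgraph" and R :: "nat \<Rightarrow> nat \<Rightarrow> ('a \<times> 'a) set"
  assumes graph: "is_graph (G n)"
    and R_sub: "m \<le> n \<Longrightarrow> R m n \<subseteq> verts (G m) \<times> verts (G n)"
    and R_refl: "R n n = Id_on (verts (G n))"
    and R_comp': "k \<le> m \<Longrightarrow> m \<le> n \<Longrightarrow> R k m O R m n = R k n"
    and R_co: "m \<le> n \<Longrightarrow> co_bijective (G n) (G m) (R m n)"
    and R_edge: "m \<le> n \<Longrightarrow> edge_preserving (G n) (G m) (R m n)"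
begin

abbreviation P :: "(nat \<times> 'a) set" where
  "P \<equiv> induced_poset G"

abbreviation le :: "((nat \<times> 'a) \<times> (nat \<times> 'a)) set" where
  "le \<equiv> induced_le G R"

abbreviation Spec :: "(nat \<times> 'a) set set" where
  "Spec \<equiv> spectrum P le"

abbreviation X :: "(nat \<times> 'a) set topology" where
  "X \<equiv> spectrum_topology P le"

lemma P_iff: "(n, x) \<in> P \<longleftrightarrow> x \<in> verts (G n)"
  by (simp add: induced_poset_def)

lemma le_iff: "((n, x), (m, y)) \<in> le \<longleftrightarrow> m \<le> n \<and> (y, x) \<in> R m n"
  using R_sub by (auto simp: induced_le_def)

lemma finite_verts: "finite (verts (G n))"
  and verts_nonempty: "verts (G n) \<noteq> {}"
  and edge_refl: "x \<in> verts (G n) \<Longrightarrow> (x, x) \<in> edges (G n)"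
  and edges_sub: "(x, y) \<in> edges (G n) \<Longrightarrow> x \<in> verts (G n) \<and> y \<in> verts (G n)"
  using graph[of n] by (auto simp: is_graph_def refl_on_def)

lemma edge_sym: "(x, y) \<in> edges (G n) \<Longrightarrow> (y, x) \<in> edges (G n)"
  using graph[of n] by (auto simp: is_graph_def dest: symD)

lemma R_verts: "m \<le> n \<Longrightarrow> (x, y) \<in> R m n \<Longrightarrow> x \<in> verts (G m) \<and> y \<in> verts (G n)"
  using R_sub by blast

lemma R_refl_iff: "(x, y) \<in> R n n \<longleftrightarrow> x = y \<and> y \<in> verts (G n)"
  unfolding R_refl by auto

lemma R_trans: "k \<le> m \<Longrightarrow> m \<le> n \<Longrightarrow> (x, y) \<in> R k m \<Longrightarrow> (y, z) \<in> R m n \<Longrightarrow> (x, z) \<in> R k n"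
  using R_comp' by blast

lemma R_factor:
  assumes "k \<le> m" "m \<le> n" "(x, z) \<in> R k n"
  obtains y where "y \<in> verts (G m)" "(x, y) \<in> R k m" "(y, z) \<in> R m n"
proof -
  have "(x, z) \<in> R k m O R m n"
    using assms(3) R_comp'[OF assms(1,2)] by simp
  then show ?thesis
    using that R_verts[OF assms(1)] by blast
qed

lemma R_total:
  assumes "m \<le> n" "y \<in> verts (G n)"
  obtains x where "x \<in> verts (G m)" "(x, y) \<in> R m n"
proof -
  have "rel_image (R m n) {y} \<noteq> {}"
    using R_co[OF assms(1)] assms(2) by (simp add: co_bijective_def)
  then show ?thesis
    using that R_verts[OF assms(1)] unfolding rel_image_def by blast
qed

lemma R_single:
  assumes "m \<le> n" "x \<in> verts (G m)"
  obtains y where "y \<in> verts (G n)" "\<And>x'. (x', y) \<in> R m n \<longleftrightarrow> x' = x"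
proof -
  obtain y where "y \<in> verts (G n)" "rel_image (R m n) {y} = {x}"
    using R_co[OF assms(1)] assms(2) unfolding co_bijective_def by blast
  then show ?thesis
    using that unfolding rel_image_def by blast
qed

lemma R_adj:
  "m \<le> n \<Longrightarrow> (x, y) \<in> R m n \<Longrightarrow> (x', y') \<in> R m n \<Longrightarrow> (y, y') \<in> edges (G n) \<Longrightarrow> (x, x') \<in> edges (G m)"
  using R_edge unfolding edge_preserving_def by blast

lemma R_adj_same: "m \<le> n \<Longrightarrow> (x, y) \<in> R m n \<Longrightarrow> (x', y) \<in> R m n \<Longrightarrow> (x, x') \<in> edges (G m)"
  using R_adj R_verts edge_refl by blast

text \<open>A band is finite, so it lies at levels up to some \<open>n\<close>, and then each vertex
  of level \<open>n\<close> is below one of its members. Conversely, co-bijectivity makes a whole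
  level a band.\<close>

lemma cap_iff: "cap P le C \<longleftrightarrow> C \<subseteq> P \<and> (\<exists>n. \<forall>g\<in>verts (G n). \<exists>c\<in>C. ((n, g), c) \<in> le)"
proof (intro iffI conjI)
  assume c: "cap P le C"
  then show "C \<subseteq> P"
    by (simp add: cap_def)
  obtain B where B: "finite B" "B \<subseteq> P" "\<And>p. p \<in> P \<Longrightarrow> \<exists>b\<in>B. (p, b) \<in> le \<or> (b, p) \<in> le"
      "\<And>b. b \<in> B \<Longrightarrow> \<exists>c\<in>C. (b, c) \<in> le"
    using c unfolding cap_def band_def by blast
  obtain n where n: "\<And>b. b \<in> B \<Longrightarrow> fst b \<le> n"
    using finite_bound[OF B(1), of fst] by blast
  have "\<exists>c\<in>C. ((n, g), c) \<in> le" if g: "g \<in> verts (G n)" for g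
  proof -
    obtain m y where b: "(m, y) \<in> B" "((n, g), (m, y)) \<in> le \<or> ((m, y), (n, g)) \<in> le"
      using B(3)[of "(n, g)"] g P_iff by force
    have "((n, g), (m, y)) \<in> le"
      using b(2)
    proof
      assume "((m, y), (n, g)) \<in> le"
      then have "n = m" "(g, y) \<in> R n m"
        using n[OF b(1)] by (auto simp: le_iff)
      then show ?thesis
        using R_refl_iff by (auto simp: le_iff)
    qed
    moreover obtain k z where c: "(k, z) \<in> C" "((m, y), (k, z)) \<in> le"
      using B(4)[OF b(1)] by force
    ultimately have "((n, g), (k, z)) \<in> le"
      using R_trans unfolding le_iff by fastforce
    then show ?thesis
      using c(1) by blast
  qed
  then show "\<exists>n. \<forall>g\<in>verts (G n). \<exists>c\<in>C. ((n, g), c) \<in> le"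
    by blast
next
  assume "C \<subseteq> P \<and> (\<exists>n. \<forall>g\<in>verts (G n). \<exists>c\<in>C. ((n, g), c) \<in> le)"
  then obtain n where n: "C \<subseteq> P" "\<forall>g\<in>verts (G n). \<exists>c\<in>C. ((n, g), c) \<in> le"
    by blast
  have "band P le ({n} \<times> verts (G n))"
    unfolding band_def
  proof (intro conjI ballI)
    show "finite ({n} \<times> verts (G n))" "{n} \<times> verts (G n) \<subseteq> P"
      using finite_verts by (auto simp: P_iff)
    fix p assume "p \<in> P"
    moreover obtain m y where p: "p = (m, y)"
      by (cases p)
    ultimately have y: "y \<in> verts (G m)"
      by (simp add: P_iff)
    show "\<exists>b\<in>{n} \<times> verts (G n). (p, b) \<in> le \<or> (b, p) \<in> le"
    proof (cases "n \<le> m")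
      case True
      then obtain x where "x \<in> verts (G n)" "(x, y) \<in> R n m"
        using R_total[OF True y] by blast
      then have "(n, x) \<in> {n} \<times> verts (G n)" "(p, (n, x)) \<in> le"
        using True p by (auto simp: le_iff)
      then show ?thesis
        by blast
    next
      case False
      then have "m \<le> n"
        by simp
      then obtain x where "x \<in> verts (G n)" "(y, x) \<in> R m n"
        using R_single[OF _ y] by metis
      then have "(n, x) \<in> {n} \<times> verts (G n)" "((n, x), p) \<in> le"
        using \<open>m \<le> n\<close> p by (auto simp: le_iff)
      then show ?thesis
        by blast
    qed
  qed
  moreover have "\<forall>b\<in>{n} \<times> verts (G n). \<exists>c\<in>C. (b, c) \<in> le"
    using n(2) by simp
  ultimately show "cap P le C"
    unfolding cap_def using n(1) by blast
qed

lemma selector_iff_cap: "S \<subseteq> P \<Longrightarrow> selector P le S \<longleftrightarrow> \<not> cap P le (P - S)"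
proof
  assume "S \<subseteq> P" "\<not> cap P le (P - S)"
  then show "selector P le S"
    unfolding selector_def cap_iff by blast
qed (auto simp: selector_def)

lemma selector_iff: "selector P le S \<longleftrightarrow> S \<subseteq> P \<and> (\<forall>n. \<exists>g\<in>verts (G n). \<forall>c. ((n, g), c) \<in> le \<longrightarrow> c \<in> S)"
proof (cases "S \<subseteq> P")
  case True
  have "c \<in> P" if "((n, g), c) \<in> le" for n g c
    using that R_verts by (cases c) (auto simp: le_iff P_iff)
  then show ?thesis
    unfolding selector_iff_cap[OF True] cap_iff using True by blast
qed (auto simp: selector_def)

definition vthread :: "(nat \<Rightarrow> 'a) \<Rightarrow> bool" where
  "vthread g \<longleftrightarrow> (\<forall>n. g n \<in> verts (G n)) \<and> (\<forall>m n. m \<le> n \<longrightarrow> (g m, g n) \<in> R m n)"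

definition up :: "(nat \<Rightarrow> 'a) \<Rightarrow> (nat \<times> 'a) set" where
  "up g = {(m, p). \<exists>n\<ge>m. (p, g n) \<in> R m n}"

lemma up_selector:
  assumes "vthread g"
  shows "selector P le (up g)"
  unfolding selector_iff
proof (intro conjI allI)
  show "up g \<subseteq> P"
    using R_verts by (auto simp: up_def P_iff)
  show "\<exists>x\<in>verts (G n). \<forall>c. ((n, x), c) \<in> le \<longrightarrow> c \<in> up g" for n
  proof (intro bexI[of _ "g n"] allI impI)
    show "c \<in> up g" if "((n, g n), c) \<in> le" for c
      using that by (cases c) (auto simp: le_iff up_def)
    show "g n \<in> verts (G n)"
      using assms by (simp add: vthread_def)
  qed
qed

text \<open>Koenig's lemma for the vertices all of whose upper bounds are in \<open>S\<close>. This
  property passes to larger vertices, which provides \<open>factor\<close> and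
  \<open>total\<close>.\<close>

lemma selector_thread:
  assumes "selector P le S"
  obtains g where "vthread g" "up g \<subseteq> S"
proof -
  let ?B = "\<lambda>n. {x \<in> verts (G n). \<forall>c. ((n, x), c) \<in> le \<longrightarrow> c \<in> S}"
  have down: "x \<in> ?B m" if "m \<le> n" "y \<in> ?B n" "(x, y) \<in> R m n" for m n x y
  proof -
    have "c \<in> S" if c: "((m, x), c) \<in> le" for c
    proof -
      obtain k z where kz: "c = (k, z)"
        by (cases c)
      then have "((n, y), c) \<in> le"
        using c R_trans[of k m n z x y] \<open>m \<le> n\<close> \<open>(x, y) \<in> R m n\<close> by (simp add: le_iff)
      then show ?thesis
        using \<open>y \<in> ?B n\<close> by blast
    qed
    then show ?thesis
      using R_verts that by blast
  qed
  obtain g where g: "\<And>n. g n \<in> ?B n" "\<And>m n. m < n \<Longrightarrow> (g m, g n) \<in> R m n"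
  proof (rule koenig[of ?B "\<lambda>m n x y. (x, y) \<in> R m n"])
    show "finite (?B n)" for n
      using finite_verts by simp
    show "?B n \<noteq> {}" for n
      using assms unfolding selector_iff by blast
    show "(x, z) \<in> R k n" if "k \<le> m" "m \<le> n" "(x, y) \<in> R k m" "(y, z) \<in> R m n" for k m n x y z
      using R_trans[OF that] .
    show "\<exists>y\<in>?B m. (x, y) \<in> R k m \<and> (y, z) \<in> R m n"
      if xz: "k \<le> m" "m \<le> n" "x \<in> ?B k" "z \<in> ?B n" "(x, z) \<in> R k n" for k m n x z
    proof -
      obtain y where y: "(x, y) \<in> R k m" "(y, z) \<in> R m n"
        using R_factor[OF xz(1,2,5)] by blast
      then show ?thesis
        using down[OF xz(2,4) y(2)] by blast
    qed
    show "\<exists>x\<in>?B m. (x, z) \<in> R m n" if mz: "m \<le> n" "z \<in> ?B n" for m n z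
    proof -
      have "z \<in> verts (G n)"
        using mz(2) by simp
      then obtain x where x: "(x, z) \<in> R m n"
        using R_total[OF mz(1)] by blast
      then show ?thesis
        using down[OF mz x] by blast
    qed
  qed blast
  have "(g m, g n) \<in> R m n" if "m \<le> n" for m n
    using g(1)[of n] g(2)[of m n] that R_refl_iff by (cases "m = n") auto
  then have "vthread g"
    unfolding vthread_def using g(1) by blast
  moreover have "up g \<subseteq> S"
  proof
    fix c assume "c \<in> up g"
    then obtain m p n where "c = (m, p)" "m \<le> n" "(p, g n) \<in> R m n"
      unfolding up_def by blast
    then have "((n, g n), c) \<in> le"
      by (simp add: le_iff)
    then show "c \<in> S"
      using g(1)[of n] by blast
  qed
  ultimately show ?thesis
    by (rule that)
qed

lemma SpecD: "S \<in> Spec \<Longrightarrow> selector P le S"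
  "S \<in> Spec \<Longrightarrow> selector P le S' \<Longrightarrow> S' \<subseteq> S \<Longrightarrow> S' = S"
  by (auto simp: spectrum_def)

text \<open>By minimality a point equals the upward closure of any chain whose closure it contains.
  Hence points are upward closed and directed, as the next lemmas record.\<close>

lemma Spec_up:
  assumes "S \<in> Spec"
  obtains g where "vthread g" "S = up g"
  using selector_thread[OF SpecD(1)[OF assms]] up_selector SpecD(2)[OF assms] by metis

lemma Spec_upward:
  assumes "S \<in> Spec" "(n, x) \<in> S" "m \<le> n" "(y, x) \<in> R m n"
  shows "(m, y) \<in> S"
proof -
  obtain g where g: "vthread g" "S = up g"
    by (rule Spec_up[OF assms(1)])
  then obtain k where "n \<le> k" "(x, g k) \<in> R n k"
    using assms(2) by (auto simp: up_def)
  then have "(y, g k) \<in> R m k" "m \<le> k"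
    using R_trans[OF assms(3) _ assms(4)] assms(3) by auto
  then show ?thesis
    unfolding g(2) up_def by blast
qed

lemma Spec_verts: "S \<in> Spec \<Longrightarrow> (n, x) \<in> S \<Longrightarrow> x \<in> verts (G n)"
  using SpecD(1) unfolding selector_def P_iff[symmetric] by blast

lemma Spec_level:
  assumes "S \<in> Spec"
  obtains x where "x \<in> verts (G n)" "(n, x) \<in> S"
proof -
  obtain g where g: "vthread g" "S = up g"
    by (rule Spec_up[OF assms(1)])
  then have "g n \<in> verts (G n)" "(g n, g n) \<in> R n n"
    by (auto simp: vthread_def)
  then show ?thesis
    using that unfolding g(2) up_def by blast
qed

lemma Spec_common:
  assumes "S \<in> Spec" "(n, x) \<in> S" "(m, y) \<in> S"
  obtains k z where "n \<le> k" "m \<le> k" "(k, z) \<in> S" "(x, z) \<in> R n k" "(y, z) \<in> R m k"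
proof -
  obtain g where g: "vthread g" "S = up g"
    by (rule Spec_up[OF assms(1)])
  obtain a b where ab: "n \<le> a" "(x, g a) \<in> R n a" "m \<le> b" "(y, g b) \<in> R m b"
    using assms(2,3) unfolding g(2) up_def by blast
  let ?k = "max a b"
  have "(x, g ?k) \<in> R n ?k" "(y, g ?k) \<in> R m ?k"
    using R_trans[OF ab(1) max.cobounded1 ab(2)] R_trans[OF ab(3) max.cobounded2 ab(4)] g(1)
    unfolding vthread_def by auto
  moreover have "(?k, g ?k) \<in> S"
    using g(1) unfolding g(2) up_def vthread_def by blast
  ultimately show ?thesis
    using that[of ?k "g ?k"] ab by simp
qed

text \<open>Complements of selectors are the sets that are no caps. Unions of chains of such sets are
  no caps, since every cap contains a finite one.\<close>

lemma minimal_selector: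
  assumes "selector P le S"
  obtains T where "T \<in> Spec" "T \<subseteq> S"
proof -
  let ?A = "{C. C \<subseteq> P \<and> \<not> cap P le C \<and> P - S \<subseteq> C}"
  have SP: "S \<subseteq> P"
    using assms by (simp add: selector_def)
  have "\<exists>M\<in>?A. \<forall>Y\<in>?A. M \<subseteq> Y \<longrightarrow> Y = M"
  proof (rule subset_Zorn_nonempty)
    have "P - S \<in> ?A"
      using assms selector_iff_cap[OF SP] by blast
    then show "?A \<noteq> {}"
      by blast
    fix \<C> assume C: "\<C> \<noteq> {}" "subset.chain ?A \<C>"
    then have sub: "\<C> \<subseteq> ?A"
      by (simp add: subset.chain_def)
    have "\<not> cap P le (\<Union>\<C>)"
    proof
      assume "cap P le (\<Union>\<C>)"
      then have "\<exists>n. \<forall>g\<in>verts (G n). \<exists>c. c \<in> \<Union>\<C> \<and> ((n, g), c) \<in> le"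
        unfolding cap_iff Bex_def by (rule conjunct2)
      then obtain n where n: "\<forall>g\<in>verts (G n). \<exists>c. c \<in> \<Union>\<C> \<and> ((n, g), c) \<in> le" ..
      from bchoice[OF n] obtain f where f: "\<forall>g\<in>verts (G n). f g \<in> \<Union>\<C> \<and> ((n, g), f g) \<in> le" ..
      have "finite (f ` verts (G n))" "f ` verts (G n) \<subseteq> \<Union>\<C>"
        using finite_verts f by auto
      then obtain B where B: "B \<in> \<C>" "f ` verts (G n) \<subseteq> B"
        using finite_subset_Union_chain[OF _ _ C] by metis
      have "\<exists>c\<in>B. ((n, g), c) \<in> le" if "g \<in> verts (G n)" for g
        using B(2) f that by (intro bexI[of _ "f g"]) auto
      moreover have "B \<subseteq> P"
        using sub B(1) by blast
      ultimately have "cap P le B"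
        unfolding cap_iff by blast
      then show False
        using B(1) sub by blast
    qed
    then show "\<Union>\<C> \<in> ?A"
      using sub C(1) by blast
  qed
  then obtain M where M: "M \<subseteq> P" "\<not> cap P le M" "P - S \<subseteq> M" "\<And>Y. Y \<in> ?A \<Longrightarrow> M \<subseteq> Y \<Longrightarrow> Y = M"
    by auto
  have PM: "P - (P - M) = M"
    using M(1) by blast
  have "selector P le (P - M)"
    using selector_iff_cap[of "P - M"] M(2) PM by simp
  moreover have "T' = P - M" if T': "selector P le T'" "T' \<subseteq> P - M" for T'
  proof -
    have "T' \<subseteq> P"
      using T'(2) by blast
    then have "\<not> cap P le (P - T')"
      using selector_iff_cap T'(1) by blast
    then have "P - T' = M"
      using M(1,3) T'(2) by (intro M(4)) auto
    then show ?thesis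
      using \<open>T' \<subseteq> P\<close> by blast
  qed
  ultimately have "P - M \<in> Spec"
    by (auto simp: spectrum_def)
  moreover have "P - M \<subseteq> S"
    using M(3) by blast
  ultimately show ?thesis
    by (rule that)
qed

text \<open>Starting from \<open>h\<close>, a descending chain is chosen in which each vertex has
  its predecessor as only image; it therefore sees \<open>h\<close> alone at level \<open>n\<close>.
  A minimal selector inside its upward closure inherits this. So every vertex occurs in a point, and
  the sets \<open>U\<close> will remember the order.\<close>

lemma Spec_rigid:
  assumes h: "h \<in> verts (G n)"
  obtains S where "S \<in> Spec" "(n, h) \<in> S" "\<And>m p. m \<le> n \<Longrightarrow> (m, p) \<in> S \<Longrightarrow> (p, h) \<in> R m n"
proof -
  have "\<exists>y. y \<in> verts (G (n + Suc j)) \<and> (\<forall>z. (z, y) \<in> R (n + j) (n + Suc j) \<longleftrightarrow> z = x)"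
    if "x \<in> verts (G (n + j))" for x j
    using R_single[of "n + j" "n + Suc j" x] that by (metis add_Suc_right le_SucI le_refl)
  then have ex: "\<exists>y. (y \<in> verts (G (n + Suc j)) \<and> (Suc j = 0 \<longrightarrow> y = h)) \<and> (\<forall>z. (z, y) \<in> R (n + j) (n + Suc j) \<longleftrightarrow> z = x)"
    if "x \<in> verts (G (n + j)) \<and> (j = 0 \<longrightarrow> x = h)" for x j
    using that by simp
  have "\<exists>x. x \<in> verts (G (n + 0)) \<and> ((0::nat) = 0 \<longrightarrow> x = h)"
    using h by simp
  from dependent_nat_choice[of "\<lambda>j x. x \<in> verts (G (n + j)) \<and> (j = 0 \<longrightarrow> x = h)"
      "\<lambda>j x y. \<forall>z. (z, y) \<in> R (n + j) (n + Suc j) \<longleftrightarrow> z = x", OF this ex]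
  obtain a where all: "\<forall>j. (a j \<in> verts (G (n + j)) \<and> (j = 0 \<longrightarrow> a j = h)) \<and>
      (\<forall>z. (z, a (Suc j)) \<in> R (n + j) (n + Suc j) \<longleftrightarrow> z = a j)" ..
  then have a: "\<And>j. a j \<in> verts (G (n + j))" "a 0 = h"
    "\<And>j z. (z, a (Suc j)) \<in> R (n + j) (n + Suc j) \<longleftrightarrow> z = a j"
    by blast+
  have row: "z = a 0" if "(z, a j) \<in> R n (n + j)" for z j
    using that
  proof (induction j arbitrary: z)
    case 0
    then show ?case
      using R_refl_iff by simp
  next
    case (Suc j)
    have le: "n \<le> n + j" "n + j \<le> n + Suc j"
      by simp_all
    obtain y where y: "(z, y) \<in> R n (n + j)" "(y, a (Suc j)) \<in> R (n + j) (n + Suc j)"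
      by (rule R_factor[OF le Suc.prems])
    have "y = a j"
      using a(3) y(2) by blast
    then show ?case
      using Suc.IH y(1) by blast
  qed
  define T where "T = {(m, p). \<exists>j. m \<le> n + j \<and> (p, a j) \<in> R m (n + j)}"
  have "selector P le T"
    unfolding selector_iff
  proof (intro conjI allI)
    show "T \<subseteq> P"
      using R_verts by (auto simp: T_def P_iff)
    fix N
    obtain g where g: "g \<in> verts (G N)" "(g, a N) \<in> R N (n + N)"
      using R_total[OF le_add2 a(1)] by blast
    have "c \<in> T" if c: "((N, g), c) \<in> le" for c
    proof -
      obtain m p where mp: "c = (m, p)"
        by (cases c)
      then have "m \<le> N" "(p, g) \<in> R m N"
        using c by (auto simp: le_iff)
      then have "(p, a N) \<in> R m (n + N)" "m \<le> n + N"
        using R_trans[of m N "n + N" p g "a N"] g(2) by auto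
      then show ?thesis
        unfolding T_def mp by blast
    qed
    then show "\<exists>g\<in>verts (G N). \<forall>c. ((N, g), c) \<in> le \<longrightarrow> c \<in> T"
      using g(1) by blast
  qed
  then obtain S where S: "S \<in> Spec" "S \<subseteq> T"
    by (rule minimal_selector)
  have below: "(p, h) \<in> R m n" if mp: "m \<le> n" "(m, p) \<in> S" for m p
  proof -
    obtain j where j: "m \<le> n + j" "(p, a j) \<in> R m (n + j)"
      using mp(2) S(2) by (auto simp: T_def)
    obtain y where "(p, y) \<in> R m n" "(y, a j) \<in> R n (n + j)"
      using R_factor[OF mp(1) le_add1 j(2)] by blast
    then show ?thesis
      using row a(2) by blast
  qed
  obtain x where x: "(n, x) \<in> S"
    using Spec_level[OF S(1)] by blast
  then have "(n, h) \<in> S"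
    using below[OF le_refl x] R_refl_iff by simp
  then show ?thesis
    using that S(1) below by blast
qed

section \<open>The topology of the spectrum\<close>

definition U :: "nat \<Rightarrow> 'a \<Rightarrow> (nat \<times> 'a) set set" where
  "U n p = {S \<in> Spec. (n, p) \<in> S}"

lemma topspace_X: "topspace X = Spec"
  unfolding spectrum_topology_def topology_generated_by_topspace by auto

lemma openin_U: "openin X (U n p)"
proof (cases "(n, p) \<in> P")
  case True
  then show ?thesis
    unfolding spectrum_topology_def U_def by (intro topology_generated_by_Basis) auto
next
  case False
  then have "U n p = {}"
    unfolding U_def P_iff using Spec_verts by blast
  then show ?thesis
    by simp
qed

lemma U_mono: "m \<le> n \<Longrightarrow> (p, q) \<in> R m n \<Longrightarrow> U n q \<subseteq> U m p"
  unfolding U_def using Spec_upward by blast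

lemma U_subset_iff:
  assumes "m \<le> n" "q \<in> verts (G n)"
  shows "U n q \<subseteq> U m p \<longleftrightarrow> (p, q) \<in> R m n"
proof
  assume sub: "U n q \<subseteq> U m p"
  obtain S where S: "S \<in> Spec" "(n, q) \<in> S" "\<And>m p. m \<le> n \<Longrightarrow> (m, p) \<in> S \<Longrightarrow> (p, q) \<in> R m n"
    using Spec_rigid[OF assms(2)] by metis
  have "S \<in> U n q"
    using S by (simp add: U_def)
  then have "S \<in> U m p"
    using sub by blast
  then show "(p, q) \<in> R m n"
    using S(3)[OF assms(1)] by (simp add: U_def)
qed (rule U_mono[OF assms(1)])

lemma U_nonempty:
  assumes "q \<in> verts (G n)"
  shows "U n q \<noteq> {}"
proof -
  obtain S where "S \<in> Spec" "(n, q) \<in> S"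
    by (rule Spec_rigid[OF assms]) blast
  then have "S \<in> U n q"
    by (simp add: U_def)
  then show ?thesis
    by blast
qed

lemma U_cover: "S \<in> Spec \<Longrightarrow> \<exists>p\<in>verts (G n). S \<in> U n p"
  unfolding U_def using Spec_level by blast

lemma U_meet:
  assumes "S \<in> U n p" "S \<in> U n q"
  shows "(p, q) \<in> edges (G n)"
proof -
  have "S \<in> Spec" "(n, p) \<in> S" "(n, q) \<in> S"
    using assms by (auto simp: U_def)
  then obtain k z where "n \<le> k" "(p, z) \<in> R n k" "(q, z) \<in> R n k"
    by (rule Spec_common)
  then show ?thesis
    using R_adj_same by blast
qed

text \<open>If \<open>S = up g\<close>, every member of \<open>S\<close> is above \<open>g n\<close>
  for all large \<open>n\<close>, so the sets \<open>U n (g n)\<close> finally lie in each subbasic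
  neighbourhood of \<open>S\<close>. For an intersection the later of two levels is taken.\<close>

lemma U_base:
  assumes "openin X W" "S \<in> W"
  obtains n p where "p \<in> verts (G n)" "S \<in> U n p" "U n p \<subseteq> W"
proof -
  have S: "S \<in> Spec"
    using assms openin_subset topspace_X by blast
  obtain g where g: "vthread g" "S = up g"
    by (rule Spec_up[OF S])
  have "generate_topology_on (insert Spec ((\<lambda>p. {S \<in> Spec. p \<in> S}) ` P)) W"
    using assms(1) unfolding spectrum_topology_def openin_topology_generated_by_iff .
  then have "\<exists>N. \<forall>n\<ge>N. U n (g n) \<subseteq> W"
    using assms(2)
  proof induction
    case (Int a b)
    then obtain N N' where "\<forall>n\<ge>N. U n (g n) \<subseteq> a" "\<forall>n\<ge>N'. U n (g n) \<subseteq> b"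
      by blast
    then have "\<forall>n\<ge>max N N'. U n (g n) \<subseteq> a \<inter> b"
      by simp
    then show ?case
      by blast
  next
    case (UN K)
    then obtain k where "k \<in> K" "S \<in> k"
      by blast
    then obtain N where "\<forall>n\<ge>N. U n (g n) \<subseteq> k"
      using UN.IH by blast
    then show ?case
      using \<open>k \<in> K\<close> by blast
  next
    case (Basis s)
    then consider "s = Spec" | m p where "s = {S \<in> Spec. (m, p) \<in> S}"
      by auto
    then show ?case
    proof cases
      case 1
      then show ?thesis
        unfolding U_def by blast
    next
      case 2
      then have "(m, p) \<in> up g"
        using Basis.prems g(2) by blast
      then obtain N where N: "m \<le> N" "(p, g N) \<in> R m N"
        unfolding up_def by blast
      have "U n (g n) \<subseteq> s" if "N \<le> n" for n
      proof -
        have "(p, g n) \<in> R m n"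
          using R_trans[OF N(1) that N(2)] g(1) that unfolding vthread_def by blast
        then show ?thesis
          using U_mono[of m n p "g n"] N(1) that 2 unfolding U_def by simp
      qed
      then show ?thesis
        by blast
    qed
  qed simp
  then obtain n where "U n (g n) \<subseteq> W"
    by blast
  moreover have "g n \<in> verts (G n)" "S \<in> U n (g n)"
    using g S unfolding vthread_def U_def up_def by blast+
  ultimately show ?thesis
    using that by blast
qed

text \<open>Compactness in combinatorial form: the vertices whose sets \<open>U\<close> lie in a
  member of the cover form a cap. Otherwise their complement would be a selector, and a minimal one
  inside it a point that the cover misses.\<close>

lemma cover_refined:
  assumes "\<And>W. W \<in> \<U> \<Longrightarrow> openin X W" "Spec \<subseteq> \<Union>\<U>"
  obtains n where "\<And>k h. n \<le> k \<Longrightarrow> h \<in> verts (G k) \<Longrightarrow> \<exists>W\<in>\<U>. U k h \<subseteq> W"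
proof -
  let ?C = "{(m, p). p \<in> verts (G m) \<and> (\<exists>W\<in>\<U>. U m p \<subseteq> W)}"
  have CP: "?C \<subseteq> P"
    by (auto simp: P_iff)
  have "cap P le ?C"
  proof (rule ccontr)
    assume no: "\<not> cap P le ?C"
    have "P - (P - ?C) = ?C"
      using CP by blast
    then have "selector P le (P - ?C)"
      using no selector_iff_cap[of "P - ?C"] by simp
    then obtain S where S: "S \<in> Spec" "S \<subseteq> P - ?C"
      by (rule minimal_selector)
    then obtain W where W: "W \<in> \<U>" "S \<in> W"
      using assms(2) by blast
    then obtain n p where "p \<in> verts (G n)" "S \<in> U n p" "U n p \<subseteq> W"
      using U_base assms(1) by metis
    then have "(n, p) \<in> S" "(n, p) \<in> ?C"
      using W(1) by (auto simp: U_def)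
    then show False
      using S(2) by blast
  qed
  then obtain n where n: "\<forall>g\<in>verts (G n). \<exists>c\<in>?C. ((n, g), c) \<in> le"
    unfolding cap_iff by blast
  have "\<exists>W\<in>\<U>. U k h \<subseteq> W" if k: "n \<le> k" "h \<in> verts (G k)" for k h
  proof -
    obtain g where g: "g \<in> verts (G n)" "(g, h) \<in> R n k"
      using R_total[OF k] by blast
    then obtain m p W where "((n, g), (m, p)) \<in> le" "W \<in> \<U>" "U m p \<subseteq> W"
      using n by blast
    then have "U n g \<subseteq> W"
      using U_mono[of m n p g] by (auto simp: le_iff)
    then show ?thesis
      using U_mono[OF k(1) g(2)] \<open>W \<in> \<U>\<close> by blast
  qed
  then show ?thesis
    by (rule that)
qed

text \<open>By regularity some level \<open>n\<close> refines \<open>m\<close> together with closures; each vertex of a later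
  level either refines the vertex of level \<open>m\<close> that belongs to a given vertex of level \<open>n\<close>, or
  misses the latter.\<close>

lemma star_refining_if_regular:
  assumes reg: "regular_space X"
    and adj: "\<And>n p q. (p, q) \<in> edges (G n) \<Longrightarrow> U n p \<inter> U n q \<noteq> {}"
  shows "\<exists>n\<ge>m. star_refining (G n) (G m) (R m n)"
proof -
  let ?\<U> = "{W. openin X W \<and> (\<exists>p\<in>verts (G m). X closure_of W \<subseteq> U m p)}"
  have "Spec \<subseteq> \<Union>?\<U>"
  proof
    fix S assume S: "S \<in> Spec"
    obtain p where p: "p \<in> verts (G m)" "S \<in> U m p"
      using U_cover[OF S] by blast
    have "neighbourhood_base_of (closedin X) X"
      using reg by (simp add: neighbourhood_base_of_closedin)
    then have "\<exists>W C. openin X W \<and> closedin X C \<and> S \<in> W \<and> W \<subseteq> C \<and> C \<subseteq> U m p"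
      unfolding neighbourhood_base_of using openin_U[of m p] p(2) by simp
    then obtain W C where W: "openin X W" "closedin X C" "S \<in> W" "W \<subseteq> C" "C \<subseteq> U m p"
      by blast
    then have "X closure_of W \<subseteq> U m p"
      using closure_of_minimal by blast
    then show "S \<in> \<Union>?\<U>"
      using W p(1) by blast
  qed
  then obtain n where n: "\<And>k h. n \<le> k \<Longrightarrow> h \<in> verts (G k) \<Longrightarrow> \<exists>W\<in>?\<U>. U k h \<subseteq> W"
    using cover_refined[of ?\<U>] by blast
  have "\<exists>p\<in>verts (G m). X closure_of (U n g) \<subseteq> U m p" if g: "g \<in> verts (G n)" for g
    using n[OF le_refl g] closure_of_mono[of "U n g" _ X] by blast
  then obtain f where f: "\<And>g. g \<in> verts (G n) \<Longrightarrow> f g \<in> verts (G m) \<and> X closure_of (U n g) \<subseteq> U m (f g)"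
    by metis
  have "\<exists>N. \<forall>g\<in>verts (G n). \<forall>k\<ge>N. \<forall>h\<in>verts (G k). U k h \<subseteq> U m (f g) \<or> U k h \<inter> U n g = {}"
  proof (rule finite_common[OF finite_verts])
    fix g assume g: "g \<in> verts (G n)"
    let ?V = "{U m (f g), Spec - X closure_of (U n g)}"
    have "openin X W" if "W \<in> ?V" for W
      using that openin_U closedin_closure_of[of X "U n g"] topspace_X by (auto simp: closedin_def)
    moreover have "Spec \<subseteq> \<Union>?V"
      using f[OF g] by blast
    ultimately obtain N where N: "\<And>k h. N \<le> k \<Longrightarrow> h \<in> verts (G k) \<Longrightarrow> \<exists>W\<in>?V. U k h \<subseteq> W"
      using cover_refined[of ?V] by blast
    have "U n g \<subseteq> X closure_of (U n g)"
      by (rule closure_of_subset) (simp add: U_def topspace_X)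
    then show "\<exists>N. \<forall>k\<ge>N. \<forall>h\<in>verts (G k). U k h \<subseteq> U m (f g) \<or> U k h \<inter> U n g = {}"
      using N by blast
  qed auto
  then obtain N where N: "\<And>g k h. g \<in> verts (G n) \<Longrightarrow> N \<le> k \<Longrightarrow> h \<in> verts (G k) \<Longrightarrow>
      U k h \<subseteq> U m (f g) \<or> U k h \<inter> U n g = {}"
    by blast
  define k where "k = max m (max n N)"
  have k: "m \<le> k" "n \<le> k" "N \<le> k"
    by (auto simp: k_def)
  have "star_refining (G k) (G m) (R m k)"
    unfolding star_refining_def
  proof
    fix y assume y: "y \<in> verts (G k)"
    obtain g where g: "g \<in> verts (G n)" "(g, y) \<in> R n k"
      using R_total[OF k(2) y] by blast
    have "(f g, h) \<in> R m k" if h: "h \<in> verts (G k)" "(h, y) \<in> edges (G k)" for h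
    proof -
      have "U k h \<inter> U n g \<noteq> {}"
        using adj[OF h(2)] U_mono[OF k(2) g(2)] by blast
      then have "U k h \<subseteq> U m (f g)"
        using N[OF g(1) k(3) h(1)] by blast
      then show ?thesis
        using U_subset_iff[OF k(1) h(1)] by simp
    qed
    then show "\<exists>h\<in>verts (G m). {g' \<in> verts (G k). (g', y) \<in> edges (G k)} \<subseteq> R m k `` {h}"
      using f[OF g(1)] by blast
  qed
  then show ?thesis
    using k(1) by blast
qed

end

section \<open>Points of the spectrum of a star-refining sequence\<close>

locale star_seq = graph_seq +
  fixes \<phi> :: "nat \<Rightarrow> nat"
  assumes \<phi>: "strict_mono \<phi>"
    and star: "star_refining (G (\<phi> (Suc n))) (G (\<phi> n)) (R (\<phi> n) (\<phi> (Suc n)))"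
begin

lemma \<phi>_le: "m \<le> n \<Longrightarrow> \<phi> m \<le> \<phi> n"
  using \<phi> by (simp add: strict_mono_less_eq)

lemma \<phi>_ge: "n \<le> \<phi> n"
  using strict_mono_imp_increasing[OF \<phi>] .

definition \<phi>_thread :: "(nat \<Rightarrow> 'a) \<Rightarrow> bool" where
  "\<phi>_thread g \<longleftrightarrow> (\<forall>n. g n \<in> verts (G (\<phi> n))) \<and> (\<forall>m n. m \<le> n \<longrightarrow> (g m, g n) \<in> R (\<phi> m) (\<phi> n))"

text \<open>The vertices above a whole star of the thread. The plain upward closure of a thread need
  not be minimal, since adjacent threads can belong to one point; passing to stars forgets their
  difference.\<close>

definition sel :: "(nat \<Rightarrow> 'a) \<Rightarrow> (nat \<times> 'a) set" where
  "sel g = {(m, p). p \<in> verts (G m) \<and>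
     (\<exists>n. m \<le> \<phi> n \<and> (\<forall>x. (x, g n) \<in> edges (G (\<phi> n)) \<longrightarrow> (p, x) \<in> R m (\<phi> n)))}"

lemma starE:
  assumes "y \<in> verts (G (\<phi> (Suc n)))"
  obtains h where "h \<in> verts (G (\<phi> n))" "\<And>x. (x, y) \<in> edges (G (\<phi> (Suc n))) \<Longrightarrow> (h, x) \<in> R (\<phi> n) (\<phi> (Suc n))"
proof -
  obtain h where h: "h \<in> verts (G (\<phi> n))"
    "{g' \<in> verts (G (\<phi> (Suc n))). (g', y) \<in> edges (G (\<phi> (Suc n)))} \<subseteq> R (\<phi> n) (\<phi> (Suc n)) `` {h}"
    using star[of n] assms unfolding star_refining_def by blast
  have "(h, x) \<in> R (\<phi> n) (\<phi> (Suc n))" if "(x, y) \<in> edges (G (\<phi> (Suc n)))" for x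
    using h(2) that edges_sub[OF that] by blast
  then show ?thesis
    using that h(1) by blast
qed

text \<open>Two further star-refinements turn a star into a double star: the star of
  \<open>g (Suc (Suc n))\<close> lies below \<open>h''\<close>, the star of \<open>h''\<close> below
  \<open>h'\<close>, and \<open>h'\<close> is adjacent to \<open>g n\<close>, hence below
  \<open>p\<close>. The second ring is needed because later comparisons with a thread pass through
  an intermediate vertex.\<close>

lemma sel_double_star:
  assumes g: "\<phi>_thread g" and p: "(m, p) \<in> sel g"
  obtains n where "m \<le> \<phi> n"
    "\<And>x y. (x, g n) \<in> edges (G (\<phi> n)) \<Longrightarrow> (y, x) \<in> edges (G (\<phi> n)) \<Longrightarrow> (p, y) \<in> R m (\<phi> n)"
proof -
  obtain n where n: "m \<le> \<phi> n" "\<And>x. (x, g n) \<in> edges (G (\<phi> n)) \<Longrightarrow> (p, x) \<in> R m (\<phi> n)"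
    using p unfolding sel_def by blast
  let ?a = "\<phi> n" and ?b = "\<phi> (Suc n)" and ?c = "\<phi> (Suc (Suc n))"
  have ab: "?a \<le> ?b" and bc: "?b \<le> ?c"
    by (auto intro: \<phi>_le)
  have gs: "g (Suc n) \<in> verts (G ?b)" "g (Suc (Suc n)) \<in> verts (G ?c)" "(g n, g (Suc n)) \<in> R ?a ?b"
    "(g (Suc n), g (Suc (Suc n))) \<in> R ?b ?c"
    using g unfolding \<phi>_thread_def by auto
  obtain h'' where h'': "h'' \<in> verts (G ?b)" "\<And>x. (x, g (Suc (Suc n))) \<in> edges (G ?c) \<Longrightarrow> (h'', x) \<in> R ?b ?c"
    by (rule starE[OF gs(2)]) blast
  obtain h' where h': "h' \<in> verts (G ?a)" "\<And>x. (x, h'') \<in> edges (G ?b) \<Longrightarrow> (h', x) \<in> R ?a ?b"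
    by (rule starE[OF h''(1)]) blast
  have "(h'', g (Suc (Suc n))) \<in> R ?b ?c"
    using h''(2) edge_refl[OF gs(2)] by blast
  then have "(g (Suc n), h'') \<in> edges (G ?b)"
    using R_adj_same[OF bc gs(4)] by blast
  then have "(h', g (Suc n)) \<in> R ?a ?b"
    using h'(2) by blast
  then have "(h', g n) \<in> edges (G ?a)"
    using R_adj_same[OF ab _ gs(3)] by blast
  then have ph': "(p, h') \<in> R m ?a"
    using n(2) by blast
  have "(p, y) \<in> R m ?c" if xy: "(x, g (Suc (Suc n))) \<in> edges (G ?c)" "(y, x) \<in> edges (G ?c)" for x y
  proof -
    have "y \<in> verts (G ?c)"
      using edges_sub[OF xy(2)] by simp
    then obtain y' where y': "(y', y) \<in> R ?b ?c"
      using R_total[OF bc] by blast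
    have "(y', h'') \<in> edges (G ?b)"
      using R_adj[OF bc y' h''(2)[OF xy(1)] xy(2)] .
    then have "(h', y') \<in> R ?a ?b"
      using h'(2) by blast
    then have "(p, y') \<in> R m ?b"
      using R_trans[OF n(1) ab ph'] by blast
    then show ?thesis
      using R_trans[OF order_trans[OF n(1) ab] bc _ y'] by blast
  qed
  then show ?thesis
    using that[of "Suc (Suc n)"] n(1) ab bc by (meson order_trans)
qed

text \<open>At level \<open>N\<close> a vertex above the star of \<open>g (Suc N)\<close> is chosen;
  all its upper bounds are above that star too.\<close>

lemma sel_selector:
  assumes g: "\<phi>_thread g"
  shows "selector P le (sel g)"
  unfolding selector_iff
proof (intro conjI allI)
  show "sel g \<subseteq> P"
    by (auto simp: sel_def P_iff)
  fix N
  have gN: "g (Suc N) \<in> verts (G (\<phi> (Suc N)))"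
    using g by (simp add: \<phi>_thread_def)
  have le: "\<phi> N \<le> \<phi> (Suc N)"
    by (rule \<phi>_le) simp
  obtain h where h: "h \<in> verts (G (\<phi> N))" "\<And>x. (x, g (Suc N)) \<in> edges (G (\<phi> (Suc N))) \<Longrightarrow> (h, x) \<in> R (\<phi> N) (\<phi> (Suc N))"
    by (rule starE[OF gN]) blast
  obtain p where p: "p \<in> verts (G N)" "(p, h) \<in> R N (\<phi> N)"
    using R_total[OF \<phi>_ge h(1)] by blast
  have "(m, q) \<in> sel g" if mq: "((N, p), (m, q)) \<in> le" for m q
  proof -
    have m: "m \<le> N" "(q, p) \<in> R m N"
      using mq by (auto simp: le_iff)
    have "(q, x) \<in> R m (\<phi> (Suc N))" if x: "(x, g (Suc N)) \<in> edges (G (\<phi> (Suc N)))" for x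
      using R_trans[OF m(1) _ m(2) R_trans[OF \<phi>_ge le p(2) h(2)[OF x]]] order_trans[OF \<phi>_ge le] by blast
    then show ?thesis
      unfolding sel_def using R_verts[OF m] order_trans[OF m(1) order_trans[OF \<phi>_ge le]] by blast
  qed
  then show "\<exists>g'\<in>verts (G N). \<forall>c. ((N, g'), c) \<in> le \<longrightarrow> c \<in> sel g"
    using p(1) by (metis surj_pair)
qed

text \<open>A selector inside \<open>sel g\<close> contains the closure of a chain \<open>h\<close>.
  As \<open>h (\<phi> n)\<close> is in \<open>sel g\<close>, it lies above some later
  \<open>g k\<close>, and so does \<open>g n\<close>; hence the two are adjacent. A vertex above the
  star of \<open>g n\<close> is then above \<open>h (\<phi> n)\<close>, and thus in the
  selector.\<close>

lemma sel_Spec: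
  assumes g: "\<phi>_thread g"
  shows "sel g \<in> Spec"
proof -
  have "sel g \<subseteq> T" if T: "selector P le T" "T \<subseteq> sel g" for T
  proof clarify
    fix m p assume p: "(m, p) \<in> sel g"
    obtain h where h: "vthread h" "up h \<subseteq> T"
      by (rule selector_thread[OF T(1)])
    obtain n where n: "m \<le> \<phi> n" "\<And>x. (x, g n) \<in> edges (G (\<phi> n)) \<Longrightarrow> (p, x) \<in> R m (\<phi> n)"
      using p unfolding sel_def by blast
    have "(h (\<phi> n), h (\<phi> n)) \<in> R (\<phi> n) (\<phi> n)"
      using h(1) by (simp add: vthread_def)
    then have "(\<phi> n, h (\<phi> n)) \<in> up h"
      unfolding up_def by blast
    then have "(\<phi> n, h (\<phi> n)) \<in> sel g"
      using h(2) T(2) by blast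
    then obtain k where k: "\<phi> n \<le> \<phi> k" "\<And>x. (x, g k) \<in> edges (G (\<phi> k)) \<Longrightarrow> (h (\<phi> n), x) \<in> R (\<phi> n) (\<phi> k)"
      unfolding sel_def by blast
    then have "n \<le> k"
      using strict_mono_less_eq[OF \<phi>] by blast
    have "g k \<in> verts (G (\<phi> k))"
      using g by (simp add: \<phi>_thread_def)
    then have "(h (\<phi> n), g k) \<in> R (\<phi> n) (\<phi> k)"
      using k(2) edge_refl by blast
    moreover have "(g n, g k) \<in> R (\<phi> n) (\<phi> k)"
      using g \<open>n \<le> k\<close> by (simp add: \<phi>_thread_def)
    ultimately have "(h (\<phi> n), g n) \<in> edges (G (\<phi> n))"
      by (rule R_adj_same[OF k(1)])
    then have "(p, h (\<phi> n)) \<in> R m (\<phi> n)"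
      using n(2) by blast
    then have "(m, p) \<in> up h"
      unfolding up_def using n(1) by blast
    then show "(m, p) \<in> T"
      using h(2) by blast
  qed
  then show ?thesis
    using sel_selector[OF g] unfolding spectrum_def by blast
qed

text \<open>\<open>near\<close> allows distance two between \<open>h n\<close> and
  \<open>g n\<close>, which is exactly what \<open>sel_double_star\<close> tolerates. This puts
  \<open>sel g\<close> inside \<open>S\<close>, and minimality of \<open>S\<close> does the
  rest.\<close>

lemma eq_selI:
  assumes S: "S \<in> Spec" and g: "\<phi>_thread g" and h: "\<And>n. (\<phi> n, h n) \<in> S"
    and near: "\<And>n. \<exists>x. (x, g n) \<in> edges (G (\<phi> n)) \<and> (h n, x) \<in> edges (G (\<phi> n))"
  shows "S = sel g"
proof -
  have "sel g \<subseteq> S"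
  proof clarify
    fix m p assume "(m, p) \<in> sel g"
    then obtain n where n: "m \<le> \<phi> n"
        "\<And>x y. (x, g n) \<in> edges (G (\<phi> n)) \<Longrightarrow> (y, x) \<in> edges (G (\<phi> n)) \<Longrightarrow> (p, y) \<in> R m (\<phi> n)"
      using sel_double_star[OF g] by metis
    then have "(p, h n) \<in> R m (\<phi> n)"
      using near by blast
    then show "(m, p) \<in> S"
      by (rule Spec_upward[OF S h n(1)])
  qed
  then show ?thesis
    using SpecD(2)[OF S sel_selector[OF g]] by simp
qed

text \<open>A partial converse of \<open>eq_selI\<close>: each member of \<open>sel g\<close> at
  level \<open>\<phi> n\<close> is adjacent to \<open>g n\<close>, so a common member is adjacent to
  both threads.\<close>

lemma sel_eqD:
  assumes g: "\<phi>_thread g" and g': "\<phi>_thread g'" and eq: "sel g = sel g'"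
  shows "\<exists>p. (p, g n) \<in> edges (G (\<phi> n)) \<and> (p, g' n) \<in> edges (G (\<phi> n))"
proof -
  obtain p where p: "(\<phi> n, p) \<in> sel g"
    using Spec_level[OF sel_Spec[OF g]] by blast
  have "(p, t n) \<in> edges (G (\<phi> n))" if t: "\<phi>_thread t" "(\<phi> n, p) \<in> sel t" for t
  proof -
    obtain k where k: "\<phi> n \<le> \<phi> k" "\<And>x. (x, t k) \<in> edges (G (\<phi> k)) \<Longrightarrow> (p, x) \<in> R (\<phi> n) (\<phi> k)"
      using t(2) unfolding sel_def by blast
    then have "n \<le> k"
      using strict_mono_less_eq[OF \<phi>] by blast
    then have "t k \<in> verts (G (\<phi> k))" "(t n, t k) \<in> R (\<phi> n) (\<phi> k)"
      using t(1) by (auto simp: \<phi>_thread_def)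
    then show ?thesis
      using R_adj_same[OF k(1)] k(2) edge_refl by blast
  qed
  then show ?thesis
    using p eq g g' by auto
qed

text \<open>Nonadjacent vertices of one level have disjoint sets \<open>U\<close>. If two points had
  only adjacent members at equal levels, \<open>eq_selI\<close> would identify both with
  \<open>sel\<close> of the same thread.\<close>

lemma Hausdorff: "Hausdorff_space X"
  unfolding Hausdorff_space_def topspace_X
proof (intro allI impI)
  fix S S' assume SS: "S \<in> Spec \<and> S' \<in> Spec \<and> S \<noteq> S'"
  have "\<exists>n p q. (n, p) \<in> S \<and> (n, q) \<in> S' \<and> (p, q) \<notin> edges (G n)"
  proof (rule ccontr)
    assume "\<not> ?thesis"
    then have adj: "(p, q) \<in> edges (G n)" if "(n, p) \<in> S" "(n, q) \<in> S'" for n p q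
      using that by blast
    obtain h where h: "vthread h" "S = up h"
      using Spec_up SS by blast
    obtain h' where h': "vthread h'" "S' = up h'"
      using Spec_up SS by blast
    have inS: "(n, h n) \<in> S" "(n, h' n) \<in> S'" "h n \<in> verts (G n)" for n
      using h h' unfolding vthread_def up_def by blast+
    let ?g = "\<lambda>n. h (\<phi> n)"
    have g: "\<phi>_thread ?g"
      using h(1) \<phi>_le unfolding \<phi>_thread_def vthread_def by blast
    have "S = sel ?g"
      using SS inS edge_refl by (intro eq_selI[of S ?g ?g] g) blast+
    moreover have "S' = sel ?g"
    proof (rule eq_selI[of S' ?g "\<lambda>n. h' (\<phi> n)"])
      fix n
      have "(h' (\<phi> n), h (\<phi> n)) \<in> edges (G (\<phi> n))"
        using adj[OF inS(1,2)] edge_sym by blast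
      then show "\<exists>x. (x, h (\<phi> n)) \<in> edges (G (\<phi> n)) \<and> (h' (\<phi> n), x) \<in> edges (G (\<phi> n))"
        using edge_refl[OF inS(3)] by blast
    qed (use SS g inS in auto)
    ultimately show False
      using SS by simp
  qed
  then obtain n p q where pq: "(n, p) \<in> S" "(n, q) \<in> S'" "(p, q) \<notin> edges (G n)"
    by blast
  have "S \<in> U n p" "S' \<in> U n q" "disjnt (U n p) (U n q)"
    using SS pq U_meet by (auto simp: U_def disjnt_def)
  then show "\<exists>W W'. openin X W \<and> openin X W' \<and> S \<in> W \<and> S' \<in> W' \<and> disjnt W W'"
    using openin_U by blast
qed

end

section \<open>Star-refining sequences of fans\<close>

text \<open>The points of the fiber over \<open>j\<close> cut the \<open>j\<close>-th interval into parts of equal length.\<close>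

lemma partition_refinement:
  fixes u :: "nat \<Rightarrow> real" and f :: "nat \<Rightarrow> nat"
  assumes u: "u 0 = 0" "u (Suc L) = 1" "\<And>j. j \<le> L \<Longrightarrow> u j < u (Suc j)" "\<And>j. j \<le> L \<Longrightarrow> u (Suc j) - u j \<le> w"
    and f: "\<And>i. i \<le> L' \<Longrightarrow> f i \<le> L" "\<And>i i'. i \<le> i' \<Longrightarrow> i' \<le> L' \<Longrightarrow> f i \<le> f i'"
    and fiber: "\<And>j. j \<le> L \<Longrightarrow> 2 \<le> card {i. i \<le> L' \<and> f i = j}"
  shows "\<exists>u' :: nat \<Rightarrow> real. u' 0 = 0 \<and> u' (Suc L') = 1 \<and>
    (\<forall>i\<le>L'. u' i < u' (Suc i) \<and> u' (Suc i) - u' i \<le> w / 2 \<and> u (f i) \<le> u' i \<and> u' (Suc i) \<le> u (Suc (f i)))"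
proof -
  \<comment> \<open>\<open>a i\<close> is the rank of \<open>i\<close> within its fibre and
    \<open>d i\<close> the size of the fibre; \<open>u'\<close> interpolates linearly between them.
    The index \<open>Suc L'\<close> belongs to no fibre and gets its value by hand.\<close>
  define a where "a i = card {i'. i' < i \<and> f i' = f i}" for i
  define d where "d i = card {i'. i' \<le> L' \<and> f i' = f i}" for i
  define u' where "u' i = (if i = Suc L' then 1 else u (f i) + (u (Suc (f i)) - u (f i)) * a i / d i)" for i
  have hit: "\<exists>i\<le>L'. f i = j" if "j \<le> L" for j
  proof (rule ccontr)
    assume "\<not> ?thesis"
    then have empty: "{i. i \<le> L' \<and> f i = j} = {}"
      by blast
    show False
      using fiber[OF that] unfolding empty by simp
  qed
  have d: "2 \<le> d i" if "i \<le> L'" for i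
    using fiber f(1) that by (simp add: d_def)
  have f0: "f 0 = 0"
    using hit[of 0] f(2)[of 0] by fastforce
  have fL: "f L' = L"
    using hit[of L] f(1)[of L'] f(2)[of _ L'] by fastforce
  \<comment> \<open>The last part of a fibre ends where the next interval begins, because a monotone
    \<open>f\<close> without empty fibres climbs by exactly one.\<close>
  have last: "Suc (a i) = d i \<and> u' (Suc i) = u (Suc (f i))"
    if i: "i \<le> L'" "i = L' \<or> f (Suc i) \<noteq> f i" for i
  proof
    have le: "i' \<le> i" if "i' \<le> L'" "f i' = f i" for i'
    proof (rule ccontr)
      assume "\<not> i' \<le> i"
      then have "Suc i \<le> i'" "i < L'"
        using that by auto
      then have "f i \<le> f (Suc i)" "f (Suc i) \<le> f i'"
        using f(2)[of i "Suc i"] f(2)[of "Suc i" i'] that(1) by simp_all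
      then show False
        using i(2) \<open>i < L'\<close> that(2) by auto
    qed
    have "{i'. i' \<le> L' \<and> f i' = f i} = insert i {i'. i' < i \<and> f i' = f i}"
      using le i(1) by (auto simp: order_less_le)
    then show "Suc (a i) = d i"
      by (simp add: a_def d_def)
    show "u' (Suc i) = u (Suc (f i))"
    proof (cases "i = L'")
      case True
      then show ?thesis
        using fL u(2) by (simp add: u'_def)
    next
      case False
      then have iL: "Suc i \<le> L'" "f (Suc i) \<noteq> f i"
        using i by auto
      then have "f i < f (Suc i)"
        using f(2)[of i "Suc i"] by simp
      moreover have "f (Suc i) \<le> Suc (f i)"
      proof -
        have "Suc (f i) \<le> L"
          using \<open>f i < f (Suc i)\<close> f(1)[OF iL(1)] by simp
        then obtain i' where i': "i' \<le> L'" "f i' = Suc (f i)"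
          using hit by blast
        then have "\<not> i' \<le> i"
          using f(2)[of i' i] i(1) by auto
        then show ?thesis
          using f(2)[of "Suc i" i'] i' by simp
      qed
      ultimately have fS: "f (Suc i) = Suc (f i)"
        by simp
      have "f i' \<noteq> f (Suc i)" if "i' < Suc i" for i'
        using f(2)[of i' i] i(1) fS that by simp
      then have "{i'. i' < Suc i \<and> f i' = f (Suc i)} = {}"
        by blast
      then have "a (Suc i) = 0"
        unfolding a_def by simp
      then show ?thesis
        using iL fS by (simp add: u'_def)
    qed
  qed
  have step: "u' (Suc i) = u (f i) + (u (Suc (f i)) - u (f i)) * Suc (a i) / d i \<and> Suc (a i) \<le> d i" if i: "i \<le> L'" for i
  proof (cases "i = L' \<or> f (Suc i) \<noteq> f i")
    case True
    then show ?thesis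
      using last[OF i True] d[OF i] by simp
  next
    case False
    then have iL: "Suc i \<le> L'" "f (Suc i) = f i"
      using i by auto
    have "{i'. i' < Suc i \<and> f i' = f (Suc i)} = insert i {i'. i' < i \<and> f i' = f i}"
      using iL by (auto simp: less_Suc_eq)
    then have aS: "a (Suc i) = Suc (a i)"
      by (simp add: a_def)
    have dS: "d (Suc i) = d i"
      using iL by (simp add: d_def)
    have "{i'. i' < Suc i \<and> f i' = f (Suc i)} \<subseteq> {i'. i' \<le> L' \<and> f i' = f i}"
      using iL by auto
    then have "a (Suc i) \<le> d i"
      unfolding a_def d_def by (intro card_mono) auto
    then show ?thesis
      using aS dS iL by (simp add: u'_def)
  qed
  have base: "u' i = u (f i) + (u (Suc (f i)) - u (f i)) * a i / d i" if "i \<le> L'" for i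
    using that by (simp add: u'_def)
  have diff: "u' (Suc i) - u' i = (u (Suc (f i)) - u (f i)) / d i" if i: "i \<le> L'" for i
  proof -
    have "x * (1 + y) / z - x * y / z = x / z" for x y z :: real
      by (simp add: distrib_left add_divide_distrib)
    from this[of "u (Suc (f i)) - u (f i)" "a i" "d i"] show ?thesis
      unfolding conjunct1[OF step[OF i]] base[OF i] of_nat_Suc by linarith
  qed
  show ?thesis
  proof (intro exI[of _ u'] conjI allI impI)
    show "u' 0 = 0"
      using base[of 0] f0 u(1) by (simp add: a_def)
    show "u' (Suc L') = 1"
      by (simp add: u'_def)
    fix i assume i: "i \<le> L'"
    have fi: "f i \<le> L"
      using f(1)[OF i] .
    have pos: "0 < u (Suc (f i)) - u (f i)" "0 < d i"
      using u(3)[OF fi] d[OF i] by auto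
    then have "0 < (u (Suc (f i)) - u (f i)) / d i"
      by simp
    then show "u' i < u' (Suc i)"
      using diff[OF i] by linarith
    have "(u (Suc (f i)) - u (f i)) / d i \<le> w / 2"
      using u(4)[OF fi] d[OF i] pos(1) by (intro frac_le) auto
    then show "u' (Suc i) - u' i \<le> w / 2"
      using diff[OF i] by simp
    show "u (f i) \<le> u' i"
      using base[OF i] pos by simp
    have "(u (Suc (f i)) - u (f i)) * (real (Suc (a i)) / d i) \<le> (u (Suc (f i)) - u (f i)) * 1"
      using step[OF i] pos by (intro mult_left_mono) auto
    then show "u' (Suc i) \<le> u (Suc (f i))"
      using step[OF i] by simp
  qed
qed

sublocale fan_seq \<subseteq> graph_seq G R
proof
  show "is_graph (G n)" for n
    using fan_coords.graph[OF coords] .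
  show "R m n \<subseteq> verts (G m) \<times> verts (G n)" "co_bijective (G n) (G m) (R m n)" "edge_preserving (G n) (G m) (R m n)"
    if "m \<le> n" for m n
    using R_hom[OF that] by (auto simp: catX_def)
qed (fact R_id R_comp)+

text \<open>A compact space \<open>B\<close> parametrises the branches of ends, \<open>f\<close> selects functions inside the
  relations, and for every end \<open>e\<close> of level \<open>n\<close> the points \<open>u n e j\<close> cut the unit interval into
  one interval per vertex of the spoke of \<open>e\<close>, compatibly with \<open>f\<close>.\<close>

locale fan_levels = fan_seq G R l v \<epsilon> \<alpha> \<beta>
  for G :: "nat \<Rightarrow> 'a::infinite rgraph" and R l v \<epsilon> \<alpha> \<beta> +
  fixes \<phi> :: "nat \<Rightarrow> nat" and f :: "nat \<Rightarrow> 'a \<Rightarrow> nat \<Rightarrow> nat" and u :: "nat \<Rightarrow> 'a \<Rightarrow> nat \<Rightarrow> real"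
    and B :: "'b topology" and c :: "nat \<Rightarrow> 'b \<Rightarrow> 'a"
  assumes \<phi>_mono: "strict_mono \<phi>"
    and refining: "refining 2 (\<phi> n) (\<phi> (Suc n))"
    and u_0: "e \<in> ends (G (\<phi> n)) \<Longrightarrow> u n e 0 = 0"
    and u_1: "e \<in> ends (G (\<phi> n)) \<Longrightarrow> u n e (Suc (l (\<phi> n) e)) = 1"
    and u_less: "e \<in> ends (G (\<phi> n)) \<Longrightarrow> j \<le> l (\<phi> n) e \<Longrightarrow> u n e j < u n e (Suc j)"
    and u_mesh: "e \<in> ends (G (\<phi> n)) \<Longrightarrow> j \<le> l (\<phi> n) e \<Longrightarrow> u n e (Suc j) - u n e j \<le> (1/2) ^ n"
    and f_rel: "e \<in> ends (G (\<phi> (Suc n))) \<Longrightarrow> i \<le> l (\<phi> (Suc n)) e \<Longrightarrow>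
      \<alpha> (\<phi> n) (\<phi> (Suc n)) e i \<le> f n e i \<and> f n e i \<le> \<beta> (\<phi> n) (\<phi> (Suc n)) e i"
    and f_u: "e \<in> ends (G (\<phi> (Suc n))) \<Longrightarrow> i \<le> l (\<phi> (Suc n)) e \<Longrightarrow>
      u n (\<epsilon> (\<phi> n) (\<phi> (Suc n)) e) (f n e i) \<le> u (Suc n) e i \<and>
      u (Suc n) e (Suc i) \<le> u n (\<epsilon> (\<phi> n) (\<phi> (Suc n)) e) (Suc (f n e i))"
    and compact_B: "compact_space B"
    and c_end: "b \<in> topspace B \<Longrightarrow> c n b \<in> ends (G (\<phi> n))"
    and c_step: "b \<in> topspace B \<Longrightarrow> \<epsilon> (\<phi> n) (\<phi> (Suc n)) (c (Suc n) b) = c n b"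
    and c_cont: "continuous_map B (discrete_topology UNIV) (c n)"
    and c_inj: "b \<in> topspace B \<Longrightarrow> b' \<in> topspace B \<Longrightarrow> (\<And>n. c n b = c n b') \<Longrightarrow> b = b'"
    and c_surj: "(\<And>n. t n \<in> ends (G (\<phi> n))) \<Longrightarrow> (\<And>n. \<epsilon> (\<phi> n) (\<phi> (Suc n)) (t (Suc n)) = t n) \<Longrightarrow>
      \<exists>b\<in>topspace B. \<forall>n. c n b = t n"

sublocale fan_levels \<subseteq> star_seq G R \<phi>
proof
  show "star_refining (G (\<phi> (Suc n))) (G (\<phi> n)) (R (\<phi> n) (\<phi> (Suc n)))" for n
    using refining refining_2_iff by blast
qed (fact \<phi>_mono)

context fan_levels
begin

abbreviation I :: "real topology" where
  "I \<equiv> top_of_set {0..1}"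

abbreviation E :: "nat \<Rightarrow> 'a set" where
  "E n \<equiv> ends (G (\<phi> n))"

abbreviation len :: "nat \<Rightarrow> 'a \<Rightarrow> nat" where
  "len n e \<equiv> l (\<phi> n) e"

lemma \<phi>_Suc: "\<phi> n \<le> \<phi> (Suc n)"
  by (rule \<phi>_le) simp

lemma \<epsilon>_E: "e \<in> E (Suc n) \<Longrightarrow> \<epsilon> (\<phi> n) (\<phi> (Suc n)) e \<in> E n"
  using \<epsilon>_in[OF \<phi>_Suc] .

lemma f_bound: "e \<in> E (Suc n) \<Longrightarrow> i \<le> len (Suc n) e \<Longrightarrow> f n e i \<le> len n (\<epsilon> (\<phi> n) (\<phi> (Suc n)) e)"
  using f_rel walk_bound(1)[OF walk[OF \<phi>_Suc]] by (meson order_trans)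

lemma f_R:
  assumes "e \<in> E (Suc n)" "i \<le> len (Suc n) e"
  shows "(v (\<phi> n) (\<epsilon> (\<phi> n) (\<phi> (Suc n)) e) (f n e i), v (\<phi> (Suc n)) e i) \<in> R (\<phi> n) (\<phi> (Suc n))"
  unfolding R_eq[OF \<phi>_Suc] by (rule fan_relI) (use assms f_rel[OF assms] in auto)

lemma u_mono:
  assumes e: "e \<in> E n" and "i \<le> j" "j \<le> Suc (len n e)"
  shows "u n e i \<le> u n e j"
  using assms(2,3)
proof (induction j rule: dec_induct)
  case (step k)
  then show ?case
    using u_less[OF e, of k] by simp
qed simp

lemma u_upper:
  assumes e: "e \<in> E n" and "i + d \<le> Suc (len n e)"
  shows "u n e (i + d) \<le> u n e i + d * (1/2) ^ n"
  using assms(2)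
proof (induction d)
  case (Suc d)
  then have "u n e (Suc (i + d)) - u n e (i + d) \<le> (1/2) ^ n"
    using u_mesh[OF e, of "i + d"] by simp
  then show ?case
    using Suc by (simp add: algebra_simps)
qed simp

lemma edge_v:
  assumes "e \<in> E n" "e' \<in> E n" "j \<le> len n e" "j' \<le> len n e'"
  shows "(v (\<phi> n) e j, v (\<phi> n) e' j') \<in> edges (G (\<phi> n)) \<longleftrightarrow> e = e' \<and> j \<le> Suc j' \<and> j' \<le> Suc j \<or> j + j' \<le> 1"
  using fan_coords.edge_iff[OF coords assms] .

text \<open>At a division point the interval to the right is taken, and at \<open>1\<close> the last
  one. With this rule \<open>pos\<close> commutes exactly with \<open>f\<close>, although
  neighbouring intervals share an endpoint.\<close>

definition pos :: "nat \<Rightarrow> 'a \<Rightarrow> real \<Rightarrow> nat" where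
  "pos n e t = Max {j. j \<le> len n e \<and> u n e j \<le> t}"

lemma pos:
  assumes e: "e \<in> E n" and t: "0 \<le> t" "t \<le> 1"
  shows "pos n e t \<le> len n e" "u n e (pos n e t) \<le> t" "t \<le> u n e (Suc (pos n e t))"
    and "j \<le> len n e \<Longrightarrow> u n e j \<le> t \<Longrightarrow> j \<le> pos n e t"
proof -
  let ?J = "{j. j \<le> len n e \<and> u n e j \<le> t}"
  have "0 \<in> ?J"
    using u_0[OF e] t by simp
  then have "Max ?J \<in> ?J"
    by (intro Max_in) auto
  then show le: "pos n e t \<le> len n e" "u n e (pos n e t) \<le> t"
    by (auto simp: pos_def)
  show max: "j \<le> pos n e t" if "j \<le> len n e" "u n e j \<le> t" for j
    unfolding pos_def using that by (intro Max_ge) auto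
  show "t \<le> u n e (Suc (pos n e t))"
  proof (cases "pos n e t = len n e")
    case True
    then show ?thesis
      using u_1[OF e] t by simp
  next
    case False
    then show ?thesis
      using max[of "Suc (pos n e t)"] le by fastforce
  qed
qed

lemma pos_0: "e \<in> E n \<Longrightarrow> pos n e 0 = 0"
proof (rule ccontr)
  assume e: "e \<in> E n" and "pos n e 0 \<noteq> 0"
  then have "u n e (Suc 0) \<le> u n e (pos n e 0)"
    using pos(1)[OF e, of 0] by (intro u_mono) auto
  then show False
    using pos(2)[OF e, of 0] u_less[OF e, of 0] u_0[OF e] by simp
qed

lemma pos_unique:
  assumes e: "e \<in> E n" and t: "0 \<le> t" "t \<le> 1" and j: "j \<le> len n e" "u n e j \<le> t" "t \<le> u n e (Suc j)"
  shows "j \<le> pos n e t" "pos n e t \<le> Suc j"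
proof -
  show "j \<le> pos n e t"
    using pos(4)[OF e t] j by simp
  show "pos n e t \<le> Suc j"
  proof (rule ccontr)
    assume "\<not> pos n e t \<le> Suc j"
    then have "Suc j \<le> len n e" "u n e (Suc (Suc j)) \<le> u n e (pos n e t)"
      using pos(1)[OF e t] by (auto intro!: u_mono[OF e])
    then show False
      using u_less[OF e, of "Suc j"] pos(2)[OF e t] j(3) by linarith
  qed
qed

text \<open>Each interval of level \<open>Suc n\<close> lies inside the interval of its image under
  \<open>f\<close>. If the coarse position were larger, \<open>t\<close> would be at or beyond the
  right endpoint of the fine interval, and \<open>pos\<close> would have taken a later one.\<close>

lemma pos_step:
  assumes e: "e \<in> E (Suc n)" and t: "0 \<le> t" "t \<le> 1"
  shows "f n e (pos (Suc n) e t) = pos n (\<epsilon> (\<phi> n) (\<phi> (Suc n)) e) t"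
proof (rule antisym)
  let ?i = "pos (Suc n) e t" and ?e = "\<epsilon> (\<phi> n) (\<phi> (Suc n)) e"
  have e': "?e \<in> E n"
    using \<epsilon>_E[OF e] .
  note p = pos[OF e t] and p' = pos[OF e' t]
  have fb: "f n e ?i \<le> len n ?e"
    by (rule f_bound[OF e p(1)])
  have fu: "u n ?e (f n e ?i) \<le> u (Suc n) e ?i" "u (Suc n) e (Suc ?i) \<le> u n ?e (Suc (f n e ?i))"
    using f_u[OF e p(1)] by auto
  show "f n e ?i \<le> pos n ?e t"
    by (rule p'(4)[OF fb order_trans[OF fu(1) p(2)]])
  show "pos n ?e t \<le> f n e ?i"
  proof (rule ccontr)
    assume "\<not> pos n ?e t \<le> f n e ?i"
    then have "u n ?e (Suc (f n e ?i)) \<le> u n ?e (pos n ?e t)"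
      using p'(1) by (intro u_mono[OF e']) auto
    then have le: "u (Suc n) e (Suc ?i) \<le> u n ?e (pos n ?e t)"
      using fu(2) by linarith
    show False
    proof (cases "?i = len (Suc n) e")
      case True
      then have "1 \<le> u n ?e (pos n ?e t)"
        using le u_1[OF e] by simp
      moreover have "u n ?e (pos n ?e t) < u n ?e (Suc (pos n ?e t))" "u n ?e (Suc (pos n ?e t)) \<le> 1"
        using u_less[OF e' p'(1)] u_mono[OF e', of "Suc (pos n ?e t)" "Suc (len n ?e)"] p'(1) u_1[OF e'] by auto
      ultimately show False
        by linarith
    next
      case False
      then have "Suc ?i \<le> len (Suc n) e"
        using p(1) by simp
      then have "Suc ?i \<le> ?i"
        using p(4)[of "Suc ?i"] le p'(2) by linarith
      then show False
        by simp
    qed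
  qed
qed

definition point :: "'b \<times> real \<Rightarrow> nat \<Rightarrow> 'a" where
  "point x n = v (\<phi> n) (c n (fst x)) (pos n (c n (fst x)) (snd x))"

lemma point_thread:
  assumes b: "b \<in> topspace B" and t: "0 \<le> t" "t \<le> 1"
  shows "\<phi>_thread (point (b, t))"
proof -
  have V: "point (b, t) n \<in> verts (G (\<phi> n))" for n
    unfolding point_def using fan_coords.vertI[OF coords c_end[OF b] pos(1)[OF c_end[OF b] t]] by simp
  have step: "(point (b, t) n, point (b, t) (Suc n)) \<in> R (\<phi> n) (\<phi> (Suc n))" for n
    using f_R[OF c_end[OF b] pos(1)[OF c_end[OF b] t], of n] pos_step[OF c_end[OF b] t, of n] c_step[OF b, of n]
    unfolding point_def by simp
  have "(point (b, t) m, point (b, t) n) \<in> R (\<phi> m) (\<phi> n)" if "m \<le> n" for m n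
    using that
  proof (induction n rule: dec_induct)
    case base
    then show ?case
      using V R_refl_iff by simp
  next
    case (step n)
    then show ?case
      using R_trans[OF \<phi>_le[OF step(1)] \<phi>_Suc step.IH \<open>(point (b, t) n, point (b, t) (Suc n)) \<in> R (\<phi> n) (\<phi> (Suc n))\<close>] by simp
  qed
  then show ?thesis
    unfolding \<phi>_thread_def using V by blast
qed

definition \<Phi> :: "'b \<times> real \<Rightarrow> (nat \<times> 'a) set" where
  "\<Phi> x = sel (point x)"

abbreviation T :: "('b \<times> real) topology" where
  "T \<equiv> prod_topology B I"

lemma T_iff: "x \<in> topspace T \<longleftrightarrow> fst x \<in> topspace B \<and> 0 \<le> snd x \<and> snd x \<le> 1"
  by (auto simp: mem_Times_iff)

lemma \<Phi>_Spec: "x \<in> topspace T \<Longrightarrow> \<Phi> x \<in> Spec"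
  unfolding \<Phi>_def using sel_Spec[OF point_thread] T_iff by (cases x) auto

lemma openin_c: "openin B {b \<in> topspace B. c n b = e}"
proof -
  have "openin B {b \<in> topspace B. c n b \<in> {e}}"
    by (rule openin_continuous_map_preimage[OF c_cont]) simp
  then show ?thesis
    by simp
qed

lemma closedin_c: "closedin B {b \<in> topspace B. c n b = e}"
proof -
  have "closedin B {b \<in> topspace B. c n b \<in> {e}}"
    by (rule closedin_continuous_map_preimage[OF c_cont]) simp
  then show ?thesis
    by simp
qed

text \<open>\<delta> is the length of the shortest interval: an index can be skipped only by
  crossing a whole interval.\<close>

lemma pos_close:
  assumes e: "e \<in> E n"
  obtains \<delta> where "0 < \<delta>" "\<And>t t'. 0 \<le> t \<Longrightarrow> t \<le> 1 \<Longrightarrow> 0 \<le> t' \<Longrightarrow> t' \<le> 1 \<Longrightarrow> \<bar>t - t'\<bar> < \<delta> \<Longrightarrow> pos n e t' \<le> Suc (pos n e t)"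
proof -
  let ?W = "(\<lambda>j. u n e (Suc j) - u n e j) ` {..len n e}"
  define \<delta> where "\<delta> = Min ?W"
  have "\<delta> \<in> ?W"
    unfolding \<delta>_def by (intro Min_in) auto
  then have "0 < \<delta>"
    using u_less[OF e] by auto
  moreover have "pos n e t' \<le> Suc (pos n e t)"
    if t: "0 \<le> t" "t \<le> 1" and t': "0 \<le> t'" "t' \<le> 1" and d: "\<bar>t - t'\<bar> < \<delta>" for t t'
  proof (rule ccontr)
    assume *: "\<not> pos n e t' \<le> Suc (pos n e t)"
    then have j: "Suc (pos n e t) \<le> len n e"
      using pos(1)[OF e t'] by simp
    have "u n e (Suc (Suc (pos n e t))) \<le> u n e (pos n e t')"
      using * pos(1)[OF e t'] by (intro u_mono[OF e]) auto
    moreover have "\<delta> \<le> u n e (Suc (Suc (pos n e t))) - u n e (Suc (pos n e t))"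
      unfolding \<delta>_def using j by (intro Min_le) auto
    ultimately show False
      using pos(3)[OF e t] pos(2)[OF e t'] d by linarith
  qed
  ultimately show ?thesis
    using that by blast
qed

text \<open>A member of \<open>sel\<close> controls a double star at some level \<open>n\<close>.
  Pairs with the same end at level \<open>n\<close> and with nearby heights have adjacent vertices
  there, so the stars of the one lie in the double star of the other.\<close>

lemma \<Phi>_continuous: "continuous_map T X \<Phi>"
  unfolding spectrum_topology_def
proof (rule continuous_on_generated_topo)
  show "\<Phi> ` topspace T \<subseteq> \<Union> (insert Spec ((\<lambda>p. {S \<in> Spec. p \<in> S}) ` P))"
    using \<Phi>_Spec by blast
  fix W assume W: "W \<in> insert Spec ((\<lambda>p. {S \<in> Spec. p \<in> S}) ` P)"
  show "openin T (\<Phi> -` W \<inter> topspace T)"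
  proof (cases "W = Spec")
    case True
    then have "\<Phi> -` W \<inter> topspace T = topspace T"
      using \<Phi>_Spec by blast
    then show ?thesis
      using openin_topspace[of T] by (simp only:)
  next
    case False
    then obtain q where q: "q \<in> P" "W = {S \<in> Spec. q \<in> S}"
      using W by blast
    obtain m p where "q = (m, p)"
      by (cases q)
    then have W: "W = {S \<in> Spec. (m, p) \<in> S}" "p \<in> verts (G m)"
      using q by (auto simp: P_iff)
    show ?thesis
    proof (subst openin_subopen, intro ballI)
      fix x assume x: "x \<in> \<Phi> -` W \<inter> topspace T"
      obtain b t where bt: "x = (b, t)"
        by (cases x)
      have b: "b \<in> topspace B" and t: "0 \<le> t" "t \<le> 1"
        using x T_iff bt by auto
      have "(m, p) \<in> sel (point (b, t))"
        using x W bt by (simp add: \<Phi>_def)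
      then obtain n where n: "m \<le> \<phi> n"
          "\<And>x y. (x, point (b, t) n) \<in> edges (G (\<phi> n)) \<Longrightarrow> (y, x) \<in> edges (G (\<phi> n)) \<Longrightarrow> (p, y) \<in> R m (\<phi> n)"
        by (rule sel_double_star[OF point_thread[OF b t]]) blast
      let ?e = "c n b"
      have e: "?e \<in> E n"
        by (rule c_end[OF b])
      obtain \<delta> where \<delta>: "0 < \<delta>" "\<And>t t'. 0 \<le> t \<Longrightarrow> t \<le> 1 \<Longrightarrow> 0 \<le> t' \<Longrightarrow> t' \<le> 1 \<Longrightarrow> \<bar>t - t'\<bar> < \<delta> \<Longrightarrow> pos n ?e t' \<le> Suc (pos n ?e t)"
        by (rule pos_close[OF e]) blast
      let ?N = "{b' \<in> topspace B. c n b' = ?e} \<times> ({0..1} \<inter> ball t \<delta>)"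
      have "openin T ?N"
        using openin_c by (auto simp: openin_prod_Times_iff intro: openin_open_Int)
      moreover have "x \<in> ?N"
        using bt b t \<delta>(1) by simp
      moreover have "?N \<subseteq> \<Phi> -` W \<inter> topspace T"
      proof clarify
        fix b' t' assume b': "b' \<in> topspace B" "c n b' = ?e" and t': "t' \<in> {0..1}" "t' \<in> ball t \<delta>"
        have t01: "0 \<le> t'" "t' \<le> 1" and d: "\<bar>t - t'\<bar> < \<delta>" "\<bar>t' - t\<bar> < \<delta>"
          using t' by (auto simp: dist_real_def)
        have in_T: "(b', t') \<in> topspace T"
          using b' t01 by (simp add: T_iff)
        have "pos n ?e t' \<le> Suc (pos n ?e t)" "pos n ?e t \<le> Suc (pos n ?e t')"
          using \<delta>(2)[OF t t01 d(1)] \<delta>(2)[OF t01 t d(2)] by auto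
        then have "(point (b', t') n, point (b, t) n) \<in> edges (G (\<phi> n))"
          unfolding point_def using edge_v[OF e e pos(1)[OF e t01] pos(1)[OF e t]] b'(2) by simp
        then have "(p, y) \<in> R m (\<phi> n)" if "(y, point (b', t') n) \<in> edges (G (\<phi> n))" for y
          using n(2) that by blast
        then have "(m, p) \<in> sel (point (b', t'))"
          unfolding sel_def using W(2) n(1) by blast
        then show "(b', t') \<in> \<Phi> -` W \<inter> topspace T"
          using W \<Phi>_Spec[OF in_T] in_T by (simp add: \<Phi>_def)
      qed
      ultimately show "\<exists>N. openin T N \<and> x \<in> N \<and> N \<subseteq> \<Phi> -` W \<inter> topspace T"
        by blast
    qed
  qed
qed

lemma compact_T: "compact_space T"
  using compact_B by (simp add: compact_space_prod_topology compact_space_subtopology)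

lemma branch_through:
  assumes "e \<in> E n"
  obtains b where "b \<in> topspace B" "c n b = e"
proof -
  obtain t where t: "thread t" "t (\<phi> n) = e"
    by (rule thread_through[OF assms])
  have "\<exists>b\<in>topspace B. \<forall>n. c n b = t (\<phi> n)"
    using thread_ends[OF t(1)] thread_\<epsilon>[OF t(1) \<phi>_Suc] by (intro c_surj) auto
  then show ?thesis
    using that t(2) by blast
qed

text \<open>Let \<open>h\<close> be a chain generating \<open>S\<close>. The pairs with a cell at
  level \<open>n\<close> adjacent to \<open>h n\<close> form a closed nonempty set
  \<open>D n\<close>, and these sets are nested since \<open>f\<close> selects inside
  \<open>R\<close>. By compactness some pair lies in all of them; its thread stays within distance
  two of \<open>h\<close>, so \<open>eq_selI\<close> applies.\<close>

lemma \<Phi>_surj: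
  assumes S: "S \<in> Spec"
  shows "S \<in> \<Phi> ` topspace T"
proof -
  obtain h0 where h0: "vthread h0" "S = up h0"
    by (rule Spec_up[OF S])
  define h where "h n = h0 (\<phi> n)" for n
  have hV: "h n \<in> verts (G (\<phi> n))" and hR: "(h n, h (Suc n)) \<in> R (\<phi> n) (\<phi> (Suc n))" and hS: "(\<phi> n, h n) \<in> S" for n
    using h0 \<phi>_Suc unfolding h_def vthread_def up_def by blast+
  define near where "near n e j \<longleftrightarrow> e \<in> E n \<and> j \<le> len n e \<and> (v (\<phi> n) e j, h n) \<in> edges (G (\<phi> n))" for n e j
  define D where "D n = (\<Union>(e, j)\<in>{(e, j). near n e j}. {b \<in> topspace B. c n b = e} \<times> {u n e j..u n e (Suc j)})" for n
  have u01: "{u n e j..u n e (Suc j)} \<subseteq> {0..1}" if "e \<in> E n" "j \<le> len n e" for n e j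
    using u_mono[OF that(1), of 0 j] u_mono[OF that(1), of "Suc j" "Suc (len n e)"] u_0[OF that(1)] u_1[OF that(1)] that(2)
    by auto
  have clo: "closedin T (D n)" for n
    unfolding D_def
  proof (rule closedin_Union)
    have "{(e, j). near n e j} \<subseteq> (SIGMA e:E n. {..len n e})"
      by (auto simp: near_def)
    then have "finite {(e, j). near n e j}"
      by (rule finite_subset) (use finite_ends in auto)
    then show "finite ((\<lambda>(e, j). {b \<in> topspace B. c n b = e} \<times> {u n e j..u n e (Suc j)}) ` {(e, j). near n e j})"
      by simp
    fix Z assume "Z \<in> (\<lambda>(e, j). {b \<in> topspace B. c n b = e} \<times> {u n e j..u n e (Suc j)}) ` {(e, j). near n e j}"
    then obtain e j where Z: "near n e j" "Z = {b \<in> topspace B. c n b = e} \<times> {u n e j..u n e (Suc j)}"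
      by auto
    have "closedin I {u n e j..u n e (Suc j)}"
      using u01[of e n j] Z(1) by (intro closed_subset) (auto simp: near_def)
    then show "closedin T Z"
      unfolding Z(2) closedin_prod_Times_iff using closedin_c by blast
  qed
  have ne: "D n \<noteq> {}" for n
  proof -
    obtain e j where ej: "e \<in> E n" "j \<le> len n e" "h n = v (\<phi> n) e j"
      using fan_coords.vertE[OF coords hV[of n]] by metis
    obtain b where b: "b \<in> topspace B" "c n b = e"
      by (rule branch_through[OF ej(1)])
    have "near n e j"
      using ej edge_refl[OF hV[of n]] by (simp add: near_def)
    moreover have "(b, u n e j) \<in> {b \<in> topspace B. c n b = e} \<times> {u n e j..u n e (Suc j)}"
      using b u_less[OF ej(1,2)] by simp
    ultimately show ?thesis
      unfolding D_def by blast
  qed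
  have "D (Suc n) \<subseteq> D n" for n
  proof
    fix x assume "x \<in> D (Suc n)"
    then obtain e j where ej: "near (Suc n) e j" "x \<in> {b \<in> topspace B. c (Suc n) b = e} \<times> {u (Suc n) e j..u (Suc n) e (Suc j)}"
      unfolding D_def by blast
    let ?e = "\<epsilon> (\<phi> n) (\<phi> (Suc n)) e"
    have e: "e \<in> E (Suc n)" "j \<le> len (Suc n) e" "(v (\<phi> (Suc n)) e j, h (Suc n)) \<in> edges (G (\<phi> (Suc n)))"
      using ej(1) by (auto simp: near_def)
    have "(v (\<phi> n) ?e (f n e j), h n) \<in> edges (G (\<phi> n))"
      by (rule R_adj[OF \<phi>_Suc f_R[OF e(1,2)] hR e(3)])
    then have "near n ?e (f n e j)"
      unfolding near_def using \<epsilon>_E[OF e(1)] f_bound[OF e(1,2)] by blast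
    moreover have "x \<in> {b \<in> topspace B. c n b = ?e} \<times> {u n ?e (f n e j)..u n ?e (Suc (f n e j))}"
      using ej(2) c_step[of "fst x" n] f_u[OF e(1,2)] by (auto simp: mem_Times_iff)
    ultimately show "x \<in> D n"
      unfolding D_def by blast
  qed
  then have "decseq D"
    by (rule decseq_SucI)
  from compact_space_imp_nest[OF compact_T clo ne this] obtain x where x: "\<And>n. x \<in> D n"
    by blast
  obtain b t where bt: "x = (b, t)"
    by (cases x)
  have near: "\<exists>j\<le>len n (c n b). u n (c n b) j \<le> t \<and> t \<le> u n (c n b) (Suc j) \<and> (v (\<phi> n) (c n b) j, h n) \<in> edges (G (\<phi> n))" for n
    using x[of n] unfolding D_def bt near_def by auto
  have "x \<in> topspace T"
    using closedin_subset[OF clo[of 0]] x by blast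
  then have b: "b \<in> topspace B" and t: "0 \<le> t" "t \<le> 1"
    using T_iff bt by auto
  have "S = sel (point x)"
  proof (rule eq_selI[OF S _ hS])
    show "\<phi>_thread (point x)"
      unfolding bt by (rule point_thread[OF b t])
    fix n
    have e: "c n b \<in> E n"
      by (rule c_end[OF b])
    obtain j where j: "j \<le> len n (c n b)" "u n (c n b) j \<le> t" "t \<le> u n (c n b) (Suc j)"
        "(v (\<phi> n) (c n b) j, h n) \<in> edges (G (\<phi> n))"
      using near by blast
    have "j \<le> pos n (c n b) t" "pos n (c n b) t \<le> Suc j"
      using pos_unique[OF e t j(1-3)] by auto
    then have "(v (\<phi> n) (c n b) j, point x n) \<in> edges (G (\<phi> n))"
      unfolding point_def bt using edge_v[OF e e j(1) pos(1)[OF e t]] by simp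
    then show "\<exists>y. (y, point x n) \<in> edges (G (\<phi> n)) \<and> (h n, y) \<in> edges (G (\<phi> n))"
      using edge_sym[OF j(4)] by blast
  qed
  then show ?thesis
    unfolding \<Phi>_def using \<open>x \<in> topspace T\<close> by blast
qed

lemma c_ne:
  assumes b: "b \<in> topspace B" "b' \<in> topspace B" and "c N b \<noteq> c N b'" "N \<le> n"
  shows "c n b \<noteq> c n b'"
  using assms(4)
proof (induction n rule: dec_induct)
  case (step n)
  then show ?case
    using c_step[OF b(1), of n] c_step[OF b(2), of n] by metis
qed (use assms(3) in simp)

lemma le_all_mesh:
  fixes x :: real
  assumes "\<And>n. N \<le> n \<Longrightarrow> x \<le> 3 * (1/2) ^ n"
  shows "x \<le> 0"
proof (rule ccontr)
  assume "\<not> x \<le> 0"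
  then obtain n where n: "(1/2 :: real) ^ n < x / 3"
    using real_arch_pow_inv[of "x / 3" "1/2"] by auto
  have "(1/2 :: real) ^ (max n N) \<le> (1/2) ^ n"
    by (rule power_decreasing) auto
  then show False
    using assms[OF max.cobounded2, of n] n by linarith
qed

text \<open>Threads of equal points have a common neighbour at each level (\<open>sel_eqD\<close>):
  either the ends agree and the positions differ by at most 2, or both positions are at most 2.
  Three intervals then span the difference of the heights, or each height itself, which gives the
  bound \<open>3 * (1/2) ^ n\<close>. If the branches differ, the second case holds at all large
  levels and both heights vanish.\<close>

lemma \<Phi>_eq_iff:
  assumes x: "x \<in> topspace T" and y: "y \<in> topspace T"
  shows "\<Phi> x = \<Phi> y \<longleftrightarrow> x = y \<or> snd x = 0 \<and> snd y = 0"
proof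
  obtain b t where bt: "x = (b, t)"
    by (cases x)
  obtain b' t' where bt': "y = (b', t')"
    by (cases y)
  have b: "b \<in> topspace B" and t: "0 \<le> t" "t \<le> 1" and b': "b' \<in> topspace B" and t': "0 \<le> t'" "t' \<le> 1"
    using x y T_iff bt bt' by auto
  note e = c_end[OF b] and e' = c_end[OF b']
  {
    assume eq: "\<Phi> x = \<Phi> y"
    have close: "c n b = c n b' \<and> pos n (c n b) t \<le> pos n (c n b') t' + 2 \<and> pos n (c n b') t' \<le> pos n (c n b) t + 2 \<or>
        pos n (c n b) t \<le> 2 \<and> pos n (c n b') t' \<le> 2" for n
    proof -
      obtain p where p: "(p, point x n) \<in> edges (G (\<phi> n))" "(p, point y n) \<in> edges (G (\<phi> n))"
        using sel_eqD[OF point_thread[OF b t] point_thread[OF b' t']] eq unfolding \<Phi>_def bt bt' by blast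
      have "p \<in> verts (G (\<phi> n))"
        using edges_sub[OF p(1)] by simp
      then obtain a j where a: "a \<in> E n" "j \<le> len n a" "p = v (\<phi> n) a j"
        by (rule fan_coords.vertE[OF coords])
      have "a = c n b \<and> j \<le> Suc (pos n (c n b) t) \<and> pos n (c n b) t \<le> Suc j \<or> j + pos n (c n b) t \<le> 1"
        using edge_v[OF a(1) e a(2) pos(1)[OF e t]] p(1) unfolding a(3) point_def bt by simp
      moreover have "a = c n b' \<and> j \<le> Suc (pos n (c n b') t') \<and> pos n (c n b') t' \<le> Suc j \<or> j + pos n (c n b') t' \<le> 1"
        using edge_v[OF a(1) e' a(2) pos(1)[OF e' t']] p(2) unfolding a(3) point_def bt' by simp
      ultimately show ?thesis
        by (elim disjE conjE) simp_all
    qed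
    have small: "s \<le> 3 * (1/2) ^ n" if "a \<in> E n" "0 \<le> s" "s \<le> 1" "pos n a s \<le> 2" for a n s
    proof -
      have "s \<le> u n a (0 + Suc (pos n a s))"
        using pos(3)[OF that(1-3)] by simp
      also have "\<dots> \<le> u n a 0 + real (Suc (pos n a s)) * (1/2) ^ n"
        by (rule u_upper[OF that(1)]) (use pos(1)[OF that(1-3)] in simp)
      also have "\<dots> \<le> 0 + 3 * (1/2) ^ n"
        using that(4) u_0[OF that(1)] by (intro add_mono mult_right_mono) auto
      finally show ?thesis
        by simp
    qed
    have near: "s' - s \<le> 3 * (1/2) ^ n"
      if a: "a \<in> E n" and s: "0 \<le> s" "s \<le> 1" and s': "0 \<le> s'" "s' \<le> 1" and "pos n a s' \<le> pos n a s + 2" for a n s s'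
    proof -
      let ?k = "min (pos n a s + 3) (Suc (len n a))"
      have "s' \<le> u n a (Suc (pos n a s'))"
        by (rule pos(3)[OF a s'])
      also have "\<dots> \<le> u n a ?k"
        using that(6) pos(1)[OF a s'] by (intro u_mono[OF a]) auto
      also have "\<dots> = u n a (pos n a s + (?k - pos n a s))"
        using pos(1)[OF a s] by simp
      also have "\<dots> \<le> u n a (pos n a s) + real (?k - pos n a s) * (1/2) ^ n"
        by (rule u_upper[OF a]) (use pos(1)[OF a s] in simp)
      also have "\<dots> \<le> s + 3 * (1/2) ^ n"
        using pos(2)[OF a s] by (intro add_mono mult_right_mono) auto
      finally show ?thesis
        by simp
    qed
    show "x = y \<or> snd x = 0 \<and> snd y = 0"
    proof (cases "b = b'")
      case True
      have "t' - t \<le> 3 * (1/2) ^ n" "t - t' \<le> 3 * (1/2) ^ n" for n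
      proof -
        have "pos n (c n b) t \<le> pos n (c n b) t' + 2" "pos n (c n b) t' \<le> pos n (c n b) t + 2"
          using close[of n] True by auto
        then show "t' - t \<le> 3 * (1/2) ^ n" "t - t' \<le> 3 * (1/2) ^ n"
          using near[OF e t t'] near[OF e t' t] by auto
      qed
      then have "t' - t \<le> 0" "t - t' \<le> 0"
        using le_all_mesh by blast+
      then show ?thesis
        using True bt bt' by simp
    next
      case False
      then obtain N where N: "c N b \<noteq> c N b'"
        using c_inj[OF b b'] by blast
      have "t \<le> 3 * (1/2) ^ n" "t' \<le> 3 * (1/2) ^ n" if n: "N \<le> n" for n
      proof -
        have "pos n (c n b) t \<le> 2" "pos n (c n b') t' \<le> 2"
          using close[of n] c_ne[OF b b' N n] by auto
        then show "t \<le> 3 * (1/2) ^ n" "t' \<le> 3 * (1/2) ^ n"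
          using small[OF e t] small[OF e' t'] by auto
      qed
      then have "t \<le> 0" "t' \<le> 0"
        using le_all_mesh by blast+
      then show ?thesis
        using t t' bt bt' by simp
    qed
  next
    assume "x = y \<or> snd x = 0 \<and> snd y = 0"
    then have "point x = point y"
    proof
      assume "snd x = 0 \<and> snd y = 0"
      then show ?thesis
        unfolding point_def bt bt' using pos_0[OF e] pos_0[OF e'] fan_coords.root_eq[OF coords e e'] by auto
    qed simp
    then show "\<Phi> x = \<Phi> y"
      by (simp add: \<Phi>_def)
  }
qed

lemma \<Phi>_quotient: "quotient_map T X \<Phi>"
proof (rule continuous_imp_quotient_map[OF \<Phi>_continuous compact_T Hausdorff])
  show "\<Phi> ` topspace T = topspace X"
    unfolding topspace_X using \<Phi>_Spec \<Phi>_surj by blast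
qed

end

section \<open>Existence of selections and partitions\<close>

context fan_seq
begin

text \<open>A lax factor \<open>p\<close> through \<open>double_walk\<close> yields the function
  \<open>p i div 2\<close> inside the relation, and \<open>p\<close> hits both \<open>2 * j\<close>
  and \<open>2 * j + 1\<close>. The width demanded is the length of the doubled spoke.\<close>

lemma selection_exists:
  assumes mn: "m \<le> n" and e: "e \<in> ends (G n)"
    and r: "refines (2 * l m (\<epsilon> m n e) + 1) (l n e) (\<alpha> m n e) (\<beta> m n e)"
  shows "\<exists>f. (\<forall>i\<le>l n e. \<alpha> m n e i \<le> f i \<and> f i \<le> \<beta> m n e i \<and> f i \<le> l m (\<epsilon> m n e)) \<and>
    (\<forall>i i'. i \<le> i' \<longrightarrow> i' \<le> l n e \<longrightarrow> f i \<le> f i') \<and>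
    (\<forall>j\<le>l m (\<epsilon> m n e). 2 \<le> card {i. i \<le> l n e \<and> f i = j})"
proof -
  let ?L = "l m (\<epsilon> m n e)" and ?L' = "l n e"
  obtain p where p: "walk ?L' (2 * ?L + 1) p p"
      "\<And>i. i \<le> ?L' \<Longrightarrow> \<alpha> m n e i \<le> p i div 2 \<and> p i div 2 \<le> \<beta> m n e i"
    using walk_lax_factor[OF walk[OF mn e] r double_walk le_refl l_pos[OF \<epsilon>_in[OF mn e]]] by blast
  have bound: "p i div 2 \<le> ?L" if "i \<le> ?L'" for i
    using p(2)[OF that] walk_bound(1)[OF walk[OF mn e] that] by simp
  have mono: "p i div 2 \<le> p i' div 2" if "i \<le> i'" "i' \<le> ?L'" for i i'
    using walk_mono(1)[OF p(1) that] by (rule div_le_mono)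
  have "2 \<le> card {i. i \<le> ?L' \<and> p i div 2 = j}" if j: "j \<le> ?L" for j
  proof -
    obtain i where i: "i \<le> ?L'" "p i = 2 * j"
      using walk_hit[OF p(1), of "2 * j"] j by auto
    obtain i' where i': "i' \<le> ?L'" "p i' = 2 * j + 1"
      using walk_hit[OF p(1), of "2 * j + 1"] j by auto
    have "i \<noteq> i'"
      using i i' by auto
    moreover have "card {i, i'} \<le> card {i. i \<le> ?L' \<and> p i div 2 = j}"
      using i i' by (intro card_mono) auto
    ultimately show ?thesis
      by simp
  qed
  then show ?thesis
    using p(2) bound mono by (intro exI[of _ "\<lambda>i. p i div 2"]) blast
qed

text \<open>The part of \<open>fan_levels\<close> that does not mention the space of branches. It is
  combined with the Cantor space when ends split, and with the inverse limit of ends when splitting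
  is still to be shown.\<close>

definition levels :: "(nat \<Rightarrow> nat) \<Rightarrow> (nat \<Rightarrow> 'a \<Rightarrow> nat \<Rightarrow> nat) \<Rightarrow> (nat \<Rightarrow> 'a \<Rightarrow> nat \<Rightarrow> real) \<Rightarrow> bool" where
  "levels \<phi> f u \<longleftrightarrow> strict_mono \<phi> \<and> (\<forall>n. refining 2 (\<phi> n) (\<phi> (Suc n))) \<and>
    (\<forall>n. \<forall>e\<in>ends (G (\<phi> n)). u n e 0 = 0 \<and> u n e (Suc (l (\<phi> n) e)) = 1 \<and>
      (\<forall>j\<le>l (\<phi> n) e. u n e j < u n e (Suc j) \<and> u n e (Suc j) - u n e j \<le> (1/2) ^ n)) \<and>
    (\<forall>n. \<forall>e\<in>ends (G (\<phi> (Suc n))). \<forall>i\<le>l (\<phi> (Suc n)) e.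
      \<alpha> (\<phi> n) (\<phi> (Suc n)) e i \<le> f n e i \<and> f n e i \<le> \<beta> (\<phi> n) (\<phi> (Suc n)) e i \<and>
      u n (\<epsilon> (\<phi> n) (\<phi> (Suc n)) e) (f n e i) \<le> u (Suc n) e i \<and>
      u (Suc n) e (Suc i) \<le> u n (\<epsilon> (\<phi> n) (\<phi> (Suc n)) e) (Suc (f n e i)))"

lemma fan_levelsI:
  assumes L: "levels \<phi> f u" and "compact_space B"
    and "\<And>n b. b \<in> topspace B \<Longrightarrow> c n b \<in> ends (G (\<phi> n))"
    and "\<And>n b. b \<in> topspace B \<Longrightarrow> \<epsilon> (\<phi> n) (\<phi> (Suc n)) (c (Suc n) b) = c n b"
    and "\<And>n. continuous_map B (discrete_topology UNIV) (c n)"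
    and "\<And>b b'. b \<in> topspace B \<Longrightarrow> b' \<in> topspace B \<Longrightarrow> (\<And>n. c n b = c n b') \<Longrightarrow> b = b'"
    and "\<And>t. (\<And>n. t n \<in> ends (G (\<phi> n))) \<Longrightarrow> (\<And>n. \<epsilon> (\<phi> n) (\<phi> (Suc n)) (t (Suc n)) = t n) \<Longrightarrow>
      \<exists>b\<in>topspace B. \<forall>n. c n b = t n"
  shows "fan_levels G R l v \<epsilon> \<alpha> \<beta> \<phi> f u B c"
proof (intro fan_levels.intro fan_levels_axioms.intro)
  show "fan_seq G R l v \<epsilon> \<alpha> \<beta>"
    by unfold_locales
  show "strict_mono \<phi>" "refining 2 (\<phi> n) (\<phi> (Suc n))" for n
    using L by (auto simp: levels_def)
  show "u n e 0 = 0" "u n e (Suc (l (\<phi> n) e)) = 1" if "e \<in> ends (G (\<phi> n))" for n e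
    using L that by (auto simp: levels_def)
  show "u n e j < u n e (Suc j)" "u n e (Suc j) - u n e j \<le> (1/2) ^ n"
    if "e \<in> ends (G (\<phi> n))" "j \<le> l (\<phi> n) e" for n e j
    using L that by (auto simp: levels_def)
  show "\<alpha> (\<phi> n) (\<phi> (Suc n)) e i \<le> f n e i \<and> f n e i \<le> \<beta> (\<phi> n) (\<phi> (Suc n)) e i"
    "u n (\<epsilon> (\<phi> n) (\<phi> (Suc n)) e) (f n e i) \<le> u (Suc n) e i \<and>
      u (Suc n) e (Suc i) \<le> u n (\<epsilon> (\<phi> n) (\<phi> (Suc n)) e) (Suc (f n e i))"
    if "e \<in> ends (G (\<phi> (Suc n)))" "i \<le> l (\<phi> (Suc n)) e" for n e i
    using L that unfolding levels_def by blast+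
qed (fact assms)+

text \<open>Splitting enters as an implication, so that one construction serves both with and
  without it.\<close>

lemma levels_exist:
  assumes fine: "\<And>m. \<exists>n. refining 2 m n"
  shows "\<exists>\<phi> f u. levels \<phi> f u \<and> ((\<forall>m. \<exists>n. splitting 2 m n) \<longrightarrow> (\<forall>n. splitting 2 (\<phi> n) (\<phi> (Suc n))))"
proof -
  have "\<exists>N. \<forall>e\<in>ends (G m). 2 * l m e + 1 \<le> N" for m
    using finite_bound[OF finite_ends[of m], where f = "\<lambda>e. 2 * l m e + 1"] by blast
  \<comment> \<open>\<open>2 * l m e + 1\<close> is the width that \<open>selection_exists\<close>
    demands; \<open>N m\<close> bounds it for all spokes of \<open>G m\<close>.\<close>
  then obtain N where N: "\<And>m e. e \<in> ends (G m) \<Longrightarrow> 2 * l m e + 1 \<le> N m"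
    by metis
  have "\<exists>n. m < n \<and> refining (max 2 (N m)) m n \<and> ((\<forall>m. \<exists>n. splitting 2 m n) \<longrightarrow> splitting 2 m n)" for m
  proof -
    obtain n where n: "refining (max 2 (N m)) m n"
      using refining_unbounded[OF fine] by blast
    obtain n' where n': "(\<forall>m. \<exists>n. splitting 2 m n) \<longrightarrow> splitting 2 m n'"
      by blast
    let ?n = "max (Suc m) (max n n')"
    have "refining (max 2 (N m)) m ?n" "(\<forall>m. \<exists>n. splitting 2 m n) \<longrightarrow> splitting 2 m ?n"
      using refining_comp[OF n] splitting_comp n' by auto
    then show ?thesis
      by (intro exI[of _ ?n]) auto
  qed
  then obtain g where g: "\<And>m. m < g m" "\<And>m. refining (max 2 (N m)) m (g m)"
      "\<And>m. (\<forall>m. \<exists>n. splitting 2 m n) \<longrightarrow> splitting 2 m (g m)"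
    by metis
  define \<phi> where "\<phi> = rec_nat 0 (\<lambda>_. g)"
  have \<phi>S: "\<phi> (Suc n) = g (\<phi> n)" for n
    by (simp add: \<phi>_def)
  have mono: "strict_mono \<phi>"
    using g(1) by (auto simp: strict_mono_Suc_iff \<phi>S)
  have le: "\<phi> n \<le> \<phi> (Suc n)" for n
    using g(1)[of "\<phi> n"] by (simp add: \<phi>S)
  have ref: "refining 2 (\<phi> n) (\<phi> (Suc n))" for n
    unfolding \<phi>S by (rule refining_mono[OF g(2)]) simp
  let ?\<epsilon> = "\<lambda>n. \<epsilon> (\<phi> n) (\<phi> (Suc n))"
  have sel: "\<exists>f. (\<forall>i\<le>l (\<phi> (Suc n)) e. \<alpha> (\<phi> n) (\<phi> (Suc n)) e i \<le> f i \<and> f i \<le> \<beta> (\<phi> n) (\<phi> (Suc n)) e i \<and> f i \<le> l (\<phi> n) (?\<epsilon> n e)) \<and>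
      (\<forall>i i'. i \<le> i' \<longrightarrow> i' \<le> l (\<phi> (Suc n)) e \<longrightarrow> f i \<le> f i') \<and>
      (\<forall>j\<le>l (\<phi> n) (?\<epsilon> n e). 2 \<le> card {i. i \<le> l (\<phi> (Suc n)) e \<and> f i = j})"
    if e: "e \<in> ends (G (\<phi> (Suc n)))" for n e
  proof (rule selection_exists[OF le e])
    have "2 * l (\<phi> n) (?\<epsilon> n e) + 1 \<le> max 2 (N (\<phi> n))"
      using N[OF \<epsilon>_in[OF le e]] by linarith
    then have "refining (2 * l (\<phi> n) (?\<epsilon> n e) + 1) (\<phi> n) (\<phi> (Suc n))"
      using g(2)[of "\<phi> n"] refining_mono unfolding \<phi>S by blast
    then show "refines (2 * l (\<phi> n) (?\<epsilon> n e) + 1) (l (\<phi> (Suc n)) e) (\<alpha> (\<phi> n) (\<phi> (Suc n)) e) (\<beta> (\<phi> n) (\<phi> (Suc n)) e)"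
      using e by (simp add: refining_def)
  qed
  have "\<forall>n. \<exists>f. \<forall>e\<in>ends (G (\<phi> (Suc n))). (\<forall>i\<le>l (\<phi> (Suc n)) e. \<alpha> (\<phi> n) (\<phi> (Suc n)) e i \<le> f e i \<and> f e i \<le> \<beta> (\<phi> n) (\<phi> (Suc n)) e i \<and> f e i \<le> l (\<phi> n) (?\<epsilon> n e)) \<and>
      (\<forall>i i'. i \<le> i' \<longrightarrow> i' \<le> l (\<phi> (Suc n)) e \<longrightarrow> f e i \<le> f e i') \<and>
      (\<forall>j\<le>l (\<phi> n) (?\<epsilon> n e). 2 \<le> card {i. i \<le> l (\<phi> (Suc n)) e \<and> f e i = j})"
    by (intro allI bchoice ballI sel)
  from choice[OF this] obtain f where f: "\<forall>n. \<forall>e\<in>ends (G (\<phi> (Suc n))). (\<forall>i\<le>l (\<phi> (Suc n)) e. \<alpha> (\<phi> n) (\<phi> (Suc n)) e i \<le> f n e i \<and> f n e i \<le> \<beta> (\<phi> n) (\<phi> (Suc n)) e i \<and> f n e i \<le> l (\<phi> n) (?\<epsilon> n e)) \<and>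
      (\<forall>i i'. i \<le> i' \<longrightarrow> i' \<le> l (\<phi> (Suc n)) e \<longrightarrow> f n e i \<le> f n e i') \<and>
      (\<forall>j\<le>l (\<phi> n) (?\<epsilon> n e). 2 \<le> card {i. i \<le> l (\<phi> (Suc n)) e \<and> f n e i = j})" ..
  define part where "part n w \<longleftrightarrow> (\<forall>e\<in>ends (G (\<phi> n)). w e 0 = (0 :: real) \<and> w e (Suc (l (\<phi> n) e)) = 1 \<and>
      (\<forall>j\<le>l (\<phi> n) e. w e j < w e (Suc j) \<and> w e (Suc j) - w e j \<le> (1/2) ^ n))" for n w
  define sub where "sub n w w' \<longleftrightarrow> (\<forall>e\<in>ends (G (\<phi> (Suc n))). \<forall>i\<le>l (\<phi> (Suc n)) e.
      w (?\<epsilon> n e) (f n e i) \<le> w' e i \<and> w' e (Suc i) \<le> w (?\<epsilon> n e) (Suc (f n e i)))" for n and w w' :: "'a \<Rightarrow> nat \<Rightarrow> real"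
  have "\<exists>u. \<forall>n. part n (u n) \<and> sub n (u n) (u (Suc n))"
  proof (rule dependent_nat_choice)
    \<comment> \<open>At level \<open>0\<close> the bound on the mesh is \<open>1\<close>, so equal
      parts will do.\<close>
    show "\<exists>w. part 0 w"
      by (intro exI[of _ "\<lambda>e j. real j / real (Suc (l (\<phi> 0) e))"]) (auto simp: part_def field_simps)
    fix w n assume w: "part n w"
    have "\<exists>w'. w' 0 = 0 \<and> w' (Suc (l (\<phi> (Suc n)) e)) = 1 \<and>
        (\<forall>i\<le>l (\<phi> (Suc n)) e. w' i < w' (Suc i) \<and> w' (Suc i) - w' i \<le> (1/2) ^ Suc n \<and>
          w (?\<epsilon> n e) (f n e i) \<le> w' i \<and> w' (Suc i) \<le> w (?\<epsilon> n e) (Suc (f n e i)))"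
      if e: "e \<in> ends (G (\<phi> (Suc n)))" for e
    proof -
      have e': "?\<epsilon> n e \<in> ends (G (\<phi> n))"
        using \<epsilon>_in[OF le e] .
      note fe = bspec[OF spec[OF f] e]
      note we = bspec[OF w[unfolded part_def] e']
      have "\<exists>w'. w' 0 = 0 \<and> w' (Suc (l (\<phi> (Suc n)) e)) = 1 \<and>
        (\<forall>i\<le>l (\<phi> (Suc n)) e. w' i < w' (Suc i) \<and> w' (Suc i) - w' i \<le> (1/2) ^ n / 2 \<and>
          w (?\<epsilon> n e) (f n e i) \<le> w' i \<and> w' (Suc i) \<le> w (?\<epsilon> n e) (Suc (f n e i)))"
        by (rule partition_refinement[where L = "l (\<phi> n) (?\<epsilon> n e)"]) (use fe we in blast)+
      then show ?thesis
        by simp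
    qed
    then have "\<forall>e\<in>ends (G (\<phi> (Suc n))). \<exists>w'. w' 0 = 0 \<and> w' (Suc (l (\<phi> (Suc n)) e)) = 1 \<and>
        (\<forall>i\<le>l (\<phi> (Suc n)) e. w' i < w' (Suc i) \<and> w' (Suc i) - w' i \<le> (1/2) ^ Suc n \<and>
          w (?\<epsilon> n e) (f n e i) \<le> w' i \<and> w' (Suc i) \<le> w (?\<epsilon> n e) (Suc (f n e i)))"
      by (rule ballI)
    from bchoice[OF this] obtain w' where w': "\<forall>e\<in>ends (G (\<phi> (Suc n))). w' e 0 = 0 \<and> w' e (Suc (l (\<phi> (Suc n)) e)) = 1 \<and>
        (\<forall>i\<le>l (\<phi> (Suc n)) e. w' e i < w' e (Suc i) \<and> w' e (Suc i) - w' e i \<le> (1/2) ^ Suc n \<and>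
          w (?\<epsilon> n e) (f n e i) \<le> w' e i \<and> w' e (Suc i) \<le> w (?\<epsilon> n e) (Suc (f n e i)))" ..
    have "part (Suc n) w'"
      unfolding part_def using w' by blast
    moreover have "sub n w w'"
      unfolding sub_def using w' by blast
    ultimately show "\<exists>w'. part (Suc n) w' \<and> sub n w w'"
      by blast
  qed
  then obtain u where u: "\<forall>n. part n (u n) \<and> sub n (u n) (u (Suc n))" ..
  have "levels \<phi> f u"
    unfolding levels_def
  proof (intro conjI allI)
    show "strict_mono \<phi>" "refining 2 (\<phi> n) (\<phi> (Suc n))" for n
      by (fact mono, fact ref)
    show "\<forall>e\<in>ends (G (\<phi> n)). u n e 0 = 0 \<and> u n e (Suc (l (\<phi> n) e)) = 1 \<and>
      (\<forall>j\<le>l (\<phi> n) e. u n e j < u n e (Suc j) \<and> u n e (Suc j) - u n e j \<le> (1/2) ^ n)" for n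
      using u unfolding part_def by blast
    show "\<forall>e\<in>ends (G (\<phi> (Suc n))). \<forall>i\<le>l (\<phi> (Suc n)) e.
      \<alpha> (\<phi> n) (\<phi> (Suc n)) e i \<le> f n e i \<and> f n e i \<le> \<beta> (\<phi> n) (\<phi> (Suc n)) e i \<and>
      u n (?\<epsilon> n e) (f n e i) \<le> u (Suc n) e i \<and> u (Suc n) e (Suc i) \<le> u n (?\<epsilon> n e) (Suc (f n e i))" for n
    proof (intro ballI allI impI)
      fix e i assume ei: "e \<in> ends (G (\<phi> (Suc n)))" "i \<le> l (\<phi> (Suc n)) e"
      have "sub n (u n) (u (Suc n))"
        using u by blast
      then show "\<alpha> (\<phi> n) (\<phi> (Suc n)) e i \<le> f n e i \<and> f n e i \<le> \<beta> (\<phi> n) (\<phi> (Suc n)) e i \<and>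
        u n (?\<epsilon> n e) (f n e i) \<le> u (Suc n) e i \<and> u (Suc n) e (Suc i) \<le> u n (?\<epsilon> n e) (Suc (f n e i))"
        using bspec[OF spec[OF f] ei(1)] ei unfolding sub_def by blast
    qed
  qed
  moreover have "splitting 2 (\<phi> n) (\<phi> (Suc n))" if "\<forall>m. \<exists>n. splitting 2 m n" for n
    unfolding \<phi>S using g(3)[of "\<phi> n"] that by blast
  ultimately show ?thesis
    by blast
qed

end

section \<open>Coding branches by binary sequences\<close>

definition is_prefix :: "bool list \<Rightarrow> (nat \<Rightarrow> bool) \<Rightarrow> bool" where
  "is_prefix w b \<longleftrightarrow> (\<forall>k<length w. b k = w ! k)"

lemma is_prefix_append: "is_prefix (w @ w') b \<longleftrightarrow> is_prefix w b \<and> is_prefix w' (\<lambda>k. b (length w + k))"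
proof
  assume *: "is_prefix (w @ w') b"
  have "b k = w ! k" if "k < length w" for k
    using * that by (auto simp: is_prefix_def nth_append dest: spec[of _ k])
  moreover have "b (length w + k) = w' ! k" if "k < length w'" for k
    using * that by (auto simp: is_prefix_def nth_append dest: spec[of _ "length w + k"])
  ultimately show "is_prefix w b \<and> is_prefix w' (\<lambda>k. b (length w + k))"
    by (simp add: is_prefix_def)
next
  assume *: "is_prefix w b \<and> is_prefix w' (\<lambda>k. b (length w + k))"
  show "is_prefix (w @ w') b"
    unfolding is_prefix_def
  proof (intro allI impI)
    fix k assume k: "k < length (w @ w')"
    show "b k = (w @ w') ! k"
    proof (cases "k < length w")
      case True
      then show ?thesis
        using * by (simp add: is_prefix_def nth_append)
    next
      case False
      then have "b (length w + (k - length w)) = w' ! (k - length w)"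
        using conjunct2[OF *] k unfolding is_prefix_def by (metis add_diff_inverse_nat length_append nat_add_left_cancel_less)
      then show ?thesis
        using False by (simp add: nth_append)
    qed
  qed
qed

lemma is_prefix_Cons: "is_prefix (x # w) b \<longleftrightarrow> b 0 = x \<and> is_prefix w (\<lambda>k. b (Suc k))"
  using is_prefix_append[of "[x]" w b] by (simp add: is_prefix_def)

lemma openin_prefix: "openin cantor_space {b. is_prefix w b}"
proof -
  have "openin cantor_space {b \<in> topspace cantor_space. b k \<in> {x}}" for k x
    unfolding cantor_space_def
    by (rule openin_continuous_map_preimage[OF continuous_map_product_projection]) auto
  then have *: "openin cantor_space {b. b k = x}" for k x
    by (simp add: cantor_space_def)
  have eq: "{b. is_prefix w b} = topspace cantor_space \<inter> (\<Inter>k\<in>{..<length w}. {b. b k = w ! k})"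
    by (auto simp: is_prefix_def cantor_space_def)
  show ?thesis
  proof (cases "w = []")
    case True
    then show ?thesis
      using openin_topspace[of cantor_space] by (simp add: is_prefix_def cantor_space_def)
  next
    case False
    then have "{..<length w} \<noteq> {}"
      by (simp add: lessThan_empty_iff)
    then show ?thesis
      unfolding eq using * by (intro openin_Int openin_INT2) auto
  qed
qed

text \<open>The words are \<open>[False]\<close>, \<open>[True, False]\<close> and so on, the last
  one consisting of \<open>True\<close> only; every binary sequence has exactly one of them as a
  prefix. A single element gets the empty word, hence the condition on the cardinality.\<close>

lemma prefix_code_exists:
  assumes "finite A" "A \<noteq> {}"
  shows "\<exists>code. (\<forall>b. \<exists>!e. e \<in> A \<and> is_prefix (code e) b) \<and> (2 \<le> card A \<longrightarrow> (\<forall>e\<in>A. code e \<noteq> []))"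
  using assms
proof (induction A rule: finite_ne_induct)
  case (singleton x)
  then show ?case
    by (intro exI[of _ "\<lambda>_. []"]) (auto simp: is_prefix_def)
next
  case (insert x A)
  then obtain code where code: "\<And>b. \<exists>!e. e \<in> A \<and> is_prefix (code e) b"
    by blast
  let ?code = "\<lambda>e. if e = x then [False] else True # code e"
  have "\<exists>!e. e \<in> insert x A \<and> is_prefix (?code e) b" for b
  proof (cases "b 0")
    case True
    from code[of "\<lambda>k. b (Suc k)"] obtain e where e: "e \<in> A" "is_prefix (code e) (\<lambda>k. b (Suc k))"
        "\<forall>e'. e' \<in> A \<and> is_prefix (code e') (\<lambda>k. b (Suc k)) \<longrightarrow> e' = e"
      unfolding Ex1_def by blast
    show ?thesis
    proof (rule ex1I[of _ e])
      show "e \<in> insert x A \<and> is_prefix (?code e) b"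
      proof -
        have "e \<noteq> x"
          using e(1) insert.hyps by blast
        then show ?thesis
          using e(1,2) True by (simp add: is_prefix_Cons)
      qed
      show "e' = e" if e': "e' \<in> insert x A \<and> is_prefix (?code e') b" for e'
      proof (cases "e' = x")
        case True
        then show ?thesis
          using e' \<open>b 0\<close> by (simp add: is_prefix_Cons)
      next
        case False
        then have "e' \<in> A \<and> is_prefix (code e') (\<lambda>k. b (Suc k))"
          using e' by (simp add: is_prefix_Cons)
        then show ?thesis
          using e(3) by blast
      qed
    qed
  next
    case False
    show ?thesis
    proof (rule ex1I[of _ x])
      show "x \<in> insert x A \<and> is_prefix (?code x) b"
        using False by (simp add: is_prefix_def)
      show "e' = x" if "e' \<in> insert x A \<and> is_prefix (?code e') b" for e'
        using that False by (auto simp: is_prefix_Cons split: if_splits)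
    qed
  qed
  then show ?case
    by (intro exI[of _ ?code]) auto
qed

text \<open>\<open>W n e\<close> concatenates the code words along the ancestors of
  \<open>e\<close>, and at each level exactly one element has its word as a prefix of
  \<open>b\<close>. Splitting makes each further word nonempty, so the words along a branch
  determine every bit of \<open>b\<close>; conversely the nested words of a branch define a
  sequence.\<close>

lemma cantor_coding:
  fixes E :: "nat \<Rightarrow> 'a set" and \<rho> :: "nat \<Rightarrow> 'a \<Rightarrow> 'a"
  assumes fin: "\<And>n. finite (E n)" and ne: "E 0 \<noteq> {}"
    and \<rho>: "\<And>n e. e \<in> E (Suc n) \<Longrightarrow> \<rho> n e \<in> E n"
    and split: "\<And>n e. e \<in> E n \<Longrightarrow> 2 \<le> card {e' \<in> E (Suc n). \<rho> n e' = e}"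
  obtains c where "\<And>n b. c n b \<in> E n" "\<And>n b. \<rho> n (c (Suc n) b) = c n b"
    "\<And>n. continuous_map cantor_space (discrete_topology UNIV) (c n)"
    "\<And>b b'. (\<And>n. c n b = c n b') \<Longrightarrow> b = b'"
    "\<And>t. (\<And>n. t n \<in> E n) \<Longrightarrow> (\<And>n. \<rho> n (t (Suc n)) = t n) \<Longrightarrow> \<exists>b. \<forall>n. c n b = t n"
proof -
  obtain code0 where code0: "\<And>b. \<exists>!e. e \<in> E 0 \<and> is_prefix (code0 e) b"
    using prefix_code_exists[OF fin ne] by blast
  define Ch where "Ch n e = {e' \<in> E (Suc n). \<rho> n e' = e}" for n e
  have Ch: "finite (Ch n e)" "Ch n e \<noteq> {}" "2 \<le> card (Ch n e)" if "e \<in> E n" for n e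
  proof -
    show "finite (Ch n e)" "2 \<le> card (Ch n e)"
      using split[OF that] fin by (auto simp: Ch_def)
    then show "Ch n e \<noteq> {}"
      by auto
  qed
  have "\<exists>code. (\<forall>b. \<exists>!e'. e' \<in> Ch n e \<and> is_prefix (code e') b) \<and> (\<forall>e'\<in>Ch n e. code e' \<noteq> [])" if "e \<in> E n" for n e
    using prefix_code_exists[OF Ch(1,2)[OF that]] Ch(3)[OF that] by blast
  then have "\<forall>n. \<exists>code. \<forall>e\<in>E n. (\<forall>b. \<exists>!e'. e' \<in> Ch n e \<and> is_prefix (code e e') b) \<and> (\<forall>e'\<in>Ch n e. code e e' \<noteq> [])"
    by (intro allI bchoice ballI)
  from choice[OF this] obtain code where
    all: "\<forall>n. \<forall>e\<in>E n. (\<forall>b. \<exists>!e'. e' \<in> Ch n e \<and> is_prefix (code n e e') b) \<and> (\<forall>e'\<in>Ch n e. code n e e' \<noteq> [])" ..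
  have code: "\<exists>!e'. e' \<in> Ch n e \<and> is_prefix (code n e e') b" if "e \<in> E n" for n e b
    using bspec[OF spec[OF all] that] by blast
  have code_ne: "code n e e' \<noteq> []" if "e \<in> E n" "e' \<in> Ch n e" for n e e'
    using bspec[OF spec[OF all] that(1)] that(2) by blast
  define W where "W = rec_nat code0 (\<lambda>n w e. w (\<rho> n e) @ code n (\<rho> n e) e)"
  have W0: "W 0 = code0" and WS: "W (Suc n) e = W n (\<rho> n e) @ code n (\<rho> n e) e" for n e
    by (simp_all add: W_def)
  have unique: "\<exists>!e. e \<in> E n \<and> is_prefix (W n e) b" for n b
  proof (induction n)
    case 0
    then show ?case
      using code0 by (simp add: W0)
  next
    case (Suc n)
    then obtain e where e: "e \<in> E n" "is_prefix (W n e) b" "\<And>e'. e' \<in> E n \<Longrightarrow> is_prefix (W n e') b \<Longrightarrow> e' = e"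
      by metis
    let ?b = "\<lambda>k. b (length (W n e) + k)"
    from code[OF e(1), of ?b] obtain e' where e': "e' \<in> Ch n e" "is_prefix (code n e e') ?b"
        "\<forall>e''. e'' \<in> Ch n e \<and> is_prefix (code n e e'') ?b \<longrightarrow> e'' = e'"
      unfolding Ex1_def by blast
    show ?case
    proof (rule ex1I[of _ e'])
      show "e' \<in> E (Suc n) \<and> is_prefix (W (Suc n) e') b"
        using e' e(2) by (simp add: WS Ch_def is_prefix_append)
      fix e'' assume e'': "e'' \<in> E (Suc n) \<and> is_prefix (W (Suc n) e'') b"
      then have "is_prefix (W n (\<rho> n e'')) b" "is_prefix (code n (\<rho> n e'') e'') (\<lambda>k. b (length (W n (\<rho> n e'')) + k))"
        by (auto simp: WS is_prefix_append)
      moreover from this have "\<rho> n e'' = e"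
        using e(3) \<rho> e'' by blast
      ultimately show "e'' = e'"
        using spec[OF e'(3), of e''] e'' by (simp add: Ch_def)
    qed
  qed
  define c where "c n b = (THE e. e \<in> E n \<and> is_prefix (W n e) b)" for n b
  have c: "c n b \<in> E n" "is_prefix (W n (c n b)) b" for n b
    using theI'[OF unique[of n b]] by (auto simp: c_def)
  have c_eq: "c n b = e" if "e \<in> E n" "is_prefix (W n e) b" for n b e
    using unique[of n b] c[of n b] that by blast
  have len: "n \<le> length (W n e)" if "e \<in> E n" for n e
    using that
  proof (induction n arbitrary: e)
    case (Suc n)
    have "code n (\<rho> n e) e \<noteq> []"
      using code_ne[OF \<rho>[OF Suc.prems]] Suc.prems by (simp add: Ch_def)
    then have "1 \<le> length (code n (\<rho> n e) e)"
      by (cases "code n (\<rho> n e) e") auto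
    then show ?case
      using Suc.IH[OF \<rho>[OF Suc.prems]] by (simp add: WS)
  qed simp
  show ?thesis
  proof
    show "c n b \<in> E n" for n b
      by (rule c(1))
    show "\<rho> n (c (Suc n) b) = c n b" for n b
      using c_eq[OF \<rho>[OF c(1)], of n b b] c(2)[of "Suc n" b] by (simp add: WS is_prefix_append)
    show "continuous_map cantor_space (discrete_topology UNIV) (c n)" for n
    proof -
      have "openin cantor_space {b \<in> topspace cantor_space. c n b \<in> Z}" for Z
      proof -
        have "{b \<in> topspace cantor_space. c n b \<in> Z} = (\<Union>e\<in>E n \<inter> Z. {b. is_prefix (W n e) b})"
        proof (intro set_eqI iffI)
          fix b assume "b \<in> {b \<in> topspace cantor_space. c n b \<in> Z}"
          then show "b \<in> (\<Union>e\<in>E n \<inter> Z. {b. is_prefix (W n e) b})"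
            using c[of n b] by blast
        next
          fix b assume "b \<in> (\<Union>e\<in>E n \<inter> Z. {b. is_prefix (W n e) b})"
          then show "b \<in> {b \<in> topspace cantor_space. c n b \<in> Z}"
            using c_eq by (auto simp: cantor_space_def)
        qed
        then show ?thesis
          using openin_prefix by (auto intro: openin_Union)
      qed
      then show ?thesis
        by (simp add: continuous_map_def)
    qed
    show "b = b'" if eq: "\<And>n. c n b = c n b'" for b b'
    proof
      fix k
      have "k < length (W (Suc k) (c (Suc k) b))"
        using len[OF c(1)[of "Suc k" b]] by simp
      then show "b k = b' k"
        using c(2)[of "Suc k" b] c(2)[of "Suc k" b'] eq[of "Suc k"] by (simp add: is_prefix_def)
    qed
    show "\<exists>b. \<forall>n. c n b = t n" if t: "\<And>n. t n \<in> E n" "\<And>n. \<rho> n (t (Suc n)) = t n" for t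
    proof -
      have pre: "\<exists>w. W n (t n) = W m (t m) @ w" if "m \<le> n" for m n
        using that
      proof (induction n rule: dec_induct)
        case (step n)
        then show ?case
          using t(2)[of n] by (auto simp: WS)
      qed simp
      \<comment> \<open>The word at level \<open>Suc k\<close> has at least \<open>Suc k\<close>
        bits, so its bit number \<open>k\<close> exists.\<close>
      define b where "b k = W (Suc k) (t (Suc k)) ! k" for k
      have "is_prefix (W n (t n)) b" for n
        unfolding is_prefix_def
      proof (intro allI impI)
        fix k assume k: "k < length (W n (t n))"
        have k': "k < length (W (Suc k) (t (Suc k)))"
          using len[OF t(1)[of "Suc k"]] by simp
        show "b k = W n (t n) ! k"
        proof (cases "n \<le> Suc k")
          case True
          then obtain w where "W (Suc k) (t (Suc k)) = W n (t n) @ w"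
            using pre by blast
          then show ?thesis
            using k by (simp add: b_def nth_append)
        next
          case False
          then obtain w where "W n (t n) = W (Suc k) (t (Suc k)) @ w"
            using pre[of "Suc k" n] by auto
          then show ?thesis
            using k' by (simp add: b_def nth_append)
        qed
      qed
      then have "c n b = t n" for n
        using c_eq[OF t(1)] by blast
      then show ?thesis
        by blast
    qed
  qed
qed

section \<open>Spectrum and Cantor fan as quotients of one space\<close>

lemma homeomorphic_of_quotient_maps:
  assumes p: "quotient_map T X p" and q: "quotient_map T Y q"
    and eq: "\<And>x y. x \<in> topspace T \<Longrightarrow> y \<in> topspace T \<Longrightarrow> p x = p y \<longleftrightarrow> q x = q y"
  shows "X homeomorphic_space Y"
proof -
  have cp: "continuous_map T X p" and cq: "continuous_map T Y q"
    using p q quotient_imp_continuous_map by blast+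
  obtain g where g: "continuous_map X Y g" "\<And>x. x \<in> topspace T \<Longrightarrow> g (p x) = q x"
    using quotient_map_lift_exists[OF p cq] eq by metis
  obtain h where h: "continuous_map Y X h" "\<And>x. x \<in> topspace T \<Longrightarrow> h (q x) = p x"
    using quotient_map_lift_exists[OF q cp] eq by metis
  have "p ` topspace T = topspace X" "q ` topspace T = topspace Y"
    using p q quotient_imp_surjective_map by blast+
  then have "homeomorphic_maps X Y g h"
    unfolding homeomorphic_maps_def using g h by force
  then show ?thesis
    unfolding homeomorphic_space_def by blast
qed

definition fan_equiv :: "(((nat \<Rightarrow> bool) \<times> real) \<times> ((nat \<Rightarrow> bool) \<times> real)) set" where
  "fan_equiv = {(x, y). x \<in> topspace (prod_topology cantor_space (top_of_set {0..1})) \<and>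
     y \<in> topspace (prod_topology cantor_space (top_of_set {0..1})) \<and> (x = y \<or> snd x = 0 \<and> snd y = 0)}"

abbreviation cantor_square :: "((nat \<Rightarrow> bool) \<times> real) topology" where
  "cantor_square \<equiv> prod_topology cantor_space (top_of_set {0..1})"

lemma cantor_fan_quotient: "quotient_map cantor_square cantor_fan (\<lambda>x. fan_equiv `` {x})"
  unfolding cantor_fan_def fan_equiv_def Let_def by (rule quotient_map_quotient_topology)

lemma fan_equiv_class_eq:
  assumes "x \<in> topspace cantor_square" "y \<in> topspace cantor_square"
  shows "fan_equiv `` {x} = fan_equiv `` {y} \<longleftrightarrow> x = y \<or> snd x = 0 \<and> snd y = 0"
proof
  assume "fan_equiv `` {x} = fan_equiv `` {y}"
  moreover have "y \<in> fan_equiv `` {y}"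
    using assms by (simp add: fan_equiv_def)
  ultimately have "(x, y) \<in> fan_equiv"
    by blast
  then show "x = y \<or> snd x = 0 \<and> snd y = 0"
    by (simp add: fan_equiv_def)
qed (use assms in \<open>auto simp: fan_equiv_def\<close>)

lemma compact_cantor_space: "compact_space cantor_space"
  unfolding cantor_space_def by (simp add: compact_space_product_topology compact_space_discrete_topology)

text \<open>With splitting, the Cantor space parametrises the branches of ends. Then both spaces are
  quotients of \<open>cantor_square\<close>, and both quotient maps identify just the points of
  height \<open>0\<close>.\<close>

lemma (in fan_seq) spectrum_cantor_fan:
  assumes fine: "\<And>m. \<exists>n. refining 2 m n \<and> splitting 2 m n"
  shows "X homeomorphic_space cantor_fan"
proof -
  have ref: "\<exists>n. refining 2 m n" and spl: "\<exists>n. splitting 2 m n" for m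
    using fine by blast+
  obtain \<phi> f u where L: "levels \<phi> f u" and split: "\<And>n. splitting 2 (\<phi> n) (\<phi> (Suc n))"
    using levels_exist[OF ref] spl by blast
  have le: "\<phi> n \<le> \<phi> (Suc n)" for n
    using split[of n] by (simp add: splitting_def)
  obtain c where c: "\<And>n b. c n b \<in> ends (G (\<phi> n))" "\<And>n b. \<epsilon> (\<phi> n) (\<phi> (Suc n)) (c (Suc n) b) = c n b"
    "\<And>n. continuous_map cantor_space (discrete_topology UNIV) (c n)"
    "\<And>b b'. (\<And>n. c n b = c n b') \<Longrightarrow> b = b'"
    "\<And>t. (\<And>n. t n \<in> ends (G (\<phi> n))) \<Longrightarrow> (\<And>n. \<epsilon> (\<phi> n) (\<phi> (Suc n)) (t (Suc n)) = t n) \<Longrightarrow> \<exists>b. \<forall>n. c n b = t n"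
  proof (rule cantor_coding[of "\<lambda>n. ends (G (\<phi> n))" "\<lambda>n. \<epsilon> (\<phi> n) (\<phi> (Suc n))"])
    show "2 \<le> card {e' \<in> ends (G (\<phi> (Suc n))). \<epsilon> (\<phi> n) (\<phi> (Suc n)) e' = e}" if "e \<in> ends (G (\<phi> n))" for n e
      using split[of n] that by (simp add: splitting_def)
  qed (use finite_ends ends_nonempty \<epsilon>_in[OF le] in blast)+
  interpret L: fan_levels G R l v \<epsilon> \<alpha> \<beta> \<phi> f u cantor_space c
  proof (rule fan_levelsI[OF L compact_cantor_space])
    show "\<exists>b\<in>topspace cantor_space. \<forall>n. c n b = t n"
      if "\<And>n. t n \<in> ends (G (\<phi> n))" "\<And>n. \<epsilon> (\<phi> n) (\<phi> (Suc n)) (t (Suc n)) = t n" for t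
      using c(5)[OF that] by (simp add: cantor_space_def)
    show "c n b \<in> ends (G (\<phi> n))" "\<epsilon> (\<phi> n) (\<phi> (Suc n)) (c (Suc n) b) = c n b" for n b
      by (fact c(1), fact c(2))
    show "b = b'" if "\<And>n. c n b = c n b'" for b b'
      by (rule c(4)[OF that])
  qed (fact c(3))
  show ?thesis
  proof (rule homeomorphic_of_quotient_maps[OF L.\<Phi>_quotient cantor_fan_quotient])
    fix x y assume "x \<in> topspace cantor_square" "y \<in> topspace cantor_square"
    then show "L.\<Phi> x = L.\<Phi> y \<longleftrightarrow> fan_equiv `` {x} = fan_equiv `` {y}"
      using L.\<Phi>_eq_iff fan_equiv_class_eq by simp
  qed
qed

section \<open>The Cantor fan\<close>

lemma topspace_cantor_square: "x \<in> topspace cantor_square \<longleftrightarrow> 0 \<le> snd x \<and> snd x \<le> 1"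
  by (auto simp: cantor_space_def mem_Times_iff)

lemma topspace_cantor_fan: "topspace cantor_fan = (\<lambda>x. fan_equiv `` {x}) ` topspace cantor_square"
  using quotient_imp_surjective_map[OF cantor_fan_quotient] by simp

lemma compact_cantor_fan: "compact_space cantor_fan"
proof -
  have "compact_space cantor_square"
    using compact_cantor_space by (simp add: compact_space_prod_topology compact_space_subtopology)
  then have "compactin cantor_fan ((\<lambda>x. fan_equiv `` {x}) ` topspace cantor_square)"
    using image_compactin quotient_imp_continuous_map[OF cantor_fan_quotient] compact_space_def by blast
  then show ?thesis
    unfolding compact_space_def topspace_cantor_fan .
qed

lemma continuous_cantor_coordinate: "continuous_map cantor_space (discrete_topology UNIV) (\<lambda>b. b k)"
  unfolding cantor_space_def by (rule continuous_map_product_projection) simp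

lemma continuous_snd_square: "continuous_map cantor_square euclideanreal snd"
  using continuous_map_snd[of cantor_space "top_of_set {0..1::real}"] by (simp add: continuous_map_in_subtopology)

text \<open>Multiplication by the height makes the coordinate vanish at the root, so that the
  function descends to the fan.\<close>

lemma continuous_branch_square:
  "continuous_map cantor_square euclideanreal (\<lambda>x. snd x * (if fst x k then 1 else 0))"
proof (rule continuous_map_real_mult[OF continuous_snd_square])
  have "continuous_map cantor_square (discrete_topology UNIV) ((\<lambda>b. b k) \<circ> fst)"
    by (rule continuous_map_compose[OF continuous_map_fst continuous_cantor_coordinate])
  moreover have "continuous_map (discrete_topology UNIV) euclideanreal (\<lambda>b. if b then 1 else 0)"
    by simp
  ultimately have "continuous_map cantor_square euclideanreal ((\<lambda>b. if b then 1 else 0) \<circ> ((\<lambda>b. b k) \<circ> fst))"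
    by (rule continuous_map_compose)
  then show "continuous_map cantor_square euclideanreal (\<lambda>x. if fst x k then 1 else 0)"
    by (simp add: comp_def)
qed

text \<open>Points are separated by real functions on the square that are constant at height
  \<open>0\<close>: the height itself, or a coordinate scaled by the height if the heights
  agree.\<close>

lemma Hausdorff_cantor_fan: "Hausdorff_space cantor_fan"
  unfolding Hausdorff_space_def
proof (intro allI impI)
  fix p q assume pq: "p \<in> topspace cantor_fan \<and> q \<in> topspace cantor_fan \<and> p \<noteq> q"
  obtain x where x: "x \<in> topspace cantor_square" "p = fan_equiv `` {x}"
    using pq unfolding topspace_cantor_fan by blast
  obtain y where y: "y \<in> topspace cantor_square" "q = fan_equiv `` {y}"
    using pq unfolding topspace_cantor_fan by blast
  have ne: "x \<noteq> y" "\<not> (snd x = 0 \<and> snd y = 0)"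
    using pq fan_equiv_class_eq[OF x(1) y(1)] x y by auto
  have "\<exists>F. continuous_map cantor_square euclideanreal F \<and> (\<forall>x y. snd x = 0 \<and> snd y = 0 \<longrightarrow> F x = F y) \<and> F x \<noteq> F y"
  proof (cases "snd x = snd y")
    case False
    then show ?thesis
      using continuous_snd_square by (intro exI[of _ snd]) auto
  next
    case True
    then have "fst x \<noteq> fst y"
      using ne(1) by (simp add: prod_eq_iff)
    then obtain k where "fst x k \<noteq> fst y k"
      by blast
    then show ?thesis
      using continuous_branch_square[of k] True ne(2) by (intro exI[of _ "\<lambda>x. snd x * (if fst x k then 1 else 0)"]) auto
  qed
  then obtain F where F: "continuous_map cantor_square euclideanreal F" "\<And>x y. snd x = 0 \<Longrightarrow> snd y = 0 \<Longrightarrow> F x = F y" "F x \<noteq> F y"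
    by blast
  obtain g where g: "continuous_map cantor_fan euclideanreal g" "\<And>x. x \<in> topspace cantor_square \<Longrightarrow> g (fan_equiv `` {x}) = F x"
  proof (rule quotient_map_lift_exists[OF cantor_fan_quotient F(1)])
    fix x y assume "x \<in> topspace cantor_square" "y \<in> topspace cantor_square" "fan_equiv `` {x} = fan_equiv `` {y}"
    then have "x = y \<or> snd x = 0 \<and> snd y = 0"
      using fan_equiv_class_eq by simp
    then show "F x = F y"
      using F(2) by blast
  qed blast
  have "g p \<noteq> g q"
    using g(2) x y F(3) by simp
  then obtain V V' where V: "open V" "open V'" "g p \<in> V" "g q \<in> V'" "V \<inter> V' = {}"
    by (metis hausdorff)
  have "openin cantor_fan {z \<in> topspace cantor_fan. g z \<in> V}" "openin cantor_fan {z \<in> topspace cantor_fan. g z \<in> V'}"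
    using openin_continuous_map_preimage[OF g(1)] V(1,2) by auto
  moreover have "disjnt {z \<in> topspace cantor_fan. g z \<in> V} {z \<in> topspace cantor_fan. g z \<in> V'}"
    using V(5) by (auto simp: disjnt_def)
  ultimately show "\<exists>W W'. openin cantor_fan W \<and> openin cantor_fan W' \<and> p \<in> W \<and> q \<in> W' \<and> disjnt W W'"
    using V(3,4) pq by blast
qed

lemma connected_cantor_fan: "connected_space cantor_fan"
proof -
  let ?q = "\<lambda>x. fan_equiv `` {x}"
  let ?A = "\<lambda>b. ?q ` ({b} \<times> {0..1})"
  have "connectedin cantor_fan (\<Union> (range ?A))"
  proof (rule connectedin_Union)
    fix S assume "S \<in> range ?A"
    then obtain b where S: "S = ?A b"
      by blast
    have "connectedin (top_of_set {0..1}) {0..1::real}"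
      by (simp add: connectedin_subtopology)
    then have "connectedin cantor_square ({b} \<times> {0..1})"
      unfolding connectedin_Times by (simp add: cantor_space_def)
    then show "connectedin cantor_fan S"
      unfolding S by (rule connectedin_continuous_map_image[OF quotient_imp_continuous_map[OF cantor_fan_quotient]])
  next
    have "?q (undefined, 0) \<in> ?A b" for b
    proof -
      have "(c, 0) \<in> topspace cantor_square" for c
        unfolding topspace_cantor_square by simp
      from fan_equiv_class_eq[OF this this] have "?q (undefined, 0) = ?q (b, 0)"
        by simp
      then show ?thesis
        by auto
    qed
    then show "\<Inter> (range ?A) \<noteq> {}"
      by blast
  qed
  moreover have "\<Union> (range ?A) = topspace cantor_fan"
  proof -
    have "topspace cantor_square = (\<Union>b. {b} \<times> {0..1})"
      by (auto simp: cantor_space_def)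
    then show ?thesis
      unfolding topspace_cantor_fan by (simp only: image_UN)
  qed
  ultimately show ?thesis
    using connectedin_topspace by metis
qed

text \<open>A basic open set restricts finitely many coordinates only; flipping a free one shows
  that there are no isolated points.\<close>

lemma openin_cantor_space_neighbour:
  assumes "openin cantor_space V" "b \<in> V"
  obtains k where "b(k := \<not> b k) \<in> V"
proof -
  obtain Z where Z: "finite {i. Z i \<noteq> (UNIV :: bool set)}" "b \<in> (\<Pi>\<^sub>E i\<in>UNIV. Z i)" "(\<Pi>\<^sub>E i\<in>UNIV. Z i) \<subseteq> V"
    using assms unfolding cantor_space_def openin_product_topology_alt by auto
  obtain k where k: "Z k = UNIV"
    using ex_new_if_finite[OF infinite_UNIV_nat Z(1)] by auto
  have "b(k := \<not> b k) \<in> (\<Pi>\<^sub>E i\<in>UNIV. Z i)"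
    using Z(2) k by (auto simp: PiE_iff)
  then show ?thesis
    using that Z(3) by blast
qed

text \<open>An open set that misses the root contains points on two branches that differ in some
  coordinate \<open>k\<close>. The value of this coordinate divides the complement of the root into
  two open sets, which would disconnect \<open>W\<close>.\<close>

lemma open_connected_cantor_fan:
  assumes W: "openin cantor_fan W" "connectedin cantor_fan W" "W \<noteq> {}"
  shows "fan_equiv `` {(\<lambda>_. False, 0)} \<in> W"
proof (rule ccontr)
  let ?q = "\<lambda>x. fan_equiv `` {x}" and ?r = "(\<lambda>_. False, 0)"
  assume no: "?q ?r \<notin> W"
  let ?W = "{x \<in> topspace cantor_square. ?q x \<in> W}"
  have open_W: "openin cantor_square ?W"
    by (rule openin_continuous_map_preimage[OF quotient_imp_continuous_map[OF cantor_fan_quotient] W(1)])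
  have r: "?r \<in> topspace cantor_square"
    unfolding topspace_cantor_square by simp
  have pos: "0 < snd x" if x: "x \<in> ?W" for x
  proof (rule ccontr)
    assume "\<not> 0 < snd x"
    then have "snd x = 0"
      using x topspace_cantor_square[of x] by simp
    then have "?q x = ?q ?r"
      using fan_equiv_class_eq[of x ?r] x r by simp
    then show False
      using x no by simp
  qed
  have WT: "W \<subseteq> ?q ` ?W"
    using openin_subset[OF W(1)] unfolding topspace_cantor_fan by blast
  then obtain x where "x \<in> ?W"
    using W(3) by blast
  then obtain b t where bt: "(b, t) \<in> ?W"
    by (cases x) blast
  obtain V V' where V: "openin cantor_space V" "b \<in> V" "t \<in> V'" "V \<times> V' \<subseteq> ?W"
    using open_W bt unfolding openin_prod_topology_alt by blast
  obtain k where k: "b(k := \<not> b k) \<in> V"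
    by (rule openin_cantor_space_neighbour[OF V(1,2)])
  then have bt': "(b(k := \<not> b k), t) \<in> ?W"
    using V(3,4) by blast
  \<comment> \<open>Positive height makes these sets saturated, so their images in the quotient are
    open.\<close>
  let ?A = "\<lambda>x. {y \<in> topspace cantor_square. 0 < snd y \<and> fst y k = x}"
  have sat: "z \<in> ?A x" if z: "z \<in> topspace cantor_square" "?q z \<in> ?q ` ?A x" for z x
  proof -
    obtain y where y: "y \<in> ?A x" "?q z = ?q y"
      using z(2) by blast
    then have "z = y \<or> snd z = 0 \<and> snd y = 0"
      using fan_equiv_class_eq[OF z(1), of y] by simp
    then show ?thesis
      using y(1) by auto
  qed
  have open_A: "openin cantor_fan (?q ` ?A x)" for x
  proof -
    have "?A x = {y \<in> topspace cantor_square. snd y \<in> {0<..}} \<inter> {y \<in> topspace cantor_square. ((\<lambda>b. b k) \<circ> fst) y \<in> {x}}"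
      by auto
    moreover have "openin cantor_square {y \<in> topspace cantor_square. snd y \<in> {0<..}}"
      by (rule openin_continuous_map_preimage[OF continuous_snd_square]) simp
    moreover have "openin cantor_square {y \<in> topspace cantor_square. ((\<lambda>b. b k) \<circ> fst) y \<in> {x}}"
      by (rule openin_continuous_map_preimage[OF continuous_map_compose[OF continuous_map_fst continuous_cantor_coordinate]]) simp
    ultimately have "openin cantor_square (?A x)"
      by (simp only: openin_Int)
    moreover have "{z \<in> topspace cantor_square. ?q z \<in> ?q ` ?A x} = ?A x"
      using sat by blast
    ultimately have "openin cantor_square {z \<in> topspace cantor_square. ?q z \<in> ?q ` ?A x}"
      by simp
    moreover have "?q ` ?A x \<subseteq> topspace cantor_fan"
      unfolding topspace_cantor_fan by blast
    ultimately show ?thesis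
      using cantor_fan_quotient unfolding quotient_map_def by blast
  qed
  have in_A: "?q (b', t') \<in> ?q ` ?A (b' k)" if "(b', t') \<in> ?W" for b' t'
    using pos[OF that] that by (intro imageI) simp
  have disj: "?q ` ?A True \<inter> ?q ` ?A False = {}"
  proof (rule ccontr)
    assume "?q ` ?A True \<inter> ?q ` ?A False \<noteq> {}"
    then obtain z where z: "z \<in> ?A True" "?q z \<in> ?q ` ?A False"
      by blast
    then have "z \<in> ?A False"
      using sat[of z False] by blast
    then show False
      using z(1) by simp
  qed
  have cover: "W \<subseteq> ?q ` ?A True \<union> ?q ` ?A False"
  proof
    fix w assume "w \<in> W"
    then obtain b' t' where "(b', t') \<in> ?W" "w = ?q (b', t')"
      using WT by fastforce
    then show "w \<in> ?q ` ?A True \<union> ?q ` ?A False"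
      using in_A[of b' t'] by (cases "b' k") auto
  qed
  have meet: "?q ` ?A x \<inter> W \<noteq> {}" for x
  proof -
    have "?q (b, t) \<in> W" "?q (b(k := \<not> b k), t) \<in> W"
      using bt bt' by auto
    then show ?thesis
      using in_A[OF bt] in_A[OF bt'] by (cases "b k = x") auto
  qed
  have "?q ` ?A True \<inter> ?q ` ?A False \<inter> W = {}"
    unfolding disj by simp
  then have "\<exists>E1 E2. openin cantor_fan E1 \<and> openin cantor_fan E2 \<and> W \<subseteq> E1 \<union> E2 \<and>
      E1 \<inter> E2 \<inter> W = {} \<and> E1 \<inter> W \<noteq> {} \<and> E2 \<inter> W \<noteq> {}"
    by (intro exI conjI) (rule open_A open_A cover meet meet | assumption)+
  with conjunct2[OF W(2)[unfolded connectedin]] show False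
    by (rule notE)
qed

section \<open>From the Cantor fan back to refinement and splitting\<close>

context fan_seq
begin

text \<open>The edge from \<open>j\<close> to \<open>Suc j\<close> is the only one between the
  vertices beyond \<open>j\<close> on a spoke and all other vertices. Since sets \<open>U\<close> of
  one level meet only along edges, disjointness along this edge would divide the spectrum into two
  open parts.\<close>

lemma connected_adjacent:
  assumes conn: "connected_space X" and pq: "(p, q) \<in> edges (G n)"
  shows "U n p \<inter> U n q \<noteq> {}"
proof -
  have consecutive: "U n (v n e j) \<inter> U n (v n e (Suc j)) \<noteq> {}" if e: "e \<in> ends (G n)" and j: "Suc j \<le> l n e" for e j
  proof (rule ccontr)
    assume no: "\<not> ?thesis"
    define V2 where "V2 = {v n e i | i. Suc j \<le> i \<and> i \<le> l n e}"
    define V1 where "V1 = verts (G n) - V2"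
    define O1 where "O1 = (\<Union>x\<in>V1. U n x)"
    define O2 where "O2 = (\<Union>x\<in>V2. U n x)"
    have V2: "V2 \<subseteq> verts (G n)" "v n e (Suc j) \<in> V2"
      using fan_coords.vertI[OF coords e] j by (auto simp: V2_def)
    have "v n e j \<notin> V2"
      using fan_coords.v_eq[OF coords e e] j by (auto simp: V2_def)
    then have V1: "v n e j \<in> V1"
      using fan_coords.vertI[OF coords e] j by (auto simp: V1_def)
    have opens: "openin X O1" "openin X O2"
      using openin_U unfolding O1_def O2_def by auto
    have cover: "topspace X \<subseteq> O1 \<union> O2"
    proof
      fix S assume "S \<in> topspace X"
      then obtain x where "x \<in> verts (G n)" "S \<in> U n x"
        using U_cover[of S n] topspace_X by blast
      then show "S \<in> O1 \<union> O2"
        unfolding O1_def O2_def V1_def by blast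
    qed
    have "U n (v n e j) \<noteq> {}" "U n (v n e (Suc j)) \<noteq> {}"
      using U_nonempty fan_coords.vertI[OF coords e] j by simp_all
    moreover have "U n (v n e j) \<subseteq> O1" "U n (v n e (Suc j)) \<subseteq> O2"
      unfolding O1_def O2_def using V1 V2(2) by (auto intro: UN_upper)
    ultimately have "O1 \<noteq> {}" "O2 \<noteq> {}"
      by auto
    then have "O1 \<inter> O2 \<noteq> {}"
      using conn opens cover unfolding connected_space_def by metis
    then obtain S x y where S: "x \<in> V1" "y \<in> V2" "S \<in> U n x" "S \<in> U n y"
      unfolding O1_def O2_def by blast
    obtain i where i: "y = v n e i" "Suc j \<le> i" "i \<le> l n e"
      using S(2) by (auto simp: V2_def)
    have "x \<in> verts (G n)"
      using S(1) by (simp add: V1_def)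
    then obtain a b where ab: "a \<in> ends (G n)" "b \<le> l n a" "x = v n a b"
      by (rule fan_coords.vertE[OF coords])
    have adj: "a = e \<and> b \<le> Suc i \<and> i \<le> Suc b \<or> b + i \<le> 1"
      using U_meet[OF S(3,4)] fan_coords.edge_iff[OF coords ab(1) e ab(2) i(3)] ab(3) i(1) by simp
    have "x = v n e j \<and> i = Suc j"
    proof (cases "a = e \<and> b \<le> Suc i \<and> i \<le> Suc b")
      case True
      then have "\<not> Suc j \<le> b"
        using S(1) ab unfolding V1_def V2_def by blast
      then have "b = j" "i = Suc j"
        using True i(2) by linarith+
      then show ?thesis
        using True ab(3) by simp
    next
      case False
      then have "b = 0" "i = 1" "j = 0"
        using adj i(2) by auto
      then show ?thesis
        using fan_coords.root_eq[OF coords ab(1) e] ab(3) by simp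
    qed
    then show False
      using no S i by blast
  qed
  have V: "p \<in> verts (G n)" "q \<in> verts (G n)"
    using edges_sub[OF pq] by auto
  obtain e i where p: "e \<in> ends (G n)" "i \<le> l n e" "p = v n e i"
    using V(1) by (rule fan_coords.vertE[OF coords])
  obtain e' j where q: "e' \<in> ends (G n)" "j \<le> l n e'" "q = v n e' j"
    using V(2) by (rule fan_coords.vertE[OF coords])
  have "e = e' \<and> i \<le> Suc j \<and> j \<le> Suc i \<or> i + j \<le> 1"
    using fan_coords.edge_iff[OF coords p(1) q(1) p(2) q(2)] pq p(3) q(3) by simp
  then consider "e = e'" "i = j" | "e = e'" "j = Suc i" | "e = e'" "i = Suc j" | "i = 0" "j = 0" | "i = 0" "j = 1" | "i = 1" "j = 0"
    by linarith
  then show ?thesis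
  proof cases
    case 1
    then show ?thesis
      using U_nonempty[OF V(1)] p q by simp
  next
    case 2
    then show ?thesis
      using consecutive[OF p(1), of i] p q by simp
  next
    case 3
    then show ?thesis
      using consecutive[OF p(1), of j] p q by (simp add: Int_commute)
  next
    case 4
    then have "p = q"
      using fan_coords.root_eq[OF coords p(1) q(1)] p q by simp
    then show ?thesis
      using U_nonempty[OF V(1)] by simp
  next
    case 5
    then have "p = v n e' 0"
      using fan_coords.root_eq[OF coords p(1) q(1)] p by simp
    then show ?thesis
      using consecutive[OF q(1), of 0] q 5 by simp
  next
    case 6
    then have "q = v n e 0"
      using fan_coords.root_eq[OF coords q(1) p(1)] q by simp
    then show ?thesis
      using consecutive[OF p(1), of 0] p 6 by (simp add: Int_commute)
  qed
qed

text \<open>An end that is split remains so at later levels, and \<open>G m\<close> has finitely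
  many ends; if each were split eventually, one level would split all of them.\<close>

lemma unsplit_end:
  assumes "\<And>n. \<not> splitting 2 m n"
  obtains e where "e \<in> ends (G m)"
    "\<And>n e1 e2. m \<le> n \<Longrightarrow> e1 \<in> ends (G n) \<Longrightarrow> e2 \<in> ends (G n) \<Longrightarrow> \<epsilon> m n e1 = e \<Longrightarrow> \<epsilon> m n e2 = e \<Longrightarrow> e1 = e2"
proof -
  let ?K = "\<lambda>n e. m \<le> n \<and> (\<exists>e1\<in>ends (G n). \<exists>e2\<in>ends (G n). e1 \<noteq> e2 \<and> \<epsilon> m n e1 = e \<and> \<epsilon> m n e2 = e)"
  have "\<exists>e\<in>ends (G m). \<forall>n. \<not> ?K n e"
  proof (rule ccontr)
    assume "\<not> ?thesis"
    then have ex: "\<exists>n. ?K n e" if "e \<in> ends (G m)" for e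
      using that by blast
    have "\<exists>n. \<forall>e\<in>ends (G m). ?K n e"
    proof (rule finite_common[OF finite_ends ex])
      fix k n e assume kn: "k \<le> n" and K: "?K k e"
      obtain e1 e2 where e: "m \<le> k" "e1 \<in> ends (G k)" "e2 \<in> ends (G k)" "e1 \<noteq> e2" "\<epsilon> m k e1 = e" "\<epsilon> m k e2 = e"
        using K by blast
      have "\<exists>x\<in>ends (G n). \<epsilon> k n x = y" if "y \<in> ends (G k)" for y
      proof -
        have "y \<in> \<epsilon> k n ` ends (G n)"
          using \<epsilon>_surj[OF kn] that by simp
        then show ?thesis
          by blast
      qed
      then obtain x1 x2 where x: "x1 \<in> ends (G n)" "\<epsilon> k n x1 = e1" "x2 \<in> ends (G n)" "\<epsilon> k n x2 = e2"
        using e(2,3) by metis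
      have "\<epsilon> m n x1 = e" "\<epsilon> m n x2 = e" "x1 \<noteq> x2"
        using comp(1)[OF e(1) kn x(1)] comp(1)[OF e(1) kn x(3)] x e by auto
      then show "?K n e"
        using x e(1) kn by auto
    qed
    then obtain n where n: "\<forall>e\<in>ends (G m). ?K n e"
      by blast
    have mn: "m \<le> n"
      using n ends_nonempty by blast
    have "splitting 2 m n"
      unfolding splitting_def
    proof (intro conjI ballI mn)
      fix e assume "e \<in> ends (G m)"
      then obtain e1 e2 where e: "e1 \<in> ends (G n)" "e2 \<in> ends (G n)" "e1 \<noteq> e2" "\<epsilon> m n e1 = e" "\<epsilon> m n e2 = e"
        using n by blast
      have "card {e1, e2} \<le> card {e' \<in> ends (G n). \<epsilon> m n e' = e}"
        using e finite_ends by (intro card_mono) auto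
      then show "2 \<le> card {e' \<in> ends (G n). \<epsilon> m n e' = e}"
        using e(3) by simp
    qed
    then show False
      using assms by blast
  qed
  then show ?thesis
    using that by blast
qed

text \<open>An end that is never split gives an isolated branch, hence an arc open in the spectrum and
  two disjoint connected open sets; in the Cantor fan, connected open sets contain the root.\<close>

lemma splitting_if_cantor_fan:
  assumes hom: "X homeomorphic_space cantor_fan" and fine: "\<And>m. \<exists>n. refining 2 m n"
  shows "\<exists>n. splitting 2 m n"
proof (rule ccontr)
  assume "\<not> ?thesis"
  then have "\<not> splitting 2 m n" for n
    by blast
  then obtain e where e: "e \<in> ends (G m)"
    "\<And>n e1 e2. m \<le> n \<Longrightarrow> e1 \<in> ends (G n) \<Longrightarrow> e2 \<in> ends (G n) \<Longrightarrow> \<epsilon> m n e1 = e \<Longrightarrow> \<epsilon> m n e2 = e \<Longrightarrow> e1 = e2"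
    by (rule unsplit_end) blast
  obtain \<phi> f u where L: "levels \<phi> f u"
    using levels_exist[OF fine] by blast
  have sm: "strict_mono \<phi>"
    using L by (simp add: levels_def)
  have le: "\<phi> j \<le> \<phi> k" if "j \<le> k" for j k
    using strict_mono_less_eq[OF sm] that by simp
  let ?E = "\<lambda>n. ends (G (\<phi> n))" and ?\<rho> = "\<lambda>n. \<epsilon> (\<phi> n) (\<phi> (Suc n))"
  define Q where "Q = product_topology (\<lambda>n. discrete_topology (?E n)) UNIV"
  have Q_iff: "b \<in> topspace Q \<longleftrightarrow> (\<forall>n. b n \<in> ?E n)" for b
    by (auto simp: Q_def PiE_iff)
  have proj: "continuous_map Q (discrete_topology (?E n)) (\<lambda>b. b n)" for n
    unfolding Q_def by (rule continuous_map_product_projection) simp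
  have proj_U: "continuous_map Q (discrete_topology UNIV) (\<lambda>b. b n)" for n
  proof -
    have "continuous_map (discrete_topology (?E n)) (discrete_topology UNIV) (\<lambda>x. x)"
      by simp
    from continuous_map_compose[OF proj this] show ?thesis
      by (simp add: comp_def)
  qed
  define Br where "Br = {b \<in> topspace Q. \<forall>n. ?\<rho> n (b (Suc n)) = b n}"
  have "closedin Q {b \<in> topspace Q. ?\<rho> n (b (Suc n)) = b n}" for n
  proof -
    have clo: "closedin Q {b \<in> topspace Q. b k = x}" for k x
      using closedin_continuous_map_preimage[OF proj_U, of "{x}" k] by simp
    have "{b \<in> topspace Q. ?\<rho> n (b (Suc n)) = b n} =
        (\<Union>x\<in>?E (Suc n). {b \<in> topspace Q. b (Suc n) = x} \<inter> {b \<in> topspace Q. b n = ?\<rho> n x})"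
      by (auto simp: Q_iff)
    moreover have "closedin Q (\<Union>x\<in>?E (Suc n). {b \<in> topspace Q. b (Suc n) = x} \<inter> {b \<in> topspace Q. b n = ?\<rho> n x})"
      using finite_ends by (intro closedin_Union) (auto intro!: closedin_Int clo)
    ultimately show ?thesis
      by simp
  qed
  then have "closedin Q (\<Inter>n. {b \<in> topspace Q. ?\<rho> n (b (Suc n)) = b n})"
    by (intro closedin_INT) auto
  moreover have "(\<Inter>n. {b \<in> topspace Q. ?\<rho> n (b (Suc n)) = b n}) = Br"
    by (auto simp: Br_def)
  ultimately have "closedin Q Br"
    by simp
  moreover have "compact_space Q"
    unfolding Q_def using finite_ends by (simp add: compact_space_product_topology compact_space_discrete_topology)
  ultimately have "compactin Q Br"
    using closedin_compact_space by blast
  then have compact: "compact_space (subtopology Q Br)"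
    by (rule compact_space_subtopology)
  have topB: "topspace (subtopology Q Br) = Br"
    by (auto simp: Br_def)
  have Br_iff: "b \<in> Br \<longleftrightarrow> (\<forall>n. b n \<in> ?E n) \<and> (\<forall>n. ?\<rho> n (b (Suc n)) = b n)" for b
    unfolding Br_def using Q_iff by blast
  interpret L: fan_levels G R l v \<epsilon> \<alpha> \<beta> \<phi> f u "subtopology Q Br" "\<lambda>n b. b n"
  proof (rule fan_levelsI[OF L compact])
    show "\<exists>b\<in>topspace (subtopology Q Br). \<forall>n. b n = t n"
      if "\<And>n. t n \<in> ?E n" "\<And>n. ?\<rho> n (t (Suc n)) = t n" for t
      unfolding topB using that by (intro bexI[of _ t]) (auto simp: Br_iff)
    show "continuous_map (subtopology Q Br) (discrete_topology UNIV) (\<lambda>b. b n)" for n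
      by (rule continuous_map_from_subtopology[OF proj_U])
    show "b = b'" if "\<And>n. b n = b' n" for b b' :: "nat \<Rightarrow> 'a"
      using that by blast
  qed (unfold topB Br_iff, blast+)
  obtain t where t: "thread t" "t m = e"
    by (rule thread_through[OF e(1)])
  define N where "N = m"
  have mN: "m \<le> \<phi> N"
    unfolding N_def by (rule strict_mono_imp_increasing[OF sm])
  define b0 where "b0 n = t (\<phi> n)" for n
  have b0: "b0 \<in> Br"
    unfolding Br_iff b0_def using thread_ends[OF t(1)] thread_\<epsilon>[OF t(1) le] by simp
  have Br_\<epsilon>: "\<epsilon> (\<phi> j) (\<phi> k) (b k) = b j" if b: "b \<in> Br" and "j \<le> k" for b j k
    using that(2)
  proof (induction k rule: dec_induct)
    case base
    then show ?case
      using b \<epsilon>_id Br_iff by blast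
  next
    case (step k)
    have "b (Suc k) \<in> ?E (Suc k)" "?\<rho> k (b (Suc k)) = b k"
      using b Br_iff by auto
    then show ?case
      using comp(1)[OF le[OF step(1)] le[of k "Suc k"], of "b (Suc k)"] step.IH by simp
  qed
  \<comment> \<open>A branch that agrees with \<open>b0\<close> at level \<open>N\<close> passes
    through \<open>e\<close>, and beyond \<open>e\<close> no level offers a choice.\<close>
  have isolated: "b = b0" if b: "b \<in> Br" "b N = b0 N" for b
  proof
    fix k
    let ?k = "max k N"
    have em: "\<epsilon> m (\<phi> ?k) (b' ?k) = e" if b': "b' \<in> Br" "b' N = b0 N" for b'
    proof -
      have "\<epsilon> m (\<phi> ?k) (b' ?k) = \<epsilon> m (\<phi> N) (\<epsilon> (\<phi> N) (\<phi> ?k) (b' ?k))"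
        using comp(1)[OF mN le[of N ?k], of "b' ?k"] b'(1) Br_iff by simp
      also have "\<dots> = e"
        using Br_\<epsilon>[OF b'(1), of N ?k] b'(2) thread_\<epsilon>[OF t(1) mN] t(2) by (simp add: b0_def)
      finally show ?thesis .
    qed
    have "b ?k = b0 ?k"
      using e(2)[of "\<phi> ?k" "b ?k" "b0 ?k"] em[OF b] em[OF b0 refl] b(1) b0 Br_iff mN le[of N ?k] by auto
    then show "b k = b0 k"
      using Br_\<epsilon>[OF b(1), of k ?k] Br_\<epsilon>[OF b0, of k ?k] by simp
  qed
  \<comment> \<open>Heights in an open subinterval of \<open>[0,1]\<close> are positive, so these
    sets of pairs are saturated and their images are open.\<close>
  define arc where "arc x y = L.\<Phi> ` ({b0} \<times> {x<..<y})" for x y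
  have arc: "openin X (arc x y) \<and> connectedin X (arc x y) \<and> arc x y \<noteq> {}" if xy: "0 \<le> x" "x < y" "y \<le> 1" for x y
  proof (intro conjI)
    let ?Z = "{b0} \<times> {x<..<y}"
    have single: "{b \<in> topspace (subtopology Q Br). b N = b0 N} = {b0}"
      using isolated b0 unfolding topB by blast
    have Isub: "{x<..<y} \<subseteq> {0..1}"
      using xy by auto
    have "openin (top_of_set {0..1}) {x<..<y}"
      using Isub by (simp add: open_subset)
    then have open_Z: "openin L.T ?Z"
      using L.openin_c[of N "b0 N"] unfolding single by (simp add: openin_prod_Times_iff)
    have Z_T: "?Z \<subseteq> topspace L.T"
      using openin_subset[OF open_Z] .
    have "{z \<in> topspace L.T. L.\<Phi> z \<in> arc x y} = ?Z"
    proof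
      show "?Z \<subseteq> {z \<in> topspace L.T. L.\<Phi> z \<in> arc x y}"
        using Z_T unfolding arc_def by blast
      show "{z \<in> topspace L.T. L.\<Phi> z \<in> arc x y} \<subseteq> ?Z"
      proof
        fix z assume z: "z \<in> {z \<in> topspace L.T. L.\<Phi> z \<in> arc x y}"
        then obtain z' where z': "z' \<in> ?Z" "L.\<Phi> z = L.\<Phi> z'"
          unfolding arc_def by blast
        have "z = z' \<or> snd z = 0 \<and> snd z' = 0"
          using L.\<Phi>_eq_iff[of z z'] z z' Z_T by blast
        then show "z \<in> ?Z"
          using z'(1) xy by auto
      qed
    qed
    then have "openin L.T {z \<in> topspace L.T. L.\<Phi> z \<in> arc x y}"
      using open_Z by simp
    moreover have "arc x y \<subseteq> topspace X"
      using Z_T L.\<Phi>_Spec unfolding arc_def topspace_X by blast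
    ultimately show "openin X (arc x y)"
      using L.\<Phi>_quotient unfolding quotient_map_def by blast
    have "connectedin (top_of_set {0..1}) {x<..<y}"
      using Isub by (simp add: connectedin_subtopology)
    moreover have "connectedin (subtopology Q Br) {b0}"
      using b0 topB by (simp add: connectedin_sing)
    ultimately have "connectedin L.T ?Z"
      unfolding connectedin_Times by blast
    then show "connectedin X (arc x y)"
      unfolding arc_def by (rule connectedin_continuous_map_image[OF L.\<Phi>_continuous])
    have "(x + y) / 2 \<in> {x<..<y}"
      using xy by simp
    then show "arc x y \<noteq> {}"
      unfolding arc_def by blast
  qed
  obtain h where h: "homeomorphic_map X cantor_fan h"
    using hom homeomorphic_space by blast
  have root: "fan_equiv `` {(\<lambda>_. False, 0)} \<in> h ` arc x y" if xy: "0 \<le> x" "x < y" "y \<le> 1" for x y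
  proof (rule open_connected_cantor_fan)
    show "openin cantor_fan (h ` arc x y)"
      using arc[OF xy] h homeomorphic_map_openness_eq openin_subset homeomorphic_imp_open_map open_map_def by metis
    show "connectedin cantor_fan (h ` arc x y)"
      using connectedin_continuous_map_image[OF homeomorphic_imp_continuous_map[OF h]] arc[OF xy] by blast
    show "h ` arc x y \<noteq> {}"
      using arc[OF xy] by blast
  qed
  \<comment> \<open>The arcs over \<open>(0, 1/2)\<close> and \<open>(1/2, 1)\<close> would both
    contain the point that corresponds to the root of the Cantor fan, although \<Phi> is injective
    at positive heights.\<close>
  obtain S where S: "S \<in> arc 0 (1/2)" "h S = fan_equiv `` {(\<lambda>_. False, 0)}"
    using root[of 0 "1/2"] by auto
  obtain S' where S': "S' \<in> arc (1/2) 1" "h S' = fan_equiv `` {(\<lambda>_. False, 0)}"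
    using root[of "1/2" 1] by auto
  have "S \<in> topspace X" "S' \<in> topspace X"
    using arc[of 0 "1/2"] arc[of "1/2" 1] S(1) S'(1) openin_subset[of X] by auto
  then have "S = S'"
    using homeomorphic_imp_injective_map[OF h] S(2) S'(2) by (metis inj_onD)
  then obtain s s' where s: "0 < s" "s < 1/2" "1/2 < s'" "s' < 1" "L.\<Phi> (b0, s) = L.\<Phi> (b0, s')"
    using S(1) S'(1) unfolding arc_def by auto
  have "(b0, s) \<in> topspace L.T" "(b0, s') \<in> topspace L.T"
    using s b0 L.T_iff topB by auto
  then show False
    using L.\<Phi>_eq_iff s by auto
qed

lemma cantor_fan_iff:
  "X homeomorphic_space cantor_fan \<longleftrightarrow> (\<forall>m. \<exists>n. refining 2 m n \<and> splitting 2 m n)"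
proof
  assume hom: "X homeomorphic_space cantor_fan"
  have reg: "regular_space X"
    using homeomorphic_regular_space[OF hom] compact_Hausdorff_imp_regular_space[OF compact_cantor_fan Hausdorff_cantor_fan] by simp
  have conn: "connected_space X"
    using homeomorphic_connected_space[OF hom] connected_cantor_fan by simp
  have ref: "\<exists>n. refining 2 m n" for m
    using star_refining_if_regular[OF reg connected_adjacent[OF conn]] refining_2_iff by blast
  show "\<forall>m. \<exists>n. refining 2 m n \<and> splitting 2 m n"
  proof
    fix m
    obtain n n' where "refining 2 m n" "splitting 2 m n'"
      using ref splitting_if_cantor_fan[OF hom ref] by meson
    then have "refining 2 m (max n n')" "splitting 2 m (max n n')"
      using refining_comp splitting_comp by auto
    then show "\<exists>n. refining 2 m n \<and> splitting 2 m n"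
      by blast
  qed
next
  assume "\<forall>m. \<exists>n. refining 2 m n \<and> splitting 2 m n"
  then show "X homeomorphic_space cantor_fan"
    using spectrum_cantor_fan by blast
qed

end

text \<open>Conditions (1) to (4) have all been reduced to \<open>\<forall>m. \<exists>n. refining 2
  m n \<and> splitting 2 m n\<close>. The statement on exactness is relative to
  \<open>lax_fraisse\<close>, because branches do not see the splitting of ends.\<close>

theorem theorem5p39:
  fixes G :: "nat \<Rightarrow> 'a::infinite rgraph"
    and R :: "nat \<Rightarrow> nat \<Rightarrow> ('a \<times> 'a) set"
  assumes "sequence_in catX G R"
  shows
    "(lax_fraisse catX G R \<longleftrightarrow>
        (\<forall>S. spoke_branch G R S \<longrightarrow> lax_fraisse catA (branch_graphs G S) (branch_rels R S)) \<and>
        fraisse catD (\<lambda>n. end_graph (G n)) (\<lambda>m n. end_rel (G n) (G m) (R m n)))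
   \<and> (lax_fraisse catX G R \<longleftrightarrow>
        (\<exists>\<phi>::nat \<Rightarrow> nat. strict_mono \<phi> \<and>
           seq_has star_refining (\<lambda>n. G (\<phi> n)) (\<lambda>m n. R (\<phi> m) (\<phi> n)) \<and>
           seq_has end_splitting (\<lambda>n. G (\<phi> n)) (\<lambda>m n. R (\<phi> m) (\<phi> n))))
   \<and> (lax_fraisse catX G R \<longleftrightarrow>
        spectrum_topology (induced_poset G) (induced_le G R) homeomorphic_space cantor_fan)
   \<and> (lax_fraisse catX G R \<longrightarrow>
        (fraisse catX G R \<longleftrightarrow>
           (\<forall>S. spoke_branch G R S \<longrightarrow> fraisse catA (branch_graphs G S) (branch_rels R S))))"
proof -
  obtain l v \<epsilon> \<alpha> \<beta> where "fan_seq G R l v \<epsilon> \<alpha> \<beta>"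
    using fan_seq_exists[OF assms] .
  then interpret fan_seq G R l v \<epsilon> \<alpha> \<beta> .
  show ?thesis
    using lax_fraisse_iff fine_iff_branches subsequence_iff cantor_fan_iff fraisse_iff_branches by simp
qed

end
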